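(* Let $n\ge2$. There is a constant $C>0$ depending only on $n$ such that the following holds. Let $k\in\mathbb{R}$ with $k\notin\mathcal{K}$, let $D=I\times(0,1)$ be bounded with $I\subseteq B_\rho(x_0)$ for some $x_0\in\mathbb{R}^{n-1}$ and some $\rho>0$ with $\rho\,\delta_->0.1$, and let $V\in L^\infty(S)$ be supported in $D$. If the problem $-\Delta u=(k+V)u$ in $S$, $u=0$ on $\partial S$, has a nontrivial admissible solution, then $$\max\left\{\frac{1}{\delta_+^{2}},\ \frac{C\rho}{\delta_-}\right\}\|V\|_\infty>1.$$
   Context: $S=\mathbb{R}^{n-1}\times(0,1)$, with points $(x,y)$, $x\in\mathbb{R}^{n-1}$, $y\in(0,1)$. $\mathcal{K}=\{m^2\pi^2:m=1,2,\dots\}$. $B_\rho(x_0)$ is the ball in $\mathbb{R}^{n-1}$ of radius $\rho$ centered at $x_0$. For $m=1,2,\dots$ let $k_m=\sqrt{k-m^2\pi^2}$ if $m^2\pi^2<k$ and $k_m=i\sqrt{m^2\pi^2-k}$ if $m^2\pi^2\ge k$. Let $\delta_+=\min\{|k_m|:m^2\pi^2>k\}$ and $\delta_-=\min\{|k_m|:m^2\pi^2<k\}$, with $\delta_-=\infty$ (so $1/\delta_-=0$) when $k<\pi^2$. For $u\in H^1_{\rm loc}(S)$ put $u_m(x)=2\int_0^1u(x,y)\sin(m\pi y)\,dy$. A weak solution $u\in H^1_{\rm loc}(S)$ of $-\Delta u=(k+V)u$ in $S$, $u=0$ on $\partial S$, is called admissible if: (1) for every $m$ with $m^2\pi^2<k$,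 as $r=|x|\to\infty$, $u_m(x)=O(r^{(2-n)/2})$ and $\left(\frac{\partial}{\partial r}-ik_m\right)u_m(x)=o(r^{(2-n)/2})$, where $\frac{\partial}{\partial r}=\frac{x}{|x|}\cdot\nabla$; and (2) $u_m\in H^1(\mathbb{R}^{n-1})$ for every $m$ with $m^2\pi^2\ge k$. *)

theory Defs
  imports
    "HOL-Analysis.Analysis"
    "HOL-Library.Landau_Symbols"
    "HOL-Probability.Essential_Supremum"
begin

section \<open>Test functions, weak derivatives and Sobolev spaces\<close>

fun iterated_deriv :: "'a::euclidean_space list \<Rightarrow> ('a \<Rightarrow> complex) \<Rightarrow> 'a \<Rightarrow> complex" where
  "iterated_deriv [] f = f"
| "iterated_deriv (b # bs) f = (\<lambda>x. frechet_derivative (iterated_deriv bs f) (at x) b)"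

text \<open>Differentiability of all iterated partial derivatives at every point forces all of them
  to be continuous, so this is \<open>C\<^sup>\<infinity>\<close>.\<close>

definition smooth :: "('a::euclidean_space \<Rightarrow> complex) \<Rightarrow> bool" where
  "smooth f \<longleftrightarrow> (\<forall>bs. set bs \<subseteq> Basis \<longrightarrow> (\<forall>x. iterated_deriv bs f differentiable (at x)))"

text \<open>The space \<open>C\<^sub>c\<^sup>\<infinity>(\<Omega>)\<close>, its elements being extended by zero to the whole space.\<close>

definition test_function :: "'a::euclidean_space set \<Rightarrow> ('a \<Rightarrow> complex) \<Rightarrow> bool" where
  "test_function \<Omega> \<phi> \<longleftrightarrow>
     smooth \<phi> \<and> compact (closure {x. \<phi> x \<noteq> 0}) \<and> closure {x. \<phi> x \<noteq> 0} \<subseteq> \<Omega>"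

definition locally_integrable :: "'a::euclidean_space set \<Rightarrow> ('a \<Rightarrow> complex) \<Rightarrow> bool" where
  "locally_integrable \<Omega> f \<longleftrightarrow> (\<forall>K. compact K \<and> K \<subseteq> \<Omega> \<longrightarrow> f absolutely_integrable_on K)"

definition L2 :: "'a::euclidean_space set \<Rightarrow> ('a \<Rightarrow> complex) \<Rightarrow> bool" where
  "L2 \<Omega> f \<longleftrightarrow> f \<in> borel_measurable (lebesgue_on \<Omega>)
     \<and> integrable (lebesgue_on \<Omega>) (\<lambda>x. (cmod (f x))\<^sup>2)"

text \<open>\<open>g\<close> is the weak partial derivative of \<open>u\<close> in direction \<open>b\<close> on the open set \<open>\<Omega>\<close>.\<close>

definition weak_deriv ::
    "'a::euclidean_space set \<Rightarrow> 'a \<Rightarrow> ('a \<Rightarrow> complex) \<Rightarrow> ('a \<Rightarrow> complex) \<Rightarrow> bool" where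
  "weak_deriv \<Omega> b u g \<longleftrightarrow> locally_integrable \<Omega> u \<and> locally_integrable \<Omega> g \<and>
     (\<forall>\<phi>. test_function \<Omega> \<phi> \<longrightarrow>
        (LINT x|lebesgue_on \<Omega>. u x * frechet_derivative \<phi> (at x) b)
          = - (LINT x|lebesgue_on \<Omega>. g x * \<phi> x))"

text \<open>A gradient is represented by the family \<open>G\<close> whose member \<open>G b\<close>, for \<open>b \<in> Basis\<close>, is the
  partial derivative in direction \<open>b\<close>.\<close>

definition H1_with_gradient ::
    "'a::euclidean_space set \<Rightarrow> ('a \<Rightarrow> complex) \<Rightarrow> ('a \<Rightarrow> 'a \<Rightarrow> complex) \<Rightarrow> bool" where
  "H1_with_gradient \<Omega> u G \<longleftrightarrow>
     L2 \<Omega> u \<and> (\<forall>b\<in>Basis. L2 \<Omega> (G b) \<and> weak_deriv \<Omega> b u (G b))"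

definition H1 :: "'a::euclidean_space set \<Rightarrow> ('a \<Rightarrow> complex) \<Rightarrow> bool" where
  "H1 \<Omega> u \<longleftrightarrow> (\<exists>G. H1_with_gradient \<Omega> u G)"

text \<open>\<open>H\<^sub>0\<^sup>1(\<Omega>)\<close>, the closure of \<open>C\<^sub>c\<^sup>\<infinity>(\<Omega>)\<close> in \<open>H\<^sup>1(\<Omega>)\<close>.\<close>

definition H1_0 :: "'a::euclidean_space set \<Rightarrow> ('a \<Rightarrow> complex) \<Rightarrow> bool" where
  "H1_0 \<Omega> u \<longleftrightarrow> (\<exists>G \<phi>. H1_with_gradient \<Omega> u G \<and> (\<forall>j::nat. test_function \<Omega> (\<phi> j)) \<and>
     (\<lambda>j. LINT x|lebesgue_on \<Omega>. (cmod (u x - \<phi> j x))\<^sup>2) \<longlonglongrightarrow> 0 \<and>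
     (\<forall>b\<in>Basis. (\<lambda>j. LINT x|lebesgue_on \<Omega>.
         (cmod (G b x - frechet_derivative (\<phi> j) (at x) b))\<^sup>2) \<longlonglongrightarrow> 0))"

text \<open>Here ``local'' refers to bounded parts of \<open>\<Omega>\<close> reaching up to its boundary, so that boundary
  values and the Fourier coefficients \<open>mode m u\<close> below make sense.\<close>

definition H1_loc :: "'a::euclidean_space set \<Rightarrow> ('a \<Rightarrow> complex) \<Rightarrow> bool" where
  "H1_loc \<Omega> u \<longleftrightarrow> (\<forall>R>0. H1 (\<Omega> \<inter> ball 0 R) u)"

text \<open>\<open>u = 0\<close> on \<open>\<partial>\<Omega>\<close>, in the usual \<open>H\<^sub>0\<^sup>1\<close> sense, localised by cut-off functions
  that need not vanish on \<open>\<partial>\<Omega>\<close>.\<close>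

definition zero_boundary_values :: "'a::euclidean_space set \<Rightarrow> ('a \<Rightarrow> complex) \<Rightarrow> bool" where
  "zero_boundary_values \<Omega> u \<longleftrightarrow>
     (\<forall>\<eta>. test_function UNIV \<eta> \<longrightarrow> H1_0 \<Omega> (\<lambda>x. \<eta> x * u x))"

section \<open>The waveguide problem\<close>

text \<open>The cross-section \<open>\<real>\<^sup>n\<^sup>-\<^sup>1\<close> is \<^typ>\<open>real^'d\<close>, so \<open>n = CARD('d) + 1 \<ge> 2\<close> is the dimension of
  \<^typ>\<open>(real^'d) \<times> real\<close>.\<close>

definition waveguide :: "((real^'d) \<times> real) set" where
  "waveguide = UNIV \<times> {0<..<1}"

definition weak_solution ::
    "real \<Rightarrow> ((real^'d) \<times> real \<Rightarrow> complex) \<Rightarrow> ((real^'d) \<times> real \<Rightarrow> complex) \<Rightarrow> bool" where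
  "weak_solution k V u \<longleftrightarrow> H1_loc waveguide u \<and> zero_boundary_values waveguide u \<and>
     (\<exists>G. (\<forall>b\<in>Basis. weak_deriv waveguide b u (G b)) \<and>
       (\<forall>\<phi>. test_function waveguide \<phi> \<longrightarrow>
          (\<Sum>b\<in>Basis. LINT p|lebesgue_on waveguide. G b p * frechet_derivative \<phi> (at p) b)
            = (LINT p|lebesgue_on waveguide. (complex_of_real k + V p) * u p * \<phi> p)))"

definition resonances :: "real set" where
  "resonances = {(real m)\<^sup>2 * pi\<^sup>2 | m. m \<ge> 1}"

definition wavenumber :: "real \<Rightarrow> nat \<Rightarrow> complex" where
  "wavenumber k m =
     (if (real m)\<^sup>2 * pi\<^sup>2 < k then complex_of_real (sqrt (k - (real m)\<^sup>2 * pi\<^sup>2))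
      else \<i> * complex_of_real (sqrt ((real m)\<^sup>2 * pi\<^sup>2 - k)))"

text \<open>Both infima are minima when the index set is nonempty, since \<open>|k\<^sub>m|\<close> is monotone in \<open>m\<close> on
  either side of the threshold. The index set of \<open>delta_minus\<close> is empty when \<open>k \<le> \<pi>\<^sup>2\<close>; the
  infimum in \<^typ>\<open>ereal\<close> is then \<open>\<infinity>\<close>, whose inverse is \<open>0\<close>.\<close>

definition delta_plus :: "real \<Rightarrow> ereal" where
  "delta_plus k = (INF m\<in>{m. m \<ge> 1 \<and> (real m)\<^sup>2 * pi\<^sup>2 > k}. ereal (cmod (wavenumber k m)))"

definition delta_minus :: "real \<Rightarrow> ereal" where
  "delta_minus k = (INF m\<in>{m. m \<ge> 1 \<and> (real m)\<^sup>2 * pi\<^sup>2 < k}. ereal (cmod (wavenumber k m)))"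

definition mode :: "nat \<Rightarrow> ((real^'d) \<times> real \<Rightarrow> complex) \<Rightarrow> real^'d \<Rightarrow> complex" where
  "mode m u x =
     2 * (LINT y|lebesgue_on {0<..<1}. u (x, y) * complex_of_real (sin (real m * pi * y)))"

definition radial_deriv :: "(real^'d \<Rightarrow> complex) \<Rightarrow> real^'d \<Rightarrow> complex" where
  "radial_deriv w x = frechet_derivative w (at x) ((1 / norm x) *\<^sub>R x)"

text \<open>The two growth conditions, with \<open>\<kappa>\<close> in place of \<open>k\<^sub>m\<close>. They are pointwise, whereas \<open>f\<close> is only
  determined almost everywhere; hence they are imposed on a representative \<open>w\<close> of \<open>f\<close> that is
  differentiable near infinity.\<close>

definition outgoing :: "complex \<Rightarrow> (real^'d \<Rightarrow> complex) \<Rightarrow> bool" where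
  "outgoing \<kappa> f \<longleftrightarrow> (\<exists>w. (AE x in lebesgue. w x = f x) \<and>
     (\<forall>\<^sub>F x in at_infinity. w differentiable (at x)) \<and>
     w \<in> O[at_infinity](\<lambda>x. complex_of_real
            (norm x powr ((2 - real DIM((real^'d) \<times> real)) / 2))) \<and>
     (\<lambda>x. radial_deriv w x - \<i> * \<kappa> * w x) \<in> o[at_infinity](\<lambda>x. complex_of_real
            (norm x powr ((2 - real DIM((real^'d) \<times> real)) / 2))))"

definition admissible_solution ::
    "real \<Rightarrow> ((real^'d) \<times> real \<Rightarrow> complex) \<Rightarrow> ((real^'d) \<times> real \<Rightarrow> complex) \<Rightarrow> bool" where
  "admissible_solution k V u \<longleftrightarrow> weak_solution k V u \<and>
     (\<forall>m\<ge>1. (real m)\<^sup>2 * pi\<^sup>2 < k \<longrightarrow> outgoing (wavenumber k m) (mode m u)) \<and>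
     (\<forall>m\<ge>1. (real m)\<^sup>2 * pi\<^sup>2 \<ge> k \<longrightarrow> H1 UNIV (mode m u))"

definition Linf_norm :: "'a::euclidean_space set \<Rightarrow> ('a \<Rightarrow> complex) \<Rightarrow> ereal" where
  "Linf_norm \<Omega> V = esssup (lebesgue_on \<Omega>) (\<lambda>p. ereal (cmod (V p)))"

definition Linf :: "'a::euclidean_space set \<Rightarrow> ('a \<Rightarrow> complex) \<Rightarrow> bool" where
  "Linf \<Omega> V \<longleftrightarrow> V \<in> borel_measurable (lebesgue_on \<Omega>) \<and> Linf_norm \<Omega> V < \<infinity>"

end

theory Submission
 imports Defs
begin

text \<open>
 Expanding \<open>u\<close> and \<open>V u\<close> in sine series across the strip turns the problem into one Helmholtz equation
 \<open>(\<Delta> + k\<^sub>m\<^sup>2) u\<^sub>m = - F\<^sub>m\<close> on \<open>\<real>\<^sup>n\<^sup>-\<^sup>1\<close> for every mode, where \<open>F\<^sub>m\<close> is the \<open>m\<close>-th coefficient of \<open>V u\<close> and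
 vanishes outside the ball of radius \<open>\<rho>\<close>. For an evanescent mode, testing with \<open>u\<^sub>m\<close> bounds the norm of \<open>u\<^sub>m\<close> by
 that of \<open>F\<^sub>m / |k\<^sub>m|\<^sup>2\<close>, and strictly unless \<open>F\<^sub>m = 0\<close>, because the gradient term is left over. For a propagating
 mode the outgoing condition and the multiplier \<open>h (|x|\<^sup>2) (x \<cdot> \<nabla> + (n - 2) / 2)\<close> of Morawetz type bound the norm of
 \<open>u\<^sub>m\<close> on a ball of radius \<open>R\<close> by \<open>C R / k\<^sub>m\<close> times that of \<open>F\<^sub>m\<close>, as long as \<open>k\<^sub>m R \<ge> 1\<close>; this is where \<open>\<rho> \<delta>\<^sub>- > 0.1\<close>
 enters, with \<open>R = 10 \<rho>\<close>. If the maximum in the theorem times the norm of \<open>V\<close> were at most \<open>1\<close>, then adding up the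
 modes by Parseval's identity would give \<open>\<parallel>V u\<parallel>\<^sup>2 \<le> \<parallel>V\<parallel>\<^sup>2 \<parallel>u\<parallel>\<^sup>2 \<le> \<parallel>V u\<parallel>\<^sup>2\<close>, the second step being strict unless \<open>V u = 0\<close>.
 Hence \<open>V u = 0\<close>, and then the same estimates on larger balls give \<open>u = 0\<close>. The estimates are proved for
 mollified modes and carried over to weak solutions.
\<close>

section \<open>Smooth functions\<close>

text \<open>The inequality is strict, so every mode needs an estimate that is strict when its source
  is nonzero. For propagating modes the constant pays for this: \<open>C^2\<close> is
  \<open>200 = 2 * 10^2\<close> times \<open>propagating_const\<close>, where \<open>10^2\<close>
  comes from \<open>R = 10 \<rho>\<close> and the factor 2 is spare. For evanescent modes there is
  no spare factor, so all limit passages must preserve constants exactly. The second obstacle is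
  regularity. A mode is known only as a distributional solution, while the multiplier identities
  need second derivatives and their symmetry; convolution with a radial kernel gives both, the
  symmetry by an explicit formula. In return the outgoing condition must survive mollification,
  although its representative is merely differentiable near infinity and only its radial derivative
  is controlled; dilations replace integration by parts there. Finally, the equation of a mode calls
  for the test function \<open>\<zeta>(x) sin (m \<pi> y)\<close>, which is not compactly supported
  in the strip, so the boundary condition has to enter through the approximation in
  \<open>H1_0\<close>.\<close>

definition pd :: "'a::euclidean_space => ('a => complex) => 'a => complex" where
 "pd b f x = frechet_derivative f (at x) b"

text \<open>The head of the list is differentiated last, so appending at the end exposes the
  innermost derivative. Induction from that end turns statements about \<open>f\<close> into
  statements about \<open>pd b f\<close>.\<close>

lemma iterated_deriv_snoc: "iterated_deriv (bs @ [b]) f = iterated_deriv bs (pd b f)"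
 by (induction bs) (simp_all add: pd_def[abs_def])

text \<open>Smoothness is a greatest fixed point: any invariant that implies differentiability and
  survives \<open>pd\<close> will do. The induction is generalised over \<open>g\<close> because its
  step replaces \<open>g\<close> by \<open>pd b g\<close>.\<close>

lemma smooth_coinduct:
 assumes "P f" and diff: "!!g x. P g ==> g differentiable (at x)"
  and step: "!!g b. P g ==> b \<in> Basis ==> P (pd b g)"
 shows "smooth f"
proof -
 have "\<forall>g. P g --> set bs \<subseteq> Basis --> (\<forall>x. iterated_deriv bs g differentiable (at x))" for bs
 proof (induction bs rule: rev_induct)
  case (snoc b bs)
  then show ?case
   by (auto simp: iterated_deriv_snoc step)
 qed (simp add: diff)
 with \<open>P f\<close> show ?thesis by (auto simp: smooth_def)
qed

lemma smooth_differentiable: "smooth f ==> f differentiable (at x)"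
 unfolding smooth_def by (metis empty_subsetI iterated_deriv.simps(1) list.set(1))

lemma smooth_pd: "smooth f ==> b \<in> Basis ==> smooth (pd b f)"
 unfolding smooth_def
 by (metis iterated_deriv_snoc Un_subset_iff empty_set insert_subset list.simps(15) set_append empty_subsetI)

lemma smooth_has_derivative:
 "smooth f ==> (f has_derivative (%v. frechet_derivative f (at x) v)) (at x)"
 using frechet_derivative_works smooth_differentiable by auto

lemma smooth_continuous: "smooth f ==> continuous_on S f"
 by (simp add: continuous_at_imp_continuous_on differentiable_imp_continuous_within smooth_differentiable)

lemma pd_eqI: "(f has_derivative f') (at x) ==> pd b f x = f' b"
 by (metis frechet_derivative_at pd_def)

lemma frechet_derivative_eq_sum_pd:
 assumes "f differentiable (at x)"
 shows "frechet_derivative f (at x) v = (\<Sum>b\<in>Basis. complex_of_real (v \<bullet> b) * pd b f x)"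
proof -
 have lin: "linear (frechet_derivative f (at x))"
  using assms frechet_derivative_works has_derivative_linear by blast
 have "frechet_derivative f (at x) v = frechet_derivative f (at x) (\<Sum>b\<in>Basis. (v \<bullet> b) *\<^sub>R b)"
  by (simp add: euclidean_representation)
 also have "... = (\<Sum>b\<in>Basis. (v \<bullet> b) *\<^sub>R frechet_derivative f (at x) b)"
  using lin by (simp add: linear_sum linear_cmul)
 finally show ?thesis by (simp add: pd_def scaleR_conv_of_real)
qed

lemma has_derivative_sum_pd:
 assumes "f differentiable (at x)"
 shows "(f has_derivative (%v. \<Sum>b\<in>Basis. complex_of_real (v \<bullet> b) * pd b f x)) (at x)"
 using assms frechet_derivative_works[of f "at x"]
 by (simp flip: frechet_derivative_eq_sum_pd add: eta_contract_eq)

lemma pd_add: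
 assumes "f differentiable (at x)" "g differentiable (at x)"
 shows "pd b (%x. f x + g x) x = pd b f x + pd b g x"
proof -
 have "((%x. f x + g x) has_derivative (%h. frechet_derivative f (at x) h + frechet_derivative g (at x) h)) (at x)"
  by (rule has_derivative_add) (use assms in \<open>simp_all only: frechet_derivative_works\<close>)
 from pd_eqI[OF this, of b] show ?thesis by (simp add: pd_def)
qed

lemma pd_mult:
 assumes "f differentiable (at x)" "g differentiable (at x)"
 shows "pd b (%x. f x * g x) x = f x * pd b g x + pd b f x * g x"
proof -
 have "((%x. f x * g x) has_derivative (%h. f x * frechet_derivative g (at x) h + frechet_derivative f (at x) h * g x)) (at x)"
  by (rule has_derivative_mult) (use assms in \<open>simp_all only: frechet_derivative_works\<close>)
 from pd_eqI[OF this, of b] show ?thesis by (simp add: pd_def)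
qed

lemma pd_linear:
 assumes "bounded_linear L" "f differentiable (at x)"
 shows "pd b (%x. L (f x)) x = L (pd b f x)"
proof -
 have "((%x. L (f x)) has_derivative (%h. L (frechet_derivative f (at x) h))) (at x)"
  by (rule bounded_linear.has_derivative[OF assms(1)]) (use assms(2) in \<open>simp only: frechet_derivative_works\<close>)
 from pd_eqI[OF this, of b] show ?thesis by (simp add: pd_def)
qed

lemmas pd_cnj = pd_linear[OF bounded_linear_cnj]

lemma pd_const [simp]: "pd b (%x. c) = (%x. 0)"
 by (rule ext, rule pd_eqI) auto

lemma pd_cmult:
 assumes "f differentiable (at x)"
 shows "pd b (%x. c * f x) x = c * pd b f x"
 using pd_mult[of "%x. c" x f b] assms by simp

lemma pd_minus: "f differentiable (at x) ==> pd b (%x. - f x) x = - pd b f x"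
 using pd_cmult[of f x b "-1"] by simp

lemma pd_diff:
 assumes "f differentiable (at x)" "g differentiable (at x)"
 shows "pd b (%x. f x - g x) x = pd b f x - pd b g x"
 using pd_add[of f x "%x. - g x" b] assms by (simp add: pd_minus)

lemma pd_sum:
 assumes "finite I" "!!i. i \<in> I ==> f i differentiable (at x)"
 shows "pd b (%x. \<Sum>i\<in>I. f i x) x = (\<Sum>i\<in>I. pd b (f i) x)"
 using assms by (induction I rule: finite_induct) (simp_all add: pd_add)

text \<open>The outer function is real, so only the real part of \<open>f\<close> enters; in this
  form cut-off profiles are composed with complex-valued functions.\<close>

lemma has_derivative_real_comp:
 assumes "f differentiable (at x)" "(\<phi> has_real_derivative d) (at (Re (f x)))"
 shows "((%x. complex_of_real (\<phi> (Re (f x)))) has_derivative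
   (%h. of_real (d * Re (frechet_derivative f (at x) h)))) (at x)"
proof -
 have "((%x. Re (f x)) has_derivative (%h. Re (frechet_derivative f (at x) h))) (at x)"
  by (rule bounded_linear.has_derivative[OF bounded_linear_Re])
   (use assms(1) in \<open>simp only: frechet_derivative_works\<close>)
 from has_derivative_compose[OF this assms(2)[unfolded has_field_derivative_def]]
 show ?thesis
  by (rule has_derivative_of_real)
qed

text \<open>An explicit sequence of derivatives stands in for higher derivative operators;
  uniqueness of derivatives makes the sequence unambiguous.\<close>

definition smooth_real :: "(real => real) => bool" where
 "smooth_real \<phi> \<longleftrightarrow> (\<exists>D::nat => real => real. D 0 = \<phi> &
   (\<forall>n t. (D n has_real_derivative D (Suc n) t) (at t)))"

lemma smooth_realE:
 assumes "smooth_real \<phi>"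
 obtains \<psi> where "smooth_real \<psi>" "!!t. (\<phi> has_real_derivative \<psi> t) (at t)"
proof -
 obtain D where D: "D 0 = \<phi>" "!!n t. (D n has_real_derivative D (Suc n) t) (at t)"
  using assms by (auto simp: smooth_real_def)
 show ?thesis
 proof
  show "smooth_real (D 1)"
   unfolding smooth_real_def by (rule exI[of _ "%n. D (Suc n)"]) (use D in auto)
  show "(\<phi> has_real_derivative D 1 t) (at t)" for t
   using D(2)[of 0 t] D(1) by simp
 qed
qed

text \<open>A derivative inside the class is chosen for each member; iterating the choice produces
  the required sequence.\<close>

lemma smooth_real_coinduct:
 assumes "P \<phi>" and step: "!!\<phi>. P \<phi> ==> \<exists>\<psi>. P \<psi> & (\<forall>t. (\<phi> has_real_derivative \<psi> t) (at t))"
 shows "smooth_real \<phi>"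
proof -
 obtain F where F: "!!\<phi>. P \<phi> ==> P (F \<phi>) & (\<forall>t. (\<phi> has_real_derivative F \<phi> t) (at t))"
  using step by metis
 have "P ((F ^^ n) \<phi>)" for n by (induction n) (use F \<open>P \<phi>\<close> in auto)
 then show ?thesis
  unfolding smooth_real_def by (intro exI[of _ "%n. (F ^^ n) \<phi>"]) (use F in auto)
qed

text \<open>The class made of \<open>\<phi>\<close> and all smooth functions is closed under
  differentiation, which suffices for coinduction.\<close>

lemma smooth_real_antiderivative:
 "smooth_real \<psi> ==> (!!t. (\<phi> has_real_derivative \<psi> t) (at t)) ==> smooth_real \<phi>"
 by (rule smooth_real_coinduct[where P="%f. f = \<phi> \<or> smooth_real f"]) (auto elim: smooth_realE)

text \<open>The derivative of a product is a sum of products, and that of a composition is a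
  product, so no single operation gives a class closed under \<open>pd\<close>. Closing under all of
  them at once does.\<close>

inductive smooth_gen :: "('a::euclidean_space => complex) => bool" where
 base: "smooth f ==> smooth_gen f"
| const: "smooth_gen (%x. c)"
| inner: "smooth_gen (%x. complex_of_real (x \<bullet> b))"
| norm2: "smooth_gen (%x. complex_of_real ((norm (x - c))^2))"
| add: "smooth_gen f ==> smooth_gen g ==> smooth_gen (%x. f x + g x)"
| mult: "smooth_gen f ==> smooth_gen g ==> smooth_gen (%x. f x * g x)"
| cnj: "smooth_gen f ==> smooth_gen (%x. cnj (f x))"
| Re: "smooth_gen f ==> smooth_gen (%x. complex_of_real (Re (f x)))"
| comp: "smooth_gen f ==> smooth_real \<phi> ==> smooth_gen (%x. complex_of_real (\<phi> (Re (f x))))"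

lemma has_derivative_inner_of_real:
 "((%x. complex_of_real (x \<bullet> b)) has_derivative (%h. complex_of_real (h \<bullet> b))) (at x)"
 by (intro has_derivative_of_real derivative_eq_intros) auto

lemma has_derivative_norm2_of_real:
 "((%x. complex_of_real ((norm (x - c))^2)) has_derivative
   (%h. complex_of_real (2 * (h \<bullet> (x - c))))) (at x)"
proof -
 have "((%x. (x - c) \<bullet> (x - c)) has_derivative (%h. 2 * (h \<bullet> (x - c)))) (at x)"
  by (auto intro!: derivative_eq_intros simp: inner_commute)
 from has_derivative_of_real[OF this] show ?thesis
  by (simp add: dot_square_norm)
qed

lemma smooth_gen_step:
 assumes "smooth_gen f"
 shows "(\<forall>x. f differentiable (at x)) & (\<forall>b\<in>Basis. smooth_gen (pd b f))"
 using assms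
proof induction
 case (base f)
 then show ?case by (auto intro: smooth_gen.base smooth_pd smooth_differentiable)
next
 case (const c)
 then show ?case by (auto intro: smooth_gen.const)
next
 case (inner b)
 have "pd i (%x. complex_of_real (x \<bullet> b)) = (%x. of_real (i \<bullet> b))" for i
  by (rule ext, rule pd_eqI[OF has_derivative_inner_of_real])
 then show ?case
  using has_derivative_inner_of_real[of b] by (auto intro: smooth_gen.const differentiableI)
next
 case (norm2 c)
 have eq: "pd i (%x. complex_of_real ((norm (x - c))^2)) = (%x. 2 * (of_real (x \<bullet> i) + of_real (- (c \<bullet> i))))" for i
  by (rule ext, subst pd_eqI[OF has_derivative_norm2_of_real]) (simp add: inner_simps inner_commute)
 have "(%x. complex_of_real ((norm (x - c))^2)) differentiable (at x)" for x
  using has_derivative_norm2_of_real differentiableI by blast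
 moreover have "smooth_gen (%x::'a. 2 * (complex_of_real (x \<bullet> i) + of_real (- (c \<bullet> i))))" for i
  by (intro smooth_gen.mult smooth_gen.add smooth_gen.inner smooth_gen.const)
 ultimately show ?case
  unfolding eq by blast
next
 case (add f g)
 then have "pd b (%x. f x + g x) = (%x. pd b f x + pd b g x)" for b
  by (auto simp: pd_add)
 moreover have "smooth_gen (%x. pd b f x + pd b g x)" if "b \<in> Basis" for b
  by (rule smooth_gen.add) (use add that in auto)
 moreover have "(%x. f x + g x) differentiable (at x)" for x
  using add by (intro differentiable_add) auto
 ultimately show ?case by simp
next
 case (mult f g)
 then have "pd b (%x. f x * g x) = (%x. f x * pd b g x + pd b f x * g x)" for b
  by (auto simp: pd_mult)
 moreover have "smooth_gen (%x. f x * pd b g x + pd b f x * g x)" if "b \<in> Basis" for b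
  by (rule smooth_gen.add; rule smooth_gen.mult) (use mult that in auto)
 moreover have "(%x. f x * g x) differentiable (at x)" for x
  using mult by (intro differentiable_mult) auto
 ultimately show ?case by simp
next
 case (cnj f)
 then have "pd b (%x. cnj (f x)) = (%x. cnj (pd b f x))" for b
  by (auto simp: pd_cnj)
 moreover have "(%x. cnj (f x)) differentiable (at x)" for x
  using cnj bounded_linear.has_derivative[OF bounded_linear_cnj] unfolding differentiable_def by blast
 moreover have "smooth_gen (%x. cnj (pd b f x))" if "b \<in> Basis" for b
  by (rule smooth_gen.cnj) (use cnj that in auto)
 ultimately show ?case by simp
next
 case (Re f)
 have L: "bounded_linear (%z. complex_of_real (Re z))"
  by (intro bounded_linear_compose[OF bounded_linear_of_real bounded_linear_Re])
 have "pd b (%x. complex_of_real (Re (f x))) = (%x. complex_of_real (Re (pd b f x)))" for b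
  using Re by (intro ext) (simp add: pd_linear[OF L])
 moreover have "(%x. complex_of_real (Re (f x))) differentiable (at x)" for x
  using Re bounded_linear.has_derivative[OF L] unfolding differentiable_def by blast
 moreover have "smooth_gen (%x. complex_of_real (Re (pd b f x)))" if "b \<in> Basis" for b
  by (rule smooth_gen.Re) (use Re that in auto)
 ultimately show ?case by simp
next
 case (comp f \<phi>)
 obtain \<psi> where \<psi>: "smooth_real \<psi>" "!!t. (\<phi> has_real_derivative \<psi> t) (at t)"
  using comp.hyps smooth_realE by blast
 have D: "((%x. complex_of_real (\<phi> (Re (f x)))) has_derivative
   (%h. of_real (\<psi> (Re (f x)) * Re (frechet_derivative f (at x) h)))) (at x)" for x
  using comp.IH \<psi>(2) by (intro has_derivative_real_comp) auto
 have "pd b (%x. complex_of_real (\<phi> (Re (f x)))) =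
   (%x. complex_of_real (\<psi> (Re (f x))) * complex_of_real (Re (pd b f x)))" for b
  by (rule ext, subst pd_eqI[OF D]) (simp add: pd_def)
 moreover have "smooth_gen (%x. complex_of_real (\<psi> (Re (f x))) * complex_of_real (Re (pd b f x)))" if "b \<in> Basis" for b
  using comp \<psi> that by (intro smooth_gen.mult smooth_gen.comp smooth_gen.Re) auto
 moreover have "(%x. complex_of_real (\<phi> (Re (f x)))) differentiable (at x)" for x
  using D by (rule differentiableI)
 ultimately show ?case by simp
qed

lemma smooth_gen_smooth: "smooth_gen f ==> smooth f"
 by (rule smooth_coinduct[where P=smooth_gen]) (auto dest: smooth_gen_step)

lemma smooth_const: "smooth (%x. c)"
 by (rule smooth_gen_smooth[OF smooth_gen.const])

lemma smooth_inner: "smooth (%x. complex_of_real (x \<bullet> b))"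
 by (rule smooth_gen_smooth[OF smooth_gen.inner])

lemma smooth_norm2: "smooth (%x. complex_of_real ((norm (x - c))^2))"
 by (rule smooth_gen_smooth[OF smooth_gen.norm2])

lemma smooth_add: "smooth f ==> smooth g ==> smooth (%x. f x + g x)"
 by (rule smooth_gen_smooth[OF smooth_gen.add[OF smooth_gen.base smooth_gen.base]])

lemma smooth_mult: "smooth f ==> smooth g ==> smooth (%x. f x * g x)"
 by (rule smooth_gen_smooth[OF smooth_gen.mult[OF smooth_gen.base smooth_gen.base]])

lemma smooth_cnj: "smooth f ==> smooth (%x. cnj (f x))"
 by (rule smooth_gen_smooth[OF smooth_gen.cnj[OF smooth_gen.base]])


lemma smooth_comp: "smooth_real \<phi> ==> smooth f ==> smooth (%x. complex_of_real (\<phi> (Re (f x))))"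
 by (rule smooth_gen_smooth[OF smooth_gen.comp[OF smooth_gen.base]])

lemma smooth_comp_of_real:
 "smooth_real \<phi> ==> smooth (%x. complex_of_real (f x)) ==> smooth (%x. complex_of_real (\<phi> (f x)))"
 using smooth_comp[of \<phi> "%x. complex_of_real (f x)"] by simp

lemma smooth_minus: "smooth f ==> smooth (%x. - f x)"
 using smooth_mult[OF smooth_const[of "-1"], of f] unfolding mult_minus1 .

lemma smooth_diff: "smooth f ==> smooth g ==> smooth (%x. f x - g x)"
 using smooth_add[OF _ smooth_minus, of f g] by (simp only: diff_conv_add_uminus)

lemma smooth_sum: "finite I ==> (!!i. i \<in> I ==> smooth (f i)) ==> smooth (%x. \<Sum>i\<in>I. f i x)"
 by (induction I rule: finite_induct) (simp_all add: smooth_add smooth_const)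

text \<open>Each derivative brings out a factor \<open>s\<close>, so the invariant carries an
  arbitrary scalar \<open>\<alpha>\<close>.\<close>

lemma smooth_affine:
 fixes f :: "'a::euclidean_space => complex"
 assumes "smooth f"
 shows "smooth (%x. f (c + s *\<^sub>R x))"
proof (rule smooth_coinduct[where P="%g. \<exists>h \<alpha>. smooth h & g = (%x. \<alpha> * h (c + s *\<^sub>R x))"])
 show "\<exists>h \<alpha>. smooth h & (%x. f (c + s *\<^sub>R x)) = (%x. \<alpha> * h (c + s *\<^sub>R x))"
  using assms by (intro exI[of _ f] exI[of _ 1]) auto
next
 fix g :: "'a => complex"
 assume "\<exists>h \<alpha>. smooth h & g = (%x. \<alpha> * h (c + s *\<^sub>R x))"
 then obtain h \<alpha> where h: "smooth h" "g = (%x. \<alpha> * h (c + s *\<^sub>R x))" by auto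
 have D: "(g has_derivative (%v. \<alpha> * frechet_derivative h (at (c + s *\<^sub>R x)) (s *\<^sub>R v))) (at x)" for x
  unfolding h(2)
  by (rule has_derivative_mult_right, rule has_derivative_compose[OF _ smooth_has_derivative[OF h(1)]])
    (auto intro!: derivative_eq_intros)
 then show "g differentiable (at x)" for x by (rule differentiableI)
 fix b :: 'a assume b: "b \<in> Basis"
 have "pd b g = (%x. (\<alpha> * of_real s) * pd b h (c + s *\<^sub>R x))"
 proof
  fix x
  have "linear (frechet_derivative h (at (c + s *\<^sub>R x)))"
   using h(1) smooth_has_derivative has_derivative_linear by blast
  then show "pd b g x = (\<alpha> * of_real s) * pd b h (c + s *\<^sub>R x)"
   by (subst pd_eqI[OF D]) (simp add: pd_def linear_cmul scaleR_conv_of_real)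
 qed
 then show "\<exists>h \<alpha>. smooth h & pd b g = (%x. \<alpha> * h (c + s *\<^sub>R x))"
  using smooth_pd[OF h(1) b] by (intro exI[of _ "pd b h"] exI[of _ "\<alpha> * of_real s"]) simp
qed

lemma pd_affine:
 assumes "smooth f"
 shows "pd b (%x. f (c + s *\<^sub>R x)) x = of_real s * pd b f (c + s *\<^sub>R x)"
proof -
 have D: "((%x. f (c + s *\<^sub>R x)) has_derivative (%v. frechet_derivative f (at (c + s *\<^sub>R x)) (s *\<^sub>R v))) (at x)"
  by (rule has_derivative_compose[OF _ smooth_has_derivative[OF assms]])
    (auto intro!: derivative_eq_intros)
 have "linear (frechet_derivative f (at (c + s *\<^sub>R x)))"
  using assms smooth_has_derivative has_derivative_linear by blast
 then show ?thesis
  by (subst pd_eqI[OF D]) (simp add: pd_def linear_cmul scaleR_conv_of_real)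
qed

lemma pd_fst:
 fixes f :: "'a::euclidean_space => complex" and p :: "'a \<times> 'b::euclidean_space"
 assumes "f differentiable (at (fst p))"
 shows "pd b (%p. f (fst p)) p = frechet_derivative f (at (fst p)) (fst b)"
proof (rule pd_eqI)
 have "(fst has_derivative fst) (at p)" by (rule bounded_linear_imp_has_derivative) (rule bounded_linear_fst)
 from has_derivative_compose[OF this] assms frechet_derivative_works
 show "((%p. f (fst p)) has_derivative (%v. frechet_derivative f (at (fst p)) (fst v))) (at p)"
  by blast
qed

lemma pd_snd:
 fixes f :: "'b::euclidean_space => complex" and p :: "'a::euclidean_space \<times> 'b"
 assumes "f differentiable (at (snd p))"
 shows "pd b (%p. f (snd p)) p = frechet_derivative f (at (snd p)) (snd b)"
proof (rule pd_eqI)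
 have "(snd has_derivative snd) (at p)" by (rule bounded_linear_imp_has_derivative) (rule bounded_linear_snd)
 from has_derivative_compose[OF this] assms frechet_derivative_works
 show "((%p. f (snd p)) has_derivative (%v. frechet_derivative f (at (snd p)) (snd v))) (at p)"
  by blast
qed

lemma smooth_fst:
 fixes f :: "'a::euclidean_space => complex"
 assumes "smooth f"
 shows "smooth (%p::'a \<times> 'b::euclidean_space. f (fst p))"
proof (rule smooth_coinduct[where P="%g. \<exists>h. smooth h & g = (%p. h (fst p))"])
 show "\<exists>h. smooth h & (%p::'a \<times> 'b. f (fst p)) = (%p. h (fst p))"
  using assms by (intro exI[of _ f]) simp
next
 fix g :: "'a \<times> 'b => complex"
 assume "\<exists>h. smooth h & g = (%p. h (fst p))"
 then obtain h where h: "smooth h" "g = (%p. h (fst p))" by auto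
 show "g differentiable (at p)" for p
  unfolding h(2) using has_derivative_compose[OF bounded_linear_imp_has_derivative[OF bounded_linear_fst]
   smooth_has_derivative[OF h(1)]] by (rule differentiableI)
 fix b :: "'a \<times> 'b" assume "b \<in> Basis"
 then consider i where "i \<in> Basis" "b = (i, 0)" | i where "i \<in> Basis" "b = (0, i)"
  by (auto simp: Basis_prod_def)
 then show "\<exists>h. smooth h & pd b g = (%p. h (fst p))"
 proof cases
  case 1
  then have "pd b g = (%p. pd i h (fst p))"
   unfolding h(2) using h(1) by (intro ext) (simp add: pd_fst smooth_differentiable, simp add: pd_def)
  then show ?thesis using smooth_pd[OF h(1) 1(1)] by (intro exI[of _ "pd i h"]) simp
 next
  \<comment> \<open>A derivative along the second factor vanishes, which is again of the required
    form, with \<open>h = 0\<close>.\<close>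
  case 2
  have "linear (frechet_derivative h (at x))" for x
   using h(1) smooth_has_derivative has_derivative_linear by blast
  with 2 have "pd b g = (%p. 0)"
   unfolding h(2) using h(1) by (intro ext) (simp add: pd_fst smooth_differentiable linear_0)
  then show ?thesis using smooth_const[of 0] by (intro exI[of _ "%x. 0"]) simp
 qed
qed

lemma smooth_snd:
 fixes f :: "'b::euclidean_space => complex"
 assumes "smooth f"
 shows "smooth (%p::'a::euclidean_space \<times> 'b. f (snd p))"
proof (rule smooth_coinduct[where P="%g. \<exists>h. smooth h & g = (%p. h (snd p))"])
 show "\<exists>h. smooth h & (%p::'a \<times> 'b. f (snd p)) = (%p. h (snd p))"
  using assms by (intro exI[of _ f]) simp
next
 fix g :: "'a \<times> 'b => complex"
 assume "\<exists>h. smooth h & g = (%p. h (snd p))"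
 then obtain h where h: "smooth h" "g = (%p. h (snd p))" by auto
 show "g differentiable (at p)" for p
  unfolding h(2) using has_derivative_compose[OF bounded_linear_imp_has_derivative[OF bounded_linear_snd]
   smooth_has_derivative[OF h(1)]] by (rule differentiableI)
 fix b :: "'a \<times> 'b" assume "b \<in> Basis"
 then consider i where "i \<in> Basis" "b = (0, i)" | i where "i \<in> Basis" "b = (i, 0)"
  by (auto simp: Basis_prod_def)
 then show "\<exists>h. smooth h & pd b g = (%p. h (snd p))"
 proof cases
  case 1
  then have "pd b g = (%p. pd i h (snd p))"
   unfolding h(2) using h(1) by (intro ext) (simp add: pd_snd smooth_differentiable, simp add: pd_def)
  then show ?thesis using smooth_pd[OF h(1) 1(1)] by (intro exI[of _ "pd i h"]) simp
 next
  case 2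
  have "linear (frechet_derivative h (at x))" for x
   using h(1) smooth_has_derivative has_derivative_linear by blast
  with 2 have "pd b g = (%p. 0)"
   unfolding h(2) using h(1) by (intro ext) (simp add: pd_snd smooth_differentiable linear_0)
  then show ?thesis using smooth_const[of 0] by (intro exI[of _ "%x. 0"]) simp
 qed
qed

section \<open>Smooth cut-off functions\<close>

text \<open>As for \<open>smooth_gen\<close>, the product rule forces sums into the class.\<close>

inductive smooth_real_gen :: "(real => real) => bool" where
 base: "smooth_real f ==> smooth_real_gen f"
| add: "smooth_real_gen f ==> smooth_real_gen g ==> smooth_real_gen (%x. f x + g x)"
| mult: "smooth_real_gen f ==> smooth_real_gen g ==> smooth_real_gen (%x. f x * g x)"

lemma smooth_real_gen_step:
 "smooth_real_gen f ==> \<exists>g. smooth_real_gen g & (\<forall>t. (f has_real_derivative g t) (at t))"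
proof (induction rule: smooth_real_gen.induct)
 case (base f)
 then show ?case by (meson smooth_realE smooth_real_gen.base)
next
 case (add f g)
 then obtain f' g' where "smooth_real_gen f'" "!!t. (f has_real_derivative f' t) (at t)"
  "smooth_real_gen g'" "!!t. (g has_real_derivative g' t) (at t)" by auto
 then show ?case
  by (intro exI[of _ "%x. f' x + g' x"] conjI smooth_real_gen.add) (auto intro!: derivative_intros)
next
 case (mult f g)
 then obtain f' g' where *: "smooth_real_gen f'" "!!t. (f has_real_derivative f' t) (at t)"
  "smooth_real_gen g'" "!!t. (g has_real_derivative g' t) (at t)" by auto
 then show ?case
  by (intro exI[of _ "%x. f' x * g x + g' x * f x"] conjI smooth_real_gen.add smooth_real_gen.mult allI)
    (use mult.hyps in \<open>auto intro!: derivative_eq_intros\<close>)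
qed

lemma smooth_real_mult: "smooth_real f ==> smooth_real g ==> smooth_real (%x. f x * g x)"
 by (rule smooth_real_coinduct[where P=smooth_real_gen])
   (rule smooth_real_gen.mult[OF smooth_real_gen.base smooth_real_gen.base], auto dest: smooth_real_gen_step)

lemma smooth_real_affine:
 assumes "smooth_real f" shows "smooth_real (%t. f (c + s * t))"
proof -
 obtain D :: "nat => real => real" where D: "D 0 = f" "!!n t. (D n has_real_derivative D (Suc n) t) (at t)"
  using assms by (auto simp: smooth_real_def)
 show ?thesis unfolding smooth_real_def
 proof (intro exI[of _ "%n t. s ^ n * D n (c + s * t)"] conjI allI)
  fix n t
  have "((%t. D n (c + s * t)) has_real_derivative D (Suc n) (c + s * t) * s) (at t)"
   by (rule DERIV_chain2[OF D(2)]) (auto intro!: derivative_eq_intros)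
  then show "((%t. s ^ n * D n (c + s * t)) has_real_derivative s ^ Suc n * D (Suc n) (c + s * t)) (at t)"
   by (auto intro!: derivative_eq_intros)
 qed (use D in simp)
qed

text \<open>The functions \<open>t^(-n) exp (-1/t)\<close>, extended by zero. Their span contains
  all derivatives of the standard flat function \<open>flat_exp 0\<close>.\<close>

definition flat_exp :: "nat => real => real" where
 "flat_exp n t = (if t > 0 then (1 / t) ^ n * exp (- (1 / t)) else 0)"

lemma flat_exp_tendsto: "(flat_exp n \<longlongrightarrow> 0) (at_right 0)"
proof -
 have "((%s::real. s ^ n / exp s) \<longlongrightarrow> 0) at_top" by (rule tendsto_power_div_exp_0)
 from filterlim_compose[OF this filterlim_inverse_at_top_right]
 have "((%t::real. (inverse t) ^ n / exp (inverse t)) \<longlongrightarrow> 0) (at_right 0)" .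
 then show ?thesis
  by (rule Lim_transform_eventually)
    (auto simp: eventually_at_filter flat_exp_def exp_minus field_simps)
qed

lemma flat_exp_deriv:
 "(flat_exp n has_real_derivative (flat_exp (n + 2) t - n * flat_exp (n + 1) t)) (at t)"
proof -
 consider "t > 0" | "t < 0" | "t = 0" by linarith
 then show ?thesis
 proof cases
  case 1
  have "((%t. (1 / t) ^ n * exp (- (1 / t))) has_real_derivative
    (flat_exp (n + 2) t - n * flat_exp (n + 1) t)) (at t)"
  proof -
   have P: "k ~= 0 ==> t * t ^ (k - Suc 0) = t ^ k" for k by (cases k) auto
   show ?thesis
    using 1 by (cases n)
     (auto intro!: derivative_eq_intros simp: flat_exp_def field_simps power2_eq_square, metis P)
  qed
  then show ?thesis
   by (rule has_field_derivative_transform_within_open[where S="{0<..}"]) (use 1 in \<open>auto simp: flat_exp_def\<close>)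
 next
  case 2
  have "((%t. 0) has_real_derivative (flat_exp (n + 2) t - n * flat_exp (n + 1) t)) (at t)"
   using 2 by (simp add: flat_exp_def)
  then show ?thesis
   by (rule has_field_derivative_transform_within_open[where S="{..<0}"]) (use 2 in \<open>auto simp: flat_exp_def\<close>)
 next
  \<comment> \<open>At the origin the right difference quotient is \<open>flat_exp (Suc n)\<close>,
    which tends to zero; the left one vanishes.\<close>
  case 3
  have "((%h. (flat_exp n (0 + h) - flat_exp n 0) / h) \<longlongrightarrow> 0) (at_right 0)"
   by (rule Lim_transform_eventually[OF flat_exp_tendsto[of "Suc n"]])
     (auto simp: eventually_at_filter flat_exp_def)
  moreover have "((%h. (flat_exp n (0 + h) - flat_exp n 0) / h) \<longlongrightarrow> 0) (at_left 0)"
   by (rule tendsto_eventually) (auto simp: eventually_at_filter flat_exp_def)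
  ultimately have "(flat_exp n has_real_derivative 0) (at 0)"
   unfolding DERIV_def using filterlim_split_at_real by blast
  with 3 show ?thesis by (simp add: flat_exp_def)
 qed
qed

inductive flat_gen :: "(real => real) => bool" where
 base: "flat_gen (flat_exp n)"
| add: "flat_gen f ==> flat_gen g ==> flat_gen (%x. f x + g x)"
| scale: "flat_gen f ==> flat_gen (%x. c * f x)"

lemma flat_gen_step:
 "flat_gen f ==> \<exists>g. flat_gen g & (\<forall>t. (f has_real_derivative g t) (at t))"
proof (induction rule: flat_gen.induct)
 case (base n)
 show ?case
  by (intro exI[of _ "%t. flat_exp (n + 2) t + (- real n) * flat_exp (n + 1) t"] conjI
     flat_gen.add flat_gen.scale flat_gen.base allI) (use flat_exp_deriv[of n] in auto)
next
 case (add f g)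
 then obtain f' g' where "flat_gen f'" "!!t. (f has_real_derivative f' t) (at t)"
  "flat_gen g'" "!!t. (g has_real_derivative g' t) (at t)" by auto
 then show ?case
  by (intro exI[of _ "%x. f' x + g' x"] conjI flat_gen.add) (auto intro!: derivative_intros)
next
 case (scale f c)
 then obtain f' where "flat_gen f'" "!!t. (f has_real_derivative f' t) (at t)" by auto
 then show ?case
  by (intro exI[of _ "%x. c * f' x"] conjI flat_gen.scale) (auto intro!: derivative_eq_intros)
qed

lemma smooth_real_flat_exp: "smooth_real (flat_exp n)"
 by (rule smooth_real_coinduct[where P=flat_gen]) (auto intro: flat_gen.base dest: flat_gen_step)

definition bump :: "real => real" where
 "bump t = flat_exp 0 t * flat_exp 0 (1 - t)"

lemma smooth_real_bump: "smooth_real bump"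
 unfolding bump_def[abs_def]
 using smooth_real_mult[OF smooth_real_flat_exp smooth_real_affine[OF smooth_real_flat_exp, of 0 1 "-1"]]
 by simp

lemma smooth_real_continuous: "smooth_real f ==> continuous_on S f"
 by (meson DERIV_isCont continuous_at_imp_continuous_on smooth_realE)

text \<open>The witness is the primitive of \<open>bump\<close>, divided by its total mass.\<close>

lemma ex_smooth_step:
 "\<exists>S. smooth_real S & mono S & (\<forall>t\<le>0. S t = 0) & (\<forall>t\<ge>1. S t = (1::real))"
proof -
 \<comment> \<open>Integration starts strictly to the left of the support of \<open>bump\<close>, so
   every \<open>t \<ge> 0\<close> is an interior point of \<open>{-1..t + 1}\<close> and the
   derivative within that interval is a full one.\<close>
 define B where "B t = integral {-1..t} bump" for t
 have cont: "continuous_on T bump" for T by (rule smooth_real_continuous[OF smooth_real_bump])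
 have nn: "bump t >= 0" for t by (simp add: bump_def flat_exp_def)
 have z: "bump t = 0" if "t <= 0 \<or> t >= 1" for t using that by (auto simp: bump_def flat_exp_def)
 have B0: "B t = 0" if "t <= 0" for t
  unfolding B_def using that z by (subst integral_cong[where g="%_. 0"]) auto
 have DB: "(B has_real_derivative bump t) (at t)" for t
 proof (cases "t < 0")
  case True
  have "((%_. 0) has_real_derivative bump t) (at t)" using True z by simp
  then show ?thesis
   by (rule has_field_derivative_transform_within_open[where S="{..<0}"]) (use True B0 in auto)
 next
  case False
  have "(B has_real_derivative bump t) (at t within {-1..t + 1})"
   unfolding B_def[abs_def] using False by (intro integral_has_real_derivative cont) auto
  then show ?thesis
   using False by (simp add: at_within_Icc_at)
 qed
 have "smooth_real B" using smooth_real_antiderivative[OF smooth_real_bump DB] .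
 have monoB: "B s <= B t" if "s <= t" for s t
  using that DB nn by (intro DERIV_nonneg_imp_nondecreasing[of s t B]) auto
 have const: "B t = B 1" if "t >= 1" for t
 proof (rule antisym)
  show "B 1 <= B t" by (rule monoB) fact
  have "B t = integral {-1..1} bump + integral {1..t} bump"
   unfolding B_def by (rule Henstock_Kurzweil_Integration.integral_combine[symmetric])
    (use that in \<open>auto intro!: integrable_continuous_real cont\<close>)
  also have "integral {1..t} bump = 0"
   by (subst integral_cong[where g="%_. 0"]) (use z in auto)
  finally show "B t <= B 1" by (simp add: B_def)
 qed
 \<comment> \<open>A vanishing total mass would make the monotone \<open>B\<close> constant on the
   unit interval, against \<open>bump (1/2) \<noteq> 0\<close>.\<close>
 have "B 1 ~= 0"
 proof
  assume "B 1 = 0"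
  have BI: "B t = 0" if "t \<in> {0<..<1}" for t
   using monoB[of t 1] monoB[of 0 t] B0[of 0] that \<open>B 1 = 0\<close> by auto
  have "((%_. 0) has_real_derivative bump (1/2)) (at (1/2))"
   by (rule has_field_derivative_transform_within_open[OF DB, where S="{0<..<1}"]) (use BI in auto)
  then have "bump (1/2) = 0" using DERIV_unique DERIV_const by blast
  then show False by (simp add: bump_def flat_exp_def)
 qed
 then have pos: "B 1 > 0" using monoB[of 0 1] B0[of 0] by simp
 show ?thesis
 proof (intro exI[of _ "%t. B t * (1 / B 1)"] conjI allI impI)
  have c: "smooth_real (%_. 1 / B 1)"
   unfolding smooth_real_def by (intro exI[of _ "%n t. if n = 0 then 1 / B 1 else 0"]) auto
  show "smooth_real (%t. B t * (1 / B 1))"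
   by (rule smooth_real_mult[OF \<open>smooth_real B\<close> c])
  show "mono (%t. B t * (1 / B 1))"
   using pos monoB by (auto simp: mono_def divide_right_mono)
  show "B t * (1 / B 1) = 0" if "t <= 0" for t using B0[OF that] by simp
  show "B t * (1 / B 1) = 1" if "t >= 1" for t using const[OF that] pos by (metis less_irrefl mult.commute nonzero_divide_eq_eq times_divide_eq_left mult_1)
 qed
qed

definition smooth_step :: "real => real" where
 "smooth_step = (SOME S. smooth_real S & mono S & (\<forall>t\<le>0. S t = 0) & (\<forall>t\<ge>1. S t = (1::real)))"

lemma smooth_real_smooth_step: "smooth_real smooth_step"
 and mono_smooth_step: "mono smooth_step"
 and smooth_step_0: "t <= 0 ==> smooth_step t = 0"
 and smooth_step_1: "t >= 1 ==> smooth_step t = 1"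
 using someI_ex[OF ex_smooth_step] unfolding smooth_step_def by auto

lemma smooth_step_bounds: "0 <= smooth_step t" "smooth_step t <= 1"
 using monoD[OF mono_smooth_step, of "min 0 t" t] monoD[OF mono_smooth_step, of t "max 1 t"]
  smooth_step_0[of "min 0 t"] smooth_step_1[of "max 1 t"] by auto

lemma bounded_outside_Icc:
 fixes f :: "real => real"
 assumes "continuous_on UNIV f" "!!t. t <= 0 \<or> t >= 1 ==> f t = 0"
 shows "\<exists>M\<ge>0. \<forall>t. \<bar>f t\<bar> <= M"
proof -
 have "compact (f ` {0..1})"
  by (intro compact_continuous_image) (auto intro: continuous_on_subset[OF assms(1)])
 then obtain M where M: "!!y. y \<in> f ` {0..1} ==> norm y <= M"
  using compact_imp_bounded bounded_iff by metis
 have "\<bar>f t\<bar> <= max M 0" for t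
  using M[of "f t"] assms(2)[of t] by (cases "t \<in> {0..1}") auto
 then show ?thesis by (intro exI[of _ "max M 0"]) auto
qed

text \<open>Outside the open unit interval \<open>smooth_step\<close> takes an extreme value, so its
  derivative \<open>S1\<close> vanishes; there \<open>S1 \<ge> 0\<close> has a minimum in turn, so
  \<open>S2\<close> vanishes as well.\<close>

lemma smooth_step_derivs:
 obtains S1 S2 M where "smooth_real S1" "smooth_real S2"
  "!!t. (smooth_step has_real_derivative S1 t) (at t)"
  "!!t. (S1 has_real_derivative S2 t) (at t)"
  "!!t. t <= 0 \<or> t >= 1 ==> S1 t = 0" "!!t. t <= 0 \<or> t >= 1 ==> S2 t = 0"
  "!!t. S1 t >= 0" "M > 0" "!!t. \<bar>S1 t\<bar> <= M" "!!t. \<bar>S2 t\<bar> <= M"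
proof -
 obtain S1 where S1: "smooth_real S1" "!!t. (smooth_step has_real_derivative S1 t) (at t)"
  using smooth_realE smooth_real_smooth_step by metis
 obtain S2 where S2: "smooth_real S2" "!!t. (S1 has_real_derivative S2 t) (at t)"
  using smooth_realE S1(1) by metis
 have z1: "S1 t = 0" if "t <= 0 \<or> t >= 1" for t
  using that
 proof
  assume "t <= 0"
  then show ?thesis
   by (intro DERIV_local_min[OF S1(2), of 1]) (auto simp: smooth_step_0 smooth_step_bounds)
 next
  assume "t >= 1"
  then show ?thesis
   by (intro DERIV_local_max[OF S1(2), of 1]) (auto simp: smooth_step_1 smooth_step_bounds)
 qed
 have nn: "S1 t >= 0" for t
 proof (rule ccontr)
  assume "\<not> S1 t >= 0"
  then obtain d where d: "d > 0" "!!h. h > 0 ==> h < d ==> smooth_step (t + h) < smooth_step t"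
   using DERIV_neg_dec_right[OF S1(2)] by (metis not_le)
  have "smooth_step t <= smooth_step (t + d/2)"
   by (rule monoD[OF mono_smooth_step]) (use d in simp)
  then show False using d(2)[of "d/2"] d(1) by simp
 qed
 have z2: "S2 t = 0" if "t <= 0 \<or> t >= 1" for t
  using z1[OF that] nn by (intro DERIV_local_min[OF S2(2), of 1]) auto
 obtain M1 where M1: "!!t. \<bar>S1 t\<bar> <= M1" "M1 >= 0"
  using bounded_outside_Icc[OF smooth_real_continuous[OF S1(1)] z1] by blast
 obtain M2 where M2: "!!t. \<bar>S2 t\<bar> <= M2" "M2 >= 0"
  using bounded_outside_Icc[OF smooth_real_continuous[OF S2(1)] z2] by blast
 show ?thesis
 proof (rule that[of S1 S2 "M1 + M2 + 1"])
  show "\<bar>S1 t\<bar> <= M1 + M2 + 1" "\<bar>S2 t\<bar> <= M1 + M2 + 1" for t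
   using M1(1)[of t] M2(1)[of t] M1(2) M2(2) by linarith+
  show "M1 + M2 + 1 > 0" using M1(2) M2(2) by linarith
 qed (fact S1 S2 z1 z2 nn)+
qed

section \<open>Test functions\<close>

text \<open>Any compact set off which \<open>f\<close> vanishes serves in place of the closed
  support.\<close>

lemma test_functionI:
 assumes "smooth f" "compact K" "K \<subseteq> Om" "!!x. x \<notin> K ==> f x = 0"
 shows "test_function Om f"
proof -
 have "closure {x. f x ~= 0} \<subseteq> K"
  using assms by (intro closure_minimal compact_imp_closed) auto
 moreover have "bounded {x. f x ~= 0}"
  by (rule bounded_subset[OF compact_imp_bounded[OF assms(2)]]) (use assms(4) in blast)
 ultimately show ?thesis
  unfolding test_function_def compact_closure using assms by blast
qed

lemma test_functionE:
 assumes "test_function Om f"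
 obtains K where "smooth f" "compact K" "K \<subseteq> Om" "!!x. x \<notin> K ==> f x = 0"
proof (rule that[of "closure {x. f x ~= 0}"])
 show "f x = 0" if "x \<notin> closure {x. f x ~= 0}" for x
  using that closure_subset[of "{x. f x ~= 0}"] by auto
qed (use assms in \<open>auto simp: test_function_def\<close>)

lemma test_function_cball:
 assumes "test_function Om f"
 obtains R where "R > 0" "!!x. norm x >= R ==> f x = 0"
proof -
 obtain K where K: "compact K" "!!x. x \<notin> K ==> f x = 0"
  using assms test_functionE by metis
 obtain B where "\<forall>x\<in>K. norm x <= B"
  using compact_imp_bounded[OF K(1)] bounded_iff by blast
 then have "f x = 0" if "norm x >= max (B + 1) 1" for x
  using K(2)[of x] that by force
 then show ?thesis by (intro that[of "max (B + 1) 1"]) auto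
qed

lemma test_function_UNIVI:
 assumes "smooth f" "!!x. norm x >= R ==> f x = 0"
 shows "test_function UNIV f"
 using assms by (intro test_functionI[of f "cball 0 R"]) auto

lemma test_function_smooth: "test_function Om f ==> smooth f"
 by (simp add: test_function_def)

lemma test_function_differentiable: "test_function Om f ==> f differentiable (at x)"
 by (simp add: test_function_def smooth_differentiable)


lemma pd_eq_0_outside:
 assumes "closed K" "!!x. x \<notin> K ==> f x = 0" "x \<notin> K"
 shows "pd b f x = 0"
proof -
 have "(f has_derivative (%_. 0)) (at x)"
  by (rule has_derivative_transform_within_open[of "%_. 0" _ x UNIV "- K"])
    (use assms in \<open>auto simp: open_Compl\<close>)
 from pd_eqI[OF this] show ?thesis by simp
qed

lemma test_function_pd:
 assumes "test_function Om f" "b \<in> Basis"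
 shows "test_function Om (pd b f)"
proof -
 obtain K where "smooth f" "compact K" "K \<subseteq> Om" "!!x. x \<notin> K ==> f x = 0"
  using test_functionE assms(1) by metis
 then show ?thesis using assms(2)
  by (intro test_functionI[of _ K] smooth_pd) (auto intro!: pd_eq_0_outside compact_imp_closed)
qed

lemma test_function_mult:
 assumes "test_function Om f" "smooth g"
 shows "test_function Om (%x. f x * g x)"
proof -
 obtain K where "smooth f" "compact K" "K \<subseteq> Om" "!!x. x \<notin> K ==> f x = 0"
  using test_functionE assms(1) by metis
 then show ?thesis using assms(2)
  by (intro test_functionI[of _ K] smooth_mult) auto
qed

lemma integrable_compact_support:
 fixes f :: "'a::euclidean_space => 'b::{banach, second_countable_topology}"
 assumes "continuous_on UNIV f" "!!x. norm x >= R ==> f x = 0"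
 shows "integrable lborel f"
proof -
 have "integrable lborel (%x. indicator (cball 0 R) x *\<^sub>R f x)"
  by (intro borel_integrable_compact) (auto intro: continuous_on_subset[OF assms(1)])
 moreover have "(%x. indicator (cball 0 R) x *\<^sub>R f x) = f"
  using assms(2) by (auto simp: indicator_def fun_eq_iff)
 ultimately show ?thesis by simp
qed

lemma bounded_compact_support:
 fixes f :: "'a::euclidean_space => 'b::real_normed_vector"
 assumes "continuous_on UNIV f" "!!x. norm x >= R ==> f x = 0"
 obtains M where "M > 0" "!!x. norm (f x) <= M"
proof -
 have "compact (f ` cball 0 R)"
  by (intro compact_continuous_image) (auto intro: continuous_on_subset[OF assms(1)])
 then obtain M where M: "!!y. y \<in> f ` cball 0 R ==> norm y <= M"
  using compact_imp_bounded bounded_iff by metis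
 have "norm (f x) <= max M 1" for x
  using M[of "f x"] assms(2)[of x] by (cases "norm x <= R") auto
 then show ?thesis by (intro that[of "max M 1"]) auto
qed

lemma test_function_continuous: "test_function Om f ==> continuous_on UNIV f"
 by (simp add: test_function_def smooth_continuous)

lemma test_function_integrable: "test_function Om f ==> integrable lborel f"
 using integrable_compact_support test_function_cball test_function_continuous by metis

lemma test_function_bounded:
 assumes "test_function Om f" obtains M where "M > 0" "!!x. norm (f x) <= M"
 using bounded_compact_support test_function_cball test_function_continuous assms by metis

text \<open>Bounds on the partial derivatives bound the operator norm of the derivative, and the
  mean value inequality applies.\<close>

lemma test_function_lipschitz:
 fixes f :: "'a::euclidean_space => complex"
 assumes "test_function Om f"
 obtains L where "L > 0" "!!x y. norm (f x - f y) <= L * norm (x - y)"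
proof -
 have "\<exists>M>0. \<forall>x. norm (pd b f x) <= M" if "b \<in> Basis" for b
  using test_function_bounded[OF test_function_pd[OF assms that]] by metis
 then obtain M where M: "!!b x. b \<in> Basis ==> norm (pd b f x) <= M b" "!!b. b \<in> Basis ==> M b > 0"
  by metis
 have "norm (f x - f y) <= (\<Sum>b\<in>Basis. M b) * norm (x - y)" for x y
 proof (rule differentiable_bound[of UNIV])
  show "(f has_derivative (%v. \<Sum>b\<in>Basis. complex_of_real (v \<bullet> b) * pd b f x)) (at x within UNIV)" for x
   using has_derivative_sum_pd[OF test_function_differentiable[OF assms]] by simp
  show "onorm (%v. \<Sum>b\<in>Basis. complex_of_real (v \<bullet> b) * pd b f x) <= (\<Sum>b\<in>Basis. M b)" for x
  proof (rule onorm_le)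
   fix v :: 'a
   have "norm (\<Sum>b\<in>Basis. complex_of_real (v \<bullet> b) * pd b f x) <= (\<Sum>b\<in>Basis. norm v * M b)"
    using M(1) by (intro sum_norm_le) (auto simp: norm_mult intro!: mult_mono Basis_le_norm)
   then show "norm (\<Sum>b\<in>Basis. complex_of_real (v \<bullet> b) * pd b f x) <= (\<Sum>b\<in>Basis. M b) * norm v"
    by (simp add: sum_distrib_left[symmetric] mult.commute[of _ "norm v"])
  qed
 qed auto
 moreover have "(\<Sum>b\<in>Basis. M b) > 0"
  using M(2) by (intro sum_pos) auto
 ultimately show ?thesis using that by blast
qed

text \<open>No measurability is assumed: if \<open>f\<close> is not measurable, neither is its
  translate, and both integrals have the default value zero.\<close>

lemma lborel_integral_translation:
 fixes f :: "'a::euclidean_space => 'b::{banach, second_countable_topology}"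
 shows "integrable lborel (%x. f (c + x)) \<longleftrightarrow> integrable lborel f" (is ?I)
  and "(LINT x|lborel. f (c + x)) = (LINT x|lborel. f x)" (is ?E)
proof -
 have inj: "f \<in> borel_measurable borel" if "(%x. f (c + x)) \<in> borel_measurable borel"
 proof -
  have "(%x. f (c + (- c + x))) \<in> borel_measurable borel"
   by (rule measurable_compose[OF _ that]) simp
  then show ?thesis by simp
 qed
 have m: "(%x. f (c + x)) \<in> borel_measurable borel" if "f \<in> borel_measurable borel"
  by (rule measurable_compose[OF _ that]) simp
 show ?I
 proof (cases "f \<in> borel_measurable borel")
  case True
  have "integrable (distr lborel borel ((+) c)) f \<longleftrightarrow> integrable lborel (%x. f (c + x))"
   by (rule integrable_distr_eq) (use True in auto)
  then show ?thesis by (simp add: lborel_distr_plus)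
 next
  case False
  then show ?thesis using inj borel_measurable_integrable by (metis measurable_lborel2)
 qed
 show ?E
 proof (cases "f \<in> borel_measurable borel")
  case True
  have "integral\<^sup>L (distr lborel borel ((+) c)) f = (LINT x|lborel. f (c + x))"
   by (rule integral_distr) (use True in auto)
  then show ?thesis by (simp add: lborel_distr_plus)
 next
  case False
  then have "\<not> integrable lborel f" "\<not> integrable lborel (%x. f (c + x))"
   using inj borel_measurable_integrable by (metis measurable_lborel2)+
  then show ?thesis by (simp add: not_integrable_integral_eq)
 qed
qed

lemma directional_quotient_tendsto:
 fixes f :: "'a::real_normed_vector => 'b::real_normed_vector"
 assumes D: "(f has_derivative f') (at x)" and h: "h \<longlonglongrightarrow> 0" "!!n. h n ~= 0"
 shows "(%n. (f (x + h n *\<^sub>R v) - f x) /\<^sub>R h n) \<longlonglongrightarrow> f' v"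
proof -
 have "((%t::real. x + t *\<^sub>R v) has_derivative (%t. t *\<^sub>R v)) (at 0)"
  by (auto intro!: derivative_eq_intros)
 then have "((%t. f (x + t *\<^sub>R v)) has_derivative (%t. f' (t *\<^sub>R v))) (at 0)"
  by (rule has_derivative_compose) (use D in simp)
 then have lim: "((%t. norm (f (x + t *\<^sub>R v) - f x - f' (t *\<^sub>R v)) / norm t) \<longlongrightarrow> 0) (at 0)"
  by (simp add: has_derivative_iff_norm)
 have eq: "norm (f (x + t *\<^sub>R v) - f x - f' (t *\<^sub>R v)) / norm t = norm ((f (x + t *\<^sub>R v) - f x) /\<^sub>R t - f' v)"
  if "t ~= 0" for t
 proof -
  have "f (x + t *\<^sub>R v) - f x - f' (t *\<^sub>R v) = t *\<^sub>R ((f (x + t *\<^sub>R v) - f x) /\<^sub>R t - f' v)"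
   using that linear_cmul[OF has_derivative_linear[OF D]] by (simp add: scaleR_diff_right)
  then show ?thesis using that by simp
 qed
 have "((%t. norm ((f (x + t *\<^sub>R v) - f x) /\<^sub>R t - f' v)) \<longlongrightarrow> 0) (at 0)"
  by (rule Lim_transform_eventually[OF lim], unfold eventually_at_filter)
    (intro always_eventually allI impI eq)
 moreover have "filterlim h (at 0) sequentially"
  using h by (auto simp: filterlim_at)
 ultimately have "(%n. norm ((f (x + h n *\<^sub>R v) - f x) /\<^sub>R h n - f' v)) \<longlonglongrightarrow> 0"
  by (rule filterlim_compose)
 then show ?thesis
  by (rule LIM_zero_cancel[OF tendsto_norm_zero_cancel])
qed

text \<open>Difference quotients have integral zero by translation invariance. The Lipschitz bound
  dominates them, so dominated convergence passes this on to the derivative.\<close>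

lemma integral_pd_test_function:
 fixes f :: "'a::euclidean_space => complex"
 assumes f: "test_function Om f" and b: "b \<in> Basis"
 shows "(LINT x|lborel. pd b f x) = 0"
proof -
 obtain R where R: "R > 0" "!!x. norm x >= R ==> f x = 0" using f test_function_cball by metis
 obtain L where L: "L > 0" "!!x y. norm (f x - f y) <= L * norm (x - y)" using f test_function_lipschitz by metis
 define h where "h n = inverse (real (Suc n))" for n
 have h: "h n > 0" "h n <= 1" for n by (auto simp: h_def field_simps)
 have hlim: "h \<longlonglongrightarrow> 0" unfolding h_def[abs_def] by (rule LIMSEQ_inverse_real_of_nat)
 define q where "q n x = (f (h n *\<^sub>R b + x) - f x) / of_real (h n)" for n x
 note [measurable] = borel_measurable_continuous_onI[OF test_function_continuous[OF f]]
  borel_measurable_continuous_onI[OF test_function_continuous[OF test_function_pd[OF f b]]]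
 have "(%n. LINT x|lborel. q n x) \<longlonglongrightarrow> (LINT x|lborel. pd b f x)"
 proof (rule integral_dominated_convergence[where w="%x. L * indicator (cball 0 (R + 1)) x"])
  show "pd b f \<in> borel_measurable lborel" by measurable
  show "q n \<in> borel_measurable lborel" for n unfolding q_def[abs_def] by measurable
  \<comment> \<open>Shifts by at most 1 enlarge the support by at most 1.\<close>
  show "integrable lborel (%x. L * indicator (cball 0 (R + 1)) x)"
   by (intro integrable_mult_right integrable_real_indicator) (use emeasure_bounded_finite[of "cball 0 (R + 1)"] in \<open>auto simp: top.not_eq_extremum\<close>)
  show "AE x in lborel. (%n. q n x) \<longlonglongrightarrow> pd b f x"
  proof (rule AE_I2)
   fix x
   have "(f has_derivative (%v. frechet_derivative f (at x) v)) (at x)"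
    using f smooth_has_derivative test_function_smooth by blast
   from directional_quotient_tendsto[OF this hlim, of b] h(1)
   have "(%n. (f (x + h n *\<^sub>R b) - f x) /\<^sub>R h n) \<longlonglongrightarrow> pd b f x"
    by (simp add: pd_def less_imp_neq[symmetric])
   then show "(%n. q n x) \<longlonglongrightarrow> pd b f x"
    by (simp add: q_def scaleR_conv_of_real divide_inverse mult.commute add.commute)
  qed
  show "AE x in lborel. norm (q n x) <= L * indicator (cball 0 (R + 1)) x" for n
  proof (rule AE_I2)
   fix x
   show "norm (q n x) <= L * indicator (cball 0 (R + 1)) x"
   proof (cases "norm x <= R + 1")
    case True
    have "norm (f (h n *\<^sub>R b + x) - f x) <= L * h n"
     using L(2)[of "h n *\<^sub>R b + x" x] b h(1)[of n] by simp
    then show ?thesis using True h(1)[of n] by (simp add: q_def norm_divide field_simps)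
   next
    case False
    have "norm x <= norm (h n *\<^sub>R b + x) + norm (h n *\<^sub>R b)"
     by (metis add_diff_cancel_left' norm_triangle_ineq4)
    also have "norm (h n *\<^sub>R b) <= 1" using b h[of n] by simp
    finally have "norm (h n *\<^sub>R b + x) >= R" using False by simp
    then show ?thesis using False R(2) by (simp add: q_def)
   qed
  qed
 qed
 moreover have "(LINT x|lborel. q n x) = 0" for n
 proof -
  have "integrable lborel (%x. f (h n *\<^sub>R b + x))"
   using lborel_integral_translation(1) test_function_integrable[OF f] by blast
  then show ?thesis
   unfolding q_def using test_function_integrable[OF f] lborel_integral_translation(2)[of f "h n *\<^sub>R b"]
   by simp
 qed
 ultimately have "(%n. 0::complex) \<longlonglongrightarrow> (LINT x|lborel. pd b f x)" by simp
 from LIMSEQ_unique[OF this tendsto_const] show ?thesis .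
qed

section \<open>Mollification\<close>

text \<open>Borel rather than Lebesgue measurability, so that products and translates remain
  measurable for \<open>lborel\<close>.\<close>

definition loc_int :: "('a::euclidean_space => complex) => bool" where
 "loc_int U \<longleftrightarrow> U \<in> borel_measurable borel & (\<forall>R. set_integrable lborel (cball 0 R) U)"

definition conv :: "('a::euclidean_space => complex) => ('a => complex) => 'a => complex" where
 "conv U K x = (LINT y|lborel. U y * K (x - y))"

lemma loc_int_measurable: "loc_int U ==> U \<in> borel_measurable borel"
 by (simp add: loc_int_def)

lemma integrable_loc_int_mult:
 fixes U g :: "'a::euclidean_space => complex"
 assumes "loc_int U" "g \<in> borel_measurable borel" "!!y. norm (g y) <= M" "!!y. norm y >= R ==> g y = 0"
 shows "integrable lborel (%y. U y * g y)"
proof (rule Bochner_Integration.integrable_bound)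
 show "integrable lborel (%y. M *\<^sub>R (indicator (cball 0 R) y *\<^sub>R U y))"
  using assms(1) by (intro integrable_scaleR_right) (simp add: loc_int_def set_integrable_def)
 show "(%y. U y * g y) \<in> borel_measurable lborel"
  using loc_int_measurable[OF assms(1)] assms(2) by simp
 show "AE y in lborel. norm (U y * g y) <= norm (M *\<^sub>R (indicator (cball 0 R) y *\<^sub>R U y))"
 proof (rule AE_I2)
  fix y
  have "norm (U y) * norm (g y) <= norm (U y) * \<bar>M\<bar>"
   using assms(3)[of y] by (intro mult_left_mono) auto
  then show "norm (U y * g y) <= norm (M *\<^sub>R (indicator (cball 0 R) y *\<^sub>R U y))"
   using assms(4)[of y] by (cases "norm y <= R") (auto simp: norm_mult mult.commute)
 qed
qed

lemma integrable_loc_int_test: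
 fixes U K :: "'a::euclidean_space => complex" and x :: 'a
 assumes "loc_int U" "continuous_on UNIV K" "!!y. norm y >= R ==> K y = 0"
 shows "integrable lborel (%y. U y * K (x - y))"
proof -
 obtain M where M: "!!y. norm (K y) <= M"
  using bounded_compact_support[OF assms(2,3)] by metis
 have "continuous_on UNIV (%y. K (x - y))"
  by (rule continuous_on_compose2[OF assms(2)]) (auto intro!: continuous_intros)
 then show ?thesis
 proof (intro integrable_loc_int_mult[OF assms(1), where M=M and R="norm x + R"] borel_measurable_continuous_onI)
  fix y :: 'a assume "norm x + R <= norm y"
  moreover have "norm y <= norm x + norm (x - y)"
   by (metis norm_minus_commute norm_triangle_sub)
  ultimately show "K (x - y) = 0" using assms(3) by simp
 qed (use M in auto)
qed

text \<open>The mean value inequality is applied to \<open>K\<close> minus its linearisation at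
  \<open>x\<close>. The derivative of this difference is at most a multiple of \<open>norm h\<close>
  on the ball of radius \<open>norm h\<close>.\<close>

lemma test_function_first_order:
 fixes K :: "'a::euclidean_space => complex"
 assumes K: "test_function Om K"
 obtains C where "C > 0"
  "!!x h. norm (K (x + h) - K x - (\<Sum>b\<in>Basis. complex_of_real (h \<bullet> b) * pd b K x)) <= C * (norm h)^2"
proof -
 have "\<exists>L>0. \<forall>x y. norm (pd b K x - pd b K y) <= L * norm (x - y)" if "b \<in> Basis" for b
  using test_function_lipschitz[OF test_function_pd[OF K that]] by metis
 then obtain L where L: "!!b x y. b \<in> Basis ==> norm (pd b K x - pd b K y) <= L b * norm (x - y)"
  "!!b. b \<in> Basis ==> L b > 0" by metis
 let ?D = "%x v. \<Sum>b\<in>Basis. complex_of_real (v \<bullet> b) * pd b K x"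
 let ?C = "\<Sum>b\<in>Basis. L b"
 have "norm (K (x + h) - K x - ?D x h) <= ?C * (norm h)^2" for x h :: 'a
 proof -
  have "norm ((K (x + h) - ?D x (x + h)) - (K x - ?D x x)) <= (?C * norm h) * norm ((x + h) - x)"
  proof (rule differentiable_bound[of "cball x (norm h)"])
   show "((%y. K y - ?D x y) has_derivative (%v. ?D y v - ?D x v)) (at y within cball x (norm h))" for y
    by (intro has_derivative_diff has_derivative_at_withinI[OF has_derivative_sum_pd]
       test_function_differentiable[OF K] bounded_linear_imp_has_derivative
       has_derivative_bounded_linear[OF has_derivative_sum_pd])
   show "onorm (%v. ?D y v - ?D x v) <= ?C * norm h" if "y \<in> cball x (norm h)" for y
   proof (rule onorm_le)
    fix v :: 'a
    have "norm (?D y v - ?D x v) = norm (\<Sum>b\<in>Basis. complex_of_real (v \<bullet> b) * (pd b K y - pd b K x))"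
     by (simp add: sum_subtractf right_diff_distrib)
    also have "... <= (\<Sum>b\<in>Basis. norm v * (L b * norm h))"
    proof (rule sum_norm_le)
     fix b :: 'a assume b: "b \<in> Basis"
     have "norm (pd b K y - pd b K x) <= L b * norm (y - x)" using L(1)[OF b] .
     also have "... <= L b * norm h"
      using that L(2)[OF b] by (intro mult_left_mono) (auto simp: dist_norm norm_minus_commute)
     finally show "norm (complex_of_real (v \<bullet> b) * (pd b K y - pd b K x)) <= norm v * (L b * norm h)"
      using Basis_le_norm[OF b] by (simp add: norm_mult mult_mono)
    qed
    also have "... = ?C * norm h * norm v"
     by (simp add: sum_distrib_left[symmetric] sum_distrib_right[symmetric] mult.commute mult.left_commute)
    finally show "norm (?D y v - ?D x v) <= ?C * norm h * norm v" .
   qed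
  qed (auto simp: dist_norm)
  moreover have "?D x (x + h) = ?D x x + ?D x h"
   by (simp add: inner_add_left distrib_right sum.distrib)
  ultimately show ?thesis by (simp add: power2_eq_square algebra_simps)
 qed
 moreover have "?C > 0" using L(2) by (intro sum_pos) auto
 ultimately show ?thesis using that by blast
qed

text \<open>The quadratic error of \<open>test_function_first_order\<close> is uniform in the point,
  so it can be integrated against \<open>U\<close> over one fixed ball; differentiation under the
  integral becomes a plain estimate.\<close>

lemma conv_has_derivative:
 fixes U K :: "'a::euclidean_space => complex"
 assumes U: "loc_int U" and K: "test_function UNIV K"
 shows "(conv U K has_derivative (%v. \<Sum>b\<in>Basis. complex_of_real (v \<bullet> b) * conv U (pd b K) x)) (at x)"
proof -
 obtain R where R: "R > 0" "!!y. norm y >= R ==> K y = 0" using K test_function_cball by metis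
 obtain C where C: "C > 0"
  "!!x h. norm (K (x + h) - K x - (\<Sum>b\<in>Basis. complex_of_real (h \<bullet> b) * pd b K x)) <= C * (norm h)^2"
  using K test_function_first_order by metis
 have pdR: "pd b K y = 0" if "norm y >= R + 1" for b y
  using R that by (intro pd_eq_0_outside[of "cball 0 R"]) auto
 have cont: "continuous_on UNIV (pd b K)" if "b \<in> Basis" for b
  using test_function_continuous test_function_pd K that by metis
 have int: "integrable lborel (%y. U y * K (x - y))" for x
  by (rule integrable_loc_int_test[OF U test_function_continuous[OF K] R(2)])
 have intp: "integrable lborel (%y. U y * pd b K (x - y))" if "b \<in> Basis" for b x
  by (rule integrable_loc_int_test[OF U cont[OF that] pdR])
 let ?D = "%v. \<Sum>b\<in>Basis. complex_of_real (v \<bullet> b) * conv U (pd b K) x"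
 let ?Q = "%h z. K (z + h) - K z - (\<Sum>b\<in>Basis. complex_of_real (h \<bullet> b) * pd b K z)"
 \<comment> \<open>For \<open>norm h \<le> 1\<close> the kernel at \<open>x\<close> and at
   \<open>x + h\<close> and its derivatives at \<open>x\<close> all vanish when \<open>y\<close>
   lies outside this ball.\<close>
 define N where "N = (LINT y|lborel. norm (indicator (cball 0 (norm x + R + 2)) y *\<^sub>R U y))"
 have intN: "integrable lborel (%y. norm (indicator (cball 0 (norm x + R + 2)) y *\<^sub>R U y))"
  by (rule integrable_norm) (use U in \<open>simp add: loc_int_def set_integrable_def\<close>)
 have key: "norm (conv U K (x + h) - conv U K x - ?D h) <= C * N * (norm h)^2" if h: "norm h <= 1" for h
 proof -
  have E: "(%y. U y * (\<Sum>b\<in>Basis. complex_of_real (h \<bullet> b) * pd b K (x - y)))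
    = (%y. \<Sum>b\<in>Basis. complex_of_real (h \<bullet> b) * (U y * pd b K (x - y)))"
   by (simp add: sum_distrib_left mult.left_commute)
  have I: "integrable lborel (%y. U y * (\<Sum>b\<in>Basis. complex_of_real (h \<bullet> b) * pd b K (x - y)))"
   unfolding E by (intro Bochner_Integration.integrable_sum integrable_mult_right intp)
  have "conv U K (x + h) - conv U K x - ?D h = (LINT y|lborel. U y * ?Q h (x - y))"
  proof -
   have xh: "x + h - y = x - y + h" for y by simp
   have "?D h = (LINT y|lborel. U y * (\<Sum>b\<in>Basis. complex_of_real (h \<bullet> b) * pd b K (x - y)))"
    unfolding conv_def E
    by (subst Bochner_Integration.integral_sum) (auto intro: integrable_mult_right intp)
   moreover have "integrable lborel (%y. U y * K (x - y + h))"
    using int[of "x + h"] unfolding xh .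
   ultimately show ?thesis
    unfolding conv_def xh using I int[of x] by (simp add: right_diff_distrib)
  qed
  also have "norm ... <= (LINT y|lborel. (C * (norm h)^2) * norm (indicator (cball 0 (norm x + R + 2)) y *\<^sub>R U y))"
  proof (rule Bochner_Integration.integral_norm_bound_integral)
   show "integrable lborel (%y. U y * ?Q h (x - y))"
    using Bochner_Integration.integrable_diff[OF Bochner_Integration.integrable_diff[OF int[of "x + h"] int[of x]] I]
    by (simp add: algebra_simps)
   show "integrable lborel (%y. (C * (norm h)^2) * norm (indicator (cball 0 (norm x + R + 2)) y *\<^sub>R U y))"
    using intN by (rule integrable_mult_right)
   fix y
   show "norm (U y * ?Q h (x - y)) <= (C * (norm h)^2) * norm (indicator (cball 0 (norm x + R + 2)) y *\<^sub>R U y)"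
   proof (cases "norm y <= norm x + R + 2")
    case True
    have "norm (U y) * norm (?Q h (x - y)) <= norm (U y) * (C * (norm h)^2)"
     by (intro mult_left_mono C(2)) auto
    then show ?thesis using True by (simp add: norm_mult mult.commute)
   next
    case False
    have "norm y <= norm x + norm (x - y)" "norm (x - y) <= norm (x - y + h) + norm h"
     by (metis norm_minus_commute norm_triangle_sub, metis add_diff_cancel_right' norm_triangle_ineq4)
    then have "norm (x - y) >= R + 1" "norm (x - y + h) >= R"
     using False h by linarith+
    then have "?Q h (x - y) = 0" using R pdR by simp
    then show ?thesis using C(1) by simp
   qed
  qed
  also have "... = C * N * (norm h)^2"
   unfolding N_def integral_mult_right_zero by (simp only: mult_ac)
  finally show ?thesis .
 qed
 have "N >= 0" unfolding N_def by (intro integral_nonneg_AE) auto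
 show ?thesis
  unfolding has_derivative_at
 proof
  show "bounded_linear ?D"
   by (intro bounded_linear_sum bounded_linear_mult_const
      bounded_linear_compose[OF bounded_linear_of_real bounded_linear_inner_left])
  have "((%h. C * N * norm h) \<longlongrightarrow> 0) (at (0::'a))"
   by (auto intro!: tendsto_eq_intros)
  then show "(%h. norm (conv U K (x + h) - conv U K x - ?D h) / norm h) \<midarrow>0\<rightarrow> 0"
  proof (rule Lim_null_comparison[rotated])
   show "\<forall>\<^sub>F h in at 0. norm (norm (conv U K (x + h) - conv U K x - ?D h) / norm h) <= C * N * norm h"
    unfolding eventually_at
    by (rule exI[of _ 1]) (use key in \<open>auto simp: divide_le_eq power2_eq_square mult.assoc\<close>)
  qed
 qed
qed

lemma pd_conv:
 assumes "loc_int U" "test_function UNIV K" "b \<in> Basis"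
 shows "pd b (conv U K) = conv U (pd b K)"
proof
 fix x
 have "pd b (conv U K) x = (\<Sum>i\<in>Basis. complex_of_real (b \<bullet> i) * conv U (pd i K) x)"
  by (rule pd_eqI[OF conv_has_derivative[OF assms(1,2)]])
 also have "... = (\<Sum>i\<in>Basis. if i = b then conv U (pd b K) x else 0)"
  by (rule sum.cong) (use assms(3) in \<open>auto simp: inner_Basis\<close>)
 finally show "pd b (conv U K) x = conv U (pd b K) x" using assms(3) by simp
qed

lemma smooth_conv:
 fixes U K :: "'a::euclidean_space => complex"
 assumes U: "loc_int U" and K: "test_function UNIV K"
 shows "smooth (conv U K)"
proof (rule smooth_coinduct[where P="%g. \<exists>K. test_function UNIV K & g = conv U K"])
 show "\<exists>K'. test_function UNIV K' & conv U K = conv U K'" using K by auto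
next
 fix g and x :: 'a assume "\<exists>K. test_function UNIV K & g = conv U K"
 then show "g differentiable (at x)" using conv_has_derivative[OF U] differentiableI by blast
next
 fix g and b :: 'a assume g: "\<exists>K. test_function UNIV K & g = conv U K" and b: "b \<in> Basis"
 then show "\<exists>K. test_function UNIV K & pd b g = conv U K"
  using pd_conv[OF U _ b] test_function_pd[OF _ b] by metis
qed

section \<open>Multiplier identities\<close>

definition lap :: "('a::euclidean_space => complex) => 'a => complex" where
 "lap v x = (\<Sum>b\<in>Basis. pd b (pd b v) x)"

text \<open>The operator \<open>x . grad\<close>, that is, \<open>r\<close> times the radial
  derivative; unlike the latter it is smooth at the origin.\<close>

definition euler :: "('a::euclidean_space => complex) => 'a => complex" where
 "euler v x = (\<Sum>b\<in>Basis. complex_of_real (x \<bullet> b) * pd b v x)"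

definition grad2 :: "('a::euclidean_space => complex) => 'a => real" where
 "grad2 v x = (\<Sum>b\<in>Basis. (cmod (pd b v x))^2)"

text \<open>The profile takes \<open>|x|^2\<close> as its argument, so smoothness at the origin is
  automatic and the gradient is \<open>2 x Q'(|x|^2)\<close>.\<close>

definition radial :: "(real => real) => 'a::euclidean_space => complex" where
 "radial Q x = complex_of_real (Q ((norm x)^2))"

lemma smooth_radial: "smooth_real Q ==> smooth (radial Q)"
 unfolding radial_def[abs_def] using smooth_comp_of_real[OF _ smooth_norm2[of 0]] by simp

lemma pd_radial:
 fixes x b :: "'a::euclidean_space"
 assumes "!!t. (Q has_real_derivative Q' t) (at t)"
 shows "pd b (radial Q) x = 2 * radial Q' x * complex_of_real (x \<bullet> b)"
proof -
 have "((%x. complex_of_real (Q (Re (complex_of_real ((norm (x - 0))^2))))) has_derivative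
   (%h. of_real (Q' (Re (complex_of_real ((norm (x - 0))^2))) *
    Re (frechet_derivative (%x. complex_of_real ((norm (x - 0))^2)) (at x) h)))) (at x)"
  by (rule has_derivative_real_comp[OF _ assms]) (rule differentiableI[OF has_derivative_norm2_of_real])
 then have "pd b (%x. complex_of_real (Q (Re (complex_of_real ((norm (x - 0))^2))))) x
   = of_real (Q' (Re (complex_of_real ((norm (x - 0))^2))) *
    Re (frechet_derivative (%x. complex_of_real ((norm (x - 0))^2)) (at x) b))"
  by (rule pd_eqI)
 moreover have "frechet_derivative (%x. complex_of_real ((norm (x - 0))^2)) (at x) b = complex_of_real (2 * (b \<bullet> x))"
  using pd_eqI[OF has_derivative_norm2_of_real[of 0 x], of b] by (simp add: pd_def)
 ultimately show ?thesis
  by (simp add: radial_def[abs_def] inner_commute)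
qed

lemma smooth_euler: "smooth v ==> smooth (euler v)"
 unfolding euler_def[abs_def] by (intro smooth_sum smooth_mult smooth_inner smooth_pd) auto

lemma smooth_lap: "smooth v ==> smooth (lap v)"
 unfolding lap_def[abs_def] by (intro smooth_sum smooth_pd) auto

lemma pd_inner: "pd c (%x. complex_of_real (x \<bullet> b)) x = of_real (c \<bullet> b)"
 by (rule pd_eqI[OF has_derivative_inner_of_real])

text \<open>Symmetry of second derivatives is taken as a hypothesis; mollified functions satisfy it
  through the explicit formula for radial kernels.\<close>

lemma pd_euler:
 fixes v :: "'a::euclidean_space => complex"
 assumes "smooth v" "c \<in> Basis" "!!b. b \<in> Basis ==> pd c (pd b v) x = pd b (pd c v) x"
 shows "pd c (euler v) x = pd c v x + euler (pd c v) x"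
proof -
 have "pd c (euler v) x = (\<Sum>b\<in>Basis. pd c (%x. complex_of_real (x \<bullet> b) * pd b v x) x)"
  unfolding euler_def[abs_def]
  by (rule pd_sum) (auto intro!: smooth_differentiable smooth_mult smooth_inner smooth_pd assms)
 also have "... = (\<Sum>b\<in>Basis. complex_of_real (x \<bullet> b) * pd b (pd c v) x + (if b = c then pd c v x else 0))"
 proof (rule sum.cong)
  fix b :: 'a assume b: "b \<in> Basis"
  have "pd c (%x. complex_of_real (x \<bullet> b) * pd b v x) x
    = complex_of_real (x \<bullet> b) * pd c (pd b v) x + complex_of_real (c \<bullet> b) * pd b v x"
   using assms(1) b by (subst pd_mult) (auto simp: pd_inner intro!: smooth_differentiable smooth_inner smooth_pd)
  then show "pd c (%x. complex_of_real (x \<bullet> b) * pd b v x) x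
    = complex_of_real (x \<bullet> b) * pd b (pd c v) x + (if b = c then pd c v x else 0)"
   using assms(2,3) b by (auto simp: inner_Basis)
 qed simp
 also have "... = pd c v x + euler (pd c v) x"
  using assms(2) by (simp add: sum.distrib euler_def add.commute)
 finally show ?thesis .
qed

text \<open>Differentiability and value travel together, so the derivative of a long expression can
  be synthesised by introduction rules alone.\<close>

definition has_pd :: "'a::euclidean_space => ('a => complex) => 'a => complex => bool" where
 "has_pd b f x d \<longleftrightarrow> f differentiable (at x) & pd b f x = d"

lemma has_pdD: "has_pd b f x d ==> d = e ==> pd b f x = e"
 by (simp add: has_pd_def)

lemma has_pd_const: "has_pd b (%x. c) x 0"
 by (simp add: has_pd_def)

lemma has_pd_smooth: "smooth f ==> has_pd b f x (pd b f x)"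
 by (simp add: has_pd_def smooth_differentiable)

lemma has_pd_inner: "has_pd b (%x. complex_of_real (x \<bullet> c)) x (of_real (b \<bullet> c))"
 by (simp add: has_pd_def pd_inner smooth_differentiable[OF smooth_inner])

lemma has_pd_add: "has_pd b f x d ==> has_pd b g x e ==> has_pd b (%x. f x + g x) x (d + e)"
 by (auto simp: has_pd_def pd_add)

lemma has_pd_diff: "has_pd b f x d ==> has_pd b g x e ==> has_pd b (%x. f x - g x) x (d - e)"
 by (auto simp: has_pd_def pd_diff)

lemma has_pd_mult: "has_pd b f x d ==> has_pd b g x e ==> has_pd b (%x. f x * g x) x (f x * e + d * g x)"
 by (auto simp: has_pd_def pd_mult intro!: differentiable_mult)

lemma has_pd_cnj: "has_pd b f x d ==> has_pd b (%x. cnj (f x)) x (cnj d)"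
 using bounded_linear.has_derivative[OF bounded_linear_cnj]
 unfolding has_pd_def differentiable_def by (metis differentiableI pd_cnj)

lemma has_pd_sum:
 assumes "finite I" "!!i. i \<in> I ==> has_pd b (f i) x (d i)"
 shows "has_pd b (%x. \<Sum>i\<in>I. f i x) x (\<Sum>i\<in>I. d i)"
 using assms by (induction I rule: finite_induct) (simp_all add: has_pd_const has_pd_add)

lemmas has_pd_intros = has_pd_add has_pd_diff has_pd_mult has_pd_cnj has_pd_const has_pd_inner

text \<open>The common frame of the three identities below: the divergence of a compactly supported
  field integrates to zero. The density \<open>g\<close> is real, while the calculation is
  complex.\<close>

lemma integral_divergence_eq_0:
 fixes F :: "'a::euclidean_space => 'a => complex"
 assumes "!!b. b \<in> Basis ==> test_function UNIV (F b)"
  and "!!x. complex_of_real (g x) = (\<Sum>b\<in>Basis. pd b (F b) x)"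
 shows "integrable lborel g" "(LINT x|lborel. g x) = 0"
proof -
 have I: "integrable lborel (pd b (F b))" if "b \<in> Basis" for b
  using assms(1) that test_function_pd test_function_integrable by metis
 have eq: "(%x. complex_of_real (g x)) = (%x. \<Sum>b\<in>Basis. pd b (F b) x)" using assms(2) by auto
 have J: "integrable lborel (%x. complex_of_real (g x))"
  unfolding eq by (intro Bochner_Integration.integrable_sum I)
 from integrable_Re[OF this] show "integrable lborel g" by simp
 have "complex_of_real (LINT x|lborel. g x) = (LINT x|lborel. complex_of_real (g x))"
  by simp
 also have "... = (\<Sum>b\<in>Basis. LINT x|lborel. pd b (F b) x)"
  unfolding eq by (rule Bochner_Integration.integral_sum) (rule I)
 also have "... = 0"
  by (intro sum.neutral ballI integral_pd_test_function[OF assms(1)])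
 finally show "(LINT x|lborel. g x) = 0" by simp
qed

lemma sum_inner_Basis_square:
 fixes x :: "'a::euclidean_space"
 shows "(\<Sum>b\<in>Basis. complex_of_real (x \<bullet> b) * complex_of_real (x \<bullet> b)) = complex_of_real ((norm x)^2)"
proof -
 have "(norm x)^2 = (\<Sum>b\<in>Basis. (x \<bullet> b) * (x \<bullet> b))"
  using euclidean_inner[of x x] by (simp add: dot_square_norm)
 then show ?thesis by simp
qed

context
 fixes v :: "'a::euclidean_space => complex" and Q Q1 Q2 :: "real => real" and T :: real
 assumes v: "smooth v"
  and sym: "!!b c x. b \<in> Basis ==> c \<in> Basis ==> pd c (pd b v) x = pd b (pd c v) x"
  and Q: "smooth_real Q" "smooth_real Q1" "smooth_real Q2"
  and Q1: "!!t. (Q has_real_derivative Q1 t) (at t)"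
  and Q2: "!!t. (Q1 has_real_derivative Q2 t) (at t)"
  and supp: "!!t. t >= T ==> Q t = 0" "!!t. t >= T ==> Q1 t = 0"
begin

lemma radial_test: "test_function UNIV (radial Q :: 'a => complex)" "test_function UNIV (radial Q1 :: 'a => complex)"
proof -
 have *: "(norm x)^2 >= T" if "norm x >= max T 1" for x :: 'a
 proof -
  have "T <= norm x * 1" using that by simp
  also have "... <= norm x * norm x" using that by (intro mult_left_mono) auto
  finally show ?thesis by (simp add: power2_eq_square)
 qed
 have "radial Q x = 0" "radial Q1 x = 0" if "norm x >= max T 1" for x :: 'a
  using *[OF that] supp by (simp_all add: radial_def)
 then show "test_function UNIV (radial Q :: 'a => complex)" "test_function UNIV (radial Q1 :: 'a => complex)"
  using test_function_UNIVI[OF smooth_radial[OF Q(1)], of "max T 1"]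
   test_function_UNIVI[OF smooth_radial[OF Q(2)], of "max T 1"] by blast+
qed

lemma sm: "b \<in> Basis ==> smooth (pd b v)" "b \<in> Basis ==> c \<in> Basis ==> smooth (pd c (pd b v))" "smooth (euler v)"
 "smooth (radial Q)" "smooth (radial Q1)" "smooth (radial Q2)"
 by (simp_all add: v smooth_pd smooth_euler smooth_radial Q)

lemmas sms = sm v smooth_mult smooth_add smooth_diff smooth_cnj smooth_const smooth_inner smooth_sum

lemma has_pd_leaf:
 "has_pd b v x (pd b v x)" "c \<in> Basis ==> has_pd b (pd c v) x (pd b (pd c v) x)"
 "has_pd b (radial Q) x (2 * radial Q1 x * complex_of_real (x \<bullet> b))"
 "has_pd b (radial Q1) x (2 * radial Q2 x * complex_of_real (x \<bullet> b))"
 "b \<in> Basis ==> has_pd b (euler v) x (pd b v x + euler (pd b v) x)"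
 by (simp_all add: has_pd_def sm v smooth_differentiable pd_euler sym pd_radial[OF Q1] pd_radial[OF Q2])

text \<open>Divergence of the current \<open>Q Im (cnj v grad v)\<close>; the factor
  \<open>- \<i> / 2\<close> turns \<open>z - cnj z\<close> into \<open>Im z\<close>.\<close>

lemma flux_identity:
 defines "g \<equiv> (%x. Q ((norm x)^2) * Im (cnj (v x) * lap v x) + 2 * Q1 ((norm x)^2) * Im (cnj (v x) * euler v x))"
 shows "integrable lborel g" "(LINT x|lborel. g x) = 0"
proof -
 let ?F = "%b x. radial Q x * (- \<i> / 2 * (cnj (v x) * pd b v x - v x * cnj (pd b v x)))"
 have t: "test_function UNIV (?F b)" if "b \<in> Basis" for b
  by (intro test_function_mult radial_test sms that)
 have eq: "complex_of_real (g x) = (\<Sum>b\<in>Basis. pd b (?F b) x)" for x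
 proof -
  have pdF: "pd b (?F b) x = - \<i> / 2 * (radial Q x * (cnj (v x) * pd b (pd b v) x - v x * cnj (pd b (pd b v) x))
    + 2 * radial Q1 x * (cnj (v x) * (complex_of_real (x \<bullet> b) * pd b v x) - v x * cnj (complex_of_real (x \<bullet> b) * pd b v x)))"
   if b: "b \<in> Basis" for b
   by (rule has_pdD, (rule has_pd_intros has_pd_leaf b)+) (simp add: algebra_simps)
  have "(\<Sum>b\<in>Basis. pd b (?F b) x) = - \<i> / 2 * (radial Q x * (cnj (v x) * lap v x - v x * cnj (lap v x))
    + 2 * radial Q1 x * (cnj (v x) * euler v x - v x * cnj (euler v x)))"
   by (simp only: pdF sum.distrib sum_subtractf sum_distrib_left[symmetric] lap_def euler_def cong: sum.cong) simp
  also have "... = complex_of_real (g x)"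
   by (simp add: g_def radial_def complex_eq_iff field_simps)
  finally show ?thesis by simp
 qed
 show "integrable lborel g" "(LINT x|lborel. g x) = 0"
  using integral_divergence_eq_0[OF t eq] by auto
qed

text \<open>Divergence of \<open>Q grad |v|^2 - |v|^2 grad Q\<close>. The second part cancels the
  first-order cross terms, so derivatives of \<open>Q\<close> enter only through its Laplacian
  \<open>2 d Q1 + 4 |x|^2 Q2\<close>.\<close>

lemma energy_identity:
 defines "g \<equiv> (%x. 2 * Q ((norm x)^2) * (Re (cnj (v x) * lap v x) + grad2 v x)
   - (2 * real DIM('a) * Q1 ((norm x)^2) + 4 * (norm x)^2 * Q2 ((norm x)^2)) * (cmod (v x))^2)"
 shows "integrable lborel g" "(LINT x|lborel. g x) = 0"
proof -
 let ?F = "%b x. radial Q x * (cnj (v x) * pd b v x + v x * cnj (pd b v x))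
   - radial Q1 x * (2 * complex_of_real (x \<bullet> b) * (v x * cnj (v x)))"
 have t: "test_function UNIV (?F b)" if b: "b \<in> Basis" for b
 proof -
  obtain R1 R2 where "!!x::'a. norm x >= R1 ==> radial Q x = 0" "!!x::'a. norm x >= R2 ==> radial Q1 x = 0"
   using radial_test test_function_cball by metis
  then show ?thesis
   by (intro test_function_UNIVI[where R="max R1 R2"] sms b) auto
 qed
 have eq: "complex_of_real (g x) = (\<Sum>b\<in>Basis. pd b (?F b) x)" for x
 proof -
  have pdF: "pd b (?F b) x = radial Q x * (cnj (v x) * pd b (pd b v) x + v x * cnj (pd b (pd b v) x))
    + 2 * radial Q x * (pd b v x * cnj (pd b v x))
    - 2 * radial Q1 x * (v x * cnj (v x)) - 4 * radial Q2 x * (v x * cnj (v x)) * (complex_of_real (x \<bullet> b) * complex_of_real (x \<bullet> b))"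
   if b: "b \<in> Basis" for b
   by (rule has_pdD, (rule has_pd_intros has_pd_leaf b)+) (simp add: algebra_simps b)
  have "(\<Sum>b\<in>Basis. pd b (?F b) x) = radial Q x * (cnj (v x) * lap v x + v x * cnj (lap v x))
    + 2 * radial Q x * (\<Sum>b\<in>Basis. pd b v x * cnj (pd b v x))
    - 2 * DIM('a) * radial Q1 x * (v x * cnj (v x)) - 4 * radial Q2 x * (v x * cnj (v x)) * complex_of_real ((norm x)^2)"
   by (simp only: pdF sum.distrib sum_subtractf sum_distrib_left[symmetric] lap_def sum_inner_Basis_square cong: sum.cong)
     (simp add: mult_ac del: of_real_power)
  also have "(\<Sum>b\<in>Basis. pd b v x * cnj (pd b v x)) = complex_of_real (grad2 v x)"
   by (simp add: grad2_def complex_norm_square del: of_real_power)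
  also have "v x * cnj (v x) = complex_of_real ((cmod (v x))^2)" by (rule complex_norm_square[symmetric])
  also have "cnj (v x) * lap v x + v x * cnj (lap v x) = complex_of_real (2 * Re (cnj (v x) * lap v x))"
   by (simp add: complex_eq_iff)
  finally show ?thesis by (simp add: g_def radial_def algebra_simps)
 qed
 show "integrable lborel g" "(LINT x|lborel. g x) = 0"
  using integral_divergence_eq_0[OF t eq] by auto
qed

text \<open>The Rellich-Morawetz field of the multiplier \<open>euler v + \<alpha> v\<close>,
  corrected by \<open>\<alpha> |v|^2 grad Q\<close> as in the energy identity. The value
  \<open>\<alpha> = (d - 1) / 2\<close> gives \<open>Q grad2 v\<close> and
  \<open>kp^2 Q |v|^2\<close> the same coefficient:
  \<open>2 (1 + \<alpha>) - d = d - 2 \<alpha> = 1\<close>.\<close>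

lemma morawetz_identity:
 fixes kp :: real
 defines "\<alpha> \<equiv> (real DIM('a) - 1) / 2"
 defines "g \<equiv> (%x. 2 * Re ((lap v x + of_real (kp^2) * v x) * cnj (of_real (Q ((norm x)^2)) * (euler v x + of_real \<alpha> * v x)))
   + (Q ((norm x)^2) - 2 * (norm x)^2 * Q1 ((norm x)^2)) * grad2 v x + 4 * Q1 ((norm x)^2) * (cmod (euler v x))^2
   + kp^2 * (Q ((norm x)^2) + 2 * (norm x)^2 * Q1 ((norm x)^2)) * (cmod (v x))^2
   - \<alpha> * (2 * real DIM('a) * Q1 ((norm x)^2) + 4 * (norm x)^2 * Q2 ((norm x)^2)) * (cmod (v x))^2)"
 shows "integrable lborel g" "(LINT x|lborel. g x) = 0"
proof -
 let ?a = "complex_of_real \<alpha>" and ?k = "complex_of_real (kp^2)"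
 let ?m = "%x. euler v x + ?a * v x"
 let ?G = "%x. (\<Sum>c\<in>Basis. pd c v x * cnj (pd c v x)) - ?k * (v x * cnj (v x))"
 let ?F = "%b x. radial Q x * (pd b v x * cnj (?m x) + cnj (pd b v x) * ?m x - complex_of_real (x \<bullet> b) * ?G x)
   - radial Q1 x * (2 * ?a * complex_of_real (x \<bullet> b) * (v x * cnj (v x)))"
 have t: "test_function UNIV (?F b)" if b: "b \<in> Basis" for b
 proof -
  obtain R1 R2 where "!!x::'a. norm x >= R1 ==> radial Q x = 0" "!!x::'a. norm x >= R2 ==> radial Q1 x = 0"
   using radial_test test_function_cball by metis
  then show ?thesis
   by (intro test_function_UNIVI[where R="max R1 R2"] sms b) auto
 qed
 have eq: "complex_of_real (g x) = (\<Sum>b\<in>Basis. pd b (?F b) x)" for x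
 proof -
  define e where "e = euler v x"
  define p where "p = (%b. pd b v x)"
  define r where "r = (%b. euler (pd b v) x)"
  define X where "X = (%b. complex_of_real (x \<bullet> b))"
  define q q1 q2 where "q = complex_of_real (Q ((norm x)^2))" and "q1 = complex_of_real (Q1 ((norm x)^2))"
   and "q2 = complex_of_real (Q2 ((norm x)^2))"
  have pdG: "has_pd b ?G x ((\<Sum>c\<in>Basis. p c * cnj (pd b (pd c v) x) + pd b (pd c v) x * cnj (p c))
    - (?k * (v x * cnj (p b) + p b * cnj (v x)) + 0 * (v x * cnj (v x))))" if b: "b \<in> Basis" for b
   unfolding p_def
   by ((rule has_pd_sum has_pd_intros has_pd_leaf finite_Basis | assumption)+)
  have pdG': "pd b ?G x = (\<Sum>c\<in>Basis. pd b (pd c v) x * cnj (p c) + p c * cnj (pd b (pd c v) x))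
    - ?k * (p b * cnj (v x) + v x * cnj (p b))" if b: "b \<in> Basis" for b
   by (rule has_pdD[OF pdG[OF b]]) (simp add: add.commute)
  have pdF: "pd b (?F b) x =
    q * (pd b (pd b v) x * cnj (?m x) + cnj (pd b (pd b v) x) * ?m x
     + p b * cnj (p b + r b + ?a * p b) + cnj (p b) * (p b + r b + ?a * p b) - ?G x - X b * pd b ?G x)
    + 2 * q1 * X b * (p b * cnj (?m x) + cnj (p b) * ?m x - X b * ?G x)
    - 2 * ?a * q1 * (v x * cnj (v x) + X b * (p b * cnj (v x) + v x * cnj (p b)))
    - 4 * ?a * q2 * X b * X b * (v x * cnj (v x))"
   if b: "b \<in> Basis" for b
  proof (rule has_pdD)
   have "has_pd b ?G x (pd b ?G x)" using pdG[OF b] by (simp add: has_pd_def)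
   note G = this
   let ?H = ?G
   \<comment> \<open>Naming \<open>?G\<close> makes the derivative rules treat it as a leaf instead
     of differentiating its sum again.\<close>
   define H where "H = ?G"
   have G: "has_pd b H x (pd b H x)" using G by (simp add: H_def)
   show "has_pd b (?F b) x
    (radial Q x * (pd b v x * cnj (pd b v x + euler (pd b v) x + (?a * pd b v x + 0 * v x)) + pd b (pd b v) x * cnj (?m x)
     + (cnj (pd b v x) * (pd b v x + euler (pd b v) x + (?a * pd b v x + 0 * v x)) + cnj (pd b (pd b v) x) * ?m x)
     - (complex_of_real (x \<bullet> b) * pd b ?G x + of_real (b \<bullet> b) * ?G x))
    + (2 * radial Q1 x * complex_of_real (x \<bullet> b)) * (pd b v x * cnj (?m x) + cnj (pd b v x) * ?m x - complex_of_real (x \<bullet> b) * ?G x)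
    - (radial Q1 x * (2 * ?a * complex_of_real (x \<bullet> b) * (v x * cnj (pd b v x) + pd b v x * cnj (v x))
       + (2 * ?a * of_real (b \<bullet> b) + (2 * 0 + 0 * ?a) * complex_of_real (x \<bullet> b)) * (v x * cnj (v x)))
      + (2 * radial Q2 x * complex_of_real (x \<bullet> b)) * (2 * ?a * complex_of_real (x \<bullet> b) * (v x * cnj (v x)))))"
    unfolding H_def[symmetric, unfolded fun_eq_iff, rule_format]
    by (rule G has_pd_intros has_pd_leaf b)+
  qed (use b in \<open>simp add: radial_def q_def q1_def q2_def X_def p_def r_def algebra_simps\<close>)
  have S1: "(\<Sum>b\<in>Basis. X b * p b) = e" by (simp add: e_def euler_def X_def p_def)
  have S1c: "(\<Sum>b\<in>Basis. X b * cnj (p b)) = cnj e"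
   unfolding S1[symmetric] by (simp add: X_def)
  define gg where "gg = (\<Sum>b\<in>Basis. p b * cnj (p b))"
  define pr where "pr = (\<Sum>b\<in>Basis. p b * cnj (r b))"
  have prc: "(\<Sum>b\<in>Basis. r b * cnj (p b)) = cnj pr" by (simp add: pr_def mult.commute)
  have S2: "(\<Sum>b\<in>Basis. X b * X b) = complex_of_real ((norm x)^2)" unfolding X_def by (rule sum_inner_Basis_square)
  \<comment> \<open>The derivative of \<open>|grad v|^2\<close> along \<open>x\<close> reproduces
    the terms \<open>pr + cnj pr\<close> that arise from differentiating \<open>euler v\<close>;
    they cancel in the divergence.\<close>
  have S3: "(\<Sum>b\<in>Basis. X b * pd b ?G x) = pr + cnj pr - ?k * (e * cnj (v x) + v x * cnj e)"
  proof -
   have "(\<Sum>b\<in>Basis. X b * pd b ?G x) = (\<Sum>b\<in>Basis. \<Sum>c\<in>Basis. X b * pd b (pd c v) x * cnj (p c) + p c * cnj (X b * pd b (pd c v) x))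
     - ?k * ((\<Sum>b\<in>Basis. X b * p b) * cnj (v x) + v x * (\<Sum>b\<in>Basis. X b * cnj (p b)))"
    by (simp only: pdG' cong: sum.cong) (simp add: right_diff_distrib sum_subtractf sum.distrib sum_distrib_left sum_distrib_right X_def algebra_simps)
   also have "(\<Sum>b\<in>Basis. \<Sum>c\<in>Basis. X b * pd b (pd c v) x * cnj (p c) + p c * cnj (X b * pd b (pd c v) x))
     = (\<Sum>c\<in>Basis. \<Sum>b\<in>Basis. X b * pd b (pd c v) x * cnj (p c) + p c * cnj (X b * pd b (pd c v) x))"
    by (rule sum.swap)
   also have "... = (\<Sum>c\<in>Basis. r c * cnj (p c) + p c * cnj (r c))"
    by (rule sum.cong) (simp_all add: r_def euler_def X_def sum.distrib sum_distrib_left sum_distrib_right)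
   also have "... = pr + cnj pr" using prc by (simp add: sum.distrib pr_def add.commute)
   finally show ?thesis by (simp add: S1 S1c)
  qed
  have "(\<Sum>b\<in>Basis. pd b (?F b) x) = q * (lap v x * cnj (?m x) + cnj (lap v x) * ?m x + 2 * (1 + ?a) * gg + pr + cnj pr
     - DIM('a) * ?G x - (pr + cnj pr - ?k * (e * cnj (v x) + v x * cnj e)))
    + 2 * q1 * (e * cnj (?m x) + cnj e * ?m x - complex_of_real ((norm x)^2) * ?G x)
    - 2 * ?a * q1 * (DIM('a) * (v x * cnj (v x)) + (e * cnj (v x) + v x * cnj e))
    - 4 * ?a * q2 * complex_of_real ((norm x)^2) * (v x * cnj (v x))"
  proof -
   let ?M = "?m x" and ?N = "?G x" and ?V = "v x"
   \<comment> \<open>The expansions are stated for free variables, where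
     \<open>algebra_simps\<close> sees a polynomial identity and cannot rewrite inside derivatives
     or sums.\<close>
   have ring1: "q * (pp * cM + cpp * M + P * (cP + cR + a * cP) + cP * (P + R + a * P) - N - Y * dG)
      + 2 * q1 * Y * (P * cM + cP * M - Y * N) - 2 * a * q1 * (V * cV + Y * (P * cV + V * cP))
      - 4 * a * q2 * Y * Y * (V * cV)
     = cM * q * pp + M * q * cpp
     + 2 * q * (1 + a) * (P * cP) + q * (P * cR) + q * (R * cP) - q * N - q * (Y * dG)
     + 2 * q1 * cM * (Y * P) + 2 * q1 * M * (Y * cP) - 2 * q1 * N * (Y * Y)
     - 2 * a * q1 * (V * cV) - 2 * a * q1 * cV * (Y * P) - 2 * a * q1 * V * (Y * cP)
     - 4 * a * q2 * (V * cV) * (Y * Y)" for pp cM cpp M P cP R cR N Y dG V cV a q q1 q2 :: complex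
    by (simp add: algebra_simps)
   have "pd b (?F b) x = cnj ?M * q * pd b (pd b v) x + ?M * q * cnj (pd b (pd b v) x)
     + 2 * q * (1 + ?a) * (p b * cnj (p b)) + q * (p b * cnj (r b)) + q * (r b * cnj (p b)) - q * ?N - q * (X b * pd b ?G x)
     + 2 * q1 * cnj ?M * (X b * p b) + 2 * q1 * ?M * (X b * cnj (p b)) - 2 * q1 * ?N * (X b * X b)
     - 2 * ?a * q1 * (?V * cnj ?V) - 2 * ?a * q1 * cnj ?V * (X b * p b) - 2 * ?a * q1 * ?V * (X b * cnj (p b))
     - 4 * ?a * q2 * (?V * cnj ?V) * (X b * X b)" if b: "b \<in> Basis" for b
    unfolding pdF[OF b] complex_cnj_add[of "p b + r b"] complex_cnj_add[of "p b" "r b"]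
     complex_cnj_mult[of ?a "p b"] complex_cnj_complex_of_real by (rule ring1)
   note expand = this
   define M N dG where "M = ?m x" and "N = ?G x" and "dG = (%b. pd b ?G x)"
   have S3': "(\<Sum>b\<in>Basis. X b * dG b) = pr + cnj pr - ?k * (e * cnj ?V + ?V * cnj e)"
    unfolding dG_def by (rule S3)
   have ring2: "cM * q * L + M * q * cL + 2 * q * (1 + a) * gg + q * pr + q * cpr - D * (q * N)
      - q * (pr + cpr - k * (e * cV + V * ce)) + 2 * q1 * cM * e + 2 * q1 * M * ce - 2 * q1 * N * s
      - D * (2 * a * q1 * (V * cV)) - 2 * a * q1 * cV * e - 2 * a * q1 * V * ce - 4 * a * q2 * (V * cV) * s
     = q * (L * cM + cL * M + 2 * (1 + a) * gg + pr + cpr - D * N - (pr + cpr - k * (e * cV + V * ce)))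
      + 2 * q1 * (e * cM + ce * M - s * N) - 2 * a * q1 * (D * (V * cV) + (e * cV + V * ce)) - 4 * a * q2 * s * (V * cV)"
    for cM M L cL gg pr cpr N e ce V cV a q q1 q2 D k s :: complex
    by (simp add: algebra_simps)
   have "(\<Sum>b\<in>Basis. pd b (?F b) x) = (\<Sum>b\<in>Basis. cnj M * q * pd b (pd b v) x + M * q * cnj (pd b (pd b v) x)
     + 2 * q * (1 + ?a) * (p b * cnj (p b)) + q * (p b * cnj (r b)) + q * (r b * cnj (p b)) - q * N - q * (X b * dG b)
     + 2 * q1 * cnj M * (X b * p b) + 2 * q1 * M * (X b * cnj (p b)) - 2 * q1 * N * (X b * X b)
     - 2 * ?a * q1 * (?V * cnj ?V) - 2 * ?a * q1 * cnj ?V * (X b * p b) - 2 * ?a * q1 * ?V * (X b * cnj (p b))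
     - 4 * ?a * q2 * (?V * cnj ?V) * (X b * X b))"
    unfolding M_def N_def dG_def by (rule sum.cong[OF refl expand])
   also have "... = cnj M * q * (\<Sum>b\<in>Basis. pd b (pd b v) x) + M * q * (\<Sum>b\<in>Basis. cnj (pd b (pd b v) x))
     + 2 * q * (1 + ?a) * (\<Sum>b\<in>Basis. p b * cnj (p b)) + q * (\<Sum>b\<in>Basis. p b * cnj (r b))
     + q * (\<Sum>b\<in>Basis. r b * cnj (p b)) - of_nat DIM('a) * (q * N) - q * (\<Sum>b\<in>Basis. X b * dG b)
     + 2 * q1 * cnj M * (\<Sum>b\<in>Basis. X b * p b) + 2 * q1 * M * (\<Sum>b\<in>Basis. X b * cnj (p b)) - 2 * q1 * N * (\<Sum>b\<in>Basis. X b * X b)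
     - of_nat DIM('a) * (2 * ?a * q1 * (?V * cnj ?V)) - 2 * ?a * q1 * cnj ?V * (\<Sum>b\<in>Basis. X b * p b)
     - 2 * ?a * q1 * ?V * (\<Sum>b\<in>Basis. X b * cnj (p b))
     - 4 * ?a * q2 * (?V * cnj ?V) * (\<Sum>b\<in>Basis. X b * X b)"
    by (simp only: sum.distrib sum_subtractf sum_distrib_left sum_constant)
   finally show ?thesis
    unfolding prc S1 S1c S2 S3' gg_def[symmetric] pr_def[symmetric] lap_def[symmetric]
     cnj_sum[symmetric] unfolding ring2 unfolding M_def N_def .
  qed
  also have "... = complex_of_real (g x)"
  proof -
   have G: "?G x = gg - ?k * (v x * cnj (v x))" by (simp add: gg_def p_def)
   have gg: "gg = complex_of_real (grad2 v x)"
    by (simp add: gg_def p_def grad2_def complex_norm_square del: of_real_power)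
   \<comment> \<open>Expressing the dimension through \<open>\<alpha>\<close> leaves a polynomial
     identity.\<close>
   have two_a: "complex_of_nat DIM('a) = 2 * ?a + 1" by (simp add: \<alpha>_def field_simps)
   have vv: "complex_of_real ((cmod (v x))^2) = v x * cnj (v x)" "complex_of_real ((cmod (euler v x))^2) = e * cnj e"
    unfolding e_def by (rule complex_norm_square)+
   have Re2: "complex_of_real (2 * Re z) = z + cnj z" for z by (simp add: complex_eq_iff)
   have d: "complex_of_real (real DIM('a)) = complex_of_nat DIM('a)" by simp
   have q_cnj: "cnj q = q" by (simp add: q_def)
   have ring3: "q * (L * (ce + a * cV) + cL * (e + a * V) + 2 * (1 + a) * gg + pr + cpr
       - (2 * a + 1) * (gg - k * (V * cV)) - (pr + cpr - k * (e * cV + V * ce)))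
      + 2 * q1 * (e * (ce + a * cV) + ce * (e + a * V) - s * (gg - k * (V * cV)))
      - 2 * a * q1 * ((2 * a + 1) * (V * cV) + (e * cV + V * ce)) - 4 * a * q2 * s * (V * cV)
     = (L + k * V) * (q * (ce + a * cV)) + (cL + k * cV) * (q * (e + a * V))
      + (q - 2 * s * q1) * gg + 4 * q1 * (e * ce) + k * (q + 2 * s * q1) * (V * cV)
      - a * (2 * (2 * a + 1) * q1 + 4 * s * q2) * (V * cV)"
    for L cL gg pr cpr e ce V cV a q q1 q2 k s :: complex
    by (simp add: algebra_simps)
   have "complex_of_real (g x) = (lap v x + ?k * v x) * cnj (q * ?m x) + cnj (lap v x + ?k * v x) * (q * ?m x)
     + (q - 2 * complex_of_real ((norm x)^2) * q1) * gg + 4 * q1 * (e * cnj e)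
     + ?k * (q + 2 * complex_of_real ((norm x)^2) * q1) * (v x * cnj (v x))
     - ?a * (2 * (2 * ?a + 1) * q1 + 4 * complex_of_real ((norm x)^2) * q2) * (v x * cnj (v x))"
   proof -
    define z where "z = (lap v x + ?k * v x) * cnj (of_real (Q ((norm x)^2)) * (euler v x + ?a * v x))"
    have "complex_of_real (g x) = complex_of_real (2 * Re z)
     + (complex_of_real (Q ((norm x)^2)) - 2 * complex_of_real ((norm x)^2) * complex_of_real (Q1 ((norm x)^2))) * complex_of_real (grad2 v x)
     + 4 * complex_of_real (Q1 ((norm x)^2)) * complex_of_real ((cmod (euler v x))^2)
     + ?k * (complex_of_real (Q ((norm x)^2)) + 2 * complex_of_real ((norm x)^2) * complex_of_real (Q1 ((norm x)^2))) * complex_of_real ((cmod (v x))^2)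
     - ?a * (2 * complex_of_nat DIM('a) * complex_of_real (Q1 ((norm x)^2)) + 4 * complex_of_real ((norm x)^2) * complex_of_real (Q2 ((norm x)^2)))
       * complex_of_real ((cmod (v x))^2)"
     unfolding g_def z_def by simp
    moreover have "cnj z = cnj (lap v x + ?k * v x) * (q * ?m x)" "z = (lap v x + ?k * v x) * cnj (q * ?m x)"
     by (simp_all add: z_def q_def)
    ultimately show ?thesis
     unfolding Re2 vv two_a gg[symmetric] q_def[symmetric] q1_def[symmetric] q2_def[symmetric] by simp
   qed
   then show ?thesis
    unfolding G two_a e_def[symmetric] complex_cnj_add complex_cnj_mult complex_cnj_complex_of_real q_cnj ring3 by simp
  qed
  finally show ?thesis by simp
 qed
 show "integrable lborel g" "(LINT x|lborel. g x) = 0"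
  using integral_divergence_eq_0[OF t eq] by auto
qed

end

section \<open>A priori estimates for smooth solutions\<close>

text \<open>The witness is \<open>smooth_step (2 - s / T^2)\<close>. With \<open>s = |x|^2\<close>
  it varies only for \<open>T \<le> |x| \<le> sqrt 2 T\<close>, and each derivative in
  \<open>s\<close> costs \<open>T^(-2)\<close>, hence a single \<open>M\<close> for all
  \<open>T\<close>.\<close>

lemma cutoff_exists:
 "\<exists>M>0. \<forall>T>0. \<exists>Q Q1 Q2. smooth_real Q & smooth_real Q1 & smooth_real Q2 &
   (\<forall>t. (Q has_real_derivative Q1 t) (at t)) & (\<forall>t. (Q1 has_real_derivative Q2 t) (at t)) &
   (\<forall>s. 0 <= Q s & Q s <= 1 & Q1 s <= 0 & \<bar>Q1 s\<bar> <= M / T^2 & \<bar>Q2 s\<bar> <= M / T ^ 4) &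
   (\<forall>s\<le>T^2. Q s = 1) & (\<forall>s\<ge>2 * T^2. Q s = 0) &
   (\<forall>s. s <= T^2 \<or> s >= 2 * T^2 --> Q1 s = 0 & Q2 s = 0)"
proof -
 obtain S1 S2 M where S: "smooth_real S1" "smooth_real S2"
  "!!t. (smooth_step has_real_derivative S1 t) (at t)"
  "!!t. (S1 has_real_derivative S2 t) (at t)"
  "!!t. t <= 0 \<or> t >= 1 ==> S1 t = 0" "!!t. t <= 0 \<or> t >= 1 ==> S2 t = 0"
  "!!t. S1 t >= 0" "M > 0" "!!t. \<bar>S1 t\<bar> <= M" "!!t. \<bar>S2 t\<bar> <= M"
  using smooth_step_derivs by blast
 have scale: "smooth_real (%t. c * f (2 + a * t))" if "smooth_real f" for f and a c :: real
 proof -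
  have "smooth_real (%_. c)"
   unfolding smooth_real_def by (intro exI[of _ "%n t. if n = 0 then c else 0"]) auto
  from smooth_real_mult[OF this smooth_real_affine[OF that]] show ?thesis .
 qed
 show ?thesis
 proof (intro exI[of _ M] conjI allI impI)
  fix T :: real assume T: "T > 0"
  define a where "a = - 1 / T^2"
  have arg: "2 + a * s >= 1 \<longleftrightarrow> s <= T^2" "2 + a * s <= 0 \<longleftrightarrow> s >= 2 * T^2" for s
   using T by (auto simp: a_def field_simps)
  have D: "((%t. c * f (2 + a * t)) has_real_derivative (c * a) * f' (2 + a * t)) (at t)"
   if "!!t. (f has_real_derivative f' t) (at t)" for f f' c t
  proof -
   have "((%t. f (2 + a * t)) has_real_derivative f' (2 + a * t) * a) (at t)"
    by (rule DERIV_chain2[OF that]) (auto intro!: derivative_eq_intros)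
   then show ?thesis by (auto intro!: derivative_eq_intros)
  qed
  show "\<exists>Q Q1 Q2. smooth_real Q & smooth_real Q1 & smooth_real Q2 &
   (\<forall>t. (Q has_real_derivative Q1 t) (at t)) & (\<forall>t. (Q1 has_real_derivative Q2 t) (at t)) &
   (\<forall>s. 0 <= Q s & Q s <= 1 & Q1 s <= 0 & \<bar>Q1 s\<bar> <= M / T^2 & \<bar>Q2 s\<bar> <= M / T ^ 4) &
   (\<forall>s\<le>T^2. Q s = 1) & (\<forall>s\<ge>2 * T^2. Q s = 0) &
   (\<forall>s. s <= T^2 \<or> s >= 2 * T^2 --> Q1 s = 0 & Q2 s = 0)"
  proof (intro exI conjI allI impI)
   show "smooth_real (%t. 1 * smooth_step (2 + a * t))" "smooth_real (%t. (1 * a) * S1 (2 + a * t))"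
    "smooth_real (%t. ((1 * a) * a) * S2 (2 + a * t))"
    using scale smooth_real_smooth_step S(1,2) by blast+
   show "((%t. 1 * smooth_step (2 + a * t)) has_real_derivative (1 * a) * S1 (2 + a * t)) (at t)"
    "((%t. (1 * a) * S1 (2 + a * t)) has_real_derivative ((1 * a) * a) * S2 (2 + a * t)) (at t)" for t
    by (rule D[OF S(3)], rule D[OF S(4)])
   fix s
   show "0 <= 1 * smooth_step (2 + a * s)" "1 * smooth_step (2 + a * s) <= 1"
    using smooth_step_bounds by auto
   show "(1 * a) * S1 (2 + a * s) <= 0" using S(7) T by (simp add: a_def)
   show "\<bar>(1 * a) * S1 (2 + a * s)\<bar> <= M / T^2"
    using S(9)[of "2 + a * s"] T by (simp add: a_def abs_mult divide_right_mono)
   show "\<bar>((1 * a) * a) * S2 (2 + a * s)\<bar> <= M / T ^ 4"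
    using S(10)[of "2 + a * s"] T by (simp add: a_def abs_mult divide_right_mono flip: power_add)
   show "1 * smooth_step (2 + a * s) = 1" if "s <= T^2" using that arg smooth_step_1 by simp
   show "1 * smooth_step (2 + a * s) = 0" if "s >= 2 * T^2" using that arg smooth_step_0 by simp
   show "(1 * a) * S1 (2 + a * s) = 0" "((1 * a) * a) * S2 (2 + a * s) = 0" if "s <= T^2 \<or> s >= 2 * T^2"
    using S(5,6)[of "2 + a * s"] that arg[of s] by auto
  qed
 qed (fact S(8))
qed

text \<open>These functions span a space closed under differentiation that contains the weight
  \<open>(1 + sqrt (1 + s^2))^(-1/2)\<close>. The inner root keeps everything smooth for negative
  \<open>s\<close>, as \<open>smooth_real\<close> demands.\<close>

definition weight_mono :: "nat => real => real => real => real" where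
 "weight_mono i a b s = s ^ i * (sqrt (1 + s^2) powr a * (1 + sqrt (1 + s^2)) powr b)"

lemma weight_mono_deriv:
 "(weight_mono i a b has_real_derivative
   i * weight_mono (i - 1) a b s + a * weight_mono (i + 1) (a - 2) b s + b * weight_mono (i + 1) (a - 1) (b - 1) s) (at s)"
proof -
 let ?u = "%s::real. sqrt (1 + s^2)"
 have u: "?u s > 0" by (simp add: add_pos_nonneg)
 have pos: "1 + s^2 > 0" by (simp add: add_pos_nonneg)
 have posn: "1 + s^2 ~= 0" "\<not> 1 + s^2 < 0" using pos by linarith+
 have Du: "(?u has_real_derivative s / ?u s) (at s)"
  using u by (auto intro!: derivative_eq_intros simp: posn field_simps)
 have "((%s. s ^ i * (?u s powr a * (1 + ?u s) powr b)) has_real_derivative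
   (i * s ^ (i - 1)) * (?u s powr a * (1 + ?u s) powr b)
   + s ^ i * ((a * ?u s powr (a - 1) * (s / ?u s)) * (1 + ?u s) powr b
    + ?u s powr a * (b * (1 + ?u s) powr (b - 1) * (s / ?u s)))) (at s)"
 proof -
  have Dp: "((%s. ?u s powr a) has_real_derivative a * ?u s powr (a - 1) * (s / ?u s)) (at s)"
   by (rule DERIV_chain2[OF has_real_derivative_powr[OF u] Du])
  have Dv: "((%s. 1 + ?u s) has_real_derivative s / ?u s) (at s)"
   using DERIV_add[OF DERIV_const Du, of 1] by simp
  have "1 + ?u s > 0" using u by linarith
  then have Dq: "((%s. (1 + ?u s) powr b) has_real_derivative b * (1 + ?u s) powr (b - 1) * (s / ?u s)) (at s)"
   by (intro DERIV_chain2[OF has_real_derivative_powr Dv])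
  show ?thesis
   by (rule DERIV_cong[OF DERIV_mult[OF DERIV_pow DERIV_mult[OF Dp Dq]]]) (simp add: algebra_simps)
 qed
 moreover define U where "U = ?u s"
 ultimately have D: "((%s. s ^ i * (?u s powr a * (1 + ?u s) powr b)) has_real_derivative
   (i * s ^ (i - 1)) * (U powr a * (1 + U) powr b)
   + s ^ i * ((a * U powr (a - 1) * (s / U)) * (1 + U) powr b
    + U powr a * (b * (1 + U) powr (b - 1) * (s / U)))) (at s)"
  by simp
 have "U > 0" using u by (simp add: U_def)
 moreover define A where "A = U powr (a - 2)"
 ultimately have A: "U powr (a - 1) = A * U" "U powr a = A * U * U"
  using powr_mult_base[of U "a - 2"] powr_mult_base[of U "a - 1"] by (simp_all add: mult.commute)
 show ?thesis
  unfolding weight_mono_def[abs_def] U_def[symmetric] A_def[symmetric]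
  by (rule DERIV_cong[OF D], unfold A) (use \<open>U > 0\<close> in \<open>simp add: field_simps\<close>)
qed

inductive weight_gen :: "(real => real) => bool" where
 base: "weight_gen (weight_mono i a b)"
| add: "weight_gen f ==> weight_gen g ==> weight_gen (%x. f x + g x)"
| scale: "weight_gen f ==> weight_gen (%x. c * f x)"

lemma weight_gen_step:
 "weight_gen f ==> \<exists>g. weight_gen g & (\<forall>t. (f has_real_derivative g t) (at t))"
proof (induction rule: weight_gen.induct)
 case (base i a b)
 show ?case
  by (intro exI[of _ "%s. (i * weight_mono (i - 1) a b s + a * weight_mono (i + 1) (a - 2) b s)
    + b * weight_mono (i + 1) (a - 1) (b - 1) s"] conjI
     weight_gen.add weight_gen.scale weight_gen.base allI weight_mono_deriv)
next
 case (add f g)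
 then obtain f' g' where "weight_gen f'" "!!t. (f has_real_derivative f' t) (at t)"
  "weight_gen g'" "!!t. (g has_real_derivative g' t) (at t)" by auto
 then show ?case
  by (intro exI[of _ "%x. f' x + g' x"] conjI weight_gen.add) (auto intro!: derivative_intros)
next
 case (scale f c)
 then obtain f' where "weight_gen f'" "!!t. (f has_real_derivative f' t) (at t)" by auto
 then show ?case
  by (intro exI[of _ "%x. c * f' x"] conjI weight_gen.scale) (auto intro!: derivative_eq_intros)
qed

lemma smooth_real_weight: "weight_gen f ==> smooth_real f"
 by (rule smooth_real_coinduct[where P=weight_gen]) (auto dest: weight_gen_step)

lemma smooth_real_scaleE:
 assumes "smooth_real f" "smooth_real f1" "smooth_real f2"
  "!!t. (f has_real_derivative f1 t) (at t)" "!!t. (f1 has_real_derivative f2 t) (at t)"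
 shows "smooth_real (%t. f (c * t))" "smooth_real (%t. c * f1 (c * t))" "smooth_real (%t. c^2 * f2 (c * t))"
  "((%t. f (c * t)) has_real_derivative c * f1 (c * t)) (at t)"
  "((%t. c * f1 (c * t)) has_real_derivative c\<^sup>2 * f2 (c * t)) (at t)"
proof -
 have k: "smooth_real (%_. k)" for k :: real
  unfolding smooth_real_def by (intro exI[of _ "%n t. if n = 0 then k else 0"]) auto
 show "smooth_real (%t. f (c * t))" using smooth_real_affine[OF assms(1), of 0 c] by simp
 show "smooth_real (%t. c * f1 (c * t))" "smooth_real (%t. c^2 * f2 (c * t))"
  using smooth_real_mult[OF k smooth_real_affine[OF assms(2), of 0 c]]
   smooth_real_mult[OF k smooth_real_affine[OF assms(3), of 0 c]] by simp_all
 have "((%t. c * t) has_real_derivative c) (at t)" by (auto intro!: derivative_eq_intros)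
 from DERIV_chain2[OF assms(4) this] DERIV_chain2[OF assms(5) this]
 show "((%t. f (c * t)) has_real_derivative c * f1 (c * t)) (at t)"
  "((%t. c * f1 (c * t)) has_real_derivative c\<^sup>2 * f2 (c * t)) (at t)"
  by (auto intro!: DERIV_cong[OF DERIV_cmult] elim!: DERIV_cong simp: power2_eq_square)
qed

text \<open>The weight is a smooth substitute for \<open>(1 + s)\<^sup>-\<^sup>1\<^sup>/\<^sup>2\<close>, where \<open>s = |x|\<^sup>2\<close>, that is defined on the
 whole line.\<close>

lemma weight_exists_unit:
 "\<exists>h h1 h2 :: real => real. smooth_real h & smooth_real h1 & smooth_real h2 &
   (\<forall>t. (h has_real_derivative h1 t) (at t)) & (\<forall>t. (h1 has_real_derivative h2 t) (at t)) &
   (\<forall>s\<ge>0. 0 < h s & h s <= 1 & h1 s <= 0 & h s + 2 * s * h1 s > 0 & s * (h s)^2 <= 1 &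
    (s <= 1 --> h s + 2 * s * h1 s >= 1 / 4) &
    (s > 0 --> 1 - sqrt s * h s <= 2 / s) &
    (\<forall>d::nat. d >= 1 --> (real d - 1) / 2 * (2 * real d * h1 s + 4 * s * h2 s) <= (h s + 2 * s * h1 s) / 2))"
proof -
 let ?u = "%s::real. sqrt (1 + s^2)"
 define h where "h = weight_mono 0 0 (-1/2)"
 define h1 where "h1 s = (-1/2) * weight_mono 1 (-1) (-3/2) s" for s
 define h2 where "h2 s = (-1/2) * (weight_mono 0 (-1) (-3/2) s + (-1) * weight_mono 2 (-3) (-3/2) s + (-3/2) * weight_mono 2 (-2) (-5/2) s)" for s
 have D: "(h has_real_derivative h1 t) (at t)" "(h1 has_real_derivative h2 t) (at t)" for t
 proof -
  show "(h has_real_derivative h1 t) (at t)"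
   unfolding h_def h1_def using weight_mono_deriv[of 0 0 "-1/2" t] by simp
  show "(h1 has_real_derivative h2 t) (at t)"
   unfolding h2_def h1_def[abs_def]
   by (rule DERIV_cmult, rule weight_mono_deriv[of 1 "-1" "-3/2" t, THEN DERIV_cong]) (simp add: eval_nat_numeral)
 qed
 have smooth: "smooth_real h" "smooth_real h1" "smooth_real h2"
  unfolding h_def h1_def[abs_def] h2_def[abs_def]
  by (intro smooth_real_weight weight_gen.add weight_gen.scale weight_gen.base)+
 have main: "0 < h s & h s <= 1 & h1 s <= 0 & h s + 2 * s * h1 s > 0 & s * (h s)^2 <= 1 &
    (s <= 1 --> h s + 2 * s * h1 s >= 1 / 4) &
    (s > 0 --> 1 - sqrt s * h s <= 2 / s) &
    (\<forall>d::nat. d >= 1 --> (real d - 1) / 2 * (2 * real d * h1 s + 4 * s * h2 s) <= (h s + 2 * s * h1 s) / 2)"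
  if s: "s >= 0" for s
 proof -
  define u where "u = ?u s"
  have u: "u >= 1" "u^2 = 1 + s^2" "u > 0" by (auto simp: u_def add_pos_nonneg)
  have us: "s <= u" "u <= 1 + s"
   using u s by (auto intro!: power2_le_imp_le[of s u] power2_le_imp_le[of u "1 + s"] simp: power2_sum)
  \<comment> \<open>With \<open>u = sqrt (1 + s^2)\<close>, the functions \<open>h\<close>,
    \<open>h1\<close> and \<open>h2\<close> are \<open>w\<close> times rational functions of
    \<open>s\<close> and \<open>u\<close>, so the claims reduce to algebra with
    \<open>u^2 = 1 + s^2\<close>.\<close>
  define w where "w = (1 + u) powr (-3/2)"
  have w: "w > 0" using u by (simp add: w_def)
  have hw: "h s = w * (1 + u)"
   using u powr_mult_base[of "1 + u" "-3/2"] by (simp add: h_def weight_mono_def w_def u_def[symmetric] mult.commute)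
  have h1w: "h1 s = - (s / (2 * u)) * w"
   using u by (simp add: h1_def weight_mono_def w_def u_def[symmetric] powr_minus field_simps)
  have w5: "(1 + u) powr (-5/2) = w / (1 + u)"
  proof -
   have "(1 + u) powr (-5/2) * (1 + u) = w"
    using u powr_mult_base[of "1 + u" "-5/2"] by (simp add: w_def mult.commute)
   then show ?thesis using u by (simp add: field_simps)
  qed
  have h2w: "h2 s = w * (- 1 / (2 * u) + s^2 / (2 * u ^ 3) + 3 * s^2 / (4 * u^2 * (1 + u)))"
  proof -
   have p: "u powr (-1) = 1 / u" "u powr (-2) = 1 / u^2" "u powr (-3) = 1 / u ^ 3"
    using u by (simp_all add: powr_minus divide_inverse powr_numeral)
   show ?thesis
    unfolding h2_def weight_mono_def u_def[symmetric] p w5 w_def[symmetric]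
    using u by (simp add: divide_simps) (simp add: algebra_simps power2_eq_square power3_eq_cube)
  qed
  have gam: "h s + 2 * s * h1 s = w * (1 + 1 / u)"
  proof -
   have "u * (u * w) = w + s * (s * w)"
    using arg_cong[OF u(2), of "%z. z * w"] by (simp add: power2_eq_square algebra_simps)
   then show ?thesis unfolding hw h1w using u(3) by (simp add: field_simps)
  qed
  have h2eq: "(h s)^2 = 1 / (1 + u)"
  proof -
   have "(1 + u) powr (-1/2) * (1 + u) powr (-1/2) = (1 + u) powr (-1)"
    by (subst powr_add[symmetric]) simp
   moreover have "h s = (1 + u) powr (-1/2)"
    using u by (simp add: h_def weight_mono_def u_def[symmetric])
   ultimately show ?thesis
    using u(1) by (simp only: power2_eq_square) (simp add: powr_minus_divide)
  qed
  have hle: "h s <= 1"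
  proof -
   have "(h s)^2 <= 1^2" unfolding h2eq using u by simp
   then show ?thesis by (rule power2_le_imp_le) simp
  qed
  have hpos: "h s > 0" unfolding hw using w u by simp
  have "w * (1 + 1 / u) > 0" using w u by (simp add: add_pos_pos)
  moreover have "h1 s <= 0" unfolding h1w using w u s by simp
  moreover have "s * (h s)^2 <= 1" unfolding h2eq using us u by simp
  \<comment> \<open>For \<open>s \<le> 1\<close> one has \<open>u \<le> 3/2\<close>, so
    \<open>h^2 = 1 / (1 + u) \<ge> 2/5 > (3/5)^2\<close>, and the quantity in question is
    \<open>h / u \<ge> 2/5\<close>.\<close>
  moreover have "w * (1 + 1 / u) >= 1 / 4" if "s <= 1"
  proof -
   have "u^2 <= 2" using u(2) that s by (simp add: power_le_one)
   then have "u^2 <= (3/2)^2" by (simp add: power_divide)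
   then have u32: "u <= 3/2" by (rule power2_le_imp_le) simp
   have "1 / (1 + u) >= 1 / (1 + 3/2)" using u32 u by (intro divide_left_mono) auto
   then have "1 / (1 + u) >= (3/5)^2" by (simp add: power_divide)
   then have "h s >= 3/5" unfolding h2eq[symmetric] by (rule power2_le_imp_le) (use hpos in simp)
   moreover have "w * (1 + 1 / u) = h s / u" unfolding hw using u by (simp add: field_simps)
   moreover have "h s / u >= (3/5) / (3/2)" using u32 u \<open>h s >= 3/5\<close> by (intro frac_le) auto
   ultimately show ?thesis by simp
  qed
  moreover have "1 - sqrt s * h s <= 2 / s" if "s > 0"
  proof -
   have sq: "(sqrt s * h s)^2 = s / (1 + u)" using s h2eq by (simp add: power_mult_distrib)
   have le1: "sqrt s * h s <= 1"
    by (rule power2_le_imp_le) (use sq us u in auto)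
   have nn: "sqrt s * h s >= 0" using s hpos by simp
   have "(sqrt s * h s)^2 <= sqrt s * h s" using le1 nn by (simp add: power2_eq_square mult_left_le)
   then have "1 - sqrt s * h s <= 1 - s / (1 + u)" using sq by simp
   also have "... = (1 + u - s) / (1 + u)" using u by (simp add: field_simps)
   also have "... <= 2 / (1 + u)" using us u by (intro divide_right_mono) auto
   also have "... <= 2 / s" using us u that by (intro divide_left_mono) auto
   finally show ?thesis .
  qed
  \<comment> \<open>The \<open>h2\<close> term is at most \<open>3 w s / u\<close>. The dimension
    then enters only through \<open>(d - 1) (3 - d)\<close>, which is at most 1 for every
    \<open>d\<close> because \<open>(d - 2)^2 \<ge> 0\<close>.\<close>
  moreover have "(real d - 1) / 2 * (2 * real d * h1 s + 4 * s * h2 s) <= w * (1 + 1 / u) / 2" if "d >= 1" for d :: nat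
  proof -
   have s2: "s^2 = u^2 - 1" using u(2) by simp
   have "4 * s * h2 s = w * (s / u) * (- 2 + 2 * s^2 / u^2 + 3 * s^2 / (u * (1 + u)))"
    unfolding h2w using u(3) by (simp add: divide_simps) (simp add: algebra_simps eval_nat_numeral)
   also have "... <= w * (s / u) * 3"
   proof (intro mult_left_mono)
    have 1: "s^2 / u^2 <= 1" unfolding s2 using u(3) by (simp add: divide_le_eq)
    have 2: "s^2 / (u * (1 + u)) <= 1"
     unfolding s2 using u(1) by (simp add: divide_le_eq) (simp add: power2_eq_square algebra_simps)
    have "2 * s^2 / u^2 = 2 * (s^2 / u^2)" "3 * s^2 / (u * (1 + u)) = 3 * (s^2 / (u * (1 + u)))" by simp_all
    with 1 2 show "- 2 + 2 * s^2 / u^2 + 3 * s^2 / (u * (1 + u)) <= 3" by linarith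
   qed (use w s u in auto)
   finally have "2 * real d * h1 s + 4 * s * h2 s <= w * (s / u) * (3 - real d)"
    unfolding h1w by (simp add: algebra_simps diff_divide_distrib)
   then have "(real d - 1) / 2 * (2 * real d * h1 s + 4 * s * h2 s) <= (real d - 1) / 2 * (w * (s / u) * (3 - real d))"
    using that by (intro mult_left_mono) auto
   also have "... = ((real d - 1) * (3 - real d)) / 2 * (w * (s / u))" by simp
   also have "... <= 1 / 2 * (w * (s / u))"
   proof (intro mult_right_mono)
    have "(real d - 2)^2 >= 0" by simp
    then show "((real d - 1) * (3 - real d)) / 2 <= 1 / 2" by (simp add: power2_eq_square algebra_simps)
   qed (use w s u in auto)
   also have "... <= 1 / 2 * (w * (1 + 1 / u))"
    using w us u s by (intro mult_left_mono) (auto simp: field_simps)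
   finally show ?thesis by simp
  qed
  ultimately show ?thesis using hle hpos unfolding gam by auto
 qed
 show ?thesis
  by (intro exI[of _ h] exI[of _ h1] exI[of _ h2] conjI smooth allI impI D main)
qed

text \<open>The unit weight evaluated at \<open>s / R^2\<close>. The last two facts carry the length
  scale: \<open>|x| h (|x|^2)\<close> tends to \<open>R\<close>, and the zero-order error of the
  multiplier is at most \<open>1 / (2 R^2)\<close> times \<open>h + 2 s h1\<close>.\<close>

lemma weight_exists:
 fixes R :: real
 assumes R: "R > 0"
 obtains h h1 h2 :: "real => real" where "smooth_real h" "smooth_real h1" "smooth_real h2"
   "!!t. (h has_real_derivative h1 t) (at t)" "!!t. (h1 has_real_derivative h2 t) (at t)"
   "!!s. s >= 0 ==> 0 < h s" "!!s. s >= 0 ==> h s <= 1" "!!s. s >= 0 ==> h1 s <= 0"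
   "!!s. s >= 0 ==> h s + 2 * s * h1 s > 0" "!!s. s >= 0 ==> s * (h s)^2 <= R^2"
   "!!s. s >= 0 ==> s <= R^2 ==> h s + 2 * s * h1 s >= 1 / 4"
   "!!s. s > 0 ==> R - sqrt s * h s <= 2 * R ^ 3 / s"
   "!!s d. s >= 0 ==> d >= 1 ==> (real d - 1) / 2 * (2 * real d * h1 s + 4 * s * h2 s) <= (h s + 2 * s * h1 s) / (2 * R^2)"
proof -
 obtain H H1 H2 :: "real => real" where sm: "smooth_real H" "smooth_real H1" "smooth_real H2"
  and D: "!!t. (H has_real_derivative H1 t) (at t)" "!!t. (H1 has_real_derivative H2 t) (at t)"
  and H: "!!s. s >= 0 ==> 0 < H s & H s <= 1 & H1 s <= 0 & H s + 2 * s * H1 s > 0 & s * (H s)^2 <= 1 &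
    (s <= 1 --> H s + 2 * s * H1 s >= 1 / 4) & (s > 0 --> 1 - sqrt s * H s <= 2 / s) &
    (\<forall>d::nat. d >= 1 --> (real d - 1) / 2 * (2 * real d * H1 s + 4 * s * H2 s) <= (H s + 2 * s * H1 s) / 2)"
  using weight_exists_unit by metis
 define c where "c = 1 / R^2"
 have c: "c > 0" using R by (simp add: c_def)
 note S = smooth_real_scaleE[OF sm D, of c]
 show ?thesis
 proof (rule that[OF S])
  fix s :: real assume s: "s >= 0"
  then have cs: "c * s >= 0" using c by simp
  have arg: "H (c * s) + 2 * s * (c * H1 (c * s)) = H (c * s) + 2 * (c * s) * H1 (c * s)" by simp
  show "0 < H (c * s)" "H (c * s) <= 1" "c * H1 (c * s) <= 0" "H (c * s) + 2 * s * (c * H1 (c * s)) > 0"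
   unfolding arg using H[OF cs] c by (auto simp: mult_le_0_iff)
  have "(c * s) * (H (c * s))^2 <= 1" using H[OF cs] by simp
  then show "s * (H (c * s))^2 <= R^2" using R by (simp add: c_def field_simps)
  show "H (c * s) + 2 * s * (c * H1 (c * s)) >= 1 / 4" if "s <= R^2"
   unfolding arg using H[OF cs] that R by (simp add: c_def)
  show "(real d - 1) / 2 * (2 * real d * (c * H1 (c * s)) + 4 * s * (c^2 * H2 (c * s)))
    <= (H (c * s) + 2 * s * (c * H1 (c * s))) / (2 * R^2)" if "d >= 1" for d :: nat
  proof -
   have "(real d - 1) / 2 * (2 * real d * (c * H1 (c * s)) + 4 * s * (c^2 * H2 (c * s)))
     = c * ((real d - 1) / 2 * (2 * real d * H1 (c * s) + 4 * (c * s) * H2 (c * s)))"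
    by (simp add: power2_eq_square algebra_simps)
   also have "... <= c * ((H (c * s) + 2 * (c * s) * H1 (c * s)) / 2)"
    using H[OF cs] c that by (intro mult_left_mono) auto
   finally show ?thesis unfolding arg by (simp add: c_def mult.commute[of "R^2"])
  qed
 next
  fix s :: real assume s: "s > 0"
  then have cs: "c * s > 0" using c by simp
  have "sqrt (c * s) = sqrt s / R" using R s by (simp add: c_def real_sqrt_divide)
  then have "1 - (sqrt s / R) * H (c * s) <= 2 / (c * s)" using H[of "c * s"] cs by simp
  then have "R * (1 - (sqrt s / R) * H (c * s)) <= R * (2 / (c * s))" using R by (intro mult_left_mono) auto
  moreover have "R * (1 - (sqrt s / R) * H (c * s)) = R - sqrt s * H (c * s)" using R by (simp add: right_diff_distrib)
  moreover have "R * (2 / (c * s)) = 2 * R ^ 3 / s" using R by (simp add: c_def power2_eq_square power3_eq_cube)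
  ultimately show "R - sqrt s * H (c * s) <= 2 * R ^ 3 / s" by simp
 qed
qed

lemma euler_le_grad2:
 fixes v :: "'a::euclidean_space => complex"
 shows "(cmod (euler v x))^2 <= (norm x)^2 * grad2 v x"
proof -
 have "cmod (euler v x) <= (\<Sum>b\<in>Basis. \<bar>x \<bullet> b\<bar> * cmod (pd b v x))"
  unfolding euler_def by (rule sum_norm_le) (simp add: norm_mult)
 then have "(cmod (euler v x))^2 <= (\<Sum>b\<in>Basis. \<bar>x \<bullet> b\<bar> * cmod (pd b v x))^2"
  by (rule power_mono) simp
 also have "... <= (\<Sum>b\<in>Basis. \<bar>x \<bullet> b\<bar>^2) * grad2 v x"
  unfolding grad2_def by (rule Cauchy_Schwarz_ineq_sum)
 also have "(\<Sum>b\<in>Basis. \<bar>x \<bullet> b\<bar>^2) = (norm x)^2"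
  using euclidean_inner[of x x] by (simp add: dot_square_norm power2_eq_square)
 finally show ?thesis .
qed

lemma grad2_nonneg: "grad2 v x >= 0"
 by (simp add: grad2_def sum_nonneg)

text \<open>The density of the Morawetz identity is combined with \<open>- 2 kp R\<close> times that
  of the flux identity. Where the cut-off varies, the flux completes the square
  \<open>|e - \<i> kp r v|^2\<close>, the defect in the radiation condition, up to a cross term with
  the factor \<open>R - r h\<close>. The choice of \<open>R\<close> as multiple is forced by
  \<open>r h (r^2)\<close> tending to \<open>R\<close>.\<close>

lemma morawetz_pointwise:
 fixes e v w :: complex and s G kp R th th1 th2 h h1 h2 \<gamma> :: real and d :: nat
 assumes s: "s >= 0" and G: "(cmod e)^2 <= s * G" "G >= 0"
  and kp: "kp > 0" and R: "R > 0" "kp * R >= 1" and d: "d >= 1"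
  and th: "0 <= th" "th <= 1" "th1 <= 0"
  and h: "0 < h" "h <= 1" "h1 <= 0" and \<gamma>: "\<gamma> = h + 2 * s * h1" "\<gamma> > 0"
  and lap: "(real d - 1) / 2 * (2 * real d * h1 + 4 * s * h2) <= \<gamma> / (2 * R^2)"
  and hr: "s * h^2 <= R^2"
  and inside: "s <= R^2 ==> \<gamma> >= 1 / 4"
  and outside: "s > R^2 ==> w = 0"
 defines "\<alpha> \<equiv> (real d - 1) / 2" and "r \<equiv> sqrt s"
 defines "Q \<equiv> th * h" and "Q1 \<equiv> th1 * h + th * h1" and "Q2 \<equiv> th2 * h + 2 * th1 * h1 + th * h2"
 shows "2 * Re (w * cnj (of_real Q * (e + of_real \<alpha> * v))) + (Q - 2 * s * Q1) * G + 4 * Q1 * (cmod e)^2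
   + kp^2 * (Q + 2 * s * Q1) * (cmod v)^2 - \<alpha> * (2 * real d * Q1 + 4 * s * Q2) * (cmod v)^2
   - 2 * kp * R * (th * Im (cnj v * w) + 2 * th1 * Im (cnj v * e))
  >= (if s <= R^2 then th * kp^2 * (cmod v)^2 / 16 else 0) - (4 + 16 * (\<alpha> + 1)^2) * R^2 * (cmod w)^2
   - (2 * \<bar>th1\<bar> * h * (cmod (e - \<i> * of_real (kp * r) * v))^2 + 4 * kp * \<bar>th1\<bar> * (R - r * h) * (cmod v * cmod e)
     + \<alpha> * (2 * real d * \<bar>th1\<bar> * h + 4 * s * \<bar>th2\<bar> * h + 4 * \<bar>th1\<bar> * h) * (cmod v)^2)"
proof -
 have \<alpha>: "\<alpha> >= 0" using d by (simp add: \<alpha>_def)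
 have r: "r >= 0" "r^2 = s" using s by (auto simp: r_def)
 define V2 where "V2 = (cmod v)^2"
 define E2 where "E2 = (cmod e)^2"
 have V2: "V2 >= 0" and E2: "E2 >= 0" "E2 <= s * G" using G by (auto simp: V2_def E2_def)
 have rhR: "r * h <= R"
  by (rule power2_le_imp_le) (use hr r R in \<open>auto simp: power_mult_distrib\<close>)
 \<comment> \<open>Since \<open>h1 \<le> 0\<close>, a purely radial gradient is the worst case, and
   there the coefficient is \<open>h + 2 s h1\<close>.\<close>
 have a: "(h - 2 * s * h1) * G + 4 * h1 * E2 >= \<gamma> * G"
 proof -
  have "h1 * E2 >= h1 * (s * G)" using h(3) E2 by (intro mult_left_mono_neg) auto
  then show ?thesis unfolding \<gamma>(1) by (simp add: algebra_simps)
 qed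
 have b: "th1 * h * (4 * E2 - 2 * s * G) >= th1 * h * (2 * E2)"
  using th(3) h(1) E2 by (intro mult_left_mono_neg) (auto simp: mult_nonpos_nonneg)
 \<comment> \<open>Because \<open>kp R \<ge> 1\<close>, the zero-order error takes at most half of
   the available \<open>kp^2 \<gamma>\<close>.\<close>
 have c: "\<alpha> * (2 * real d * h1 + 4 * s * h2) <= kp^2 * \<gamma> / 2"
 proof -
  have "1 <= (kp * R)^2" using R(2) by (simp add: one_le_power)
  then have "1 / R^2 <= kp^2" using R(1) by (simp add: power_mult_distrib field_simps)
  then have "\<gamma> / 2 * (1 / R^2) <= \<gamma> / 2 * kp^2" using \<gamma>(2) by (intro mult_left_mono) auto
  with lap show ?thesis by (simp add: \<alpha>_def mult.commute)
 qed
 have dd: "2 * real d * th1 * h + 4 * s * th2 * h + 8 * s * th1 * h1 <= 2 * real d * \<bar>th1\<bar> * h + 4 * s * \<bar>th2\<bar> * h + 4 * \<bar>th1\<bar> * h"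
 proof -
  have "2 * real d * th1 * h <= 2 * real d * \<bar>th1\<bar> * h" using h(1) by (intro mult_right_mono mult_left_mono) auto
  moreover have "4 * s * th2 * h <= 4 * s * \<bar>th2\<bar> * h" using h(1) s by (intro mult_right_mono mult_left_mono) auto
  moreover have "8 * s * th1 * h1 <= 4 * \<bar>th1\<bar> * h"
  proof -
   have "(- 2 * s * h1) * (4 * \<bar>th1\<bar>) <= h * (4 * \<bar>th1\<bar>)"
    using \<gamma> by (intro mult_right_mono) auto
   then show ?thesis using th(3) by (simp add: algebra_simps)
  qed
  ultimately show ?thesis by linarith
 qed
 define REM3 where "REM3 = \<alpha> * (2 * real d * \<bar>th1\<bar> * h + 4 * s * \<bar>th2\<bar> * h + 4 * \<bar>th1\<bar> * h) * V2"
 have pos: "(Q - 2 * s * Q1) * G + 4 * Q1 * E2 + kp^2 * (Q + 2 * s * Q1) * V2 - \<alpha> * (2 * real d * Q1 + 4 * s * Q2) * V2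
   >= th * (\<gamma> * G + kp^2 * \<gamma> / 2 * V2) + 2 * th1 * h * (E2 + s * kp^2 * V2) - REM3"
 proof -
  have eq: "(Q - 2 * s * Q1) * G + 4 * Q1 * E2 + kp^2 * (Q + 2 * s * Q1) * V2 - \<alpha> * (2 * real d * Q1 + 4 * s * Q2) * V2
   = th * ((h - 2 * s * h1) * G + 4 * h1 * E2) + th1 * h * (4 * E2 - 2 * s * G) + kp^2 * th * \<gamma> * V2
    + 2 * s * kp^2 * th1 * h * V2 - th * V2 * (\<alpha> * (2 * real d * h1 + 4 * s * h2))
    - (\<alpha> * V2) * (2 * real d * th1 * h + 4 * s * th2 * h + 8 * s * th1 * h1)"
   unfolding Q_def Q1_def Q2_def \<gamma>(1) by (simp add: algebra_simps)
  have 1: "th * ((h - 2 * s * h1) * G + 4 * h1 * E2) >= th * (\<gamma> * G)" using a th by (intro mult_left_mono) auto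
  have 2: "th * V2 * (\<alpha> * (2 * real d * h1 + 4 * s * h2)) <= th * V2 * (kp^2 * \<gamma> / 2)"
   using c th V2 by (intro mult_left_mono) auto
  have 3: "(\<alpha> * V2) * (2 * real d * th1 * h + 4 * s * th2 * h + 8 * s * th1 * h1) <= REM3"
  proof -
   have "(\<alpha> * V2) * (2 * real d * th1 * h + 4 * s * th2 * h + 8 * s * th1 * h1)
     <= (\<alpha> * V2) * (2 * real d * \<bar>th1\<bar> * h + 4 * s * \<bar>th2\<bar> * h + 4 * \<bar>th1\<bar> * h)"
    using dd \<alpha> V2 by (intro mult_left_mono) auto
   also have "... = REM3" by (simp add: REM3_def)
   finally show ?thesis .
  qed
  have "th * (\<gamma> * G + kp^2 * \<gamma> / 2 * V2) + 2 * th1 * h * (E2 + s * kp^2 * V2) - REM3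
    = th * (\<gamma> * G) + th1 * h * (2 * E2) + kp^2 * th * \<gamma> * V2 + 2 * s * kp^2 * th1 * h * V2 - th * V2 * (kp^2 * \<gamma> / 2) - REM3"
   by (simp add: algebra_simps)
  with 1 2 3 b show ?thesis unfolding eq by linarith
 qed
 \<comment> \<open>The square is completed exactly; the leftover cross term has coefficient
   \<open>4 kp |th1| (R - r h)\<close>, which is nonnegative by \<open>r h \<le> R\<close>.\<close>
 have bdry: "2 * th1 * h * (E2 + s * kp^2 * V2) - 4 * kp * R * th1 * Im (cnj v * e)
   >= - (2 * \<bar>th1\<bar> * h * (cmod (e - \<i> * of_real (kp * r) * v))^2 + 4 * kp * \<bar>th1\<bar> * (R - r * h) * (cmod v * cmod e))"
 proof -
  have D: "(cmod (e - \<i> * of_real (kp * r) * v))^2 = E2 + s * kp^2 * V2 - 2 * kp * r * Im (cnj v * e)"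
   unfolding E2_def V2_def r(2)[symmetric] cmod_power2 by (simp add: power2_eq_square algebra_simps)
  have "\<bar>Im (cnj v * e)\<bar> <= cmod v * cmod e"
   using abs_Im_le_cmod[of "cnj v * e"] by (simp add: norm_mult)
  then have "(4 * kp * \<bar>th1\<bar> * (R - r * h)) * \<bar>Im (cnj v * e)\<bar> <= (4 * kp * \<bar>th1\<bar> * (R - r * h)) * (cmod v * cmod e)"
   using kp rhR by (intro mult_left_mono) auto
  moreover have "(4 * kp * \<bar>th1\<bar> * (R - r * h)) * Im (cnj v * e) >= - ((4 * kp * \<bar>th1\<bar> * (R - r * h)) * \<bar>Im (cnj v * e)\<bar>)"
   using mult_left_mono[of "- \<bar>Im (cnj v * e)\<bar>" "Im (cnj v * e)" "4 * kp * \<bar>th1\<bar> * (R - r * h)"] kp rhR by auto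
  moreover have "2 * th1 * h * (E2 + s * kp^2 * V2) - 4 * kp * R * th1 * Im (cnj v * e)
    = - (2 * \<bar>th1\<bar> * h * (cmod (e - \<i> * of_real (kp * r) * v))^2) + (4 * kp * \<bar>th1\<bar> * (R - r * h)) * Im (cnj v * e)"
   unfolding D using th(3) by (simp add: algebra_simps)
  ultimately show ?thesis by linarith
 qed
 have src1: "2 * Re (w * cnj (of_real Q * (e + of_real \<alpha> * v))) >= - (th * (2 * cmod w * (cmod e + \<alpha> * cmod v)))"
 proof -
  have "cmod (w * cnj (of_real Q * (e + of_real \<alpha> * v))) = cmod w * (\<bar>Q\<bar> * cmod (e + of_real \<alpha> * v))"
   by (simp only: norm_mult complex_mod_cnj norm_of_real)
  also have "... <= cmod w * (th * (cmod e + \<alpha> * cmod v))"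
  proof (intro mult_left_mono mult_mono)
   show "\<bar>Q\<bar> <= th" using th h by (simp add: Q_def abs_mult mult_left_le)
   show "cmod (e + of_real \<alpha> * v) <= cmod e + \<alpha> * cmod v"
    using norm_triangle_ineq[of e "of_real \<alpha> * v"] \<alpha> by (simp add: norm_mult)
  qed (use th in auto)
  finally show ?thesis
   using abs_Re_le_cmod[of "w * cnj (of_real Q * (e + of_real \<alpha> * v))"] by (simp add: algebra_simps)
 qed
 have src2: "2 * kp * R * (th * Im (cnj v * w)) <= th * (2 * kp * R * (cmod v * cmod w))"
 proof -
  have "Im (cnj v * w) <= cmod v * cmod w"
   using abs_Im_le_cmod[of "cnj v * w"] by (simp add: norm_mult)
  then have "(2 * kp * R * th) * Im (cnj v * w) <= (2 * kp * R * th) * (cmod v * cmod w)"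
   using kp R th by (intro mult_left_mono) auto
  then show ?thesis by (simp add: algebra_simps)
 qed
 \<comment> \<open>Young's inequality inside the ball, where \<open>\<gamma> \<ge> 1/4\<close>. The
   squares of \<open>g1 / 2 - 2 R F\<close> and \<open>y / 4 - 4 (\<alpha> + 1) R F\<close> produce
   the constants 4 and \<open>16 (\<alpha> + 1)^2\<close>, and \<open>y^2 / 16\<close> of
   \<open>y^2 / 8\<close> survives.\<close>
 have absorb: "\<gamma> * G + kp^2 * \<gamma> / 2 * V2 - 2 * cmod w * (cmod e + \<alpha> * cmod v) - 2 * kp * R * (cmod v * cmod w)
   >= (if s <= R^2 then kp\<^sup>2 * V2 / 16 else 0) - (4 + 16 * (\<alpha> + 1)^2) * R^2 * (cmod w)^2"
 proof (cases "s <= R^2")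
  case False
  then have "w = 0" using outside by simp
  then show ?thesis using False \<gamma> G V2 by simp
 next
  case True
  define F where "F = cmod w" define y where "y = kp * cmod v" define g1 where "g1 = sqrt G"
  have F: "F >= 0" and y: "y >= 0" "y^2 = kp^2 * V2" and g1: "g1 >= 0" "g1^2 = G"
   using kp G by (auto simp: F_def y_def g1_def V2_def power_mult_distrib)
  have e: "cmod e <= R * g1"
  proof (rule power2_le_imp_le)
   have "(cmod e)^2 <= R^2 * G" using G True by (meson mult_right_mono order_trans)
   then show "(cmod e)^2 <= (R * g1)^2" by (simp add: power_mult_distrib g1)
  qed (use R g1 in simp)
  have v: "cmod v <= R * y"
   using mult_right_mono[OF R(2), of "cmod v"] by (simp add: y_def mult_ac)
  have i1: "2 * F * cmod e <= 2 * F * (R * g1)" using e F by (intro mult_left_mono) auto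
  have i2: "2 * F * (\<alpha> * cmod v) <= 2 * F * (\<alpha> * (R * y))" using v F \<alpha> by (intro mult_left_mono) auto
  have i3: "g1^2 / 4 - 2 * F * (R * g1) + 4 * R^2 * F^2 >= 0"
   using zero_le_power2[of "g1 / 2 - 2 * (R * F)"] by (simp add: power2_eq_square algebra_simps)
  have i4: "y^2 / 16 - 2 * (\<alpha> + 1) * R * F * y + 16 * (\<alpha> + 1)^2 * R^2 * F^2 >= 0"
   using zero_le_power2[of "y / 4 - 4 * ((\<alpha> + 1) * R * F)"] by (simp add: power2_eq_square algebra_simps)
  have i5: "\<gamma> * G >= g1^2 / 4" using inside[OF True] G g1 mult_right_mono[of "1/4" \<gamma> G] by simp
  have i6: "kp^2 * \<gamma> / 2 * V2 >= y^2 / 8"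
   using inside[OF True] mult_right_mono[of "1/4" \<gamma> "kp^2 * V2 / 2"] V2 unfolding y(2) by (simp add: mult_ac)
  have e1: "2 * F * (cmod e + \<alpha> * cmod v) = 2 * F * cmod e + 2 * F * (\<alpha> * cmod v)" by (simp add: algebra_simps)
  have e2: "2 * kp * R * (cmod v * F) = 2 * R * F * y" by (simp add: y_def)
  have e3: "2 * (\<alpha> + 1) * R * F * y = 2 * F * (\<alpha> * (R * y)) + 2 * R * F * y" by (simp add: algebra_simps)
  have e4: "(4 + 16 * (\<alpha> + 1)^2) * R^2 * F^2 = 4 * R^2 * F^2 + 16 * (\<alpha> + 1)^2 * R^2 * F^2" by (simp add: algebra_simps)
  show ?thesis
   using True i1 i2 i3 i4 i5 i6 unfolding F_def[symmetric] e1 e2 e3 e4 y(2)[symmetric] by simp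
 qed
 define X where "X = \<gamma> * G + kp^2 * \<gamma> / 2 * V2 - 2 * cmod w * (cmod e + \<alpha> * cmod v) - 2 * kp * R * (cmod v * cmod w)"
 have "th * X >= th * ((if s <= R^2 then kp\<^sup>2 * V2 / 16 else 0) - (4 + 16 * (\<alpha> + 1)^2) * R^2 * (cmod w)^2)"
  unfolding X_def using absorb th by (intro mult_left_mono) auto
 also have "th * ((if s <= R^2 then kp\<^sup>2 * V2 / 16 else 0) - (4 + 16 * (\<alpha> + 1)^2) * R^2 * (cmod w)^2)
   >= (if s <= R^2 then th * kp^2 * V2 / 16 else 0) - (4 + 16 * (\<alpha> + 1)^2) * R^2 * (cmod w)^2"
 proof -
  have "th * ((4 + 16 * (\<alpha> + 1)^2) * R^2 * (cmod w)^2) <= 1 * ((4 + 16 * (\<alpha> + 1)^2) * R^2 * (cmod w)^2)"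
   using th by (intro mult_right_mono) auto
  then show ?thesis by (simp add: right_diff_distrib)
 qed
 finally have X: "th * X >= (if s <= R^2 then th * kp^2 * V2 / 16 else 0) - (4 + 16 * (\<alpha> + 1)^2) * R^2 * (cmod w)^2" .
 have Xe: "th * X = th * (\<gamma> * G + kp^2 * \<gamma> / 2 * V2) - th * (2 * cmod w * (cmod e + \<alpha> * cmod v)) - th * (2 * kp * R * (cmod v * cmod w))"
  by (simp add: X_def right_diff_distrib)
 have split: "2 * kp * R * (th * Im (cnj v * w) + 2 * th1 * Im (cnj v * e))
   = 2 * kp * R * (th * Im (cnj v * w)) + 4 * kp * R * th1 * Im (cnj v * e)" by (simp add: distrib_left)
 show ?thesis
  unfolding split using X Xe pos bdry src1 src2 unfolding REM3_def V2_def E2_def by linarith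
qed

lemma integral_lincomb3:
 fixes f1 f2 f3 :: "'a => real"
 assumes "integrable M f1" "integrable M f2" "integrable M f3"
 shows "(LINT x|M. c1 * f1 x - c2 * f2 x - c3 * f3 x)
  = c1 * (LINT x|M. f1 x) - c2 * (LINT x|M. f2 x) - c3 * (LINT x|M. f3 x)"
 using assms by simp

lemma measure_lborel_cball:
 "measure lborel (cball (c::'a::euclidean_space) r) = unit_ball_vol (real DIM('a)) * r ^ DIM('a)" if "r >= 0"
 using content_cball[OF that, of c] by simp

text \<open>The cut-off at radius \<open>T\<close> contributes a remainder that is supported in an
 annulus, and the radiation condition makes it vanish as \<open>T\<close> tends to infinity.\<close>

lemma propagating_smooth:
 fixes v :: "'a::euclidean_space => complex" and kp R B r0 :: real
 defines "p \<equiv> (1 - real DIM('a)) / 2" and "\<alpha> \<equiv> (real DIM('a) - 1) / 2"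
 assumes v: "smooth v"
  and sym: "!!b c x. b \<in> Basis ==> c \<in> Basis ==> pd c (pd b v) x = pd b (pd c v) x"
  and kp: "kp > 0" and R: "R > 0" "kp * R >= 1"
  and src: "!!x. norm x > R ==> lap v x + of_real (kp^2) * v x = 0"
  and B: "!!x. norm x >= r0 ==> cmod (v x) <= B * norm x powr p"
   "!!x. norm x >= r0 ==> cmod (euler v x) <= B * norm x * norm x powr p"
  and rad: "!!\<eta>. \<eta> > 0 ==> \<exists>r. \<forall>x. norm x >= r -->
    cmod (euler v x - \<i> * of_real (kp * norm x) * v x) <= \<eta> * norm x * norm x powr p"
 shows "kp^2 * (LINT x|lborel. indicator (cball 0 R) x * (cmod (v x))^2)
  <= 16 * (4 + 16 * (\<alpha> + 1)^2) * R^2 * (LINT x|lborel. (cmod (lap v x + of_real (kp^2) * v x))^2)"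
proof -
 let ?d = "DIM('a)"
 define W where "W x = lap v x + of_real (kp^2) * v x" for x
 define A where "A = 4 + 16 * (\<alpha> + 1)^2"
 have d1: "?d >= 1" by (simp add: Suc_leI)
 have \<alpha>: "\<alpha> >= 0" using d1 by (simp add: \<alpha>_def)
 have p: "p <= 0" using d1 by (simp add: p_def)
 have smW: "smooth W" unfolding W_def[abs_def] by (intro smooth_add smooth_mult smooth_const smooth_lap v)
 obtain h h1 h2 :: "real => real" where h: "smooth_real h" "smooth_real h1" "smooth_real h2"
   "!!t. (h has_real_derivative h1 t) (at t)" "!!t. (h1 has_real_derivative h2 t) (at t)"
   "!!s. s >= 0 ==> 0 < h s" "!!s. s >= 0 ==> h s <= 1" "!!s. s >= 0 ==> h1 s <= 0"
   "!!s. s >= 0 ==> h s + 2 * s * h1 s > 0" "!!s. s >= 0 ==> s * (h s)^2 <= R^2"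
   "!!s. s >= 0 ==> s <= R^2 ==> h s + 2 * s * h1 s >= 1 / 4"
   "!!s. s > 0 ==> R - sqrt s * h s <= 2 * R ^ 3 / s"
   "!!s d. s >= 0 ==> d >= 1 ==> (real d - 1) / 2 * (2 * real d * h1 s + 4 * s * h2 s) <= (h s + 2 * s * h1 s) / (2 * R^2)"
 proof (rule weight_exists[OF R(1)], goal_cases)
  case (1 h h1 h2)
  show ?case by (rule that[of h h1 h2]) (fact 1)+
 qed
 obtain M where M: "M > 0" and cut: "!!T. T > 0 ==> \<exists>Q Q1 Q2. smooth_real Q & smooth_real Q1 & smooth_real Q2 &
   (\<forall>t. (Q has_real_derivative Q1 t) (at t)) & (\<forall>t. (Q1 has_real_derivative Q2 t) (at t)) &
   (\<forall>s. 0 <= Q s & Q s <= 1 & Q1 s <= 0 & \<bar>Q1 s\<bar> <= M / T^2 & \<bar>Q2 s\<bar> <= M / T ^ 4) &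
   (\<forall>s\<le>T^2. Q s = 1) & (\<forall>s\<ge>2 * T^2. Q s = 0) &
   (\<forall>s. s <= T^2 \<or> s >= 2 * T^2 --> Q1 s = 0 & Q2 s = 0)"
  using cutoff_exists by metis
 define IV where "IV = (LINT x|lborel. indicator (cball 0 R) x * (cmod (v x))^2)"
 define IW where "IW = (LINT x|lborel. (cmod (W x))^2)"
 have contW: "continuous_on UNIV (%x. (cmod (W x))^2)" and contv: "continuous_on UNIV (%x. (cmod (v x))^2)"
  using smW v by (auto intro!: continuous_intros smooth_continuous)
 have intW: "integrable lborel (%x. (cmod (W x))^2)"
  by (rule integrable_compact_support[OF contW, of "R + 1"]) (use src in \<open>auto simp: W_def\<close>)
 have intV: "integrable lborel (%x. indicator (cball 0 R) x * (cmod (v x))^2)"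
  using borel_integrable_compact[of "cball 0 R" "%x. (cmod (v x))^2"] continuous_on_subset[OF contv] by auto
 \<comment> \<open>\<open>K1\<close> collects the remainders that decay like \<open>T^(-2)\<close>
   by the size bounds alone; \<open>\<omega> T^d\<close> will be the volume of the ball of radius
   \<open>2 T\<close>.\<close>
 define K1 where "K1 = 8 * kp * M * R ^ 3 * B^2 + \<alpha> * R * M * B^2 * (2 * real ?d + 12)"
 define \<omega> where "\<omega> = unit_ball_vol (real ?d) * 2 ^ ?d"
 have K1: "K1 >= 0" using kp M R \<alpha> by (auto simp: K1_def intro!: add_nonneg_nonneg mult_nonneg_nonneg)
 have \<omega>: "\<omega> >= 0" by (simp add: \<omega>_def)
 have step: "kp^2 / 16 * IV <= A * R^2 * IW + \<omega> * (4 * M * R * \<eta>^2 + K1 / T^2)"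
  if \<eta>: "\<eta> > 0" and T: "T >= 1" "T >= R" "T >= r0"
   and o: "!!x. norm x >= T ==> cmod (euler v x - \<i> * of_real (kp * norm x) * v x) <= \<eta> * norm x * norm x powr p" for \<eta> T
 proof -
  have "T > 0" using T by simp
  from cut[OF this] obtain th th1 th2 where C: "smooth_real th & smooth_real th1 & smooth_real th2 &
   (\<forall>t. (th has_real_derivative th1 t) (at t)) & (\<forall>t. (th1 has_real_derivative th2 t) (at t)) &
   (\<forall>s. 0 <= th s & th s <= 1 & th1 s <= 0 & \<bar>th1 s\<bar> <= M / T^2 & \<bar>th2 s\<bar> <= M / T ^ 4) &
   (\<forall>s\<le>T^2. th s = 1) & (\<forall>s\<ge>2 * T^2. th s = 0) &
   (\<forall>s. s <= T^2 \<or> s >= 2 * T^2 --> th1 s = 0 & th2 s = 0)"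
   by (elim exE) (rule that)
  note th = C[THEN conjunct1]
   C[THEN conjunct2, THEN conjunct1]
   C[THEN conjunct2, THEN conjunct2, THEN conjunct1]
   C[THEN conjunct2, THEN conjunct2, THEN conjunct2, THEN conjunct1, rule_format]
   C[THEN conjunct2, THEN conjunct2, THEN conjunct2, THEN conjunct2, THEN conjunct1, rule_format]
   C[THEN conjunct2, THEN conjunct2, THEN conjunct2, THEN conjunct2, THEN conjunct2, THEN conjunct1, THEN spec]
   C[THEN conjunct2, THEN conjunct2, THEN conjunct2, THEN conjunct2, THEN conjunct2, THEN conjunct2, THEN conjunct1, rule_format]
   C[THEN conjunct2, THEN conjunct2, THEN conjunct2, THEN conjunct2, THEN conjunct2, THEN conjunct2, THEN conjunct2, THEN conjunct1, rule_format]
   C[THEN conjunct2, THEN conjunct2, THEN conjunct2, THEN conjunct2, THEN conjunct2, THEN conjunct2, THEN conjunct2, THEN conjunct2, rule_format]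
  define Q where "Q s = th s * h s" for s
  define Q1 where "Q1 s = th1 s * h s + th s * h1 s" for s
  define Q2 where "Q2 s = th2 s * h s + 2 * th1 s * h1 s + th s * h2 s" for s
  have add: "smooth_real (%x. f x + g x)" if "smooth_real f" "smooth_real g" for f g
   by (rule smooth_real_coinduct[where P=smooth_real_gen])
     (rule smooth_real_gen.add[OF smooth_real_gen.base[OF that(1)] smooth_real_gen.base[OF that(2)]], auto dest: smooth_real_gen_step)
  have DQ: "(Q has_real_derivative Q1 t) (at t)" "(Q1 has_real_derivative Q2 t) (at t)" for t
  proof -
   show "(Q has_real_derivative Q1 t) (at t)"
    unfolding Q_def[abs_def] Q1_def by (rule DERIV_cong[OF DERIV_mult[OF th(4) h(4)]]) simp
   show "(Q1 has_real_derivative Q2 t) (at t)"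
    unfolding Q1_def[abs_def] Q2_def
    by (rule DERIV_cong[OF DERIV_add[OF DERIV_mult[OF th(5) h(4)] DERIV_mult[OF th(4) h(5)]]]) simp
  qed
  have smQ: "smooth_real Q" "smooth_real Q1"
   unfolding Q_def[abs_def] Q1_def[abs_def] by (intro add smooth_real_mult th h)+
  \<comment> \<open>Smoothness of \<open>Q1\<close> yields some smooth derivative, and uniqueness
    identifies it with the explicit formula for \<open>Q2\<close>.\<close>
  obtain Q2' where Q2': "smooth_real Q2'" "!!t. (Q1 has_real_derivative Q2' t) (at t)"
   using smooth_realE smQ(2) by metis
  have "Q2' = Q2" using Q2'(2) DQ(2) DERIV_unique by blast
  with Q2' have smQ2: "smooth_real Q2" by simp
  have supp: "Q t = 0" "Q1 t = 0" if "t >= 2 * T^2" for t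
   using th(8)[OF that] th(9)[of t] that by (auto simp: Q_def Q1_def)
  have Dth: "th t = 0" "th1 t = 0" if "t >= 2 * T^2" for t
   using th(8)[OF that] th(9)[of t] that by auto
  define g where "g = (%x. 2 * Re (W x * cnj (of_real (Q ((norm x)^2)) * (euler v x + of_real \<alpha> * v x)))
   + (Q ((norm x)^2) - 2 * (norm x)^2 * Q1 ((norm x)^2)) * grad2 v x + 4 * Q1 ((norm x)^2) * (cmod (euler v x))^2
   + kp^2 * (Q ((norm x)^2) + 2 * (norm x)^2 * Q1 ((norm x)^2)) * (cmod (v x))^2
   - \<alpha> * (2 * real ?d * Q1 ((norm x)^2) + 4 * (norm x)^2 * Q2 ((norm x)^2)) * (cmod (v x))^2)"
  define g2 where "g2 = (%x. th ((norm x)^2) * Im (cnj (v x) * lap v x) + 2 * th1 ((norm x)^2) * Im (cnj (v x) * euler v x))"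
  have I1: "integrable lborel g" "(LINT x|lborel. g x) = 0"
   unfolding g_def W_def \<alpha>_def
   by (rule morawetz_identity[where kp=kp and T="2 * T^2", OF v sym smQ smQ2 DQ supp]; assumption)+
  have I2: "integrable lborel g2" "(LINT x|lborel. g2 x) = 0"
   unfolding g2_def
   by (rule flux_identity[where T="2 * T^2", OF v sym th(1-5) Dth]; assumption)+
  \<comment> \<open>The remainder is bounded by a constant on the ball of radius \<open>2 T\<close>;
    dividing by \<open>T^d\<close> anticipates the volume factor of the integration.\<close>
  define E where "E = (4 * M * R * \<eta>^2 + K1 / T^2) / T ^ ?d"
  have E: "E >= 0" using M R K1 T by (auto simp: E_def intro!: divide_nonneg_nonneg add_nonneg_nonneg)
  have ptw: "g x - 2 * kp * R * g2 x >= kp^2 / 16 * (indicator (cball 0 R) x * (cmod (v x))^2)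
    - A * R^2 * (cmod (W x))^2 - E * indicator (cball 0 (2 * T)) x" for x
  proof -
   define s where "s = (norm x)^2"
   have s: "s >= 0" "sqrt s = norm x" by (auto simp: s_def)
   have sR: "s <= R^2 \<longleftrightarrow> norm x <= R" unfolding s_def using R(1) by (simp add: abs_le_square_iff[symmetric])
   have srcW: "W x = 0" if "s > R^2" using src[of x] sR that by (simp add: W_def not_le[symmetric])
   have Im: "Im (cnj (v x) * lap v x) = Im (cnj (v x) * W x)"
    by (simp add: W_def algebra_simps)
   define REM where "REM = 2 * \<bar>th1 s\<bar> * h s * (cmod (euler v x - \<i> * of_real (kp * sqrt s) * v x))^2
     + 4 * kp * \<bar>th1 s\<bar> * (R - sqrt s * h s) * (cmod (v x) * cmod (euler v x))
     + \<alpha> * (2 * real ?d * \<bar>th1 s\<bar> * h s + 4 * s * \<bar>th2 s\<bar> * h s + 4 * \<bar>th1 s\<bar> * h s) * (cmod (v x))^2"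
   have main: "g x - 2 * kp * R * g2 x >= (if s <= R^2 then th s * kp^2 * (cmod (v x))^2 / 16 else 0) - A * R^2 * (cmod (W x))^2 - REM"
    unfolding g_def g2_def Im REM_def A_def s_def[symmetric] Q_def Q1_def Q2_def \<alpha>_def
    by (rule morawetz_pointwise[where \<gamma>="h s + 2 * s * h1 s"])
      (use s kp R d1 th(6)[of s] h(6-11,13)[OF s(1)] euler_le_grad2[of v x] grad2_nonneg[of v x] srcW
       in \<open>auto simp: s_def\<close>)
   have REM: "REM <= E * indicator (cball 0 (2 * T)) x"
   proof (cases "s <= T^2 \<or> s >= 2 * T^2")
    case True
    then have "REM = 0" using th(9)[of s] by (simp add: REM_def)
    then show ?thesis using E by simp
   next
    case False
    then have sT: "T^2 < s" "s < 2 * T^2" by auto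
    define r where "r = norm x"
    have r: "r >= 0" "r^2 = s" "sqrt s = r" by (auto simp: r_def s_def)
    have rT: "T < r" using sT(1) r T by (metis power_mono not_le order_less_le_trans less_le_not_le)
    have r2T: "r <= 2 * T"
    proof (rule power2_le_imp_le)
     have "(2 * T)^2 = 4 * T^2" "T^2 >= 0" by (simp_all add: power_mult_distrib)
     then show "r^2 <= (2 * T)^2" using sT(2) r(2) by linarith
    qed (use T in simp)
    have r0: "r > 0" "s > 0" using rT T sT by (auto intro: less_trans zero_less_power)
    have ind: "indicator (cball 0 (2 * T)) x = (1::real)" using r2T by (simp add: r_def)
    \<comment> \<open>The squared decay rate \<open>r^(1 - d)\<close>, at most
      \<open>T / T^d\<close> where the cut-off varies.\<close>
    define P where "P = (r powr p)^2"
    have P: "P >= 0" "P <= T / T ^ ?d"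
    proof -
     have "P = r powr (1 - real ?d)"
      unfolding P_def power2_eq_square powr_add[symmetric] p_def by (simp only: field_sum_of_halves)
     also have "... <= T powr (1 - real ?d)"
      using rT T d1 by (intro powr_mono2') auto
     also have "... = T / T ^ ?d"
      using T by (simp add: powr_diff powr_realpow)
     finally show "P <= T / T ^ ?d" .
    qed (simp add: P_def)
    have Bx: "cmod (v x) <= B * r powr p" "cmod (euler v x) <= B * r * r powr p"
     using B[of x] rT T(3) by (auto simp: r_def)
    have vv: "(cmod (v x))^2 <= B^2 * P"
     using power_mono[OF Bx(1), of 2] by (simp add: P_def power_mult_distrib)
    have ve: "cmod (v x) * cmod (euler v x) <= B^2 * r * P"
     using mult_mono[OF Bx(1) Bx(2)] order_trans[OF norm_ge_zero Bx(1)]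
     by (simp add: P_def power2_eq_square mult_ac)
    have oo: "(cmod (euler v x - \<i> * of_real (kp * sqrt s) * v x))^2 <= \<eta>^2 * s * P"
    proof -
     have "cmod (euler v x - \<i> * of_real (kp * r) * v x) <= \<eta> * r * r powr p"
      using o[of x] rT by (simp add: r_def)
     from power_mono[OF this, of 2] show ?thesis by (simp add: r P_def power_mult_distrib)
    qed
    have hs: "0 < h s" "h s <= R / r"
    proof -
     show "0 < h s" using h(6) s by simp
     have "h s * r <= R"
      by (rule power2_le_imp_le) (use h(10)[OF s(1)] R r in \<open>auto simp: power_mult_distrib mult.commute\<close>)
     then show "h s <= R / r" using r0 by (simp add: field_simps)
    qed
    have hsT: "h s <= R / T"
     using hs(2) rT T R by (meson divide_left_mono less_imp_le order_trans mult_pos_pos less_trans zero_less_one order_less_le_trans)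
    have t1: "\<bar>th1 s\<bar> <= M / T^2" "\<bar>th2 s\<bar> <= M / T ^ 4" using th(6)[of s] by auto
    have T0: "T > 0" using T by simp
    \<comment> \<open>Apart from the common \<open>T^(-d)\<close>, this term is of order
      \<open>\<eta>^2\<close> by the radiation condition, while the next two are of order
      \<open>T^(-2)\<close> by the size bounds.\<close>
    have 1: "2 * \<bar>th1 s\<bar> * h s * (cmod (euler v x - \<i> * of_real (kp * sqrt s) * v x))^2 <= 4 * M * R * \<eta>^2 / T ^ ?d"
    proof -
     have "2 * \<bar>th1 s\<bar> * h s * (cmod (euler v x - \<i> * of_real (kp * sqrt s) * v x))^2
       <= 2 * (M / T^2) * (R / r) * (\<eta>^2 * s * (T / T ^ ?d))"
      using t1(1) hs oo P M R r0 T0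
      by (intro mult_mono order_trans[OF oo] mult_left_mono) auto
     also have "... = (2 * M * R * \<eta>^2 * T / (T^2 * T ^ ?d)) * r"
      unfolding r(2)[symmetric] using r0 by (simp add: power2_eq_square field_simps)
     also have "... <= (2 * M * R * \<eta>^2 * T / (T^2 * T ^ ?d)) * (2 * T)"
      using r2T M R T0 by (intro mult_left_mono) auto
     also have "... = 4 * M * R * \<eta>^2 / T ^ ?d" using T0 by (simp add: power2_eq_square)
     finally show ?thesis .
    qed
    have 2: "4 * kp * \<bar>th1 s\<bar> * (R - sqrt s * h s) * (cmod (v x) * cmod (euler v x)) <= 8 * kp * M * R ^ 3 * B^2 / T^2 / T ^ ?d"
    proof -
     have "4 * kp * \<bar>th1 s\<bar> * (R - sqrt s * h s) * (cmod (v x) * cmod (euler v x))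
       <= 4 * kp * (M / T^2) * (2 * R ^ 3 / s) * (B^2 * r * (T / T ^ ?d))"
     proof (rule mult_mono)
      show "cmod (v x) * cmod (euler v x) <= B^2 * r * (T / T ^ ?d)"
       using ve mult_left_mono[OF P(2), of "B^2 * r"] r0 by simp
      show "4 * kp * \<bar>th1 s\<bar> * (R - sqrt s * h s) <= 4 * kp * (M / T^2) * (2 * R ^ 3 / s)"
      proof (rule mult_mono)
       show "4 * kp * \<bar>th1 s\<bar> <= 4 * kp * (M / T^2)" using t1 kp by (intro mult_left_mono) auto
       have "r * h s <= R" using hs(2) r0 by (simp add: field_simps)
       then show "0 <= R - sqrt s * h s" using r by simp
      qed (use h(12)[OF r0(2)] kp M R r0 T0 in auto)
     qed (use kp M R r0 T0 in auto)
     also have "... = (8 * kp * M * R ^ 3 * B^2 / T^2 / T ^ ?d) * (T / r)"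
      unfolding r(2)[symmetric] using r0 T0 by (simp add: power2_eq_square field_simps)
     also have "... <= (8 * kp * M * R ^ 3 * B^2 / T^2 / T ^ ?d) * 1"
      using rT r0 kp M R T0 by (intro mult_left_mono) auto
     finally show ?thesis by simp
    qed
    have 3: "\<alpha> * (2 * real ?d * \<bar>th1 s\<bar> * h s + 4 * s * \<bar>th2 s\<bar> * h s + 4 * \<bar>th1 s\<bar> * h s) * (cmod (v x))^2
      <= \<alpha> * R * M * B^2 * (2 * real ?d + 12) / T^2 / T ^ ?d"
    proof -
     have a: "\<bar>th1 s\<bar> * h s <= (M / T^2) * (R / T)" using t1 hs hsT M T0 by (intro mult_mono) auto
     have b: "s * \<bar>th2 s\<bar> * h s <= (2 * T^2) * (M / T ^ 4) * (R / T)"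
      using t1 hs hsT M T0 sT s by (intro mult_mono) auto
     have b': "(2 * T^2) * (M / T ^ 4) * (R / T) = 2 * ((M / T^2) * (R / T))"
      using T0 by (simp add: power2_eq_square power4_eq_xxxx)
     have c: "2 * real ?d * \<bar>th1 s\<bar> * h s + 4 * s * \<bar>th2 s\<bar> * h s + 4 * \<bar>th1 s\<bar> * h s <= (2 * real ?d + 12) * ((M / T^2) * (R / T))"
     proof -
      define X where "X = (M / T^2) * (R / T)"
      have 1: "2 * real ?d * (\<bar>th1 s\<bar> * h s) <= 2 * real ?d * X" using a by (intro mult_left_mono) (auto simp: X_def)
      have 2: "s * \<bar>th2 s\<bar> * h s <= 2 * X" "\<bar>th1 s\<bar> * h s <= X" using a b b' by (simp_all add: X_def)
      have 3: "2 * real ?d * \<bar>th1 s\<bar> * h s + 4 * s * \<bar>th2 s\<bar> * h s + 4 * \<bar>th1 s\<bar> * h s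
       = 2 * real ?d * (\<bar>th1 s\<bar> * h s) + 4 * (s * \<bar>th2 s\<bar> * h s) + 4 * (\<bar>th1 s\<bar> * h s)" by (simp add: algebra_simps)
      have 4: "(2 * real ?d + 12) * X = 2 * real ?d * X + 12 * X" by (simp add: algebra_simps)
      show ?thesis unfolding X_def[symmetric] 3 4 using 1 2 by linarith
     qed
     have "\<alpha> * (2 * real ?d * \<bar>th1 s\<bar> * h s + 4 * s * \<bar>th2 s\<bar> * h s + 4 * \<bar>th1 s\<bar> * h s) * (cmod (v x))^2
       <= \<alpha> * ((2 * real ?d + 12) * ((M / T^2) * (R / T))) * (B^2 * (T / T ^ ?d))"
     proof (rule mult_mono[OF mult_left_mono[OF c \<alpha>]])
      show "(cmod (v x))^2 <= B^2 * (T / T ^ ?d)"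
       using vv mult_left_mono[OF P(2), of "B^2"] by simp
     qed (use \<alpha> M R T0 in auto)
     also have "... = \<alpha> * R * M * B^2 * (2 * real ?d + 12) / T^2 / T ^ ?d" using T0 by (simp add: field_simps)
     finally show ?thesis .
    qed
    have "REM <= 4 * M * R * \<eta>^2 / T ^ ?d + 8 * kp * M * R ^ 3 * B^2 / T^2 / T ^ ?d + \<alpha> * R * M * B^2 * (2 * real ?d + 12) / T^2 / T ^ ?d"
     unfolding REM_def using 1 2 3 by linarith
    also have "... = E" by (simp add: E_def K1_def add_divide_distrib)
    finally show ?thesis using ind by simp
   qed
   have "(if s <= R^2 then th s * kp^2 * (cmod (v x))^2 / 16 else 0) = kp^2 / 16 * (indicator (cball 0 R) x * (cmod (v x))^2)"
   proof (cases "norm x <= R")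
    case True
    have "s <= T^2" unfolding s_def using True T(2) by (intro power_mono) auto
    then show ?thesis using True sR th(7) by simp
   qed (use sR in simp)
   with main REM show ?thesis by linarith
  qed
  have fin: "integrable lborel (%x. indicator (cball 0 (2 * T)) x :: real)"
   using emeasure_bounded_finite[of "cball 0 (2 * T)"] by (intro integrable_real_indicator) auto
  have "(LINT x|lborel. kp^2 / 16 * (indicator (cball 0 R) x * (cmod (v x))^2)
    - A * R^2 * (cmod (W x))^2 - E * indicator (cball 0 (2 * T)) x) <= (LINT x|lborel. g x - 2 * kp * R * g2 x)"
   using I1 I2 intV intW fin ptw by (intro integral_mono) auto
  also have "... = 0" using I1 I2 by simp
  finally have "kp^2 / 16 * IV - A * R^2 * IW - E * measure lborel (cball (0::'a) (2 * T)) <= 0"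
   unfolding integral_lincomb3[OF intV intW fin] by (simp add: IV_def IW_def)
  moreover have "E * measure lborel (cball (0::'a) (2 * T)) = \<omega> * (4 * M * R * \<eta>^2 + K1 / T^2)"
   using T by (simp add: measure_lborel_cball E_def \<omega>_def power_mult_distrib)
  ultimately show ?thesis by linarith
 qed
 have "kp^2 / 16 * IV <= A * R^2 * IW + eps" if eps: "eps > 0" for eps
 proof -
  have "((%\<eta>. \<omega> * (4 * M * R * \<eta>^2 + K1 * \<eta>^2)) \<longlongrightarrow> 0) (at_right 0)"
   by (auto intro!: tendsto_eq_intros)
  then have "\<forall>\<^sub>F \<eta> in at_right 0. \<omega> * (4 * M * R * \<eta>^2 + K1 * \<eta>^2) < eps"
   using eps order_tendstoD(2) by blast
  then have "\<forall>\<^sub>F \<eta> in at_right 0. \<eta> > (0::real) & \<omega> * (4 * M * R * \<eta>^2 + K1 * \<eta>^2) < eps"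
   using eventually_at_right_less[of "0::real"] by eventually_elim auto
  then obtain \<eta> where \<eta>: "\<eta> > 0" "\<omega> * (4 * M * R * \<eta>^2 + K1 * \<eta>^2) < eps"
   using eventually_happens'[OF trivial_limit_at_right_real] by blast
  obtain r where r: "!!x. norm x >= r ==> cmod (euler v x - \<i> * of_real (kp * norm x) * v x) <= \<eta> * norm x * norm x powr p"
   using rad[OF \<eta>(1)] by blast
  \<comment> \<open>Taking \<open>T \<ge> 1 / \<eta>\<close> gives
    \<open>K1 / T^2 \<le> K1 \<eta>^2\<close>, so the single parameter \<open>\<eta>\<close>
    controls the whole error.\<close>
  define T where "T = max (max 1 R) (max (max r0 r) (1 / \<eta>))"
  have T: "T >= 1" "T >= R" "T >= r0" "T >= r" "T >= 1 / \<eta>" by (auto simp: T_def)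
  have "kp^2 / 16 * IV <= A * R^2 * IW + \<omega> * (4 * M * R * \<eta>^2 + K1 / T^2)"
   using T r by (intro step[OF \<eta>(1)]) auto
  moreover have "K1 / T^2 <= K1 * \<eta>^2"
  proof -
   have "1 / T <= \<eta>" using T(1,5) \<eta>(1) by (simp add: field_simps)
   then have "(1 / T)^2 <= \<eta>^2" using T(1) by (intro power_mono) auto
   then show ?thesis using K1 mult_left_mono[of "(1 / T)^2" "\<eta>^2" K1] by (simp add: power_divide)
  qed
  then have "\<omega> * (4 * M * R * \<eta>^2 + K1 / T^2) <= \<omega> * (4 * M * R * \<eta>^2 + K1 * \<eta>^2)" using \<omega> by (intro mult_left_mono) auto
  ultimately show ?thesis using \<eta>(2) by linarith
 qed
 then have "kp^2 / 16 * IV <= A * R^2 * IW" by (rule field_le_epsilon)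
 then show ?thesis unfolding IV_def IW_def W_def A_def by (simp add: algebra_simps)
qed

section \<open>Square-integrable functions and their mollifications\<close>

text \<open>The squared norm of \<open>L^2(A)\<close>, with values in \<open>ennreal\<close> so that
  no integrability conditions are attached to it.\<close>

definition n2 :: "'a::euclidean_space set => ('a => complex) => ennreal" where
 "n2 A f = (\<integral>\<^sup>+x. ennreal ((cmod (f x))^2) * indicator A x \<partial>lborel)"

lemma n2_mono_set: "A \<subseteq> B ==> n2 A f <= n2 B f"
 unfolding n2_def by (intro nn_integral_mono mult_left_mono) (auto simp: indicator_def)

lemma n2_le_UNIV: "n2 A f <= n2 UNIV f"
 by (rule n2_mono_set) simp

lemma n2_cong_AE: "(AE x in lborel. x \<in> A --> f x = g x) ==> n2 A f = n2 A g"
 unfolding n2_def by (intro nn_integral_cong_AE) (auto simp: indicator_def elim!: eventually_mono)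

text \<open>The free parameter matters: as \<open>t\<close> tends to 0 the factor of
  \<open>n2 A g\<close> tends to 1, so nothing is lost in a limit.\<close>

lemma n2_add_le:
 fixes t :: real
 assumes [measurable]: "f \<in> borel_measurable borel" "g \<in> borel_measurable borel" "A \<in> sets borel" and t: "t > 0"
 shows "n2 A f <= ennreal (1 + t) * n2 A g + ennreal (1 + 1 / t) * n2 A (%x. f x - g x)"
proof -
 have *: "(cmod (f x))^2 <= (1 + t) * (cmod (g x))^2 + (1 + 1 / t) * (cmod (f x - g x))^2" for x
 proof -
  define a b where "a = cmod (g x)" and "b = cmod (f x - g x)"
  have "cmod (f x) <= a + b" unfolding a_def b_def by (metis add.commute norm_triangle_sub)
  then have "(cmod (f x))^2 <= (a + b)^2" by (intro power_mono) auto
  also have "... <= (1 + t) * a^2 + (1 + 1 / t) * b^2"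
  proof -
   have "0 <= (t * a - b)^2 / t" using t by simp
   also have "... = t * a^2 - 2 * a * b + b^2 / t" using t by (simp add: power2_eq_square field_simps)
   finally show ?thesis by (simp add: power2_sum algebra_simps)
  qed
  finally show ?thesis by (simp add: a_def b_def)
 qed
 have "n2 A f <= (\<integral>\<^sup>+x. (ennreal (1 + t) * (ennreal ((cmod (g x))^2) * indicator A x)
   + ennreal (1 + 1 / t) * (ennreal ((cmod (f x - g x))^2) * indicator A x)) \<partial>lborel)"
  unfolding n2_def
 proof (rule nn_integral_mono)
  fix x
  show "ennreal ((cmod (f x))^2) * indicator A x <= ennreal (1 + t) * (ennreal ((cmod (g x))^2) * indicator A x)
   + ennreal (1 + 1 / t) * (ennreal ((cmod (f x - g x))^2) * indicator A x)"
   using *[of x] t by (cases "x \<in> A") (auto simp: ennreal_mult[symmetric] ennreal_plus[symmetric] simp del: ennreal_plus intro!: ennreal_leI)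
 qed
 also have "... = ennreal (1 + t) * n2 A g + ennreal (1 + 1 / t) * n2 A (%x. f x - g x)"
  unfolding n2_def by (simp add: nn_integral_add nn_integral_cmult)
 finally show ?thesis .
qed

text \<open>The bound \<open>M\<close> passes to the limit unchanged, a sharpness that the
  evanescent modes require.\<close>

lemma n2_limit_le:
 assumes [measurable]: "f \<in> borel_measurable borel" "A \<in> sets borel"
  and approx: "!!\<delta>::real. \<delta> > 0 ==> \<exists>g. g \<in> borel_measurable borel & n2 A g <= M & n2 A (%x. f x - g x) <= ennreal \<delta>"
 shows "n2 A f <= M"
proof (cases "M = \<infinity>")
 case False
 then obtain m where m: "M = ennreal m" "m >= 0" by (cases M) auto
 have "n2 A f <= ennreal (m + eps)" if eps: "eps > 0" for eps :: real
 proof -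
  \<comment> \<open>\<open>t\<close> spends half of \<open>eps\<close> on the factor
    \<open>1 + t\<close>; afterwards \<open>\<delta>\<close> spends the other half against
    \<open>1 + 1 / t\<close>.\<close>
  define t where "t = eps / (2 * (m + 1))"
  have t: "t > 0" "t * m <= eps / 2" using eps m(2) by (auto simp: t_def field_simps)
  define \<delta> where "\<delta> = eps / (2 * (1 + 1 / t))"
  have w: "1 + 1 / t > 0" using t by (simp add: add_pos_pos)
  have \<delta>: "\<delta> > 0" using eps w by (simp add: \<delta>_def)
  have "w * (eps / (2 * w)) = eps / 2" if "w > 0" for w using that by simp
  note \<delta> = \<delta> this[OF w, folded \<delta>_def]
  obtain g where g[measurable]: "g \<in> borel_measurable borel" and g2: "n2 A g <= M" "n2 A (%x. f x - g x) <= ennreal \<delta>"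
   using approx[OF \<delta>(1)] by blast
  have "n2 A f <= ennreal (1 + t) * n2 A g + ennreal (1 + 1 / t) * n2 A (%x. f x - g x)"
   by (rule n2_add_le) (use t in measurable)
  also have "... <= ennreal (1 + t) * ennreal m + ennreal (1 + 1 / t) * ennreal \<delta>"
   using g2 m by (intro add_mono mult_left_mono) auto
  also have "... = ennreal ((1 + t) * m + (1 + 1 / t) * \<delta>)"
   using t m \<delta> by (simp add: ennreal_mult[symmetric] ennreal_plus[symmetric] del: ennreal_plus)
  also have "... <= ennreal (m + eps)"
   using t(2) eps unfolding \<delta>(2) by (intro ennreal_leI) (simp add: algebra_simps)
  finally show ?thesis .
 qed
 note le = this
 show ?thesis unfolding m(1)
 proof (rule ennreal_le_epsilon)
  fix e :: real assume "e > 0"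
  then show "n2 A f <= ennreal m + ennreal e" using le[of e] m(2) by (simp add: ennreal_plus)
 qed
qed simp

lemma clip_bounded_tendsto:
 fixes g :: "nat => complex"
 assumes "g \<longlonglongrightarrow> z" "cmod z <= real n" "n > 0"
 shows "(%k. (real n / max (real n) (cmod (g k))) *\<^sub>R g k) \<longlonglongrightarrow> z"
proof -
 have "(%k. (real n / max (real n) (cmod (g k))) *\<^sub>R g k) \<longlonglongrightarrow> (real n / max (real n) (cmod z)) *\<^sub>R z"
  by (intro tendsto_intros assms(1)) (use assms in auto)
 then show ?thesis using assms(2,3) by (simp add: max_def)
qed

text \<open>\<open>f\<close> is truncated in size and support. The truncation is an almost
  everywhere limit of continuous functions, and clipping those makes dominated convergence
  applicable.\<close>

lemma n2_dense:
 fixes f :: "'a::euclidean_space => complex"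
 assumes f[measurable]: "f \<in> borel_measurable borel" and fin: "n2 UNIV f < \<infinity>" and \<delta>: "\<delta> > (0::real)"
 shows "\<exists>c R. continuous_on UNIV c & (\<forall>x. norm x >= R --> c x = 0) & n2 UNIV (%x. f x - c x) <= ennreal \<delta>"
proof -
 define V where "V n x = (if norm x <= real n & cmod (f x) <= real n then f x else 0)" for n x
 have [measurable]: "V n \<in> borel_measurable borel" for n unfolding V_def by measurable
 have "(%n. \<integral>\<^sup>+x. ennreal ((cmod (f x - V n x))^2) \<partial>lborel) \<longlonglongrightarrow> (\<integral>\<^sup>+x. 0 \<partial>(lborel :: 'a measure))"
 proof (rule nn_integral_dominated_convergence[where w="%x. ennreal ((cmod (f x))^2)"])
  show "(\<integral>\<^sup>+x. ennreal ((cmod (f x))^2) \<partial>lborel) < \<infinity>" using fin by (simp add: n2_def)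
  show "AE x in lborel. (%n. ennreal ((cmod (f x - V n x))^2)) \<longlonglongrightarrow> 0"
  proof (rule AE_I2)
   fix x
   obtain N where N: "real N >= max (norm x) (cmod (f x))" using real_arch_simple by blast
   have "\<forall>\<^sub>F n in sequentially. ennreal ((cmod (f x - V n x))^2) = 0"
    unfolding eventually_sequentially by (intro exI[of _ N]) (use N in \<open>auto simp: V_def\<close>)
   then show "(%n. ennreal ((cmod (f x - V n x))^2)) \<longlonglongrightarrow> 0" by (rule tendsto_eventually)
  qed
 qed (auto simp: V_def intro!: AE_I2)
 then have "(%n. n2 UNIV (%x. f x - V n x)) \<longlonglongrightarrow> 0" by (simp add: n2_def)
 then have "\<forall>\<^sub>F n in sequentially. n2 UNIV (%x. f x - V n x) < ennreal (\<delta> / 4)"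
  by (rule order_tendstoD) (use \<delta> in simp)
 then have "\<forall>\<^sub>F n in sequentially. n2 UNIV (%x. f x - V n x) < ennreal (\<delta> / 4) & n > 0"
  using eventually_gt_at_top[of 0] by (rule eventually_conj)
 then obtain n where n: "n2 UNIV (%x. f x - V n x) < ennreal (\<delta> / 4)" "n > 0"
  using eventually_happens' sequentially_bot by blast
 have "V n \<in> borel_measurable (lebesgue_on UNIV)"
  using \<open>V n \<in> borel_measurable borel\<close> by (simp add: borel_measurable_if_D lebesgue_on_UNIV_eq measurable_completion)
 then have "V n measurable_on UNIV" using measurable_on_iff_borel_measurable[of UNIV "V n"] by simp
 then obtain N g where N: "negligible N" and g: "!!k. continuous_on UNIV (g k)"
  and lim: "!!x. x \<notin> N ==> (%k. g k x) \<longlonglongrightarrow> V n x"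
  unfolding measurable_on_def by auto
 \<comment> \<open>The outer factor is a continuous cut-off, equal to 1 where \<open>V n\<close> may
   be nonzero; the inner one projects radially onto the disc of radius \<open>n\<close>.\<close>
 define c where "c k x = max 0 (min 1 (real n + 1 - norm x)) *\<^sub>R ((real n / max (real n) (cmod (g k x))) *\<^sub>R g k x)" for k x
 have cont: "continuous_on UNIV (c k)" for k
  unfolding c_def[abs_def] by (intro continuous_intros g) (use n in auto)
 note [measurable] = borel_measurable_continuous_onI[OF cont]
 have cz: "c k x = 0" if "norm x >= real n + 1" for k x using that by (simp add: c_def)
 have cb: "cmod (c k x) <= real n" for k x
 proof -
  have "cmod (c k x) = \<bar>max 0 (min 1 (real n + 1 - norm x))\<bar> * (real n / max (real n) (cmod (g k x)) * cmod (g k x))"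
   by (simp add: c_def)
  also have "... <= 1 * real n"
   using n by (intro mult_mono) (auto simp: field_simps max_def)
  finally show ?thesis by simp
 qed
 have "(%k. \<integral>\<^sup>+x. ennreal ((cmod (V n x - c k x))^2) \<partial>lborel) \<longlonglongrightarrow> (\<integral>\<^sup>+x. 0 \<partial>(lborel :: 'a measure))"
 proof (rule nn_integral_dominated_convergence[where w="%x. ennreal ((2 * real n)^2) * indicator (cball 0 (real n + 1)) x"])
  show "(%x. ennreal ((2 * real n)^2) * indicator (cball (0::'a) (real n + 1)) x) \<in> borel_measurable lborel"
   by (intro borel_measurable_times_ennreal borel_measurable_indicator) auto
  have "emeasure lborel (cball (0::'a) (real n + 1)) < \<infinity>" by (rule emeasure_bounded_finite) simp
  then show "(\<integral>\<^sup>+x. ennreal ((2 * real n)^2) * indicator (cball (0::'a) (real n + 1)) x \<partial>lborel) < \<infinity>"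
   by (subst nn_integral_cmult_indicator) (auto simp: ennreal_mult_less_top)
  show "AE x in lborel. ennreal ((cmod (V n x - c k x))^2) <= ennreal ((2 * real n)^2) * indicator (cball 0 (real n + 1)) x" for k
  proof (rule AE_I2)
   fix x
   show "ennreal ((cmod (V n x - c k x))^2) <= ennreal ((2 * real n)^2) * indicator (cball 0 (real n + 1)) x"
   proof (cases "norm x <= real n + 1")
    case True
    have "cmod (V n x) <= real n" by (simp add: V_def)
    then have "cmod (V n x - c k x) <= 2 * real n" using cb[of k x] norm_triangle_ineq4[of "V n x" "c k x"] by linarith
    then have "(cmod (V n x - c k x))^2 <= (2 * real n)^2" by (intro power_mono) auto
    then show ?thesis using True by (simp add: ennreal_leI)
   next
    case False
    then show ?thesis using cz[of x k] by (auto simp: V_def)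
   qed
  qed
  have "N \<in> null_sets lebesgue" using N by (simp add: negligible_iff_null_sets)
  then have "AE x in lebesgue. x \<notin> N" by (rule AE_not_in)
  then have "AE x in lborel. x \<notin> N" by (simp add: AE_completion_iff)
  then show "AE x in lborel. (%k. ennreal ((cmod (V n x - c k x))^2)) \<longlonglongrightarrow> 0"
  proof eventually_elim
   fix x assume x: "x \<notin> N"
   have "(%k. (real n / max (real n) (cmod (g k x))) *\<^sub>R g k x) \<longlonglongrightarrow> V n x"
    by (rule clip_bounded_tendsto[OF lim[OF x]]) (use n in \<open>auto simp: V_def\<close>)
   then have "(%k. c k x) \<longlonglongrightarrow> max 0 (min 1 (real n + 1 - norm x)) *\<^sub>R V n x"
    unfolding c_def by (rule tendsto_scaleR[OF tendsto_const])
   moreover have "max 0 (min 1 (real n + 1 - norm x)) *\<^sub>R V n x = V n x" by (auto simp: V_def)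
   ultimately have l: "(%k. c k x) \<longlonglongrightarrow> V n x" by simp
   have "(%k. ennreal ((cmod (V n x - c k x))^2)) \<longlonglongrightarrow> ennreal ((cmod (V n x - V n x))^2)"
    by (intro tendsto_intros l)
   then show "(%k. ennreal ((cmod (V n x - c k x))^2)) \<longlonglongrightarrow> 0" by simp
  qed
 qed auto
 then have "(%k. n2 UNIV (%x. V n x - c k x)) \<longlonglongrightarrow> 0" by (simp add: n2_def)
 then have "\<forall>\<^sub>F k in sequentially. n2 UNIV (%x. V n x - c k x) < ennreal (\<delta> / 4)"
  by (rule order_tendstoD) (use \<delta> in simp)
 then obtain k where k: "n2 UNIV (%x. V n x - c k x) < ennreal (\<delta> / 4)"
  using eventually_happens' sequentially_bot by blast
 have "n2 UNIV (%x. f x - c k x) <= ennreal (1 + 1) * n2 UNIV (%x. f x - V n x)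
   + ennreal (1 + 1 / 1) * n2 UNIV (%x. (f x - c k x) - (f x - V n x))"
  by (rule n2_add_le) auto
 also have "(%x. (f x - c k x) - (f x - V n x)) = (%x. V n x - c k x)" by (simp add: fun_eq_iff)
 also have "ennreal (1 + 1) * n2 UNIV (%x. f x - V n x) + ennreal (1 + 1 / 1) * n2 UNIV (%x. V n x - c k x)
   <= ennreal 2 * ennreal (\<delta> / 4) + ennreal 2 * ennreal (\<delta> / 4)"
  using n(1) k by (intro add_mono mult_mono) auto
 also have "ennreal 2 * ennreal (\<delta> / 4) = ennreal (\<delta> / 2)"
  by (subst ennreal_mult[symmetric]) (use \<delta> in auto)
 also have "ennreal (\<delta> / 2) + ennreal (\<delta> / 2) = ennreal \<delta>"
  by (subst ennreal_plus[symmetric]) (use \<delta> in auto)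
 finally have "n2 UNIV (%x. f x - c k x) <= ennreal \<delta>" .
 then show ?thesis by (intro exI[of _ "c k"] exI[of _ "real n + 1"]) (use cont cz in simp)
qed

section \<open>Convolution with probability densities and mollifiers\<close>

lemma lborel_distr_reflect: "distr lborel borel (%y. x - y) = (lborel :: 'a::euclidean_space measure)"
 using lborel_affine[of "-1" x] by (simp add: density_1)

lemma nn_integral_reflect:
 fixes f :: "'a::euclidean_space => ennreal"
 assumes "f \<in> borel_measurable borel"
 shows "(\<integral>\<^sup>+y. f (x - y) \<partial>lborel) = (\<integral>\<^sup>+y. f y \<partial>lborel)"
 using nn_integral_distr[of "%y. x - y" lborel borel f] assms by (simp add: lborel_distr_reflect)

lemma nn_integral_translate:
 fixes f :: "'a::euclidean_space => ennreal"
 assumes "f \<in> borel_measurable borel"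
 shows "(\<integral>\<^sup>+y. f (x + y) \<partial>lborel) = (\<integral>\<^sup>+y. f y \<partial>lborel)"
 using nn_integral_distr[of "(+) x" lborel borel f] assms by (simp add: lborel_distr_plus)

text \<open>Young's inequality with constant 1: Cauchy-Schwarz for \<open>U sqrt k\<close> and
  \<open>sqrt k\<close>, followed by Tonelli.\<close>

lemma n2_conv_le:
 fixes U :: "'a::euclidean_space => complex" and k :: "'a => real"
 assumes U[measurable]: "U \<in> borel_measurable borel" and k[measurable]: "k \<in> borel_measurable borel"
  and k0: "!!x. k x >= 0" and k1: "(\<integral>\<^sup>+x. ennreal (k x) \<partial>lborel) = 1"
 shows "n2 UNIV (conv U (%x. complex_of_real (k x))) <= n2 UNIV U"
proof -
 have pt: "ennreal ((cmod (conv U (%x. complex_of_real (k x)) x))^2) <= (\<integral>\<^sup>+y. ennreal ((cmod (U y))^2 * k (x - y)) \<partial>lborel)" for x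
 proof (cases "integrable lborel (%y. U y * complex_of_real (k (x - y)))")
  case True
  have "ennreal (cmod (conv U (%x. complex_of_real (k x)) x)) <= (\<integral>\<^sup>+y. ennreal (cmod (U y * complex_of_real (k (x - y)))) \<partial>lborel)"
   unfolding conv_def by (rule integral_norm_bound_ennreal[OF True])
  also have "... = (\<integral>\<^sup>+y. ennreal (cmod (U y) * sqrt (k (x - y))) * ennreal (sqrt (k (x - y))) \<partial>lborel)"
   using k0 by (intro nn_integral_cong) (simp add: norm_mult ennreal_mult[symmetric] mult.assoc)
  finally have "(ennreal (cmod (conv U (%x. complex_of_real (k x)) x)))^2
    <= (\<integral>\<^sup>+y. ennreal (cmod (U y) * sqrt (k (x - y))) * ennreal (sqrt (k (x - y))) \<partial>lborel)^2"
   by (rule power_mono) simp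
  also have "... <= (\<integral>\<^sup>+y. (ennreal (cmod (U y) * sqrt (k (x - y))))^2 \<partial>lborel) * (\<integral>\<^sup>+y. (ennreal (sqrt (k (x - y))))^2 \<partial>lborel)"
   by (rule Cauchy_Schwarz_nn_integral) measurable
  also have "(\<integral>\<^sup>+y. (ennreal (sqrt (k (x - y))))^2 \<partial>lborel) = (\<integral>\<^sup>+y. ennreal (k (x - y)) \<partial>lborel)"
   using k0 by (intro nn_integral_cong) (simp add: ennreal_power)
  also have "... = 1" using nn_integral_reflect[of "%z. ennreal (k z)" x] k1 by simp
  also have "(\<integral>\<^sup>+y. (ennreal (cmod (U y) * sqrt (k (x - y))))^2 \<partial>lborel) = (\<integral>\<^sup>+y. ennreal ((cmod (U y))^2 * k (x - y)) \<partial>lborel)"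
   using k0 by (intro nn_integral_cong) (simp add: ennreal_power power_mult_distrib)
  finally show ?thesis by (simp add: ennreal_power)
 \<comment> \<open>Without integrability the convolution has the default value zero.\<close>
 qed (simp add: conv_def not_integrable_integral_eq)
 have "n2 UNIV (conv U (%x. complex_of_real (k x))) <= (\<integral>\<^sup>+x. (\<integral>\<^sup>+y. ennreal ((cmod (U y))^2 * k (x - y)) \<partial>lborel) \<partial>lborel)"
  unfolding n2_def by (intro nn_integral_mono) (use pt in simp)
 also have "... = (\<integral>\<^sup>+y. (\<integral>\<^sup>+x. ennreal ((cmod (U y))^2 * k (x - y)) \<partial>lborel) \<partial>lborel)"
  by (rule lborel_pair.Fubini'[symmetric]) measurable
 also have "... = (\<integral>\<^sup>+y. ennreal ((cmod (U y))^2) \<partial>lborel)"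
 proof (rule nn_integral_cong)
  fix y
  have "(\<integral>\<^sup>+x. ennreal ((cmod (U y))^2 * k (x - y)) \<partial>lborel) = ennreal ((cmod (U y))^2) * (\<integral>\<^sup>+x. ennreal (k (- y + x)) \<partial>lborel)"
   using k0 by (subst nn_integral_cmult[symmetric]) (auto simp: ennreal_mult intro!: nn_integral_cong)
  also have "(\<integral>\<^sup>+x. ennreal (k (- y + x)) \<partial>lborel) = 1"
   using nn_integral_translate[of "%z. ennreal (k z)" "- y"] k1 by simp
  finally show "(\<integral>\<^sup>+x. ennreal ((cmod (U y))^2 * k (x - y)) \<partial>lborel) = ennreal ((cmod (U y))^2)" by simp
 qed
 finally show ?thesis by (simp add: n2_def)
qed

lemma ex_mollifier:
 assumes "eps > (0::real)"
 shows "\<exists>Q. smooth_real Q & (\<forall>s. Q s >= 0) & (\<forall>s\<ge>eps^2. Q s = 0) &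
  (\<integral>\<^sup>+x. ennreal (Q ((norm (x::'a::euclidean_space))^2)) \<partial>lborel) = 1"
proof -
 define Q0 where "Q0 s = smooth_step (1 + (- 1 / eps^2) * s)" for s
 have Q0: "smooth_real Q0" unfolding Q0_def[abs_def] by (rule smooth_real_affine[OF smooth_real_smooth_step])
 have z: "Q0 s = 0" if "s >= eps^2" for s
  unfolding Q0_def using that assms by (intro smooth_step_0) (simp add: field_simps)
 have nn: "Q0 s >= 0" for s by (simp add: Q0_def smooth_step_bounds)
 let ?f = "%x::'a. Q0 ((norm x)^2)"
 have cont: "continuous_on UNIV ?f"
  by (intro continuous_on_compose2[OF smooth_real_continuous[OF Q0, of UNIV]] continuous_intros) auto
 have "?f x = 0" if "norm x >= eps" for x
  by (rule z, rule power_mono) (use that assms in auto)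
 then have int: "integrable lborel ?f" by (rule integrable_compact_support[OF cont])
 define c where "c = (LINT x|lborel. ?f x)"
 have "c ~= 0"
 proof
  assume "c = 0"
  then have "AE x in lborel. ?f x = 0"
   using integral_nonneg_eq_0_iff_AE[OF int] nn by (simp add: c_def)
  moreover have "{x. ?f x ~= 0} \<in> sets lborel"
   using borel_measurable_continuous_onI[OF cont] by measurable
  ultimately have "emeasure lborel {x. ?f x ~= 0} = 0"
   by (subst (asm) AE_iff_measurable[OF _ refl]) auto
  moreover have "open {x. ?f x ~= 0}" using open_Collect_neq[OF cont continuous_on_const] by simp
  ultimately have "{x. ?f x ~= 0} = {}" using open_not_negligible negligible_iff_null_sets null_sets_completionI
   by (metis null_setsI sets_lborel borel_open)
  then have "?f 0 = 0" by blast
  then show False by (simp add: Q0_def smooth_step_1)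
 qed
 moreover have "c >= 0" unfolding c_def by (rule integral_nonneg_AE) (use nn in auto)
 ultimately have c: "c > 0" by simp
 have k: "smooth_real (%_. 1 / c)"
  unfolding smooth_real_def by (intro exI[of _ "%n t. if n = 0 then 1 / c else 0"]) auto
 show ?thesis
 proof (intro exI[of _ "%s. (1 / c) * Q0 s"] conjI allI impI)
  show "smooth_real (%s. (1 / c) * Q0 s)" by (rule smooth_real_mult[OF k Q0])
  have "(\<integral>\<^sup>+x. ennreal ((1 / c) * ?f x) \<partial>lborel) = ennreal (LINT x|lborel. (1 / c) * ?f x)"
   using int nn c by (intro nn_integral_eq_integral integrable_mult_right) auto
  also have "... = 1" using c by (simp add: c_def)
  finally show "(\<integral>\<^sup>+x. ennreal ((1 / c) * ?f x) \<partial>lborel) = 1" .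
 qed (use nn z c in auto)
qed

text \<open>The type argument is there because the normalisation depends on the dimension.\<close>

definition moll_profile :: "'a::euclidean_space itself => real => real => real" where
 "moll_profile T eps = (SOME Q. smooth_real Q & (\<forall>s. Q s >= 0) & (\<forall>s\<ge>eps^2. Q s = 0) &
  (\<integral>\<^sup>+x. ennreal (Q ((norm (x::'a::euclidean_space))^2)) \<partial>lborel) = 1)"

definition moll :: "real => 'a::euclidean_space => complex" where
 "moll eps = radial (moll_profile TYPE('a) eps)"

lemma moll_profile:
 assumes "eps > 0"
 shows "smooth_real (moll_profile TYPE('a::euclidean_space) eps)" "moll_profile TYPE('a) eps s >= 0"
  "s >= eps^2 ==> moll_profile TYPE('a) eps s = 0"
  "(\<integral>\<^sup>+x. ennreal (moll_profile TYPE('a) eps ((norm (x::'a))^2)) \<partial>lborel) = 1"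
 using someI_ex[OF ex_mollifier[OF assms, where 'a='a]] unfolding moll_profile_def by auto

lemma moll_outside: "eps > 0 ==> norm x >= eps ==> moll eps x = 0"
 unfolding moll_def radial_def by (subst moll_profile) (auto intro!: power_mono)

lemma test_function_moll: "eps > 0 ==> test_function UNIV (moll eps)"
 by (rule test_function_UNIVI[where R=eps, OF _ moll_outside]) (auto simp: moll_def intro!: smooth_radial moll_profile)

lemma n2_conv_moll_le:
 fixes U :: "'a::euclidean_space => complex"
 assumes "U \<in> borel_measurable borel" "eps > 0"
 shows "n2 UNIV (conv U (moll eps)) <= n2 UNIV U"
 unfolding moll_def radial_def[abs_def]
proof (rule n2_conv_le[OF assms(1)])
 have "continuous_on UNIV (%x::'a. moll_profile TYPE('a) eps ((norm x)^2))"
  by (intro continuous_on_compose2[OF smooth_real_continuous[OF moll_profile(1)[OF assms(2)], of UNIV]] continuous_intros) auto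
 then show "(%x::'a. moll_profile TYPE('a) eps ((norm x)^2)) \<in> borel_measurable borel"
  by (rule borel_measurable_continuous_onI)
qed (use moll_profile[OF assms(2)] in auto)

text \<open>For a radial kernel the mixed derivative is \<open>2 Q1 (c . b) + 4 Q2 x_c x_b\<close>,
  visibly symmetric. The symmetry hypotheses for mollified modes are discharged from here.\<close>

lemma moll_sym:
 assumes "eps > 0"
 shows "pd c (pd b (moll eps)) (x::'a::euclidean_space) = pd b (pd c (moll eps)) x"
proof -
 obtain Q1 where Q1: "smooth_real Q1" "!!t. (moll_profile TYPE('a) eps has_real_derivative Q1 t) (at t)"
  using smooth_realE moll_profile(1)[OF assms] by metis
 obtain Q2 where Q2: "smooth_real Q2" "!!t. (Q1 has_real_derivative Q2 t) (at t)"
  using smooth_realE Q1(1) by metis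
 have 1: "pd b (moll eps) = (%x::'a. 2 * radial Q1 x * complex_of_real (x \<bullet> b))" for b
  unfolding moll_def by (rule ext, rule pd_radial[OF Q1(2)])
 have leaf: "has_pd c (radial Q1) x (2 * radial Q2 x * complex_of_real (x \<bullet> c))" for c
  by (simp add: has_pd_def pd_radial[OF Q2(2)] smooth_differentiable smooth_radial Q1(1))
 have eq: "pd c (%x. 2 * radial Q1 x * complex_of_real (x \<bullet> b)) x
   = 2 * radial Q1 x * of_real (c \<bullet> b) + 4 * radial Q2 x * complex_of_real (x \<bullet> c) * complex_of_real (x \<bullet> b)" for b c
  by (rule has_pdD, (rule leaf has_pd_intros)+) (simp add: algebra_simps)
 show ?thesis unfolding 1 eq by (simp add: inner_commute mult_ac)
qed

lemma integrable_moll: "eps > 0 ==> integrable lborel (moll eps :: 'a::euclidean_space => complex)"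
 using test_function_integrable test_function_moll by blast

lemma integral_moll_reflect:
 assumes "eps > 0"
 shows "integrable lborel (%y. moll eps (x - y :: 'a::euclidean_space))" "(LINT y|lborel. moll eps (x - y :: 'a)) = 1"
  "(\<integral>\<^sup>+y. ennreal (cmod (moll eps (x - y :: 'a))) \<partial>lborel) = 1"
proof -
 note [measurable] = borel_measurable_continuous_onI[OF test_function_continuous[OF test_function_moll[OF assms, where 'a='a]]]
 have i: "integrable (distr lborel borel (%y. x - y)) (moll eps :: 'a => complex)"
  using integrable_moll[OF assms] by (simp add: lborel_distr_reflect)
 show "integrable lborel (%y. moll eps (x - y :: 'a))"
  using integrable_distr_eq[of "%y. x - y" lborel borel "moll eps :: 'a => complex"] i by simp
 have nn: "(\<integral>\<^sup>+y. ennreal (cmod (moll eps (y :: 'a))) \<partial>lborel) = 1"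
  using moll_profile(2,4)[OF assms, where 'a='a] by (simp add: moll_def radial_def)
 then show "(\<integral>\<^sup>+y. ennreal (cmod (moll eps (x - y :: 'a))) \<partial>lborel) = 1"
  using nn_integral_reflect[of "%y. ennreal (cmod (moll eps (y :: 'a)))" x] by simp
 have "(LINT y|lborel. cmod (moll eps (y :: 'a))) = 1"
  using nn by (subst integral_eq_nn_integral) auto
 then have 1: "(LINT y|lborel. complex_of_real (cmod (moll eps (y :: 'a)))) = 1" by simp
 have 2: "complex_of_real (cmod (moll eps (y :: 'a))) = moll eps y" for y
  using moll_profile(2)[OF assms, where 'a='a] by (simp add: moll_def radial_def)
 have 3: "(LINT y|lborel. moll eps (y :: 'a)) = 1" using 1 unfolding 2 .
 have "(LINT y|lborel. moll eps (x - y :: 'a)) = integral\<^sup>L (distr lborel borel (%y. x - y)) (moll eps)"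
  by (rule integral_distr[symmetric]) auto
 then show "(LINT y|lborel. moll eps (x - y :: 'a)) = 1" using 3 by (simp add: lborel_distr_reflect)
qed

lemma loc_int_continuous: "continuous_on UNIV c ==> loc_int c"
 unfolding loc_int_def set_integrable_def
 by (auto intro!: borel_measurable_continuous_onI borel_integrable_compact intro: continuous_on_subset)

lemma integrable_conv_moll:
 fixes x :: "'a::euclidean_space"
 assumes "loc_int U" "eps > 0"
 shows "integrable lborel (%y. U y * moll eps (x - y))"
 by (rule integrable_loc_int_test[OF assms(1) test_function_continuous[OF test_function_moll[OF assms(2)]], of eps])
   (simp add: moll_outside assms)

lemma conv_moll_diff:
 assumes "loc_int U" "loc_int V" "eps > 0"
 shows "conv (%y. U y - V y) (moll eps) x = conv U (moll eps) x - conv V (moll eps) x"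
 unfolding conv_def using integrable_conv_moll[OF assms(1,3)] integrable_conv_moll[OF assms(2,3)]
 by (simp add: left_diff_distrib)

lemma borel_measurable_conv_moll: "loc_int U ==> eps > 0 ==> conv U (moll eps) \<in> borel_measurable borel"
 by (intro borel_measurable_continuous_onI smooth_continuous smooth_conv test_function_moll)

lemma conv_moll_outside:
 assumes "!!y. norm y >= R ==> U y = 0" "eps > 0" "norm x >= R + eps"
 shows "conv U (moll eps) x = 0"
proof -
 have z: "U y * moll eps (x - y) = 0" for y
 proof (cases "norm y >= R")
  case False
  have "norm x <= norm y + norm (x - y)" by (metis norm_triangle_sub)
  then have "norm (x - y) >= eps" using False assms(3) by linarith
  then show ?thesis by (simp add: moll_outside[OF assms(2)])
 qed (use assms(1) in simp)
 show ?thesis unfolding conv_def z by simp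
qed

text \<open>Uniform continuity bounds the difference by \<open>\<eta>\<close> on a ball of measure
  \<open>m\<close> containing all supports, and \<open>\<eta>\<close> is chosen with
  \<open>\<eta>^2 m \<le> \<delta>\<close>.\<close>

lemma n2_moll_tendsto_continuous:
 fixes c :: "'a::euclidean_space => complex"
 assumes cont: "continuous_on UNIV c" and supp: "!!x. norm x >= R ==> c x = 0" and \<delta>: "\<delta> > (0::real)"
 shows "\<exists>eps0>0. \<forall>eps. 0 < eps --> eps <= eps0 --> n2 UNIV (%x. c x - conv c (moll eps) x) <= ennreal \<delta>"
proof -
 define m where "m = measure lborel (cball (0::'a) (R + 1))"
 have m: "m >= 0" by (simp add: m_def)
 define \<eta> where "\<eta> = sqrt (\<delta> / (m + 1))"
 have \<eta>: "\<eta> > 0" "\<eta>^2 * m <= \<delta>" using \<delta> m by (auto simp: \<eta>_def field_simps)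
 have "uniformly_continuous_on (cball 0 (R + 2)) c"
  by (intro compact_uniformly_continuous continuous_on_subset[OF cont]) auto
 then obtain d where d: "d > 0" "!!x y. x \<in> cball 0 (R + 2) ==> y \<in> cball 0 (R + 2) ==> dist x y < d ==> dist (c x) (c y) < \<eta>"
  unfolding uniformly_continuous_on_def using \<eta>(1) by (metis dist_commute)
 show ?thesis
 proof (intro exI[of _ "min (d / 2) 1"] conjI allI impI)
  show "0 < min (d / 2) 1" using d by simp
  fix eps :: real assume eps: "0 < eps" "eps <= min (d / 2) 1"
  have pt: "cmod (c x - conv c (moll eps) x) <= \<eta> * indicator (cball 0 (R + 1)) x" for x
  proof (cases "norm x <= R + 1")
   case False
   then have "conv c (moll eps) x = 0" using eps by (intro conv_moll_outside[OF supp]) auto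
   then show ?thesis using False supp by simp
  next
   case True
   have "c x - conv c (moll eps) x = (LINT y|lborel. c x * moll eps (x - y)) - (LINT y|lborel. c y * moll eps (x - y))"
    using integral_moll_reflect[OF eps(1), of x] by (simp add: conv_def)
   also have "... = (LINT y|lborel. (c x - c y) * moll eps (x - y))"
    using integral_moll_reflect(1)[OF eps(1), of x] integrable_conv_moll[OF loc_int_continuous[OF cont] eps(1), of x]
    by (simp add: left_diff_distrib)
   finally have eq: "c x - conv c (moll eps) x = (LINT y|lborel. (c x - c y) * moll eps (x - y))" .
   have I: "integrable lborel (%y. (c x - c y) * moll eps (x - y))"
    unfolding left_diff_distrib using integral_moll_reflect(1)[OF eps(1), of x] integrable_conv_moll[OF loc_int_continuous[OF cont] eps(1), of x]
    by (intro Bochner_Integration.integrable_diff integrable_mult_right)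
   have "cmod (LINT y|lborel. (c x - c y) * moll eps (x - y)) <= (LINT y|lborel. \<eta> * cmod (moll eps (x - y)))"
   proof (rule Bochner_Integration.integral_norm_bound_integral[OF I])
    show "integrable lborel (%y. \<eta> * cmod (moll eps (x - y)))"
     by (intro integrable_mult_right integrable_norm integral_moll_reflect eps)
    fix y
    show "cmod ((c x - c y) * moll eps (x - y)) <= \<eta> * cmod (moll eps (x - y))"
    proof (cases "norm (x - y) >= eps")
     case False
     have "norm y <= norm x + norm (x - y)" by (metis norm_minus_commute norm_triangle_sub)
     then have "norm y <= R + 2" "dist x y < d" using False eps True d(1) by (auto simp: dist_norm)
     then have "dist (c x) (c y) < \<eta>" using True by (intro d(2)) auto
     then show ?thesis by (simp add: norm_mult dist_norm mult_right_mono)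
    qed (simp add: moll_outside eps)
   qed
   also have "... = \<eta> * (LINT y|lborel. cmod (moll eps (x - y)))" by simp
   also have "(LINT y|lborel. cmod (moll eps (x - y))) = 1"
    using integral_moll_reflect(3)[OF eps(1), of x] integral_moll_reflect(1)[OF eps(1), of x]
    by (subst integral_eq_nn_integral) auto
   finally show ?thesis using True eq by simp
  qed
  have "n2 UNIV (%x. c x - conv c (moll eps) x) <= (\<integral>\<^sup>+x. ennreal (\<eta>^2) * indicator (cball (0::'a) (R + 1)) x \<partial>lborel)"
   unfolding n2_def
  proof (rule nn_integral_mono)
   fix x
   have "(cmod (c x - conv c (moll eps) x))^2 <= (\<eta> * indicator (cball 0 (R + 1)) x)^2"
    using pt[of x] by (intro power_mono) auto
   also have "... = \<eta>^2 * indicator (cball 0 (R + 1)) x" by (simp add: indicator_def)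
   finally have "ennreal ((cmod (c x - conv c (moll eps) x))^2) <= ennreal (\<eta>^2 * indicator (cball 0 (R + 1)) x)"
    by (rule ennreal_leI)
   then show "ennreal ((cmod (c x - conv c (moll eps) x))^2) * indicator UNIV x <= ennreal (\<eta>^2) * indicator (cball 0 (R + 1)) x"
    by (simp add: ennreal_mult ennreal_indicator)
  qed
  also have "... = ennreal (\<eta>^2) * emeasure lborel (cball (0::'a) (R + 1))"
   by (rule nn_integral_cmult_indicator) simp
  also have "emeasure lborel (cball (0::'a) (R + 1)) = ennreal m"
   unfolding m_def using emeasure_bounded_finite[of "cball (0::'a) (R + 1)"]
   by (intro emeasure_eq_ennreal_measure) auto
  also have "ennreal (\<eta>^2) * ennreal m <= ennreal \<delta>"
   using \<eta>(2) m by (simp add: ennreal_mult[symmetric] ennreal_leI)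
  finally show "n2 UNIV (%x. c x - conv c (moll eps) x) <= ennreal \<delta>" .
 qed
qed

text \<open>Density of continuous functions combined with the contraction property of mollification.
  Splitting twice with \<open>t = 1\<close> multiplies \<open>\<delta> / 12\<close> by
  \<open>2 + 2 (2 + 2) = 10\<close>.\<close>

lemma n2_moll_tendsto:
 fixes U :: "'a::euclidean_space => complex"
 assumes U: "loc_int U" and fin: "n2 UNIV U < \<infinity>" and \<delta>: "\<delta> > (0::real)"
 shows "\<exists>eps0>0. \<forall>eps. 0 < eps --> eps <= eps0 --> n2 UNIV (%x. U x - conv U (moll eps) x) <= ennreal \<delta>"
proof -
 note Um[measurable] = loc_int_measurable[OF U]
 obtain c R where c: "continuous_on UNIV c" "!!x. norm x >= R ==> c x = 0" "n2 UNIV (%x. U x - c x) <= ennreal (\<delta> / 12)"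
  using n2_dense[OF Um fin, of "\<delta> / 12"] \<delta> by auto
 note lc = loc_int_continuous[OF c(1)]
 note cm[measurable] = loc_int_measurable[OF lc]
 obtain eps0 where eps0: "eps0 > 0" "!!eps. 0 < eps ==> eps <= eps0 ==> n2 UNIV (%x. c x - conv c (moll eps) x) <= ennreal (\<delta> / 12)"
  using n2_moll_tendsto_continuous[OF c(1,2), of R "\<delta> / 12"] \<delta> by auto
 show ?thesis
 proof (intro exI[of _ eps0] conjI allI impI eps0(1))
  fix eps assume eps: "0 < eps" "eps <= eps0"
  note [measurable] = borel_measurable_conv_moll[OF U eps(1)] borel_measurable_conv_moll[OF lc eps(1)]
  let ?Ue = "conv U (moll eps)" and ?ce = "conv c (moll eps)"
  have one: "ennreal (1 + 1) = 2" "ennreal (1 + 1 / 1) = 2" by simp_all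
  have "n2 UNIV (%x. U x - ?Ue x) <= 2 * n2 UNIV (%x. U x - c x) + 2 * n2 UNIV (%x. c x - ?Ue x)"
   using n2_add_le[of "%x. U x - ?Ue x" "%x. U x - c x" UNIV 1] by (simp add: one)
  also have "n2 UNIV (%x. c x - ?Ue x) <= 2 * n2 UNIV (%x. c x - ?ce x) + 2 * n2 UNIV (%x. ?ce x - ?Ue x)"
   using n2_add_le[of "%x. c x - ?Ue x" "%x. c x - ?ce x" UNIV 1] by (simp add: one)
  also have "n2 UNIV (%x. ?ce x - ?Ue x) = n2 UNIV (conv (%x. c x - U x) (moll eps))"
   by (simp add: conv_moll_diff[OF lc U eps(1)] fun_eq_iff[symmetric] n2_def)
  also have "... <= n2 UNIV (%x. c x - U x)"
   by (rule n2_conv_moll_le) (use eps in measurable)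
  also have "... = n2 UNIV (%x. U x - c x)" by (simp add: n2_def norm_minus_commute)
  finally have "n2 UNIV (%x. U x - ?Ue x) <= 2 * n2 UNIV (%x. U x - c x)
    + 2 * (2 * n2 UNIV (%x. c x - ?ce x) + 2 * n2 UNIV (%x. U x - c x))"
   by (meson add_left_mono mult_left_mono order_trans zero_le)
  also have "... <= 2 * ennreal (\<delta> / 12) + 2 * (2 * ennreal (\<delta> / 12) + 2 * ennreal (\<delta> / 12))"
   by (intro add_mono mult_left_mono c eps0 eps) auto
  also have "... = ennreal (2 * (\<delta> / 12) + 2 * (2 * (\<delta> / 12) + 2 * (\<delta> / 12)))"
  proof -
   have two: "2 * ennreal a = ennreal (2 * a)" if "a >= 0" for a using ennreal_mult[of 2 a] that by simp
   define a where "a = \<delta> / 12"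
   have a: "a >= 0" using \<delta> by (simp add: a_def)
   have "2 * ennreal a + 2 * (2 * ennreal a + 2 * ennreal a) = ennreal (2 * a + 2 * (2 * a + 2 * a))"
    using a two[of a] two[of "2 * a + 2 * a"] by (simp only: ennreal_plus[symmetric] mult_nonneg_nonneg add_nonneg_nonneg zero_le_numeral)
   then show ?thesis by (simp add: a_def)
  qed
  also have "... <= ennreal \<delta>" using \<delta> by (intro ennreal_leI) simp
  finally show "n2 UNIV (%x. U x - ?Ue x) <= ennreal \<delta>" .
 qed
qed

text \<open>The device that carries estimates from mollified to weak solutions: a bound uniform in
  small \<open>eps\<close> is inherited with the same constant.\<close>

lemma n2_moll_limit:
 fixes U :: "'a::euclidean_space => complex"
 assumes U: "loc_int U" and fin: "n2 UNIV U < \<infinity>" and A: "A \<in> sets borel" and eps1: "eps1 > 0"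
  and M: "!!eps. 0 < eps ==> eps <= eps1 ==> n2 A (conv U (moll eps)) <= M"
 shows "n2 A U <= M"
proof (rule n2_limit_le[OF loc_int_measurable[OF U] A])
 fix \<delta> :: real assume "\<delta> > 0"
 then obtain eps0 where eps0: "eps0 > 0" "!!eps. 0 < eps ==> eps <= eps0 ==> n2 UNIV (%x. U x - conv U (moll eps) x) <= ennreal \<delta>"
  using n2_moll_tendsto[OF U fin] by blast
 define eps where "eps = min eps0 eps1"
 have eps: "eps > 0" "eps <= eps0" "eps <= eps1" using eps0 eps1 by (auto simp: eps_def)
 show "\<exists>g. g \<in> borel_measurable borel & n2 A g <= M & n2 A (%x. U x - g x) <= ennreal \<delta>"
  using M[OF eps(1,3)] eps0(2)[OF eps(1,2)] n2_le_UNIV order_trans borel_measurable_conv_moll[OF U eps(1)] by metis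
qed

text \<open>Propagating modes are square integrable only locally. Cutting \<open>U\<close> off
  outside radius \<open>r + 1\<close> leaves its mollifications on \<open>A\<close> unchanged once
  \<open>eps \<le> 1\<close>.\<close>

lemma n2_moll_limit_local:
 fixes U :: "'a::euclidean_space => complex"
 assumes U: "loc_int U" and fin: "n2 (cball 0 (r + 1)) U < \<infinity>" and A: "A \<in> sets borel" "A \<subseteq> cball 0 r" and eps1: "eps1 > 0"
  and M: "!!eps. 0 < eps ==> eps <= eps1 ==> n2 A (conv U (moll eps)) <= M"
 shows "n2 A U <= M"
proof -
 define V where "V = (%x. indicator (cball 0 (r + 1)) x *\<^sub>R U x)"
 have [measurable]: "U \<in> borel_measurable borel" using U by (rule loc_int_measurable)
 have V: "loc_int V"
  unfolding loc_int_def
 proof (intro conjI allI)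
  show "V \<in> borel_measurable borel"
   unfolding V_def by (intro borel_measurable_scaleR borel_measurable_indicator loc_int_measurable[OF U]) auto
  fix R
  have "set_integrable lborel (cball 0 (r + 1) \<inter> cball 0 R) U"
   by (rule set_integrable_subset[of _ "cball 0 R"]) (use U in \<open>auto simp: loc_int_def\<close>)
  then show "set_integrable lborel (cball 0 R) V"
   by (simp add: set_integrable_def V_def indicator_inter_arith mult.commute)
 qed
 have VU: "n2 A V = n2 A U"
  by (rule n2_cong_AE, rule AE_I2) (use A(2) in \<open>auto simp: V_def\<close>)
 have nV: "n2 UNIV V = n2 (cball 0 (r + 1)) U"
  unfolding n2_def by (intro nn_integral_cong) (simp add: V_def indicator_def)
 have "n2 A V <= M"
 proof (rule n2_moll_limit[OF V _ A(1), of "min eps1 1"])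
  show "n2 UNIV V < \<infinity>" using fin nV by simp
  show "min eps1 1 > 0" using eps1 by simp
  fix eps assume eps: "0 < eps" "eps <= min eps1 1"
  have "conv V (moll eps) x = conv U (moll eps) x" if "x \<in> A" for x
  proof -
   have e: "V y * moll eps (x - y) = U y * moll eps (x - y)" for y
   proof (cases "norm (x - y) >= eps")
    case False
    have "norm y <= norm x + norm (x - y)" by (metis norm_minus_commute norm_triangle_sub)
    then have "y \<in> cball 0 (r + 1)" using False eps that A(2) by fastforce
    then show ?thesis by (simp add: V_def)
   qed (simp add: moll_outside eps)
   show ?thesis unfolding conv_def e ..
  qed
  then have "n2 A (conv V (moll eps)) = n2 A (conv U (moll eps))"
   by (intro n2_cong_AE AE_I2) auto
  then show "n2 A (conv V (moll eps)) <= M" using M[of eps] eps by simp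
 qed
 then show ?thesis using VU by simp
qed

section \<open>Very weak solutions of the Helmholtz equation\<close>

text \<open>All derivatives fall on the test function, so local integrability is enough for both
  functions. The sign convention is that of \<open>(\<Delta> + \<mu>) U = - F\<close>.\<close>

definition weak_helm :: "real => ('a::euclidean_space => complex) => ('a => complex) => bool" where
 "weak_helm \<mu> U F \<longleftrightarrow> loc_int U & loc_int F & (\<forall>zt. test_function UNIV zt -->
   (LINT y|lborel. U y * (lap zt y + of_real \<mu> * zt y)) = - (LINT y|lborel. F y * zt y))"

lemma conv_moll_sym:
 assumes "loc_int U" "eps > 0" "b \<in> Basis" "c \<in> Basis"
 shows "pd c (pd b (conv U (moll eps))) x = pd b (pd c (conv U (moll eps))) x"
 using assms by (simp add: pd_conv test_function_moll test_function_pd conv_def moll_sym)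

text \<open>Testing with the reflected kernel \<open>y \<mapsto> moll eps (x - y)\<close> turns the
  weak equation into a pointwise one at \<open>x\<close>.\<close>

lemma conv_moll_pde:
 fixes U F :: "'a::euclidean_space => complex"
 assumes w: "weak_helm \<mu> U F" and eps: "eps > 0"
 shows "lap (conv U (moll eps)) x + of_real \<mu> * conv U (moll eps) x = - conv F (moll eps) x"
proof -
 have U: "loc_int U" using w by (simp add: weak_helm_def)
 let ?K = "moll eps :: 'a => complex"
 note K = test_function_moll[OF eps, where 'a='a]
 define zt where "zt = (%y. ?K (x + (-1) *\<^sub>R y))"
 have sm: "smooth ?K" using K by (rule test_function_smooth)
 have "smooth zt" unfolding zt_def by (rule smooth_affine[OF sm])
 moreover have "zt y = 0" if "norm y >= norm x + eps" for y
 proof -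
  have "norm y <= norm x + norm (x - y)" by (metis norm_minus_commute norm_triangle_sub)
  then show ?thesis using that by (simp add: zt_def moll_outside eps)
 qed
 ultimately have zt: "test_function UNIV zt" by (rule test_function_UNIVI)
 have lapz: "lap zt y = lap ?K (x - y)" for y
 proof -
  have "pd b (pd b zt) y = pd b (pd b ?K) (x - y)" if b: "b \<in> Basis" for b
  proof -
   have 1: "pd b zt = (%y. - pd b ?K (x + (-1) *\<^sub>R y))"
    unfolding zt_def by (rule ext) (subst pd_affine[OF sm], simp)
   have "pd b (%y. - pd b ?K (x + (-1) *\<^sub>R y)) y = - pd b (%y. pd b ?K (x + (-1) *\<^sub>R y)) y"
    by (rule pd_minus) (intro smooth_differentiable smooth_affine smooth_pd sm b)
   also have "... = pd b (pd b ?K) (x + (-1) *\<^sub>R y)"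
    by (subst pd_affine[OF smooth_pd[OF sm b]]) simp
   finally show ?thesis unfolding 1 by simp
  qed
  then show ?thesis by (simp add: lap_def)
 qed
 have int: "integrable lborel (%y. U y * pd b (pd b ?K) (x - y))" if b: "b \<in> Basis" for b
 proof -
  obtain R where "!!y. norm y >= R ==> pd b (pd b ?K) y = 0"
   using test_function_cball[OF test_function_pd[OF test_function_pd[OF K b] b]] by metis
  then show ?thesis
   by (intro integrable_loc_int_test[OF U test_function_continuous[OF test_function_pd[OF test_function_pd[OF K b] b]]])
 qed
 have "lap (conv U ?K) x = (\<Sum>b\<in>Basis. conv U (pd b (pd b ?K)) x)"
  unfolding lap_def by (rule sum.cong) (simp_all add: pd_conv U K test_function_pd)
 also have "... = (LINT y|lborel. (\<Sum>b\<in>Basis. U y * pd b (pd b ?K) (x - y)))"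
  unfolding conv_def by (rule Bochner_Integration.integral_sum[symmetric]) (rule int)
 also have "... = (LINT y|lborel. U y * lap zt y)" unfolding lapz unfolding lap_def sum_distrib_left ..
 finally have 1: "lap (conv U ?K) x = (LINT y|lborel. U y * lap zt y)" .
 have I1: "integrable lborel (%y. U y * lap zt y)"
  unfolding lapz unfolding lap_def sum_distrib_left by (intro Bochner_Integration.integrable_sum int)
 have I2: "integrable lborel (%y. U y * zt y)"
  unfolding zt_def using integrable_conv_moll[OF U eps, of x] by simp
 have "(LINT y|lborel. U y * (lap zt y + of_real \<mu> * zt y)) = (LINT y|lborel. U y * lap zt y + of_real \<mu> * (U y * zt y))"
  by (simp add: algebra_simps)
 also have "... = (LINT y|lborel. U y * lap zt y) + of_real \<mu> * (LINT y|lborel. U y * zt y)"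
  using I1 I2 by simp
 finally have "(LINT y|lborel. U y * lap zt y) + of_real \<mu> * (LINT y|lborel. U y * zt y) = - (LINT y|lborel. F y * zt y)"
  using w zt by (simp add: weak_helm_def)
 then show ?thesis unfolding 1 by (simp add: conv_def zt_def)
qed

section \<open>Evanescent modes\<close>

lemma ennreal_cancel_left: "c > 0 ==> ennreal (1 / c) * (ennreal c * x) = x"
 "c > 0 ==> ennreal c * (ennreal (1 / c) * x) = x"
 by (simp_all add: mult.assoc[symmetric] ennreal_mult[symmetric])

lemma n2_eq_integral:
 assumes "integrable lborel (%x. (cmod (f x))^2)"
 shows "n2 UNIV f = ennreal (LINT x|lborel. (cmod (f x))^2)"
 unfolding n2_def using nn_integral_eq_integral[OF assms] by simp

lemma integrable_n2:
 assumes "continuous_on UNIV f" "n2 UNIV f < \<infinity>"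
 shows "integrable lborel (%x. (cmod (f x))^2)"
proof (rule integrableI_nonneg)
 show "(%x. (cmod (f x))^2) \<in> borel_measurable lborel"
  using borel_measurable_continuous_onI[OF assms(1)] by simp
qed (use assms(2) in \<open>auto simp: n2_def\<close>)

text \<open>Formally one expands the squared norm of \<open>\<Delta> v - \<mu> v\<close> and drops
  the square of \<open>\<Delta> v\<close>. The proof obtains the same from the energy identity and
  Young's inequality; finiteness of the norm of \<open>v\<close> makes the cut-off error
  vanish.\<close>

lemma evanescent_smooth:
 fixes v :: "'a::euclidean_space => complex"
 assumes v: "smooth v" and sym: "!!b c x. b \<in> Basis ==> c \<in> Basis ==> pd c (pd b v) x = pd b (pd c v) x"
  and \<mu>: "\<mu> > 0" and fin: "n2 UNIV v < \<infinity>"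
 shows "(\<integral>\<^sup>+x. ennreal (\<mu>^2 * (cmod (v x))^2 + 2 * \<mu> * grad2 v x) \<partial>lborel)
  <= n2 UNIV (%x. lap v x + of_real (- \<mu>) * v x)"
proof -
 let ?d = "real DIM('a)"
 define W where "W x = lap v x + of_real (- \<mu>) * v x" for x
 have contW: "continuous_on UNIV W"
  unfolding W_def[abs_def] by (intro smooth_continuous smooth_add smooth_mult smooth_const smooth_lap v)
 show ?thesis
 proof (cases "n2 UNIV W = \<infinity>")
  case True
  then show ?thesis unfolding W_def[abs_def] by simp
 next
  case False
  then have intW: "integrable lborel (%x. (cmod (W x))^2)"
   using integrable_n2[OF contW] by (simp add: less_top)
  have intv: "integrable lborel (%x. (cmod (v x))^2)" by (rule integrable_n2[OF smooth_continuous[OF v] fin])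
  define IW Iv where "IW = (LINT x|lborel. (cmod (W x))^2)" and "Iv = (LINT x|lborel. (cmod (v x))^2)"
  define G where "G x = \<mu>^2 * (cmod (v x))^2 + 2 * \<mu> * grad2 v x" for x
  have G0: "G x >= 0" for x using \<mu> by (simp add: G_def grad2_nonneg)
  obtain M where M: "M > 0" and cut: "\<forall>T>0. \<exists>Q Q1 Q2. smooth_real Q & smooth_real Q1 & smooth_real Q2 &
   (\<forall>t. (Q has_real_derivative Q1 t) (at t)) & (\<forall>t. (Q1 has_real_derivative Q2 t) (at t)) &
   (\<forall>s. 0 <= Q s & Q s <= 1 & Q1 s <= 0 & \<bar>Q1 s\<bar> <= M / T^2 & \<bar>Q2 s\<bar> <= M / T ^ 4) &
   (\<forall>s\<le>T^2. Q s = 1) & (\<forall>s\<ge>2 * T^2. Q s = 0) &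
   (\<forall>s. s <= T^2 \<or> s >= 2 * T^2 --> Q1 s = 0 & Q2 s = 0)"
   using cutoff_exists by blast
  \<comment> \<open>The cut-off error is \<open>\<mu>\<close> times the Laplacian of the cut-off,
    which is at most \<open>(2 d + 8) M / T^2\<close>.\<close>
  define c where "c = \<mu> * ((2 * ?d + 8) * M)"
  have ex: "\<exists>Q. (\<forall>s. Q s >= 0) & (\<forall>s\<le>(real (Suc n))^2. Q s = 1) & continuous_on UNIV Q &
    (\<integral>\<^sup>+x. ennreal (Q ((norm x)^2) * G x) \<partial>lborel) <= ennreal (IW + c / (real (Suc n))^2 * Iv)" for n
  proof -
   define T where "T = real (Suc n)"
   have T: "T > 0" by (simp add: T_def)
   from cut[rule_format, OF T] obtain Q Q1 Q2 where C: "smooth_real Q & smooth_real Q1 & smooth_real Q2 &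
    (\<forall>t. (Q has_real_derivative Q1 t) (at t)) & (\<forall>t. (Q1 has_real_derivative Q2 t) (at t)) &
    (\<forall>s. 0 <= Q s & Q s <= 1 & Q1 s <= 0 & \<bar>Q1 s\<bar> <= M / T^2 & \<bar>Q2 s\<bar> <= M / T ^ 4) &
    (\<forall>s\<le>T^2. Q s = 1) & (\<forall>s\<ge>2 * T^2. Q s = 0) &
    (\<forall>s. s <= T^2 \<or> s >= 2 * T^2 --> Q1 s = 0 & Q2 s = 0)"
    by (elim exE) (rule that)
   note smQ = C[THEN conjunct1] C[THEN conjunct2, THEN conjunct1] C[THEN conjunct2, THEN conjunct2, THEN conjunct1]
   note C3 = C[THEN conjunct2, THEN conjunct2, THEN conjunct2]
   note DQ = C3[THEN conjunct1, rule_format] C3[THEN conjunct2, THEN conjunct1, rule_format]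
   note C5 = C3[THEN conjunct2, THEN conjunct2]
   note B = C5[THEN conjunct1, THEN spec]
   note Q1' = C5[THEN conjunct2, THEN conjunct1, rule_format]
   note Z = C5[THEN conjunct2, THEN conjunct2, THEN conjunct1, rule_format]
   note Z2 = C5[THEN conjunct2, THEN conjunct2, THEN conjunct2, rule_format]
   have Z1: "Q1 s = 0" if "s >= 2 * T^2" for s using Z2[of s] that by simp
   define g where "g = (%x. 2 * Q ((norm x)^2) * (Re (cnj (v x) * lap v x) + grad2 v x)
    - (2 * real DIM('a) * Q1 ((norm x)^2) + 4 * (norm x)^2 * Q2 ((norm x)^2)) * (cmod (v x))^2)"
   have I: "integrable lborel g" "(LINT x|lborel. g x) = 0"
    unfolding g_def by (rule energy_identity[where T="2 * T^2", OF v sym smQ DQ Z Z1]; assumption)+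
   \<comment> \<open>Of the term \<open>2 Q \<mu>^2 |v|^2\<close> in \<open>\<mu> g\<close>, one
     half absorbs the source by \<open>- 2 \<mu> X \<le> \<mu>^2 |v|^2 + |W|^2\<close> and the other
     half is kept.\<close>
   have pt: "Q ((norm x)^2) * G x <= \<mu> * g x + (cmod (W x))^2 + c / T^2 * (cmod (v x))^2" for x
   proof -
    define s where "s = (norm x)^2"
    define V2 where "V2 = (cmod (v x))^2"
    define X where "X = Re (cnj (v x) * W x)"
    have Re: "Re (cnj (v x) * lap v x) = \<mu> * V2 + X"
     unfolding X_def W_def V2_def cmod_power2 by (simp add: algebra_simps power2_eq_square)
    have "\<bar>X\<bar> <= cmod (v x) * cmod (W x)"
     unfolding X_def using abs_Re_le_cmod[of "cnj (v x) * W x"] by (simp add: norm_mult)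
    moreover have "2 * \<mu> * (cmod (v x) * cmod (W x)) <= \<mu>^2 * V2 + (cmod (W x))^2"
     using zero_le_power2[of "\<mu> * cmod (v x) - cmod (W x)"] by (simp add: V2_def power2_eq_square algebra_simps)
    moreover have "\<mu> * - X <= \<mu> * \<bar>X\<bar>" using \<mu> by (intro mult_left_mono) auto
    moreover have "\<mu> * \<bar>X\<bar> <= \<mu> * (cmod (v x) * cmod (W x))" using calculation(1) \<mu> by (intro mult_left_mono) auto
    ultimately have X: "- (2 * \<mu> * X) <= \<mu>^2 * V2 + (cmod (W x))^2" by linarith
    have "Q s * (- (2 * \<mu> * X)) <= Q s * (\<mu>^2 * V2 + (cmod (W x))^2)"
     using X B[of s] by (intro mult_left_mono) auto
    also have "... <= Q s * (\<mu>^2 * V2) + 1 * (cmod (W x))^2"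
     unfolding distrib_left using B[of s] by (intro add_mono mult_right_mono) (auto simp: V2_def)
    finally have 1: "- (Q s * (2 * \<mu> * X)) <= Q s * (\<mu>^2 * V2) + (cmod (W x))^2" by simp
    have q: "2 * ?d * Q1 s + 4 * s * Q2 s <= (2 * ?d + 8) * M / T^2"
    proof (cases "s <= T^2 \<or> s >= 2 * T^2")
     case True
     then show ?thesis using Z2[of s] M T by simp
    next
     case False
     have "2 * ?d * Q1 s <= 2 * ?d * (M / T^2)" using B[of s] by (intro mult_left_mono) auto
     moreover have "s * Q2 s <= (2 * T^2) * (M / T ^ 4)"
     proof -
      have "s * Q2 s <= s * \<bar>Q2 s\<bar>" by (intro mult_left_mono) (auto simp: s_def)
      also have "... <= (2 * T^2) * (M / T ^ 4)" using B[of s] False M T by (intro mult_mono) auto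
      finally show ?thesis .
     qed
     moreover have "(2 * T^2) * (M / T ^ 4) = 2 * (M / T^2)" using T by (simp add: power2_eq_square power4_eq_xxxx)
     moreover have "(2 * ?d + 8) * M / T^2 = 2 * ?d * (M / T^2) + 8 * (M / T^2)"
      by (simp add: algebra_simps add_divide_distrib)
     moreover have "4 * s * Q2 s = 4 * (s * Q2 s)" by simp
     ultimately show ?thesis by linarith
    qed
    have "\<mu> * V2 * (2 * ?d * Q1 s + 4 * s * Q2 s) <= \<mu> * V2 * ((2 * ?d + 8) * M / T^2)"
     using q \<mu> by (intro mult_left_mono) (auto simp: V2_def)
    then have 2: "\<mu> * V2 * (2 * ?d * Q1 s + 4 * s * Q2 s) <= c / T^2 * V2" by (simp add: c_def mult_ac)
    have "\<mu> * g x = 2 * (Q s * (\<mu>^2 * V2)) + Q s * (2 * \<mu> * X) + Q s * (2 * \<mu> * grad2 v x) - \<mu> * V2 * (2 * ?d * Q1 s + 4 * s * Q2 s)"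
     unfolding g_def Re s_def[symmetric] V2_def[symmetric] by (simp add: algebra_simps power2_eq_square)
    moreover have "Q s * G x = Q s * (\<mu>^2 * V2) + Q s * (2 * \<mu> * grad2 v x)"
     by (simp add: G_def V2_def distrib_left)
    ultimately show ?thesis using 1 2 unfolding s_def[symmetric] V2_def[symmetric] by linarith
   qed
   have int: "integrable lborel (%x. \<mu> * g x + (cmod (W x))^2 + c / T^2 * (cmod (v x))^2)"
    using I intW intv by (intro Bochner_Integration.integrable_add integrable_mult_right) auto
   have "(\<integral>\<^sup>+x. ennreal (Q ((norm x)^2) * G x) \<partial>lborel) <= (\<integral>\<^sup>+x. ennreal (\<mu> * g x + (cmod (W x))^2 + c / T^2 * (cmod (v x))^2) \<partial>lborel)"
    by (intro nn_integral_mono ennreal_leI pt)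
   also have "... = ennreal (LINT x|lborel. \<mu> * g x + (cmod (W x))^2 + c / T^2 * (cmod (v x))^2)"
   proof (rule nn_integral_eq_integral[OF int], rule AE_I2)
    fix x
    have "0 <= Q ((norm x)^2) * G x" using B[of "(norm x)^2"] G0 by simp
    then show "0 <= \<mu> * g x + (cmod (W x))^2 + c / T^2 * (cmod (v x))^2" using pt[of x] by linarith
   qed
   also have "(LINT x|lborel. \<mu> * g x + (cmod (W x))^2 + c / T^2 * (cmod (v x))^2) = IW + c / T^2 * Iv"
    using I intW intv by (simp add: IW_def Iv_def)
   finally show ?thesis
    using B Q1' smooth_real_continuous[OF smQ(1)] unfolding T_def[symmetric] by (intro exI[of _ Q]) auto
  qed
  have "\<exists>(Q::nat => real => real). \<forall>n. (\<forall>s. Q n s >= (0::real)) & (\<forall>s\<le>(real (Suc n))^2. Q n s = 1) & continuous_on UNIV (Q n) &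
    (\<integral>\<^sup>+(x::'a). ennreal (Q n ((norm x)^2) * G x) \<partial>lborel) <= ennreal (IW + c / (real (Suc n))^2 * Iv)"
   by (rule choice, rule allI, rule ex)
  then obtain Q where Q': "\<forall>n. (\<forall>s. Q n s >= (0::real)) & (\<forall>s\<le>(real (Suc n))^2. Q n s = 1) & continuous_on UNIV (Q n) &
    (\<integral>\<^sup>+(x::'a). ennreal (Q n ((norm x)^2) * G x) \<partial>lborel) <= ennreal (IW + c / (real (Suc n))^2 * Iv)" by (elim exE) (rule that)
  have Q: "!!n s. Q n s >= (0::real)" "!!n s. s <= (real (Suc n))^2 ==> Q n s = 1" "!!n. continuous_on UNIV (Q n)"
    "!!n. (\<integral>\<^sup>+(x::'a). ennreal (Q n ((norm x)^2) * G x) \<partial>lborel) <= ennreal (IW + c / (real (Suc n))^2 * Iv)"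
   using Q'[rule_format] by simp_all
  have contG: "continuous_on UNIV G"
   unfolding G_def[abs_def] grad2_def using v by (intro continuous_intros smooth_continuous smooth_pd) auto
  have [measurable]: "(%x. ennreal (Q n ((norm x)^2) * G x)) \<in> borel_measurable lborel" for n
  proof -
   have "continuous_on UNIV (%x. Q n ((norm x)^2) * G x)"
    by (intro continuous_intros contG continuous_on_compose2[OF Q(3)]) auto
   from borel_measurable_continuous_onI[OF this] show ?thesis by simp
  qed
  \<comment> \<open>Fatou's lemma removes the cut-offs: at each fixed point they are eventually
    equal to 1.\<close>
  have "(\<integral>\<^sup>+x. ennreal (G x) \<partial>lborel) = (\<integral>\<^sup>+x. liminf (%n. ennreal (Q n ((norm x)^2) * G x)) \<partial>lborel)"
  proof (rule nn_integral_cong)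
   fix x :: 'a
   obtain N where N: "real N >= norm x" using real_arch_simple by blast
   have "\<forall>\<^sub>F n in sequentially. ennreal (Q n ((norm x)^2) * G x) = ennreal (G x)"
    unfolding eventually_sequentially
   proof (intro exI[of _ N] allI impI)
    fix n assume "N <= n"
    then have "norm x <= real (Suc n)" using N by linarith
    then have "(norm x)^2 <= (real (Suc n))^2" by (intro power_mono) auto
    then show "ennreal (Q n ((norm x)^2) * G x) = ennreal (G x)" using Q(2) by simp
   qed
   then have "(%n. ennreal (Q n ((norm x)^2) * G x)) \<longlonglongrightarrow> ennreal (G x)" by (rule tendsto_eventually)
   then show "ennreal (G x) = liminf (%n. ennreal (Q n ((norm x)^2) * G x))"
    by (rule lim_imp_Liminf[OF sequentially_bot, symmetric])
  qed
  also have "... <= liminf (%n. \<integral>\<^sup>+x. ennreal (Q n ((norm x)^2) * G x) \<partial>lborel)"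
   by (rule nn_integral_liminf) measurable
  also have "... <= liminf (%n. ennreal (IW + c / (real (Suc n))^2 * Iv))"
   by (intro Liminf_mono always_eventually allI Q(4))
  also have "... = ennreal IW"
  proof (rule lim_imp_Liminf)
   have "(%n. inverse (real (Suc n))) \<longlonglongrightarrow> 0" by (rule LIMSEQ_inverse_real_of_nat)
   then have "(%n. IW + c * (inverse (real (Suc n)))^2 * Iv) \<longlonglongrightarrow> IW + c * 0^2 * Iv" by (intro tendsto_intros)
   then show "(%n. ennreal (IW + c / (real (Suc n))^2 * Iv)) \<longlonglongrightarrow> ennreal IW"
    by (intro tendsto_ennrealI) (simp add: divide_inverse power_inverse)
  qed simp
  also have "... = n2 UNIV W" using n2_eq_integral[OF intW] by (simp add: IW_def)
  finally show ?thesis unfolding G_def W_def[abs_def] .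
 qed
qed

text \<open>For one basis vector \<open>e\<close>, the derivative of \<open>(x . e) |v|^2\<close> in
  direction \<open>e\<close> integrates to zero; Young's inequality absorbs half of
  \<open>|v|^2\<close>.\<close>

lemma poincare_smooth:
 fixes v :: "'a::euclidean_space => complex"
 assumes v: "smooth v" and T: "T > 0" "!!x. norm x >= T ==> v x = 0"
 shows "n2 UNIV v <= ennreal (4 * T^2) * (\<integral>\<^sup>+x. ennreal (grad2 v x) \<partial>lborel)"
proof -
 obtain e :: 'a where e: "e \<in> Basis" using nonempty_Basis by blast
 define F where "F = (%x. v x * (complex_of_real (x \<bullet> e) * cnj (v x)))"
 have tv: "test_function UNIV v" by (rule test_function_UNIVI[OF v T(2)])
 have t: "test_function UNIV F"
  unfolding F_def by (intro test_function_mult tv smooth_mult smooth_inner smooth_cnj v)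
 define g where "g x = (cmod (v x))^2 + 2 * (x \<bullet> e) * Re (cnj (v x) * pd e v x)" for x
 have leaf: "has_pd e v x (pd e v x)" for x by (rule has_pd_smooth[OF v])
 have pdF: "pd e F x = complex_of_real (g x)" for x
 proof -
  have "pd e F x = v x * (complex_of_real (x \<bullet> e) * cnj (pd e v x) + of_real (e \<bullet> e) * cnj (v x))
    + pd e v x * (complex_of_real (x \<bullet> e) * cnj (v x))"
   unfolding F_def by (rule has_pdD, (rule leaf has_pd_intros)+) simp
  also have "... = complex_of_real (g x)"
   using e unfolding g_def cmod_power2 by (simp add: complex_eq_iff power2_eq_square algebra_simps)
  finally show ?thesis .
 qed
 have "(LINT x|lborel. complex_of_real (g x)) = 0"
  using integral_pd_test_function[OF t e] unfolding pdF[abs_def] .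
 then have g0: "(LINT x|lborel. g x) = 0" by simp
 have gz: "g x = 0" if "norm x >= T" for x using that T(2) by (simp add: g_def)
 have contg: "continuous_on UNIV g"
  unfolding g_def[abs_def] using v e by (intro continuous_intros smooth_continuous smooth_pd) auto
 have intg: "integrable lborel g" by (rule integrable_compact_support[OF contg gz])
 have contv: "continuous_on UNIV (%x. (cmod (v x))^2)" using v by (intro continuous_intros smooth_continuous)
 have intv: "integrable lborel (%x. (cmod (v x))^2)" by (rule integrable_compact_support[OF contv, of T]) (simp add: T)
 have gr0: "grad2 v x = 0" if "norm x >= T + 1" for x
  unfolding grad2_def using T that by (intro sum.neutral ballI) (auto intro!: pd_eq_0_outside[of "cball 0 T"])
 have contgr: "continuous_on UNIV (grad2 v)"
  unfolding grad2_def[abs_def] using v by (intro continuous_intros smooth_continuous smooth_pd) auto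
 have intgr: "integrable lborel (grad2 v)" by (rule integrable_compact_support[OF contgr gr0])
 have pt: "(cmod (v x))^2 / 2 <= g x + 2 * T^2 * grad2 v x" for x
 proof (cases "norm x >= T")
  case True
  then show ?thesis using T gz by (simp add: grad2_nonneg)
 next
  case False
  have p: "(cmod (pd e v x))^2 <= grad2 v x"
   unfolding grad2_def by (rule member_le_sum[OF e]) auto
  have "\<bar>x \<bullet> e\<bar> <= T" using Basis_le_norm[OF e, of x] False by linarith
  moreover have "\<bar>Re (cnj (v x) * pd e v x)\<bar> <= cmod (v x) * cmod (pd e v x)"
   using abs_Re_le_cmod[of "cnj (v x) * pd e v x"] by (simp add: norm_mult)
  ultimately have "\<bar>x \<bullet> e\<bar> * \<bar>Re (cnj (v x) * pd e v x)\<bar> <= T * (cmod (v x) * cmod (pd e v x))"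
   using T by (intro mult_mono) auto
  then have "- (2 * (x \<bullet> e) * Re (cnj (v x) * pd e v x)) <= 2 * (T * (cmod (v x) * cmod (pd e v x)))"
   using abs_ge_minus_self[of "(x \<bullet> e) * Re (cnj (v x) * pd e v x)"] by (simp add: abs_mult)
  also have "... <= (cmod (v x))^2 / 2 + 2 * T^2 * (cmod (pd e v x))^2"
   using zero_le_power2[of "cmod (v x) - 2 * T * cmod (pd e v x)"] by (simp add: power2_eq_square algebra_simps)
  also have "... <= (cmod (v x))^2 / 2 + 2 * T^2 * grad2 v x"
   using p by (intro add_left_mono mult_left_mono) auto
  finally show ?thesis by (simp add: g_def)
 qed
 have "(LINT x|lborel. (cmod (v x))^2 / 2) <= (LINT x|lborel. g x + 2 * T^2 * grad2 v x)"
  using intv intg intgr pt by (intro integral_mono) auto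
 then have "(LINT x|lborel. (cmod (v x))^2) <= 4 * T^2 * (LINT x|lborel. grad2 v x)"
  using intv intg intgr g0 by simp
 moreover have "(\<integral>\<^sup>+x. ennreal (grad2 v x) \<partial>lborel) = ennreal (LINT x|lborel. grad2 v x)"
  by (rule nn_integral_eq_integral[OF intgr]) (simp add: grad2_nonneg)
 moreover have "(LINT x|lborel. grad2 v x) >= 0" by (simp add: grad2_nonneg integral_nonneg_AE)
 ultimately show ?thesis
  unfolding n2_eq_integral[OF intv] by (simp add: ennreal_mult[symmetric] ennreal_leI)
qed

text \<open>The gradient term of \<open>evanescent_smooth\<close> is discarded, since it has no
  bound uniform in \<open>eps\<close> to compare with; what it contributes is recovered in the
  strict version.\<close>

lemma weak_helm_evanescent:
 fixes U F :: "'a::euclidean_space => complex"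
 assumes \<mu>: "\<mu> > 0" and w: "weak_helm (- \<mu>) U F" and finU: "n2 UNIV U < \<infinity>"
 shows "ennreal (\<mu>^2) * n2 UNIV U <= n2 UNIV F"
proof -
 have U: "loc_int U" and F: "loc_int F" using w by (auto simp: weak_helm_def)
 have l2: "\<mu>^2 > 0" using \<mu> by simp
 have "n2 UNIV U <= ennreal (1 / \<mu>^2) * n2 UNIV F"
 proof (rule n2_moll_limit[OF U finU _ zero_less_one])
  fix eps :: real assume eps: "0 < eps"
  let ?v = "conv U (moll eps)"
  have Um: "U \<in> borel_measurable borel" "F \<in> borel_measurable borel" using U F loc_int_measurable by auto
  have finv: "n2 UNIV ?v < \<infinity>" using n2_conv_moll_le[OF Um(1) eps] finU by (rule le_less_trans)
  have sm: "smooth ?v" by (rule smooth_conv[OF U test_function_moll[OF eps]])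
  have [measurable]: "?v \<in> borel_measurable borel" by (rule borel_measurable_conv_moll[OF U eps])
  have "ennreal (\<mu>^2) * n2 UNIV ?v = (\<integral>\<^sup>+x. ennreal (\<mu>^2 * (cmod (?v x))^2) \<partial>lborel)"
   unfolding n2_def by (subst nn_integral_cmult[symmetric]) (auto simp: ennreal_mult)
  also have "... <= (\<integral>\<^sup>+x. ennreal (\<mu>^2 * (cmod (?v x))^2 + 2 * \<mu> * grad2 ?v x) \<partial>lborel)"
   using \<mu> by (intro nn_integral_mono ennreal_leI) (simp add: grad2_nonneg)
  also have "... <= n2 UNIV (%x. lap ?v x + of_real (- \<mu>) * ?v x)"
   by (rule evanescent_smooth[OF sm _ \<mu> finv]) (rule conv_moll_sym[OF U eps])
  also have "... = n2 UNIV (conv F (moll eps))"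
   unfolding conv_moll_pde[OF w eps] by (simp add: n2_def)
  also have "... <= n2 UNIV F" by (rule n2_conv_moll_le[OF Um(2) eps])
  finally have "ennreal (1 / \<mu>^2) * (ennreal (\<mu>^2) * n2 UNIV ?v) <= ennreal (1 / \<mu>^2) * n2 UNIV F"
   by (intro mult_left_mono) auto
  then show "n2 UNIV ?v <= ennreal (1 / \<mu>^2) * n2 UNIV F" unfolding ennreal_cancel_left[OF l2] .
 qed simp
 then have "ennreal (\<mu>^2) * n2 UNIV U <= ennreal (\<mu>^2) * (ennreal (1 / \<mu>^2) * n2 UNIV F)"
  by (intro mult_left_mono) auto
 then show ?thesis unfolding ennreal_cancel_left[OF l2] .
qed

text \<open>Equality in the evanescent estimate would make \<open>U\<close> vanish outside \<open>A\<close>, and then the gradient term that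
 was dropped controls \<open>U\<close> by Poincare's inequality.\<close>

lemma weak_helm_evanescent_strict:
 fixes U F :: "'a::euclidean_space => complex"
 assumes \<mu>: "\<mu> > 0" and w: "weak_helm (- \<mu>) U F" and finU: "n2 UNIV U < \<infinity>" and finF: "n2 UNIV F < \<infinity>"
  and A: "A \<in> sets borel" "A \<subseteq> cball 0 r" and r: "r > 0" and ge: "n2 UNIV F <= ennreal (\<mu>^2) * n2 A U"
 shows "n2 UNIV F = 0"
proof -
 have U: "loc_int U" and F: "loc_int F" using w by (auto simp: weak_helm_def)
 have Um[measurable]: "U \<in> borel_measurable borel" and Fm[measurable]: "F \<in> borel_measurable borel"
  using U F loc_int_measurable by auto
 note [measurable] = A(1)
 have l2: "\<mu>^2 > 0" using \<mu> by simp
 \<comment> \<open>The estimate on the whole space and the hypothesis \<open>ge\<close> squeeze the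
   norm of \<open>U\<close> into \<open>A\<close>.\<close>
 have "ennreal (\<mu>^2) * n2 UNIV U <= ennreal (\<mu>^2) * n2 A U"
  using weak_helm_evanescent[OF \<mu> w finU] ge by (rule order_trans)
 then have "ennreal (1 / \<mu>^2) * (ennreal (\<mu>^2) * n2 UNIV U) <= ennreal (1 / \<mu>^2) * (ennreal (\<mu>^2) * n2 A U)"
  by (rule mult_left_mono) simp
 then have le: "n2 UNIV U <= n2 A U" unfolding ennreal_cancel_left[OF l2] .
 have split: "n2 UNIV U = n2 A U + n2 (- A) U"
  unfolding n2_def by (subst nn_integral_add[symmetric]) (auto intro!: nn_integral_cong simp: indicator_def)
 have "n2 A U < \<infinity>" using finU n2_le_UNIV le_less_trans by blast
 with le split have "n2 (- A) U = 0"
  by (metis add.right_neutral ennreal_add_left_cancel_le infinity_ennreal_def le_zero_eq less_irrefl)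
 then have "AE x in lborel. ennreal ((cmod (U x))^2) * indicator (- A) x = 0"
  unfolding n2_def by (subst (asm) nn_integral_0_iff_AE) auto
 then have AE: "AE x in lborel. x \<notin> A --> U x = 0"
  by eventually_elim (auto simp: indicator_def split: if_splits)
 \<comment> \<open>Mollification with \<open>eps \<le> 1\<close> enlarges the support by at most 1.
   By Poincare the gradient term \<open>2 \<mu>\<close> then contributes at least
   \<open>2 \<mu> / (4 T^2)\<close> times the norm, which is the excess of \<open>k\<close> over
   \<open>\<mu>^2\<close>.\<close>
 define T where "T = r + 1"
 have T: "T > 0" using r by (simp add: T_def)
 define k where "k = \<mu>^2 + \<mu> / (2 * T^2)"
 have k: "k > \<mu>^2" "k > 0" using \<mu> T by (auto simp: k_def add_pos_pos)
 have "n2 UNIV U <= ennreal (1 / k) * n2 UNIV F"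
 proof (rule n2_moll_limit[OF U finU _ zero_less_one])
  fix eps :: real assume eps: "0 < eps" "eps <= 1"
  let ?v = "conv U (moll eps)"
  have finv: "n2 UNIV ?v < \<infinity>" using n2_conv_moll_le[OF Um eps(1)] finU by (rule le_less_trans)
  have sm: "smooth ?v" by (rule smooth_conv[OF U test_function_moll[OF eps(1)]])
  have [measurable]: "?v \<in> borel_measurable borel" by (rule borel_measurable_conv_moll[OF U eps(1)])
  have vz: "?v x = 0" if "norm x >= T" for x
  proof -
   have "AE y in lborel. U y * moll eps (x - y) = 0"
    using AE
   proof eventually_elim
    fix y assume y: "y \<notin> A --> U y = 0"
    show "U y * moll eps (x - y) = 0"
    proof (cases "y \<in> A")
     case True
     then have "norm y <= r" using A(2) by auto
     moreover have "norm x <= norm y + norm (x - y)" by (metis norm_triangle_sub)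
     ultimately have "norm (x - y) >= eps" using that eps by (simp add: T_def)
     then show ?thesis by (simp add: moll_outside[OF eps(1)])
    qed (use y in simp)
   qed
   then show ?thesis unfolding conv_def by (rule integral_eq_zero_AE)
  qed
  have contg: "continuous_on UNIV (grad2 ?v)"
   unfolding grad2_def[abs_def] using sm by (intro continuous_intros smooth_continuous smooth_pd) auto
  note [measurable] = borel_measurable_continuous_onI[OF contg]
  let ?g = "\<integral>\<^sup>+x. ennreal (grad2 ?v x) \<partial>lborel"
  have "ennreal (\<mu>^2) * n2 UNIV ?v + ennreal (2 * \<mu>) * ?g = (\<integral>\<^sup>+x. ennreal (\<mu>^2 * (cmod (?v x))^2 + 2 * \<mu> * grad2 ?v x) \<partial>lborel)"
   unfolding n2_def using \<mu>
   by (subst (1 2) nn_integral_cmult[symmetric], measurable, subst nn_integral_add[symmetric])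
     (auto simp: ennreal_mult[symmetric] grad2_nonneg ennreal_plus[symmetric] simp del: ennreal_plus intro!: nn_integral_cong)
  also have "... <= n2 UNIV (%x. lap ?v x + of_real (- \<mu>) * ?v x)"
   by (rule evanescent_smooth[OF sm _ \<mu> finv]) (rule conv_moll_sym[OF U eps(1)])
  also have "... = n2 UNIV (conv F (moll eps))"
   unfolding conv_moll_pde[OF w eps(1)] by (simp add: n2_def)
  also have "... <= n2 UNIV F" by (rule n2_conv_moll_le[OF Fm eps(1)])
  finally have 1: "ennreal (\<mu>^2) * n2 UNIV ?v + ennreal (2 * \<mu>) * ?g <= n2 UNIV F" .
  have "ennreal (\<mu> / (2 * T^2)) * n2 UNIV ?v <= ennreal (\<mu> / (2 * T^2)) * (ennreal (4 * T^2) * ?g)"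
   by (intro mult_left_mono poincare_smooth[OF sm T vz]) auto
  also have "... = ennreal (2 * \<mu>) * ?g"
   using \<mu> T by (simp add: mult.assoc[symmetric] ennreal_mult[symmetric])
  finally have "ennreal (\<mu>^2) * n2 UNIV ?v + ennreal (\<mu> / (2 * T^2)) * n2 UNIV ?v <= n2 UNIV F"
   using 1 by (meson add_left_mono order_trans)
  then have "ennreal k * n2 UNIV ?v <= n2 UNIV F"
   unfolding k_def using \<mu> T by (simp add: ennreal_plus distrib_right)
  then have "ennreal (1 / k) * (ennreal k * n2 UNIV ?v) <= ennreal (1 / k) * n2 UNIV F"
   by (intro mult_left_mono) auto
  then show "n2 UNIV ?v <= ennreal (1 / k) * n2 UNIV F" unfolding ennreal_cancel_left[OF k(2)] .
 qed simp
 then have "ennreal (\<mu>^2) * n2 UNIV U <= ennreal (\<mu>^2) * (ennreal (1 / k) * n2 UNIV F)"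
  by (intro mult_left_mono) auto
 moreover have "n2 UNIV F <= ennreal (\<mu>^2) * n2 UNIV U"
  using ge n2_le_UNIV[of A U] by (meson mult_left_mono order_trans zero_le)
 moreover have "ennreal (\<mu>^2) * (ennreal (1 / k) * n2 UNIV F) = ennreal (\<mu>^2 / k) * n2 UNIV F"
  using k by (simp add: mult.assoc[symmetric] ennreal_mult[symmetric])
 ultimately have le2: "n2 UNIV F <= ennreal (\<mu>^2 / k) * n2 UNIV F" by simp
 \<comment> \<open>Since \<open>k > \<mu>^2\<close>, the norm of \<open>F\<close> is at most a
   proper fraction of itself and hence zero.\<close>
 obtain f where f: "n2 UNIV F = ennreal f" "f >= 0" using finF by (cases "n2 UNIV F") auto
 have "f <= \<mu>^2 / k * f" using le2 f k by (simp add: ennreal_mult[symmetric])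
 then have "f * (k - \<mu>\<^sup>2) <= 0" using k by (simp add: field_simps)
 then have "f = 0" using f(2) k(1) by (simp add: mult_le_0_iff)
 then show ?thesis using f by simp
qed

section \<open>The radiation condition under mollification\<close>

lemma lborel_integral_scale:
 fixes f :: "'a::euclidean_space => complex"
 assumes f: "f \<in> borel_measurable borel" and c: "c > 0"
 shows "(LINT x|lborel. f x) = of_real (c ^ DIM('a)) * (LINT x|lborel. f (c *\<^sub>R x))"
  "integrable lborel f \<longleftrightarrow> integrable lborel (%x. f (c *\<^sub>R x))"
proof -
 have L: "(lborel :: 'a measure) = density (distr lborel borel (%x. c *\<^sub>R x)) (%_. ennreal (c ^ DIM('a)))"
  using lborel_affine[of c "0::'a"] c by simp
 have D: "integral\<^sup>L (distr lborel borel (%x. c *\<^sub>R x)) g = (LINT x|lborel. g (c *\<^sub>R x))" if "g \<in> borel_measurable borel" for g :: "'a => complex"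
  by (rule integral_distr) (use that in auto)
 have "(LINT x|lborel. f x) = integral\<^sup>L (distr lborel borel (%x. c *\<^sub>R x)) (%x. (c ^ DIM('a)) *\<^sub>R f x)"
  by (subst L, rule integral_density) (use f c in auto)
 also have "... = (LINT x|lborel. (c ^ DIM('a)) *\<^sub>R f (c *\<^sub>R x))" using f by (intro D) auto
 finally show "(LINT x|lborel. f x) = of_real (c ^ DIM('a)) * (LINT x|lborel. f (c *\<^sub>R x))"
  by (simp add: scaleR_conv_of_real)
 have "integrable lborel f \<longleftrightarrow> integrable (distr lborel borel (%x. c *\<^sub>R x)) (%x. (c ^ DIM('a)) *\<^sub>R f x)"
  by (subst L, rule integrable_density) (use f c in auto)
 also have "... \<longleftrightarrow> integrable lborel (%x. (c ^ DIM('a)) *\<^sub>R f (c *\<^sub>R x))"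
  by (rule integrable_distr_eq) (use f in auto)
 finally show "integrable lborel f \<longleftrightarrow> integrable lborel (%x. f (c *\<^sub>R x))"
  using c integrable_scaleR_right[of "c ^ DIM('a)" lborel "%x. f (c *\<^sub>R x)"]
   integrable_scaleR_right[of "1 / c ^ DIM('a)" lborel "%x. (c ^ DIM('a)) *\<^sub>R f (c *\<^sub>R x)"] by auto
qed

lemma euler_eq_frechet: "f differentiable (at x) ==> euler f x = frechet_derivative f (at x) x"
 by (simp add: euler_def frechet_derivative_eq_sum_pd)

text \<open>Differentiating \<open>\<integral> w(s y) \<zeta>(y) dy = s\<^sup>-\<^sup>d \<integral> w(y) \<zeta>(y/s) dy\<close> at \<open>s = 1\<close> integrates the radial derivative of
 a function that is merely differentiable by parts.\<close>

lemma dilation_identity: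
 fixes w W zt :: "'a::euclidean_space => complex"
 assumes a: "a > 0" and zt: "test_function UNIV zt"
  and supp: "!!y. norm y < a \<or> norm y > b ==> zt y = 0"
  and diff: "!!y. norm y >= a ==> w differentiable (at y)"
  and bd: "!!y. a <= norm y ==> norm y <= 2 * b ==> cmod (w y) <= C"
   "!!y. a <= norm y ==> norm y <= 2 * b ==> cmod (frechet_derivative w (at y) y) <= C"
  and C: "C >= 0" and b: "b > 0"
  and W: "!!y. W y = (if norm y >= a then w y else 0)"
 shows "integrable lborel (%y. frechet_derivative w (at y) y * zt y)"
  "(LINT y|lborel. frechet_derivative w (at y) y * zt y) = - (LINT y|lborel. W y * (euler zt y + of_nat DIM('a) * zt y))"
proof -
 let ?d = "DIM('a)"
 define h where "h n = inverse (real (Suc n))" for n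
 have h: "h n > 0" "h n <= 1" "h n ~= 0" for n by (auto simp: h_def field_simps)
 have hlim: "h \<longlonglongrightarrow> 0" unfolding h_def[abs_def] by (rule LIMSEQ_inverse_real_of_nat)
 define s where "s n = 1 + h n" for n
 have s: "s n > 1" "s n <= 2" "s n > 0" for n using h[of n] by (auto simp: s_def)
 obtain M where M: "M > 0" "!!y. cmod (zt y) <= M" using test_function_bounded[OF zt] by metis
 obtain L where L: "L > 0" "!!x y. cmod (zt x - zt y) <= L * norm (x - y)" using test_function_lipschitz[OF zt] by metis
 have cW: "continuous_on {y. norm y >= a} w"
  by (intro continuous_at_imp_continuous_on ballI differentiable_imp_continuous_within diff) simp
 \<comment> \<open>\<open>w\<close> is arbitrary near the origin; restricted to
   \<open>norm y \<ge> a\<close>, where it is continuous, it becomes Borel measurable.\<close>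
 have "(%y. indicator {y. norm y >= a} y *\<^sub>R w y) \<in> borel_measurable borel"
  by (rule borel_measurable_continuous_on_indicator[OF _ cW]) simp
 also have "(%y. indicator {y. norm y >= a} y *\<^sub>R w y) = W" using W by (auto simp: fun_eq_iff indicator_def)
 finally have Wm[measurable]: "W \<in> borel_measurable borel" .
 note ztm[measurable] = borel_measurable_continuous_onI[OF test_function_continuous[OF zt]]
 define q where "q n y = (W (s n *\<^sub>R y) - W y) / of_real (h n) * zt y" for n y
 define D where "D y = frechet_derivative w (at y) y * zt y" for y
 have fin: "integrable lborel (%x. c * indicator (cball (0::'a) r) x :: real)" for c r
  using emeasure_bounded_finite[of "cball (0::'a) r"] by (intro integrable_mult_right integrable_real_indicator) auto
 have qlim: "(%n. q n y) \<longlonglongrightarrow> D y" for y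
 proof (cases "zt y = 0")
  case False
  then have y: "norm y >= a" using supp[of y] by force
  have "(w has_derivative frechet_derivative w (at y)) (at y)"
   using diff[OF y] frechet_derivative_works by blast
  from directional_quotient_tendsto[OF this hlim h(3), of y]
  have "(%n. (w (y + h n *\<^sub>R y) - w y) /\<^sub>R h n * zt y) \<longlonglongrightarrow> D y"
   unfolding D_def by (rule tendsto_mult[OF _ tendsto_const])
  moreover have "q n y = (w (y + h n *\<^sub>R y) - w y) /\<^sub>R h n * zt y" for n
  proof -
   have "1 * norm y <= s n * norm y" using s(1)[of n] by (intro mult_right_mono) auto
   then have "norm (s n *\<^sub>R y) >= a" using y s(3)[of n] by simp
   moreover have "y + h n *\<^sub>R y = s n *\<^sub>R y" by (simp add: s_def scaleR_add_left)
   ultimately show ?thesis using W y by (simp add: q_def scaleR_conv_of_real divide_inverse mult.commute)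
  qed
  ultimately show ?thesis by simp
 qed (simp add: q_def D_def)
 have qm: "q n \<in> borel_measurable lborel" for n unfolding q_def[abs_def] by measurable
 have Dm: "D \<in> borel_measurable lborel" by (rule borel_measurable_LIMSEQ_metric[OF qm qlim])
 \<comment> \<open>Along the ray through \<open>y\<close> the mean value inequality involves only
   the derivative in the direction of the ray, which is the one that is bounded.\<close>
 have qb: "norm (q n y) <= (C * M) * indicator (cball 0 b) y" for n y
 proof (cases "zt y = 0")
  case True
  then show ?thesis using C M by (simp add: q_def)
 next
  case False
  then have y: "norm y >= a" "norm y <= b" using supp[of y] by force+
  have ty: "a <= norm (t *\<^sub>R y)" "norm (t *\<^sub>R y) <= 2 * b" if "t \<in> {1..s n}" for t
  proof -
   have "1 * norm y <= t * norm y" "t * norm y <= 2 * b"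
    using that s(2)[of n] y by (intro mult_right_mono mult_mono; simp)+
   then show "a <= norm (t *\<^sub>R y)" "norm (t *\<^sub>R y) <= 2 * b" using y that by auto
  qed
  have "norm (w (s n *\<^sub>R y) - w (1 *\<^sub>R y)) <= C * norm (s n - 1)"
  proof (rule differentiable_bound[of "{1..s n}"])
   fix t assume t: "t \<in> {1..s n}"
   have D1: "(w has_derivative frechet_derivative w (at (t *\<^sub>R y))) (at (t *\<^sub>R y))"
    using diff[OF ty(1)[OF t]] frechet_derivative_works by blast
   have "((%t. t *\<^sub>R y) has_derivative (%\<tau>. \<tau> *\<^sub>R y)) (at t)" by (auto intro!: derivative_eq_intros)
   from has_derivative_compose[OF this D1]
   show "((%t. w (t *\<^sub>R y)) has_derivative (%\<tau>. frechet_derivative w (at (t *\<^sub>R y)) (\<tau> *\<^sub>R y))) (at t within {1..s n})"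
    by (rule has_derivative_at_withinI)
   show "onorm (%\<tau>. frechet_derivative w (at (t *\<^sub>R y)) (\<tau> *\<^sub>R y)) <= C"
   proof (rule onorm_le)
    fix \<tau> :: real
    have "frechet_derivative w (at (t *\<^sub>R y)) (\<tau> *\<^sub>R y) = (\<tau> / t) *\<^sub>R frechet_derivative w (at (t *\<^sub>R y)) (t *\<^sub>R y)"
     using linear_cmul[OF has_derivative_linear[OF D1], of "\<tau> / t" "t *\<^sub>R y"] t by simp
    then have "norm (frechet_derivative w (at (t *\<^sub>R y)) (\<tau> *\<^sub>R y)) = \<bar>\<tau>\<bar> / t * norm (frechet_derivative w (at (t *\<^sub>R y)) (t *\<^sub>R y))"
     using t by simp
    also have "... <= \<bar>\<tau>\<bar> * C"
    proof (intro mult_mono)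
     have "\<bar>\<tau>\<bar> / t <= \<bar>\<tau>\<bar> / 1" using t by (intro divide_left_mono) auto
     then show "\<bar>\<tau>\<bar> / t <= \<bar>\<tau>\<bar>" by simp
    qed (use bd(2)[OF ty[OF t]] in auto)
    finally show "norm (frechet_derivative w (at (t *\<^sub>R y)) (\<tau> *\<^sub>R y)) <= C * norm \<tau>" by (simp add: mult.commute)
   qed
  qed (use s[of n] in auto)
  moreover have "W (s n *\<^sub>R y) = w (s n *\<^sub>R y)" "W y = w y" using W ty(1)[of "s n"] y s(1)[of n] by auto
  ultimately have "norm (W (s n *\<^sub>R y) - W y) <= C * h n" using h[of n] by (simp add: s_def)
  then have "norm ((W (s n *\<^sub>R y) - W y) / of_real (h n)) <= C" using h[of n] by (simp add: norm_divide field_simps)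
  then have "norm (q n y) <= C * M" unfolding q_def norm_mult using M(2)[of y] C by (intro mult_mono) auto
  then show ?thesis using y by simp
 qed
 have DCT1: "integrable lborel D" "(%n. LINT y|lborel. q n y) \<longlonglongrightarrow> (LINT y|lborel. D y)"
  by (rule integrable_dominated_convergence[OF Dm qm fin[of "C * M" b] AE_I2[OF qlim] AE_I2[OF qb]],
    rule integral_dominated_convergence[OF Dm qm fin[of "C * M" b] AE_I2[OF qlim] AE_I2[OF qb]])
 have Wb: "cmod (W y) <= C" if "norm y <= 2 * b" for y using W bd(1) that C by simp
 have intW: "integrable lborel (%y. W y * g y)" if g: "g \<in> borel_measurable borel" "!!y. cmod (g y) <= K" "!!y. norm y > 2 * b ==> g y = 0" for g K
 proof (rule Bochner_Integration.integrable_bound[OF fin[of "C * K" "2 * b"]])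
  show "(%y. W y * g y) \<in> borel_measurable lborel" using g(1) by measurable
  show "AE y in lborel. norm (W y * g y) <= norm (C * K * indicator (cball 0 (2 * b)) y)"
  proof (rule AE_I2)
   fix y
   have "cmod (W y) * cmod (g y) <= C * K" if "norm y <= 2 * b" using Wb[OF that] g(2)[of y] C by (intro mult_mono) auto
   moreover have "K >= 0" using g(2)[of y] norm_ge_zero[of "g y"] by linarith
   ultimately show "norm (W y * g y) <= norm (C * K * indicator (cball 0 (2 * b)) y)"
    using g(3)[of y] C by (cases "norm y <= 2 * b") (auto simp: norm_mult)
  qed
 qed
 \<comment> \<open>The same integrals after replacing \<open>y\<close> by \<open>y / s n\<close>:
   the difference quotient now acts on the smooth \<open>zt\<close> and on the Jacobian.\<close>
 define r where "r n y = W y * ((of_real ((1 / s n) ^ ?d) * zt ((1 / s n) *\<^sub>R y) - zt y) / of_real (h n))" for n y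
 have supp2: "zt ((1 / s n) *\<^sub>R y) = 0" if "norm y > 2 * b \<or> norm y < a" for n y
 proof (rule supp)
  have "norm ((1 / s n) *\<^sub>R y) = norm y / s n" using s(3)[of n] by simp
  moreover have "norm y / s n > b" if "norm y > 2 * b"
  proof -
   have "b * s n <= b * 2" using s(2)[of n] b by (intro mult_left_mono) auto
   then show ?thesis using that s(3)[of n] by (simp add: pos_less_divide_eq)
  qed
  moreover have "norm y / s n < a" if "norm y < a"
  proof -
   have "norm y / s n <= norm y / 1" using s(1)[of n] by (intro divide_left_mono) auto
   then show ?thesis using that by simp
  qed
  ultimately show "norm ((1 / s n) *\<^sub>R y) < a \<or> b < norm ((1 / s n) *\<^sub>R y)" using that by auto
 qed
 have qr: "(LINT y|lborel. q n y) = (LINT y|lborel. r n y)" for n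
 proof -
  have I1: "integrable lborel (%y. W y * zt y)"
   by (rule intW[OF ztm M(2)]) (use supp b in auto)
  have I2: "integrable lborel (%y. W y * zt ((1 / s n) *\<^sub>R y))"
   by (rule intW[where K=M]) (use M supp2 in auto)
  have sc: "(LINT y|lborel. W (s n *\<^sub>R y) * zt y) = of_real ((1 / s n) ^ ?d) * (LINT y|lborel. W y * zt ((1 / s n) *\<^sub>R y))"
   using lborel_integral_scale(1)[of "%y. W (s n *\<^sub>R y) * zt y" "1 / s n"] s(3)[of n] by simp
  have I3: "integrable lborel (%y. W (s n *\<^sub>R y) * zt y)"
   using lborel_integral_scale(2)[of "%y. W (s n *\<^sub>R y) * zt y" "1 / s n"] s(3)[of n] I2 by simp
  have "(LINT y|lborel. q n y) = (LINT y|lborel. (W (s n *\<^sub>R y) * zt y - W y * zt y) / of_real (h n))"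
   by (simp add: q_def left_diff_distrib diff_divide_distrib)
  also have "... = (of_real ((1 / s n) ^ ?d) * (LINT y|lborel. W y * zt ((1 / s n) *\<^sub>R y)) - (LINT y|lborel. W y * zt y)) / of_real (h n)"
   using I1 I3 by (simp add: sc)
  also have "... = (LINT y|lborel. (of_real ((1 / s n) ^ ?d) * (W y * zt ((1 / s n) *\<^sub>R y)) - W y * zt y) / of_real (h n))"
   using I1 I2 by simp
  also have "... = (LINT y|lborel. r n y)"
   by (rule Bochner_Integration.integral_cong) (simp_all add: r_def algebra_simps diff_divide_distrib)
  finally show ?thesis .
 qed
 define E where "E y = - (W y * (euler zt y + of_nat ?d * zt y))" for y
 have smzt: "smooth zt" using zt by (rule test_function_smooth)
 have rlim: "(%n. r n y) \<longlonglongrightarrow> E y" for y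
 proof -
  define Z where "Z t = complex_of_real ((1 / t) ^ ?d) * zt ((1 / t) *\<^sub>R y)" for t :: real
  have d1: "((%t::real. 1 / t) has_derivative (%\<tau>. - \<tau>)) (at 1)" by (auto intro!: derivative_eq_intros)
  have "((%t::real. (1 / t) ^ ?d) has_derivative (%\<tau>. of_nat ?d * (- \<tau>) * (1 / 1) ^ (?d - 1))) (at 1)"
   by (rule has_derivative_power[OF d1])
  then have d2: "((%t. complex_of_real ((1 / t) ^ ?d)) has_derivative (%\<tau>. complex_of_real (of_nat ?d * (- \<tau>) * (1 / 1) ^ (?d - 1)))) (at 1)"
   by (rule has_derivative_of_real)
  have "((%t. (1 / t) *\<^sub>R y) has_derivative (%\<tau>. (- \<tau>) *\<^sub>R y)) (at 1)"
   by (rule has_derivative_scaleR_left[OF d1])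
  from has_derivative_compose[OF this, of zt "frechet_derivative zt (at y)"]
  have d3: "((%t. zt ((1 / t) *\<^sub>R y)) has_derivative (%\<tau>. frechet_derivative zt (at y) ((- \<tau>) *\<^sub>R y))) (at 1)"
   using smooth_has_derivative[OF smzt, of y] by simp
  from has_derivative_mult[OF d2 d3]
  have "(Z has_derivative (%\<tau>. frechet_derivative zt (at y) ((- \<tau>) *\<^sub>R y) + complex_of_real (of_nat ?d * (- \<tau>)) * zt y)) (at 1)"
   unfolding Z_def[abs_def] by simp
  from directional_quotient_tendsto[OF this hlim h(3), of 1]
  have "(%n. (Z (1 + h n *\<^sub>R 1) - Z 1) /\<^sub>R h n) \<longlonglongrightarrow> frechet_derivative zt (at y) ((- 1) *\<^sub>R y) - of_nat ?d * zt y"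
   by simp
  moreover have "frechet_derivative zt (at y) ((- 1) *\<^sub>R y) = - euler zt y"
   using linear_cmul[OF has_derivative_linear[OF smooth_has_derivative[OF smzt, of y]], of "-1" y]
   by (simp add: euler_eq_frechet smooth_differentiable[OF smzt])
  ultimately have "(%n. W y * ((Z (1 + h n *\<^sub>R 1) - Z 1) /\<^sub>R h n)) \<longlonglongrightarrow> W y * (- euler zt y - of_nat ?d * zt y)"
   by (intro tendsto_mult tendsto_const) simp
  moreover have "W y * (- euler zt y - of_nat ?d * zt y) = E y" by (simp add: E_def algebra_simps)
  moreover have "W y * ((Z (1 + h n *\<^sub>R 1) - Z 1) /\<^sub>R h n) = r n y" for n
   by (simp add: r_def Z_def s_def scaleR_conv_of_real divide_inverse mult.commute)
  ultimately show ?thesis by simp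
 qed
 have rm: "r n \<in> borel_measurable lborel" for n unfolding r_def[abs_def] by measurable
 have Em: "E \<in> borel_measurable lborel" by (rule borel_measurable_LIMSEQ_metric[OF rm rlim])
 have rb: "norm (r n y) <= (C * (?d * M + L * (2 * b))) * indicator (cball 0 (2 * b)) y" for n y
 proof (cases "norm y <= 2 * b")
  case False
  then show ?thesis using supp2[of y n] supp[of y] b by (simp add: r_def)
 next
  case True
  have si: "1 - 1 / s n <= h n" "1 - 1 / s n >= 0" "1 / s n <= 1" using s[of n] h[of n] by (auto simp: s_def field_simps)
  \<comment> \<open>Bernoulli's inequality bounds the change of the Jacobian by \<open>d\<close>
    times \<open>h n\<close>.\<close>
  have "1 + real ?d * (1 / s n - 1) <= (1 + (1 / s n - 1)) ^ ?d"
   by (rule Bernoulli_inequality) (use s(3)[of n] in simp)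
  then have "1 - (1 / s n) ^ ?d <= real ?d * (1 - 1 / s n)" by (simp add: algebra_simps)
  also have "... <= real ?d * h n" using si by (intro mult_left_mono) auto
  finally have p1: "1 - (1 / s n) ^ ?d <= real ?d * h n" .
  have "(1 / s n) ^ ?d <= 1" using si s(3)[of n] by (intro power_le_one) auto
  then have p2: "cmod (complex_of_real ((1 / s n) ^ ?d - 1)) <= real ?d * h n" using p1 by (simp only: norm_of_real)
  have "of_real ((1 / s n) ^ ?d) * zt ((1 / s n) *\<^sub>R y) - zt y
    = complex_of_real ((1 / s n) ^ ?d - 1) * zt ((1 / s n) *\<^sub>R y) + (zt ((1 / s n) *\<^sub>R y) - zt y)"
   by (simp add: algebra_simps)
  also have "cmod ... <= cmod (complex_of_real ((1 / s n) ^ ?d - 1) * zt ((1 / s n) *\<^sub>R y)) + cmod (zt ((1 / s n) *\<^sub>R y) - zt y)"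
   by (rule norm_triangle_ineq)
  also have "... <= (real ?d * h n) * M + L * (h n * (2 * b))"
  proof (intro add_mono)
   show "cmod (complex_of_real ((1 / s n) ^ ?d - 1) * zt ((1 / s n) *\<^sub>R y)) <= (real ?d * h n) * M"
    unfolding norm_mult using p2 M h[of n] by (intro mult_mono) auto
   have "(1 / s n) *\<^sub>R y - y = (1 / s n - 1) *\<^sub>R y" by (simp add: scaleR_diff_left)
   then have "norm ((1 / s n) *\<^sub>R y - y) = (1 - 1 / s n) * norm y" using si by simp
   also have "... <= h n * (2 * b)" using si True h[of n] by (intro mult_mono) auto
   finally show "cmod (zt ((1 / s n) *\<^sub>R y) - zt y) <= L * (h n * (2 * b))"
    using L(2)[of "(1 / s n) *\<^sub>R y" y] L(1) by (meson mult_left_mono order_trans less_imp_le)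
  qed
  also have "... = (?d * M + L * (2 * b)) * h n" by (simp add: algebra_simps)
  finally have "cmod ((of_real ((1 / s n) ^ ?d) * zt ((1 / s n) *\<^sub>R y) - zt y) / of_real (h n)) <= ?d * M + L * (2 * b)"
   using h[of n] by (simp add: norm_divide pos_divide_le_eq)
  then have "norm (r n y) <= C * (?d * M + L * (2 * b))"
   unfolding r_def norm_mult using Wb[OF True] C by (intro mult_mono) auto
  then show ?thesis using True by simp
 qed
 have DCT2: "(%n. LINT y|lborel. r n y) \<longlonglongrightarrow> (LINT y|lborel. E y)"
  by (rule integral_dominated_convergence[OF Em rm fin[of "C * (?d * M + L * (2 * b))" "2 * b"] AE_I2[OF rlim] AE_I2[OF rb]])
 show "integrable lborel (%y. frechet_derivative w (at y) y * zt y)" using DCT1(1) by (simp add: D_def[abs_def])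
 have "(LINT y|lborel. D y) = (LINT y|lborel. E y)"
  using LIMSEQ_unique[OF DCT1(2)] DCT2 unfolding qr by blast
 then show "(LINT y|lborel. frechet_derivative w (at y) y * zt y) = - (LINT y|lborel. W y * (euler zt y + of_nat DIM('a) * zt y))"
  by (simp add: D_def E_def)
qed

text \<open>Only values of \<open>g\<close> within distance \<open>eps\<close> of \<open>x\<close>
  matter. If the integrand is not integrable, the default value zero makes the bound
  trivial.\<close>

lemma conv_bound:
 fixes g K :: "'a::euclidean_space => complex"
 assumes K: "integrable lborel K" and AE: "AE y in lborel. norm (x - y) < eps --> cmod (g y) <= S"
  and supp: "!!z. norm z >= eps ==> K z = 0" and S: "S >= 0"
 shows "cmod (LINT y|lborel. g y * K (x - y)) <= S * (LINT y|lborel. cmod (K y))"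
proof -
 have Km[measurable]: "K \<in> borel_measurable borel" using K by auto
 have I: "integrable lborel (%y. cmod (K (x - y)))"
  using integrable_distr_eq[of "%y. x - y" lborel borel "%y. cmod (K y)"] integrable_norm[OF K]
  by (simp add: lborel_distr_reflect)
 have E: "(LINT y|lborel. cmod (K (x - y))) = (LINT y|lborel. cmod (K y))"
  using integral_distr[of "%y. x - y" lborel borel "%y. cmod (K y)"] by (simp add: lborel_distr_reflect)
 show ?thesis
 proof (cases "integrable lborel (%y. g y * K (x - y))")
  case True
  have "cmod (LINT y|lborel. g y * K (x - y)) <= (LINT y|lborel. cmod (g y * K (x - y)))"
   by (rule integral_norm_bound)
  also have "... <= (LINT y|lborel. S * cmod (K (x - y)))"
  proof (rule integral_mono_AE)
   show "AE y in lborel. cmod (g y * K (x - y)) <= S * cmod (K (x - y))"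
    using AE
   proof eventually_elim
    fix y assume "norm (x - y) < eps --> cmod (g y) <= S"
    then show "cmod (g y * K (x - y)) <= S * cmod (K (x - y))"
     using supp[of "x - y"] by (cases "norm (x - y) < eps") (auto simp: norm_mult mult_right_mono)
   qed
  qed (use True I in auto)
  also have "... = S * (LINT y|lborel. cmod (K y))" by (simp add: E)
  finally show ?thesis .
 next
  case False
  then show ?thesis using S by (simp add: not_integrable_integral_eq)
 qed
qed

lemma powr_half_bound:
 fixes p x y :: real
 assumes "p <= 0" "x > 0" "y >= x / 2"
 shows "y powr p <= (1 / 2) powr p * x powr p"
proof -
 have "y powr p <= (x / 2) powr p" using assms by (intro powr_mono2') auto
 also have "... = (1 / 2) powr p * x powr p" using assms by (subst powr_mult[symmetric]) auto
 finally show ?thesis .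
qed

text \<open>In \<open>x . grad\<close> of the convolution, \<open>x\<close> is split as
  \<open>(x - y) + y\<close>. The first part is a convolution with \<open>euler\<close> of the
  kernel; in the second, the dilation identity moves the derivative to \<open>w\<close>. All terms
  except the radiation defect of \<open>w\<close> are of order \<open>|x|^p\<close>, one power below
  what the radiation condition sees.\<close>

lemma radiating_moll:
 fixes U w :: "'a::euclidean_space => complex" and p kp C r1 eps :: real
 assumes U: "loc_int U" and eps: "0 < eps" "eps <= 1" and p: "p <= 0" and kp: "kp > 0"
  and r1: "r1 > 0" and C: "C >= 0"
  and diff: "!!y. norm y >= r1 ==> w differentiable (at y)"
  and AE: "AE y in lborel. norm y >= r1 --> U y = w y"
  and dec: "!!y. norm y >= r1 ==> cmod (w y) <= C * norm y powr p"
  and rad: "!!\<eta>. \<eta> > 0 ==> \<exists>r. \<forall>y. norm y >= r -->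
    cmod (frechet_derivative w (at y) y - \<i> * of_real (kp * norm y) * w y) <= \<eta> * norm y * norm y powr p"
 shows "\<exists>B r. B >= 0 & (\<forall>x. norm x >= r --> cmod (conv U (moll eps) x) <= B * norm x powr p &
   (\<forall>b\<in>Basis. cmod (pd b (conv U (moll eps)) x) <= B * norm x powr p))" (is ?thesis1)
  and "\<forall>\<eta>>0. \<exists>r. \<forall>x. norm x >= r -->
   cmod (euler (conv U (moll eps)) x - \<i> * of_real (kp * norm x) * conv U (moll eps) x) <= \<eta> * norm x * norm x powr p" (is ?thesis2)
proof -
 let ?K = "moll eps :: 'a => complex"
 define u where "u = conv U ?K"
 note K = test_function_moll[OF eps(1), where 'a='a]
 have smK: "smooth ?K" using K by (rule test_function_smooth)
 define c2 where "c2 = (1 / 2 :: real) powr p"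
 have c2: "c2 > 0" by (simp add: c2_def)
 \<comment> \<open>For \<open>|x| \<ge> 2 r1 + 4\<close>, every \<open>y\<close> within distance 2
   of \<open>x\<close> satisfies both \<open>|y| \<ge> |x| / 2\<close> and
   \<open>|y| \<ge> r1\<close>.\<close>
 have near: "AE y in lborel. norm (x - y) < eps + 1 --> cmod (U y) <= C * (c2 * norm x powr p)" if x: "norm x >= 2 * r1 + 4" for x
  using AE
 proof eventually_elim
  fix y assume y: "norm y >= r1 --> U y = w y"
  show "norm (x - y) < eps + 1 --> cmod (U y) <= C * (c2 * norm x powr p)"
  proof
   assume "norm (x - y) < eps + 1"
   moreover have "norm x <= norm y + norm (x - y)" by (metis norm_triangle_sub)
   ultimately have ny: "norm y >= norm x / 2" "norm y >= r1" using x eps r1 by linarith+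
   have "cmod (U y) <= C * norm y powr p" using y dec ny by simp
   also have "... <= C * (c2 * norm x powr p)"
    unfolding c2_def using p ny x r1 C by (intro mult_left_mono powr_half_bound) auto
   finally show "cmod (U y) <= C * (c2 * norm x powr p)" .
  qed
 qed
 have decay: "cmod (LINT y|lborel. U y * L (x - y)) <= C * (c2 * norm x powr p) * (LINT y|lborel. cmod (L y))"
  if "norm x >= 2 * r1 + 4" "integrable lborel L" "!!z. norm z >= eps + 1 ==> L z = 0" for x L
  by (rule conv_bound[OF that(2) near[OF that(1)] that(3)]) (use C c2 in auto)
 have pdz: "pd b ?K z = 0" if "norm z > eps" for b z
  using that by (intro pd_eq_0_outside[of "cball 0 eps"]) (auto simp: moll_outside eps)
 have pdz': "pd b ?K z = 0" if "norm z >= eps + 1" for b z using pdz[of z b] that by simp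
 have Kz': "?K z = 0" if "norm z >= eps + 1" for z using moll_outside[OF eps(1), of z] that by simp
 have eulz': "euler ?K z = 0" if "norm z >= eps + 1" for z unfolding euler_def using pdz'[OF that] by simp
 have int_pd: "integrable lborel (pd b ?K)" if "b \<in> Basis" for b
  using test_function_integrable test_function_pd[OF K that] by blast
 have teul: "test_function UNIV (euler ?K)"
  by (rule test_function_UNIVI[OF smooth_euler[OF smK] eulz'])
 have int_eul: "integrable lborel (euler ?K)" using teul by (rule test_function_integrable)
 have KN: "(LINT y|lborel. cmod (?K y)) = 1"
 proof -
  have "(LINT y|lborel. cmod (?K (0 - y))) = 1"
   using integral_moll_reflect(3)[OF eps(1), of "0::'a"] integral_moll_reflect(1)[OF eps(1), of "0::'a"]
   by (subst integral_eq_nn_integral) auto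
  moreover have "?K (0 - y) = ?K y" for y by (simp add: moll_def radial_def)
  ultimately show ?thesis by simp
 qed
 have u_dec: "cmod (u x) <= C * (c2 * norm x powr p)" if "norm x >= 2 * r1 + 4" for x
  using decay[OF that integrable_moll[OF eps(1)] Kz'] KN by (simp add: u_def conv_def)
 define S where "S = (\<Sum>b\<in>Basis. LINT y|lborel. cmod (pd b ?K y))"
 have S0: "(LINT y|lborel. cmod (pd b ?K y)) <= S" if "b \<in> Basis" for b
  unfolding S_def by (rule member_le_sum[OF that]) auto
 have S: "S >= 0" unfolding S_def by (intro sum_nonneg integral_nonneg_AE) auto
 have pd_dec: "cmod (pd b u x) <= C * c2 * S * norm x powr p" if "norm x >= 2 * r1 + 4" "b \<in> Basis" for b x
 proof -
  have "cmod (pd b u x) <= C * (c2 * norm x powr p) * (LINT y|lborel. cmod (pd b ?K y))"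
   using decay[OF that(1) int_pd[OF that(2)] pdz'] by (simp add: u_def pd_conv[OF U K that(2)] conv_def)
  also have "... <= C * (c2 * norm x powr p) * S" using S0[OF that(2)] C c2 by (intro mult_left_mono) auto
  finally show ?thesis by (simp add: mult_ac)
 qed
 show ?thesis1
 proof (intro exI conjI allI impI ballI)
  show "C * c2 * (1 + S) >= 0" using C c2 S by simp
  fix x :: 'a assume x: "norm x >= 2 * r1 + 4"
  have m: "C * c2 * 1 <= C * c2 * (1 + S)" "C * c2 * S <= C * c2 * (1 + S)" using C c2 S by (intro mult_left_mono; simp)+
  show "cmod (conv U ?K x) <= C * c2 * (1 + S) * norm x powr p"
   using u_dec[OF x] mult_right_mono[OF m(1), of "norm x powr p"] by (simp add: u_def mult.assoc)
  show "cmod (pd b (conv U ?K) x) <= C * c2 * (1 + S) * norm x powr p" if "b \<in> Basis" for b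
   using pd_dec[OF x that] mult_right_mono[OF m(2), of "norm x powr p"] by (simp add: u_def)
 qed
 obtain ra where ra: "!!y. norm y >= ra ==> cmod (frechet_derivative w (at y) y - \<i> * of_real (kp * norm y) * w y) <= 1 * norm y * norm y powr p"
  using rad[of 1] by auto
 define N where "N = (LINT y|lborel. cmod (euler ?K y))"
 have N: "N >= 0" unfolding N_def by (intro integral_nonneg_AE) auto
 define C3 where "C3 = c2 * C * (N + DIM('a) + kp)"
 have C3: "C3 >= 0" using c2 C N kp by (simp add: C3_def)
 have main: "cmod (euler u x - \<i> * of_real (kp * norm x) * u x) <= C3 * norm x powr p + 2 * \<eta> * c2 * norm x * norm x powr p"
  if \<eta>: "\<eta> > 0" and rb: "!!y. norm y >= rb ==> cmod (frechet_derivative w (at y) y - \<i> * of_real (kp * norm y) * w y) <= \<eta> * norm y * norm y powr p"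
   and x: "norm x >= 2 * r1 + 4" "norm x >= ra + 1" "norm x >= rb + 1" for x \<eta> rb
 proof -
  define zt where "zt = (%y. ?K (x + (-1) *\<^sub>R y))"
  have smzt: "smooth zt" unfolding zt_def by (rule smooth_affine[OF smK])
  define a b where "a = norm x - eps" and "b = norm x + eps"
  have a: "a > 0" "a >= r1" "a >= ra" "a >= rb" using x eps r1 by (auto simp: a_def)
  have near': "norm y >= a" "norm y <= b" if "norm (x - y) <= eps" for y
  proof -
   have "norm x <= norm y + norm (x - y)" "norm y <= norm x + norm (x - y)"
    by (metis norm_triangle_sub, metis norm_minus_commute norm_triangle_sub)
   then show "norm y >= a" "norm y <= b" using that by (auto simp: a_def b_def)
  qed
  have supp: "zt y = 0" if "norm y < a \<or> norm y > b" for y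
  proof -
   have "norm (x - y) >= eps" using near'[of y] that by (cases "norm (x - y) <= eps") auto
   then show ?thesis by (simp add: zt_def moll_outside[OF eps(1)])
  qed
  have b0: "b > 0" using a eps by (simp add: a_def b_def)
  have tzt: "test_function UNIV zt" by (rule test_function_UNIVI[OF smzt, of "b + 1"]) (use supp in auto)
  define W where "W y = (if norm y >= a then w y else 0)" for y
  \<comment> \<open>Any finite bound on the shell serves the dilation identity; its growth with
    \<open>x\<close> is harmless because the identity itself does not contain it.\<close>
  define C0 where "C0 = C * a powr p + (2 * b + kp * (2 * b) * C) * a powr p"
  have C0: "C0 >= 0" using C b0 kp by (auto simp: C0_def intro!: add_nonneg_nonneg mult_nonneg_nonneg)
  have bd: "cmod (w y) <= C0" "cmod (frechet_derivative w (at y) y) <= C0" if y: "a <= norm y" "norm y <= 2 * b" for y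
  proof -
   have pw: "norm y powr p <= a powr p" using y a p by (intro powr_mono2') auto
   have 1: "cmod (w y) <= C * a powr p"
    using dec[of y] y a(2) mult_left_mono[OF pw C] by linarith
   have nn: "0 <= (2 * b + kp * (2 * b) * C) * a powr p" using C b0 kp by (auto intro!: add_nonneg_nonneg mult_nonneg_nonneg)
   then show "cmod (w y) <= C0" using 1 by (simp add: C0_def)
   have 2: "norm y * norm y powr p <= (2 * b) * a powr p" using pw y b0 by (intro mult_mono) auto
   have 3: "cmod (\<i> * of_real (kp * norm y) * w y) <= kp * (2 * b) * (C * a powr p)"
   proof -
    have "cmod (\<i> * of_real (kp * norm y) * w y) = (kp * norm y) * cmod (w y)" using kp by (simp add: norm_mult)
    also have "... <= kp * (2 * b) * (C * a powr p)" by (intro mult_mono) (use 1 y kp C b0 in auto)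
    finally show ?thesis .
   qed
   have "cmod (frechet_derivative w (at y) y) <= cmod (frechet_derivative w (at y) y - \<i> * of_real (kp * norm y) * w y) + cmod (\<i> * of_real (kp * norm y) * w y)"
    by (metis add.commute norm_triangle_sub)
   also have "... <= (2 * b) * a powr p + kp * (2 * b) * (C * a powr p)"
    using ra[of y] 2 3 y a(3) by simp
   also have "... <= C0" using C by (simp add: C0_def algebra_simps)
   finally show "cmod (frechet_derivative w (at y) y) <= C0" .
  qed
  have D: "integrable lborel (%y. frechet_derivative w (at y) y * zt y)"
   "(LINT y|lborel. frechet_derivative w (at y) y * zt y) = - (LINT y|lborel. W y * (euler zt y + of_nat DIM('a) * zt y))"
   using dilation_identity[OF a(1) tzt supp diff bd C0 b0 W_def] a(2) by auto
  have pdzt: "pd c zt y = - pd c ?K (x - y)" for c y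
   unfolding zt_def by (subst pd_affine[OF smK]) simp
  have eulzt: "euler zt y = - (\<Sum>c\<in>Basis. complex_of_real (y \<bullet> c) * pd c ?K (x - y))" for y
   unfolding euler_def pdzt by (simp add: sum_negf)
  have eztz: "euler zt y = 0" if "norm y < a" for y
  proof -
   have "norm (x - y) > eps" using near'[of y] that by (cases "norm (x - y) <= eps") auto
   then show ?thesis unfolding eulzt using pdz by simp
  qed
  have UW: "AE y in lborel. norm y >= a --> U y = W y"
   using AE by eventually_elim (use a in \<open>auto simp: W_def\<close>)
  have I1: "integrable lborel (%y. U y * euler ?K (x - y))"
   by (rule integrable_loc_int_test[OF U test_function_continuous[OF teul] eulz'])
  obtain Re where Re: "!!y. norm y >= Re ==> euler zt y = 0"
  proof -
   have "euler zt y = 0" if "norm y >= b + 1" for y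
   proof -
    have "norm (x - y) > eps" using near'[of y] that by (cases "norm (x - y) <= eps") auto
    then show ?thesis unfolding eulzt using pdz by simp
   qed
   then show ?thesis using that by blast
  qed
  have tezt: "test_function UNIV (euler zt)" by (rule test_function_UNIVI[OF smooth_euler[OF smzt] Re])
  have int_test: "integrable lborel (%y. U y * g y)" if tg: "test_function UNIV g" for g
  proof -
   obtain M where "!!y. cmod (g y) <= M" by (rule test_function_bounded[OF tg]) (rule that)
   moreover obtain R where "!!y. norm y >= R ==> g y = 0" by (rule test_function_cball[OF tg]) (rule that)
   ultimately show ?thesis
    by (intro integrable_loc_int_mult[OF U borel_measurable_continuous_onI[OF test_function_continuous[OF tg]]])
  qed
  note I2 = int_test[OF tezt] note I3 = int_test[OF tzt]
  have eu: "euler u x = conv U (euler ?K) x - (LINT y|lborel. U y * euler zt y)"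
  proof -
   have "euler u x = (\<Sum>c\<in>Basis. complex_of_real (x \<bullet> c) * conv U (pd c ?K) x)"
    unfolding euler_def u_def by (rule sum.cong) (simp_all add: pd_conv[OF U K])
   also have "... = (\<Sum>c\<in>Basis. LINT y|lborel. complex_of_real (x \<bullet> c) * (U y * pd c ?K (x - y)))"
    by (simp add: conv_def)
   also have "... = (LINT y|lborel. (\<Sum>c\<in>Basis. complex_of_real (x \<bullet> c) * (U y * pd c ?K (x - y))))"
   proof (rule Bochner_Integration.integral_sum[symmetric], rule integrable_mult_right)
    fix c :: 'a assume "c \<in> Basis"
    then show "integrable lborel (%y. U y * pd c ?K (x - y))"
     by (intro integrable_loc_int_test[OF U test_function_continuous[OF test_function_pd[OF K]] pdz'])
   qed
   also have "... = (LINT y|lborel. U y * euler ?K (x - y) - U y * euler zt y)"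
   proof (rule Bochner_Integration.integral_cong[OF refl])
    fix y
    have "(\<Sum>c\<in>Basis. complex_of_real (x \<bullet> c) * (U y * pd c ?K (x - y)))
      = (\<Sum>c\<in>Basis. U y * (complex_of_real ((x - y) \<bullet> c) * pd c ?K (x - y)) + U y * (complex_of_real (y \<bullet> c) * pd c ?K (x - y)))"
     by (rule sum.cong) (simp_all add: inner_diff_left algebra_simps)
    also have "... = U y * euler ?K (x - y) - U y * euler zt y"
     unfolding eulzt by (simp add: sum.distrib euler_def sum_distrib_left)
    finally show "(\<Sum>c\<in>Basis. complex_of_real (x \<bullet> c) * (U y * pd c ?K (x - y))) = U y * euler ?K (x - y) - U y * euler zt y" .
   qed
   also have "... = conv U (euler ?K) x - (LINT y|lborel. U y * euler zt y)"
    using I1 I2 by (simp add: conv_def)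
   finally show ?thesis .
  qed
  have UWm: "(LINT y|lborel. U y * (euler zt y + of_nat DIM('a) * zt y)) = (LINT y|lborel. W y * (euler zt y + of_nat DIM('a) * zt y))"
  proof (rule integral_cong_AE)
   have cW: "continuous_on {y. norm y >= a} w"
    using a(2) by (intro continuous_at_imp_continuous_on ballI differentiable_imp_continuous_within diff) simp
   have "(%y. indicator {y. norm y >= a} y *\<^sub>R w y) \<in> borel_measurable borel"
    by (rule borel_measurable_continuous_on_indicator[OF _ cW]) simp
   also have "(%y. indicator {y. norm y >= a} y *\<^sub>R w y) = W" by (auto simp: fun_eq_iff indicator_def W_def)
   finally have [measurable]: "W \<in> borel_measurable borel" .
   note [measurable] = borel_measurable_continuous_onI[OF test_function_continuous[OF tezt]]
    borel_measurable_continuous_onI[OF test_function_continuous[OF tzt]] loc_int_measurable[OF U]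
   show "(%y. U y * (euler zt y + of_nat DIM('a) * zt y)) \<in> borel_measurable lborel"
    "(%y. W y * (euler zt y + of_nat DIM('a) * zt y)) \<in> borel_measurable lborel" by measurable
   show "AE y in lborel. U y * (euler zt y + of_nat DIM('a) * zt y) = W y * (euler zt y + of_nat DIM('a) * zt y)"
    using UW
   proof eventually_elim
    fix y assume "norm y >= a --> U y = W y"
    then show "U y * (euler zt y + of_nat DIM('a) * zt y) = W y * (euler zt y + of_nat DIM('a) * zt y)"
     using eztz[of y] supp[of y] by (cases "norm y >= a") auto
   qed
  qed
  have ux: "u x = (LINT y|lborel. U y * zt y)" by (simp add: u_def conv_def zt_def)
  have split: "(LINT y|lborel. U y * (euler zt y + of_nat DIM('a) * zt y)) = (LINT y|lborel. U y * euler zt y) + of_nat DIM('a) * u x"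
  proof -
   have "(LINT y|lborel. U y * (euler zt y + of_nat DIM('a) * zt y)) = (LINT y|lborel. U y * euler zt y + of_nat DIM('a) * (U y * zt y))"
    by (simp add: algebra_simps)
   then show ?thesis using I2 I3 by (simp add: ux)
  qed
  have ux2: "u x = (LINT y|lborel. w y * zt y)" and I4: "integrable lborel (%y. w y * zt y)"
  proof -
   have cW: "continuous_on {y. norm y >= a} w"
    using a(2) by (intro continuous_at_imp_continuous_on ballI differentiable_imp_continuous_within diff) simp
   have "(%y. indicator {y. norm y >= a} y *\<^sub>R w y) \<in> borel_measurable borel"
    by (rule borel_measurable_continuous_on_indicator[OF _ cW]) simp
   then have "(%y. (indicator {y. norm y >= a} y *\<^sub>R w y) * zt y) \<in> borel_measurable borel"
    by (rule borel_measurable_times) (rule borel_measurable_continuous_onI[OF test_function_continuous[OF tzt]])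
   moreover have "(%y. w y * zt y) = (%y. (indicator {y. norm y >= a} y *\<^sub>R w y) * zt y)"
    using supp by (auto simp: fun_eq_iff indicator_def)
   ultimately have m: "(%y. w y * zt y) \<in> borel_measurable lborel" by simp
   have AEq: "AE y in lborel. U y * zt y = w y * zt y"
    using AE
   proof eventually_elim
    fix y assume "norm y >= r1 --> U y = w y"
    then show "U y * zt y = w y * zt y" using supp[of y] a(2) by (cases "norm y >= a") auto
   qed
   have m2: "(%y. U y * zt y) \<in> borel_measurable lborel" using I3 by auto
   show "integrable lborel (%y. w y * zt y)" using integrable_cong_AE[OF m2 m AEq] I3 by simp
   show "u x = (LINT y|lborel. w y * zt y)" unfolding ux by (rule integral_cong_AE[OF m2 m AEq])
  qed
  \<comment> \<open>The radiation defect of \<open>w\<close> with the radius frozen at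
    \<open>|x|\<close>. Since the radii of \<open>x\<close> and \<open>y\<close> differ by at most 1
    on the support of the kernel, unfreezing costs at most \<open>kp |w y|\<close>.\<close>
  define J where "J = (LINT y|lborel. (frechet_derivative w (at y) y - \<i> * of_real (kp * norm x) * w y) * ?K (x - y))"
  have Jeq: "J = (LINT y|lborel. frechet_derivative w (at y) y * zt y) - \<i> * of_real (kp * norm x) * u x"
  proof -
   have "J = (LINT y|lborel. frechet_derivative w (at y) y * zt y - \<i> * of_real (kp * norm x) * (w y * zt y))"
    unfolding J_def by (simp add: zt_def left_diff_distrib mult.assoc)
   then show ?thesis using D(1) I4 by (simp add: ux2)
  qed
  have key: "euler u x - \<i> * of_real (kp * norm x) * u x = conv U (euler ?K) x + of_nat DIM('a) * u x + J"
   unfolding Jeq eu D(2) UWm[symmetric] split by simp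
  have b1: "cmod (conv U (euler ?K) x) <= C * (c2 * norm x powr p) * N"
   unfolding conv_def N_def by (rule decay[OF x(1) int_eul eulz'])
  have b2: "cmod (of_nat DIM('a) * u x) <= real DIM('a) * (C * (c2 * norm x powr p))"
   unfolding norm_mult using u_dec[OF x(1)] by (simp add: mult_left_mono)
  have b3: "cmod J <= (2 * \<eta> * c2 * norm x * norm x powr p + kp * (C * (c2 * norm x powr p))) * 1"
   unfolding J_def KN[symmetric]
  proof (rule conv_bound[OF integrable_moll[OF eps(1)], where eps=eps])
   show "AE y in lborel. norm (x - y) < eps --> cmod (frechet_derivative w (at y) y - \<i> * of_real (kp * norm x) * w y)
     <= 2 * \<eta> * c2 * norm x * norm x powr p + kp * (C * (c2 * norm x powr p))"
   proof (rule AE_I2, rule impI)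
    fix y assume xy: "norm (x - y) < eps"
    then have y: "norm y >= a" "norm y <= b" using near'[of y] by auto
    have ny: "norm y >= norm x / 2" "norm y <= 2 * norm x" "\<bar>norm y - norm x\<bar> <= 1"
     using y x eps r1 by (auto simp: a_def b_def)
    have pw: "norm y powr p <= c2 * norm x powr p"
     unfolding c2_def using p ny x r1 by (intro powr_half_bound) auto
    have "frechet_derivative w (at y) y - \<i> * of_real (kp * norm x) * w y
     = (frechet_derivative w (at y) y - \<i> * of_real (kp * norm y) * w y) + \<i> * of_real (kp * (norm y - norm x)) * w y"
     by (simp add: algebra_simps)
    also have "cmod ... <= cmod (frechet_derivative w (at y) y - \<i> * of_real (kp * norm y) * w y) + cmod (\<i> * of_real (kp * (norm y - norm x)) * w y)"
     by (rule norm_triangle_ineq)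
    finally have t1: "cmod (frechet_derivative w (at y) y - \<i> * of_real (kp * norm x) * w y)
     <= cmod (frechet_derivative w (at y) y - \<i> * of_real (kp * norm y) * w y) + cmod (\<i> * of_real (kp * (norm y - norm x)) * w y)" .
    have t2: "cmod (frechet_derivative w (at y) y - \<i> * of_real (kp * norm y) * w y) <= \<eta> * norm y * norm y powr p"
     using rb[of y] y a(4) by simp
    have "cmod (\<i> * of_real (kp * (norm y - norm x)) * w y) = kp * \<bar>norm y - norm x\<bar> * cmod (w y)"
     using kp by (simp add: norm_mult abs_mult del: of_real_mult of_real_diff)
    also have "... <= kp * 1 * (C * (c2 * norm x powr p))"
    proof (intro mult_mono)
     show "cmod (w y) <= C * (c2 * norm x powr p)"
      using dec[of y] y a(2) mult_left_mono[OF pw C] by linarith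
    qed (use kp ny C c2 in auto)
    finally have t3: "cmod (\<i> * of_real (kp * (norm y - norm x)) * w y) <= kp * 1 * (C * (c2 * norm x powr p))" .
    have "\<eta> * norm y * norm y powr p <= \<eta> * (2 * norm x) * (c2 * norm x powr p)"
     using \<eta> ny pw by (intro mult_mono) auto
    then have t4: "\<eta> * norm y * norm y powr p <= 2 * \<eta> * c2 * norm x * norm x powr p" by (simp add: mult_ac)
    show "cmod (frechet_derivative w (at y) y - \<i> * of_real (kp * norm x) * w y)
     <= 2 * \<eta> * c2 * norm x * norm x powr p + kp * (C * (c2 * norm x powr p))"
     using t1 t2 t3 t4 by simp
   qed
  qed (use moll_outside[OF eps(1)] \<eta> c2 kp C in auto)
  have "cmod (euler u x - \<i> * of_real (kp * norm x) * u x)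
    <= cmod (conv U (euler ?K) x) + cmod (of_nat DIM('a) * u x) + cmod J"
   unfolding key by (intro norm_triangle_le add_mono order_refl)
  also have "... <= C3 * norm x powr p + 2 * \<eta> * c2 * norm x * norm x powr p"
   using b1 b2 b3 by (simp add: C3_def algebra_simps)
  finally show ?thesis .
 qed
 show ?thesis2
 proof (intro allI impI)
  fix \<eta> :: real assume \<eta>: "\<eta> > 0"
  define \<eta>' where "\<eta>' = \<eta> / (4 * c2)"
  have \<eta>': "\<eta>' > 0" "2 * \<eta>' * c2 = \<eta> / 2" using \<eta> c2 by (auto simp: \<eta>'_def)
  obtain rb where rb: "!!y. norm y >= rb ==> cmod (frechet_derivative w (at y) y - \<i> * of_real (kp * norm y) * w y) <= \<eta>' * norm y * norm y powr p"
   using rad[OF \<eta>'(1)] by auto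
  show "\<exists>r. \<forall>x. norm x >= r --> cmod (euler (conv U ?K) x - \<i> * of_real (kp * norm x) * conv U ?K x) <= \<eta> * norm x * norm x powr p"
  proof (intro exI[of _ "max (max (2 * r1 + 4) (ra + 1)) (max (rb + 1) (2 * C3 / \<eta>))"] allI impI)
   fix x :: 'a assume x: "norm x >= max (max (2 * r1 + 4) (ra + 1)) (max (rb + 1) (2 * C3 / \<eta>))"
   have "cmod (euler u x - \<i> * of_real (kp * norm x) * u x) <= C3 * norm x powr p + 2 * \<eta>' * c2 * norm x * norm x powr p"
    by (rule main[OF \<eta>'(1) rb]) (use x in auto)
   moreover have "C3 <= \<eta> / 2 * norm x" using x \<eta> by (simp add: field_simps)
   then have "C3 * norm x powr p <= \<eta> / 2 * norm x * norm x powr p" by (intro mult_right_mono) auto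
   moreover have "2 * \<eta>' * c2 * norm x * norm x powr p = \<eta> / 2 * norm x * norm x powr p" using \<eta>'(2) by simp
   moreover have "\<eta> / 2 * norm x * norm x powr p + \<eta> / 2 * norm x * norm x powr p = \<eta> * norm x * norm x powr p" by simp
   ultimately show "cmod (euler (conv U ?K) x - \<i> * of_real (kp * norm x) * conv U ?K x) <= \<eta> * norm x * norm x powr p"
    unfolding u_def by linarith
  qed
 qed
qed

section \<open>Propagating modes\<close>

text \<open>Recentring at \<open>x0\<close> adds the derivative \<open>x0 . grad u\<close> and the
  phase error \<open>kp (|x0 + x| - |x|) u\<close>. Both are of order \<open>|x|^p\<close>, hence
  negligible; the first is the reason why all partial derivatives must be known to decay.\<close>

lemma shifted_radiating:
 fixes u :: "'a::euclidean_space => complex" and x0 :: 'a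
 assumes sm: "smooth u" and kp: "kp > 0" and p: "p <= 0" and B: "B >= 0"
  and bd: "!!x. norm x >= r ==> cmod (u x) <= B * norm x powr p"
   "!!x b. norm x >= r ==> b \<in> Basis ==> cmod (pd b u x) <= B * norm x powr p"
  and rad: "!!\<eta>. \<eta> > 0 ==> \<exists>r. \<forall>x. norm x >= r -->
    cmod (euler u x - \<i> * of_real (kp * norm x) * u x) <= \<eta> * norm x * norm x powr p"
  and v: "v = (%x. u (x0 + 1 *\<^sub>R x))"
 shows "\<exists>B r. \<forall>x. norm x >= r --> cmod (v x) <= B * norm x powr p & cmod (euler v x) <= B * norm x * norm x powr p"
  and "!!\<eta>. \<eta> > 0 ==> \<exists>r. \<forall>x. norm x >= r -->
    cmod (euler v x - \<i> * of_real (kp * norm x) * v x) <= \<eta> * norm x * norm x powr p"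
proof -
 let ?d = "real DIM('a)"
 have d1: "?d >= 1" using DIM_positive[where 'a='a] by linarith
 define c where "c = 2 powr (- p)"
 have c: "c > 0" by (simp add: c_def)
 have pdv: "pd b v x = pd b u (x0 + x)" for b x
  unfolding v pd_affine[OF sm] by simp
 have near: "norm (x0 + x) >= norm x / 2" "norm (x0 + x) <= 2 * norm x" if "norm x >= 2 * norm x0" for x
  using that norm_triangle_ineq[of x0 x] norm_triangle_ineq4[of "x0 + x" x0] by auto
 have pw: "norm (x0 + x) powr p <= c * norm x powr p" if "norm x >= 2 * norm x0" "norm x > 0" for x
 proof -
  have "norm (x0 + x) powr p <= (norm x / 2) powr p" using near[OF that(1)] that p by (intro powr_mono2') auto
  also have "... = c * norm x powr p" using that by (simp add: powr_divide c_def powr_minus field_simps)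
  finally show ?thesis .
 qed
 define r' where "r' = max 1 (max (2 * norm x0) (2 * \<bar>r\<bar>))"
 have r': "norm x >= 2 * norm x0" "norm x > 0" "norm (x0 + x) >= r" if "norm x >= r'" for x
  using that near(1)[of x] by (auto simp: r'_def)
 have bu: "cmod (u (x0 + x)) <= B * (c * norm x powr p)" if "norm x >= r'" for x
  using bd(1)[OF r'(3)[OF that]] mult_left_mono[OF pw[OF r'(1)[OF that] r'(2)[OF that]] B] by linarith
 have bp: "cmod (pd b u (x0 + x)) <= B * (c * norm x powr p)" if "norm x >= r'" "b \<in> Basis" for x b
  using bd(2)[OF r'(3)[OF that(1)] that(2)] mult_left_mono[OF pw[OF r'(1)[OF that(1)] r'(2)[OF that(1)]] B] by linarith
 have eu: "cmod (\<Sum>b\<in>Basis. complex_of_real (z \<bullet> b) * pd b u (x0 + x)) <= ?d * (norm z * (B * (c * norm x powr p)))"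
  if "norm x >= r'" for x z
 proof -
  have "cmod (\<Sum>b\<in>Basis. complex_of_real (z \<bullet> b) * pd b u (x0 + x)) <= (\<Sum>b\<in>(Basis::'a set). norm z * (B * (c * norm x powr p)))"
  proof (rule sum_norm_le)
   fix b :: 'a assume b: "b \<in> Basis"
   show "cmod (complex_of_real (z \<bullet> b) * pd b u (x0 + x)) <= norm z * (B * (c * norm x powr p))"
    unfolding norm_mult norm_of_real using Basis_le_norm[OF b, of z] bp[OF that b] by (intro mult_mono) auto
  qed
  then show ?thesis by simp
 qed
 show "\<exists>B r. \<forall>x. norm x >= r --> cmod (v x) <= B * norm x powr p & cmod (euler v x) <= B * norm x * norm x powr p"
 proof (rule exI[of _ "?d * (B * c)"], rule exI[of _ r'], intro allI impI conjI)
  fix x :: 'a assume x: "r' <= norm x"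
  have "1 * (B * (c * norm x powr p)) <= ?d * (B * (c * norm x powr p))"
   using d1 B c by (intro mult_right_mono) auto
  then show "cmod (v x) <= ?d * (B * c) * norm x powr p" using bu[OF x] by (simp add: v mult.assoc)
  show "cmod (euler v x) <= ?d * (B * c) * norm x * norm x powr p"
   using eu[OF x, of x] unfolding euler_def pdv by (simp add: mult_ac)
 qed
 fix \<eta> :: real assume \<eta>: "\<eta> > 0"
 define D where "D = (?d + kp) * (norm x0 * B)"
 have D: "D >= 0" using kp B by (simp add: D_def)
 obtain r2 where r2: "\<forall>x. norm x >= r2 -->
    cmod (euler u x - \<i> * of_real (kp * norm x) * u x) <= (\<eta> / (4 * c)) * norm x * norm x powr p"
  using rad[OF divide_pos_pos[OF \<eta>, of "4 * c"]] c by auto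
 show "\<exists>r. \<forall>x. norm x >= r -->
    cmod (euler v x - \<i> * of_real (kp * norm x) * v x) <= \<eta> * norm x * norm x powr p"
 proof (intro exI[of _ "max r' (max (2 * \<bar>r2\<bar>) (2 * D * c / \<eta>))"] allI impI)
  fix x :: 'a assume x': "max r' (max (2 * \<bar>r2\<bar>) (2 * D * c / \<eta>)) <= norm x"
  then have x: "norm x >= r'" and x2: "norm x >= 2 * \<bar>r2\<bar>" and x3: "2 * D * c / \<eta> <= norm x" by auto
  define z where "z = x0 + x"
  have nz: "norm z >= r2" "norm z <= 2 * norm x" using near[OF r'(1)[OF x]] x2 by (auto simp: z_def)
  define E where "E = c * norm x powr p"
  have E: "E >= 0" using c by (simp add: E_def)
  have e: "euler v x - \<i> * of_real (kp * norm x) * v x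
    = (euler u z - \<i> * of_real (kp * norm z) * u z) - (\<Sum>b\<in>Basis. complex_of_real (x0 \<bullet> b) * pd b u (x0 + x))
     + \<i> * of_real (kp * (norm z - norm x)) * u z"
  proof -
   have "euler v x = euler u z - (\<Sum>b\<in>Basis. complex_of_real (x0 \<bullet> b) * pd b u (x0 + x))"
    unfolding euler_def pdv z_def by (simp add: sum_subtractf[symmetric] inner_add_left algebra_simps)
   then show ?thesis by (simp add: v z_def algebra_simps)
  qed
  have 1: "cmod (euler u z - \<i> * of_real (kp * norm z) * u z) <= (\<eta> / (4 * c)) * (2 * norm x) * E"
  proof -
   have "cmod (euler u z - \<i> * of_real (kp * norm z) * u z) <= (\<eta> / (4 * c)) * norm z * norm z powr p"
    using r2 nz(1) by simp
   also have "... <= (\<eta> / (4 * c)) * (2 * norm x) * E"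
    using pw[OF r'(1)[OF x] r'(2)[OF x]] nz \<eta> c unfolding z_def[symmetric] E_def[symmetric] by (intro mult_mono) auto
   finally show ?thesis .
  qed
  have 2: "cmod (\<Sum>b\<in>Basis. complex_of_real (x0 \<bullet> b) * pd b u (x0 + x)) <= ?d * (norm x0 * (B * E))"
   using eu[OF x, of x0] by (simp add: E_def)
  have "\<bar>norm z - norm x\<bar> <= norm x0" using norm_triangle_ineq3[of z x] by (simp add: z_def)
  then have 3: "cmod (\<i> * of_real (kp * (norm z - norm x)) * u z) <= (kp * norm x0) * (B * E)"
  proof -
   assume n: "\<bar>norm z - norm x\<bar> <= norm x0"
   have "cmod (\<i> * of_real (kp * (norm z - norm x)) * u z) = (kp * \<bar>norm z - norm x\<bar>) * cmod (u z)"
    using kp by (simp add: norm_mult abs_mult del: of_real_mult of_real_diff)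
   also have "... <= (kp * norm x0) * (B * E)"
    by (intro mult_mono) (use n bu[OF x] kp in \<open>auto simp: z_def E_def\<close>)
   finally show ?thesis .
  qed
  have "cmod (euler v x - \<i> * of_real (kp * norm x) * v x) <= (\<eta> / (4 * c)) * (2 * norm x) * E + ?d * (norm x0 * (B * E)) + (kp * norm x0) * (B * E)"
   unfolding e by (intro norm_triangle_le norm_triangle_le_diff add_mono order_refl 1 2 3)
  also have "... = ((\<eta> / 2) * norm x + D * c) * norm x powr p" using c by (simp add: D_def E_def field_simps)
  also have "... <= (\<eta> * norm x) * norm x powr p"
  proof (intro mult_right_mono)
   have "2 * (D * c) <= \<eta> * norm x" using x3 \<eta> by (simp add: pos_divide_le_eq mult_ac)
   moreover have "\<eta> / 2 * norm x = (\<eta> * norm x) / 2" by simp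
   ultimately show "\<eta> / 2 * norm x + D * c <= \<eta> * norm x" by linarith
  qed simp
  finally show "cmod (euler v x - \<i> * of_real (kp * norm x) * v x) <= \<eta> * norm x * norm x powr p" .
 qed
qed

lemma n2_translate:
 assumes [measurable]: "f \<in> borel_measurable borel" "A \<in> sets borel"
 shows "n2 {x. x0 + x \<in> A} (%x. f (x0 + x)) = n2 A f"
proof -
 have "(%y. ennreal ((cmod (f y))^2) * indicator A y) \<in> borel_measurable borel" by measurable
 from nn_integral_translate[OF this, of x0] show ?thesis
  by (simp add: n2_def indicator_def)
qed

text \<open>The constant \<open>4 + 16 (\<alpha> + 1)^2\<close> of the pointwise estimate, times the
  16 by which \<open>kp^2 |v|^2 / 16\<close> is cleared.\<close>

definition propagating_const :: "nat => real" where
 "propagating_const d = 16 * (4 + 16 * ((real d - 1) / 2 + 1)^2)"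

lemma propagating_const_pos: "propagating_const d > 0"
 unfolding propagating_const_def by (simp add: add_pos_nonneg)

text \<open>The smooth estimate is applied to mollified modes recentred at \<open>x0\<close>. The
  bound \<open>eps \<le> R - \<rho>\<close> keeps the mollified source inside the ball of radius
  \<open>R\<close>.\<close>

lemma weak_helm_propagating:
 fixes U F w :: "'a::euclidean_space => complex" and kp R C r1 \<rho> :: real
 defines "p \<equiv> (1 - real DIM('a)) / 2"
 assumes wh: "weak_helm (kp^2) U F" and kp: "kp > 0"
  and F0: "!!y. y \<notin> ball x0 \<rho> ==> F y = 0" and R: "\<rho> > 0" "R > \<rho>" "kp * R >= 1"
  and fin: "!!r. n2 (cball 0 r) U < \<infinity>"
  and r1: "r1 > 0" and C: "C >= 0"
  and diff: "!!y. norm y >= r1 ==> w differentiable (at y)"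
  and AE: "AE y in lborel. norm y >= r1 --> U y = w y"
  and dec: "!!y. norm y >= r1 ==> cmod (w y) <= C * norm y powr p"
  and rad: "!!\<eta>. \<eta> > 0 ==> \<exists>r. \<forall>y. norm y >= r -->
    cmod (frechet_derivative w (at y) y - \<i> * of_real (kp * norm y) * w y) <= \<eta> * norm y * norm y powr p"
 shows "ennreal (kp^2) * n2 (cball x0 R) U <= ennreal (propagating_const DIM('a) * R^2) * n2 UNIV F"
proof (cases "n2 UNIV F = \<infinity>")
 case True
 have "propagating_const DIM('a) * R^2 > 0" using R propagating_const_pos[of "DIM('a)"] by simp
 then have "ennreal (propagating_const DIM('a) * R^2) ~= 0" by (simp only: ennreal_eq_0_iff not_le)
 then show ?thesis using True by (simp add: ennreal_mult_top)
next
 case False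
 let ?K = "propagating_const DIM('a)"
 have k2: "kp^2 > 0" using kp by simp
 have p: "p <= 0" using DIM_positive[where 'a='a] unfolding p_def by simp
 have U: "loc_int U" and F: "loc_int F" using wh by (auto simp: weak_helm_def)
 note Um = loc_int_measurable[OF U] note Fm = loc_int_measurable[OF F]
 have sub: "cball x0 R \<subseteq> cball 0 (norm x0 + R)"
 proof
  fix y assume "y \<in> cball x0 R"
  then show "y \<in> cball 0 (norm x0 + R)"
   using norm_triangle_sub[of y x0] by (simp add: dist_norm norm_minus_commute)
 qed
 have "n2 (cball x0 R) U <= ennreal (1 / kp^2) * (ennreal (?K * R^2) * n2 UNIV F)"
 proof (rule n2_moll_limit_local[OF U fin _ sub, of "min 1 (R - \<rho>)"])
  fix eps :: real assume eps: "0 < eps" and eps': "eps <= min 1 (R - \<rho>)"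
  then have eps1: "eps <= 1" and eps2: "eps <= R - \<rho>" by auto
  define u where "u = conv U (moll eps)"
  define g where "g = conv F (moll eps)"
  have sm: "smooth u" unfolding u_def by (rule smooth_conv[OF U test_function_moll[OF eps]])
  define v where "v = (%x. u (x0 + 1 *\<^sub>R x))"
  have smv: "smooth v" unfolding v_def by (rule smooth_affine[OF sm])
  have pdv: "pd b v = (%x. pd b u (x0 + 1 *\<^sub>R x))" for b
   unfolding v_def by (rule ext) (simp only: pd_affine[OF sm] of_real_1 mult_1_left)
  have pdv2: "pd c (pd b v) x = pd c (pd b u) (x0 + x)" if "b \<in> Basis" for b c x
   unfolding pdv by (subst pd_affine[OF smooth_pd[OF sm that]]) simp
  have sym: "pd c (pd b v) x = pd b (pd c v) x" if "b \<in> Basis" "c \<in> Basis" for b c x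
   using pdv2 that conv_moll_sym[OF U eps that] by (simp add: u_def)
  have src: "lap v x + of_real (kp^2) * v x = - g (x0 + x)" for x
  proof -
   have "lap v x = lap u (x0 + x)" unfolding lap_def by (rule sum.cong) (simp_all add: pdv2)
   then show ?thesis using conv_moll_pde[OF wh eps, of "x0 + x"] by (simp add: v_def u_def g_def)
  qed
  have gz: "g (x0 + x) = 0" if "norm x > R" for x
  proof -
   have "F y * moll eps (x0 + x - y) = 0" for y
   proof (cases "y \<in> ball x0 \<rho>")
    case True
    have "norm x <= norm (x0 + x - y) + norm (y - x0)" using norm_triangle_ineq[of "x0 + x - y" "y - x0"] by simp
    moreover have "norm (y - x0) < \<rho>" using True by (simp add: dist_norm norm_minus_commute)
    ultimately have "norm (x0 + x - y) >= eps" using that eps2 by linarith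
    then show ?thesis by (simp add: moll_outside[OF eps])
   qed (simp add: F0)
   then have "(%y. F y * moll eps (x0 + x - y)) = (%y. 0)" by (rule ext)
   then show ?thesis unfolding g_def conv_def by simp
  qed
  have rm1: "\<exists>B r. B >= 0 & (\<forall>x. norm x >= r --> cmod (u x) <= B * norm x powr p &
   (\<forall>b\<in>Basis. cmod (pd b u x) <= B * norm x powr p))"
   unfolding u_def by (rule radiating_moll(1)[OF U eps eps1 p kp r1 C diff AE dec rad])
  have rm2: "\<forall>\<eta>>0. \<exists>r. \<forall>x. norm x >= r -->
   cmod (euler u x - \<i> * of_real (kp * norm x) * u x) <= \<eta> * norm x * norm x powr p"
   unfolding u_def by (rule radiating_moll(2)[OF U eps eps1 p kp r1 C diff AE dec rad])
  obtain B0 r0 where B0: "B0 >= 0 & (\<forall>x. norm x >= r0 --> cmod (u x) <= B0 * norm x powr p &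
   (\<forall>b\<in>Basis. cmod (pd b u x) <= B0 * norm x powr p))"
   using rm1 by (elim exE) (rule that)
  note B1 = B0[THEN conjunct2, rule_format, THEN conjunct1]
  note B2 = B0[THEN conjunct2, rule_format, THEN conjunct2, rule_format]
  have sr1: "\<exists>B r. \<forall>x. norm x >= r --> cmod (v x) <= B * norm x powr p & cmod (euler v x) <= B * norm x * norm x powr p"
   by (rule shifted_radiating(1)[OF sm kp p B0[THEN conjunct1] B1 B2 rm2[rule_format] v_def])
  have sr2: "\<exists>r. \<forall>x. norm x >= r --> cmod (euler v x - \<i> * of_real (kp * norm x) * v x) <= \<eta> * norm x * norm x powr p"
   if "\<eta> > 0" for \<eta>
   by (rule shifted_radiating(2)[OF sm kp p B0[THEN conjunct1] B1 B2 rm2[rule_format] v_def that])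
  obtain B r where Br: "\<forall>x. norm x >= r --> cmod (v x) <= B * norm x powr p & cmod (euler v x) <= B * norm x * norm x powr p"
   using sr1 by (elim exE) (rule that)
  note Bv = Br[rule_format, THEN conjunct1] Br[rule_format, THEN conjunct2]
  have main: "kp^2 * (LINT x|lborel. indicator (cball 0 R) x * (cmod (v x))^2) <= ?K * R^2 * (LINT x|lborel. (cmod (lap v x + of_real (kp^2) * v x))^2)"
   unfolding propagating_const_def
  proof (rule propagating_smooth[OF smv sym kp _ R(3)])
   show "R > 0" using R by simp
   show "lap v x + of_real (kp^2) * v x = 0" if "norm x > R" for x using gz[OF that] src by simp
   show "cmod (v x) <= B * norm x powr ((1 - real DIM('a)) / 2)" if "norm x >= r" for x
    using Bv(1)[OF that] unfolding p_def .
   show "cmod (euler v x) <= B * norm x * norm x powr ((1 - real DIM('a)) / 2)" if "norm x >= r" for x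
    using Bv(2)[OF that] unfolding p_def .
   show "\<exists>r. \<forall>x. norm x >= r --> cmod (euler v x - \<i> * of_real (kp * norm x) * v x) <= \<eta> * norm x * norm x powr ((1 - real DIM('a)) / 2)"
    if "\<eta> > 0" for \<eta> using sr2[OF that] unfolding p_def .
  qed
  have um: "u \<in> borel_measurable borel" and gm: "g \<in> borel_measurable borel"
   unfolding u_def g_def by (rule borel_measurable_conv_moll[OF U eps], rule borel_measurable_conv_moll[OF F eps])
  have fing: "n2 UNIV (%x. g (x0 + x)) <= n2 UNIV F"
   using n2_translate[OF gm, of UNIV x0] n2_conv_moll_le[OF Fm eps] by (simp add: g_def)
  have eqg: "(%x. lap v x + of_real (kp^2) * v x) = (%x. - g (x0 + x))" using src by (rule ext)
  have contg: "continuous_on UNIV (%x. lap v x + of_real (kp^2) * v x)"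
   by (intro smooth_continuous smooth_add smooth_mult smooth_const smooth_lap smv)
  have n2g: "n2 UNIV (%x. lap v x + of_real (kp^2) * v x) = n2 UNIV (%x. g (x0 + x))"
   unfolding eqg by (simp add: n2_def)
  have "n2 UNIV (%x. lap v x + of_real (kp^2) * v x) < \<infinity>"
   unfolding n2g by (rule le_less_trans[OF fing]) (use False in \<open>simp add: less_top\<close>)
  from n2_eq_integral[OF integrable_n2[OF contg this]]
  have rhs: "ennreal (LINT x|lborel. (cmod (lap v x + of_real (kp^2) * v x))^2) <= n2 UNIV F"
   using n2g fing by simp
  have "integrable lborel (%x. indicator (cball 0 R) x *\<^sub>R (cmod (v x))\<^sup>2)"
   by (rule borel_integrable_compact) (auto intro!: continuous_intros smooth_continuous smv)
  then have "(\<integral>\<^sup>+x. ennreal (indicator (cball 0 R) x * (cmod (v x))^2) \<partial>lborel) = ennreal (LINT x|lborel. indicator (cball 0 R) x * (cmod (v x))^2)"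
   by (intro nn_integral_eq_integral) (auto simp: scaleR_conv_of_real)
  moreover have "(\<integral>\<^sup>+x. ennreal (indicator (cball 0 R) x * (cmod (v x))^2) \<partial>lborel) = n2 {x. x0 + x \<in> cball x0 R} (%x. u (x0 + x))"
   unfolding n2_def v_def by (intro nn_integral_cong) (auto simp: indicator_def dist_norm)
  ultimately have lhs: "n2 (cball x0 R) u = ennreal (LINT x|lborel. indicator (cball 0 R) x * (cmod (v x))^2)"
   using n2_translate[OF um, of "cball x0 R" x0] by simp
  have "ennreal (kp^2) * n2 (cball x0 R) u <= ennreal (?K * R^2) * n2 UNIV F"
  proof -
   have "ennreal (kp^2) * n2 (cball x0 R) u = ennreal (kp^2 * (LINT x|lborel. indicator (cball 0 R) x * (cmod (v x))^2))"
    unfolding lhs by (simp add: ennreal_mult')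
   also have "... <= ennreal (?K * R^2 * (LINT x|lborel. (cmod (lap v x + of_real (kp^2) * v x))^2))"
    using main by (rule ennreal_leI)
   also have "... = ennreal (?K * R^2) * ennreal (LINT x|lborel. (cmod (lap v x + of_real (kp^2) * v x))^2)"
    using propagating_const_pos[of "DIM('a)"] by (intro ennreal_mult') auto
   also have "... <= ennreal (?K * R^2) * n2 UNIV F" by (intro mult_left_mono rhs) auto
   finally show ?thesis .
  qed
  then have "ennreal (1 / kp^2) * (ennreal (kp^2) * n2 (cball x0 R) u) <= ennreal (1 / kp^2) * (ennreal (?K * R^2) * n2 UNIV F)"
   by (intro mult_left_mono) auto
  then show "n2 (cball x0 R) (conv U (moll eps)) <= ennreal (1 / kp^2) * (ennreal (?K * R^2) * n2 UNIV F)"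
   unfolding ennreal_cancel_left[OF k2] u_def .
 qed (use R in auto)
 then have "ennreal (kp^2) * n2 (cball x0 R) U <= ennreal (kp^2) * (ennreal (1 / kp^2) * (ennreal (?K * R^2) * n2 UNIV F))"
  by (intro mult_left_mono) auto
 then show ?thesis unfolding ennreal_cancel_left[OF k2] .
qed

text \<open>Multiplying \<open>radial_deriv\<close> by \<open>|x|\<close> gives the derivative in
  the direction \<open>x\<close> itself, and the exponent \<open>(2 - n) / 2\<close> is
  \<open>(1 - d) / 2\<close> for \<open>d = n - 1\<close>.\<close>

lemma weak_helm_outgoing:
 fixes U F :: "real^'d => complex"
 assumes wh: "weak_helm (kp^2) U F" and kp: "kp > 0"
  and F0: "!!y. y \<notin> ball x0 \<rho> ==> F y = 0" and R: "\<rho> > 0" "R > \<rho>" "kp * R >= 1"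
  and fin: "!!r. n2 (cball 0 r) U < \<infinity>"
  and out: "outgoing (complex_of_real kp) f" and Uf: "AE x in lborel. U x = f x"
 shows "ennreal (kp^2) * n2 (cball x0 R) U <= ennreal (propagating_const CARD('d) * R^2) * n2 UNIV F"
proof -
 define p where "p = (1 - real DIM(real^'d)) / 2"
 have p: "(2 - real DIM((real^'d) \<times> real)) / 2 = p" by (simp add: p_def)
 obtain w where w: "(AE x in lebesgue. w x = f x) & (\<forall>\<^sub>F x in at_infinity. w differentiable (at x)) &
   w \<in> O[at_infinity](%x. complex_of_real (norm x powr p)) &
   (%x. radial_deriv w x - \<i> * complex_of_real kp * w x) \<in> o[at_infinity](%x. complex_of_real (norm x powr p))"
  using out unfolding outgoing_def p by (elim exE) (rule that)
 note w1 = w[THEN conjunct1] note w2 = w[THEN conjunct2, THEN conjunct1]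
 note w3 = w[THEN conjunct2, THEN conjunct2, THEN conjunct1] note w4 = w[THEN conjunct2, THEN conjunct2, THEN conjunct2]
 obtain C where C: "C > 0" "\<forall>\<^sub>F x in at_infinity. cmod (w x) <= C * cmod (complex_of_real (norm x powr p))"
  by (rule landau_o.bigE[OF w3]) (rule that)
 obtain b1 where b1: "\<forall>x. b1 <= norm x --> w differentiable (at x) & cmod (w x) <= C * cmod (complex_of_real (norm x powr p))"
  using eventually_conj[OF w2 C(2)] unfolding eventually_at_infinity by (elim exE) (rule that)
 define r1 where "r1 = max 1 b1"
 have r1: "r1 > 0" by (simp add: r1_def)
 have diff: "w differentiable (at y)" if "norm y >= r1" for y using b1 that by (simp add: r1_def)
 have dec: "cmod (w y) <= C * norm y powr p" if "norm y >= r1" for y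
  using b1[rule_format, of y] that by (simp add: r1_def)
 have AE: "AE y in lborel. norm y >= r1 --> U y = w y"
  using Uf w1[unfolded AE_completion_iff] by eventually_elim simp
 have rad: "\<exists>r. \<forall>y. norm y >= r -->
    cmod (frechet_derivative w (at y) y - \<i> * of_real (kp * norm y) * w y) <= \<eta> * norm y * norm y powr p" if \<eta>: "\<eta> > 0" for \<eta>
 proof -
  obtain b where b: "\<forall>x. b <= norm x --> cmod (radial_deriv w x - \<i> * complex_of_real kp * w x) <= \<eta> * cmod (complex_of_real (norm x powr p))"
   using landau_o.smallD[OF w4 \<eta>] unfolding eventually_at_infinity by (elim exE) (rule that)
  show ?thesis
  proof (intro exI[of _ "max r1 b"] allI impI)
   fix y :: "real^'d" assume y: "max r1 b <= norm y"
   have y0: "norm y > 0" by (rule less_le_trans[OF r1]) (use y in simp)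
   have "frechet_derivative w (at y) ((1 / norm y) *\<^sub>R y) = (1 / norm y) *\<^sub>R frechet_derivative w (at y) y"
    using linear_frechet_derivative[OF diff] y by (intro linear_scale) auto
   then have "frechet_derivative w (at y) y = complex_of_real (norm y) * radial_deriv w y"
    using y0 unfolding radial_deriv_def by (simp add: scaleR_conv_of_real)
   then have "frechet_derivative w (at y) y - \<i> * of_real (kp * norm y) * w y
     = complex_of_real (norm y) * (radial_deriv w y - \<i> * complex_of_real kp * w y)" by (simp add: algebra_simps)
   also have "cmod ... = norm y * cmod (radial_deriv w y - \<i> * complex_of_real kp * w y)"
    by (simp add: norm_mult)
   also have "... <= norm y * (\<eta> * norm y powr p)"
    using b[rule_format, of y] y by (intro mult_left_mono) auto
   finally show "cmod (frechet_derivative w (at y) y - \<i> * of_real (kp * norm y) * w y) <= \<eta> * norm y * norm y powr p"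
    by (simp add: mult_ac)
  qed
 qed
 have "C >= 0" using C by simp
 from weak_helm_propagating[OF wh kp F0 R fin r1 this diff AE dec[unfolded p_def] rad[unfolded p_def]]
 show ?thesis by simp
qed

section \<open>Sine series\<close>

text \<open>The factor supported on the unit interval turns orthogonality into a statement about
  \<open>lborel\<close>.\<close>

definition esin :: "nat => real => real" where
 "esin m y = sin (real m * pi * y) * indicator {0..1} y"

text \<open>The integral runs over the whole line; for functions that vanish outside the open unit
  interval it is the coefficient that appears in \<open>mode\<close>.\<close>

definition sine_coef :: "nat => (real => complex) => complex" where
 "sine_coef m f = 2 * (LINT y|lborel. f y * of_real (sin (real m * pi * y)))"

lemma esin_measurable [measurable]: "esin m \<in> borel_measurable borel"
 unfolding esin_def[abs_def] by measurable

lemma integral_cos_int: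
 "has_bochner_integral lborel (%y. cos (of_int k * pi * y) * indicator {0..1} y) (if k = 0 then 1 else 0 :: real)"
proof (cases "k = 0")
 case True
 have "has_bochner_integral lborel (%y::real. 1 * indicator {0..1} y) (1 - 0 :: real)"
  by (rule has_bochner_integral_FTC_Icc_real[where F="%y. y" and f="%_. 1"]) (auto intro!: derivative_eq_intros)
 then show ?thesis using True by simp
next
 case False
 have "has_bochner_integral lborel (%y. cos (of_int k * pi * y) * indicator {0..1} y)
   (sin (of_int k * pi * 1) / (of_int k * pi) - sin (of_int k * pi * 0) / (of_int k * pi))"
  by (rule has_bochner_integral_FTC_Icc_real) (use False in \<open>auto intro!: derivative_eq_intros continuous_intros\<close>)
 moreover have "sin (of_int k * pi * 1) = 0" using sin_zero_iff_int2[of "of_int k * pi"] by auto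
 ultimately show ?thesis using False by simp
qed

lemma esin_orthogonal:
 assumes "m >= 1" "n >= 1"
 shows "has_bochner_integral lborel (%y. esin m y * esin n y) (if m = n then 1 / 2 else 0)"
proof -
 have e: "esin m y * esin n y = (1 / 2) * (cos (of_int (int m - int n) * pi * y) * indicator {0..1} y
   - cos (of_int (int m + int n) * pi * y) * indicator {0..1} y)" for y
  using sin_times_sin[of "real m * pi * y" "real n * pi * y"]
  by (auto simp: esin_def indicator_def algebra_simps)
 have "has_bochner_integral lborel (%y. (1 / 2) * (cos (of_int (int m - int n) * pi * y) * indicator {0..1} y
   - cos (of_int (int m + int n) * pi * y) * indicator {0..1} y))
   ((1 / 2) * ((if int m - int n = 0 then 1 else 0) - (if int m + int n = 0 then 1 else 0 :: real)))"
  by (intro has_bochner_integral_mult_right has_bochner_integral_diff integral_cos_int)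
 then show ?thesis unfolding e using assms by (auto split: if_splits)
qed

lemma sine_coef_esin:
 assumes "!!y. y \<notin> {0<..<1} ==> f y = 0"
 shows "sine_coef m f = 2 * (LINT y|lborel. f y * of_real (esin m y))"
proof -
 have h: "f y * of_real (sin (real m * pi * y)) = f y * of_real (esin m y)" for y
  using assms[of y] by (cases "y \<in> {0<..<1}") (auto simp: esin_def indicator_def)
 show ?thesis by (simp only: sine_coef_def h)
qed

lemma integrable_mult_esin:
 fixes f :: "real => complex"
 assumes [measurable]: "f \<in> borel_measurable borel" and f2: "integrable lborel (%y. (cmod (f y))^2)"
 shows "integrable lborel (%y. f y * of_real (esin m y))"
proof (rule Bochner_Integration.integrable_bound)
 show "integrable lborel (%y. (cmod (f y))^2 + indicator {0..1} y :: real)"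
  using f2 by (intro Bochner_Integration.integrable_add) (auto simp: integrable_indicator_iff)
 show "AE y in lborel. norm (f y * complex_of_real (esin m y)) <= norm ((cmod (f y))^2 + indicator {0..1} y :: real)"
 proof (rule AE_I2)
  fix y
  have "cmod (f y) * \<bar>sin (real m * pi * y)\<bar> <= cmod (f y) * 1" by (intro mult_left_mono) auto
  also have "... <= (cmod (f y))^2 + 1"
  proof -
   have "0 <= (cmod (f y))^2 + 1 - 2 * cmod (f y)"
    using zero_le_power2[of "cmod (f y) - 1"] by (simp add: power2_diff)
   then show ?thesis using norm_ge_zero[of "f y"] by linarith
  qed
  finally show "norm (f y * complex_of_real (esin m y)) <= norm ((cmod (f y))^2 + indicator {0..1} y :: real)"
   by (auto simp: esin_def indicator_def norm_mult abs_mult)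
 qed
qed measurable

text \<open>The coefficients are arbitrary: \<open>a m = sine_coef m f\<close> gives Bessel's
  inequality, and comparison with any other choice shows that the Fourier sum is the best
  approximation.\<close>

lemma sine_distance:
 fixes f :: "real => complex"
 assumes f[measurable]: "f \<in> borel_measurable borel" and f0: "!!y. y \<notin> {0<..<1} ==> f y = 0"
  and f2: "integrable lborel (%y. (cmod (f y))^2)"
 shows "has_bochner_integral lborel (%y. (cmod (f y - (\<Sum>m\<in>{1..N}. a m * of_real (esin m y))))^2)
  ((LINT y|lborel. (cmod (f y))^2) - (\<Sum>m\<in>{1..N}. (cmod (sine_coef m f))^2 / 2)
   + (\<Sum>m\<in>{1..N}. (cmod (sine_coef m f - a m))^2 / 2))"
proof -
 let ?c = "%m. sine_coef m f"
 have pt: "(cmod (f y - (\<Sum>m\<in>{1..N}. a m * of_real (esin m y))))^2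
   = (cmod (f y))^2 - 2 * Re (\<Sum>m\<in>{1..N}. cnj (a m) * (f y * of_real (esin m y)))
    + (\<Sum>m\<in>{1..N}. \<Sum>n\<in>{1..N}. Re (a m * cnj (a n)) * (esin m y * esin n y))" for y
 proof -
  let ?T = "\<Sum>m\<in>{1..N}. a m * of_real (esin m y)"
  have "(cmod (z - t))^2 = (cmod z)^2 - 2 * Re (z * cnj t) + Re (t * cnj t)" for z t
   unfolding cmod_power2 by (simp add: power2_eq_square algebra_simps)
  from this[of "f y" ?T] have 1: "(cmod (f y - ?T))^2 = (cmod (f y))^2 - 2 * Re (f y * cnj ?T) + Re (?T * cnj ?T)" .
  have 2: "f y * cnj ?T = (\<Sum>m\<in>{1..N}. cnj (a m) * (f y * of_real (esin m y)))"
   by (simp add: sum_distrib_left mult_ac)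
  have "?T * cnj ?T = (\<Sum>m\<in>{1..N}. \<Sum>n\<in>{1..N}. (a m * of_real (esin m y)) * (cnj (a n) * of_real (esin n y)))"
   by (simp add: sum_product)
  also have "Re ... = (\<Sum>m\<in>{1..N}. \<Sum>n\<in>{1..N}. Re (a m * cnj (a n)) * (esin m y * esin n y))"
   unfolding Re_sum
  proof (intro sum.cong refl)
   fix m n
   have "(a m * of_real (esin m y)) * (cnj (a n) * of_real (esin n y)) = of_real (esin m y * esin n y) * (a m * cnj (a n))"
    by (simp add: mult_ac)
   then show "Re ((a m * of_real (esin m y)) * (cnj (a n) * of_real (esin n y))) = Re (a m * cnj (a n)) * (esin m y * esin n y)"
    by (simp only: Re_complex_of_real times_complex.sel Im_complex_of_real) simp
  qed
  finally show ?thesis using 1 unfolding 2 by (simp only:)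
 qed
 have I2: "has_bochner_integral lborel (%y. f y * of_real (esin m y)) (?c m / 2)" for m
  using integrable_mult_esin[OF f f2, where m=m] sine_coef_esin[OF f0, where m=m] by (simp add: has_bochner_integral_iff)
 have tot: "has_bochner_integral lborel (%y. (cmod (f y))^2 - 2 * Re (\<Sum>m\<in>{1..N}. cnj (a m) * (f y * of_real (esin m y)))
    + (\<Sum>m\<in>{1..N}. \<Sum>n\<in>{1..N}. Re (a m * cnj (a n)) * (esin m y * esin n y)))
   ((LINT y|lborel. (cmod (f y))^2) - 2 * Re (\<Sum>m\<in>{1..N}. cnj (a m) * (?c m / 2))
    + (\<Sum>m\<in>{1..N}. \<Sum>n\<in>{1..N}. Re (a m * cnj (a n)) * (if m = n then 1 / 2 else 0)))"
 proof (intro has_bochner_integral_add has_bochner_integral_diff has_bochner_integral_mult_right has_bochner_integral_sum)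
  show "has_bochner_integral lborel (%y. (cmod (f y))^2) (LINT y|lborel. (cmod (f y))^2)"
   using f2 by (rule has_bochner_integral_integrable)
  show "has_bochner_integral lborel (%y. Re (\<Sum>m\<in>{1..N}. cnj (a m) * (f y * of_real (esin m y)))) (Re (\<Sum>m\<in>{1..N}. cnj (a m) * (?c m / 2)))"
   by (intro has_bochner_integral_bounded_linear[OF bounded_linear_Re] has_bochner_integral_sum has_bochner_integral_mult_right I2)
  show "has_bochner_integral lborel (%y. esin m y * esin n y) (if m = n then 1 / 2 else 0)"
   if "m \<in> {1..N}" "n \<in> {1..N}" for m n using that by (intro esin_orthogonal) auto
 qed
 have "(\<Sum>n\<in>{1..N}. Re (a m * cnj (a n)) * (if m = n then 1 / 2 else 0)) = (cmod (a m))^2 / 2" if "m \<in> {1..N}" for m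
 proof -
  have "(\<Sum>n\<in>{1..N}. Re (a m * cnj (a n)) * (if m = n then 1 / 2 else 0)) = (\<Sum>n\<in>{1..N}. if m = n then Re (a m * cnj (a n)) / 2 else 0)"
   by (rule sum.cong) auto
  also have "... = Re (a m * cnj (a m)) / 2" using that by simp
  also have "... = (cmod (a m))^2 / 2" unfolding cmod_power2 by (simp add: power2_eq_square)
  finally show ?thesis .
 qed
 then have q: "(\<Sum>m\<in>{1..N}. \<Sum>n\<in>{1..N}. Re (a m * cnj (a n)) * (if m = n then 1 / 2 else 0)) = (\<Sum>m\<in>{1..N}. (cmod (a m))^2 / 2)"
  by (rule sum.cong[OF refl])
 have "(\<Sum>m\<in>{1..N}. (cmod (a m))^2 / 2) - 2 * Re (\<Sum>m\<in>{1..N}. cnj (a m) * (?c m / 2))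
   = (\<Sum>m\<in>{1..N}. (cmod (a m))^2 / 2 - 2 * Re (cnj (a m) * (?c m / 2)))"
  by (simp add: Re_sum sum_subtractf sum_distrib_left)
 also have "... = (\<Sum>m\<in>{1..N}. (cmod (?c m - a m))^2 / 2 - (cmod (?c m))\<^sup>2 / 2)"
  unfolding cmod_power2 by (intro sum.cong refl) (simp add: power2_eq_square field_simps)
 finally have v: "(\<Sum>m\<in>{1..N}. (cmod (a m))^2 / 2) - 2 * Re (\<Sum>m\<in>{1..N}. cnj (a m) * (?c m / 2))
   = (\<Sum>m\<in>{1..N}. (cmod (?c m - a m))^2 / 2) - (\<Sum>m\<in>{1..N}. (cmod (?c m))^2 / 2)"
  by (simp add: sum_subtractf)
 have val: "(LINT y|lborel. (cmod (f y))^2) - 2 * Re (\<Sum>m\<in>{1..N}. cnj (a m) * (?c m / 2)) + (\<Sum>m\<in>{1..N}. (cmod (a m))^2 / 2)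
   = (LINT y|lborel. (cmod (f y))^2) - (\<Sum>m\<in>{1..N}. (cmod (?c m))^2 / 2) + (\<Sum>m\<in>{1..N}. (cmod (?c m - a m))^2 / 2)"
  using v by linarith
 show ?thesis using tot unfolding pt q val .
qed

inductive sine_poly :: "(real => complex) => bool" where
 single: "sine_poly (%y. a * of_real (sin (real m * pi * y)))"
| sum: "sine_poly f ==> sine_poly g ==> sine_poly (%y. f y + g y)"

lemma sine_poly_scale: "sine_poly f ==> sine_poly (%y. b * f y)"
proof (induction rule: sine_poly.induct)
 case (single a m)
 show ?case using sine_poly.single[of "b * a" m] by (simp add: mult.assoc)
next
 case (sum f g)
 from sine_poly.sum[OF sum.IH] show ?case by (simp add: distrib_left)
qed

text \<open>\<open>cos (\<pi> y) sin (m \<pi> y)\<close> is half the sum of the two neighbouring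
  sines; for \<open>m = 0\<close> everything vanishes.\<close>

lemma sine_poly_mult_cos: "sine_poly f ==> sine_poly (%y. of_real (cos (pi * y)) * f y)"
proof (induction rule: sine_poly.induct)
 case (single a m)
 show ?case
 proof (cases m)
  case 0
  then show ?thesis using sine_poly.single[of 0 0] by simp
 next
  case (Suc n)
  have "of_real (cos (pi * y)) * (a * of_real (sin (real m * pi * y)))
   = (a / 2) * of_real (sin (real (Suc m) * pi * y)) + (a / 2) * of_real (sin (real n * pi * y))" for y
  proof -
   have "cos (pi * y) * sin (real m * pi * y) = sin (real m * pi * y) * cos (pi * y)" by (rule mult.commute)
   also have "... = (sin (real m * pi * y + pi * y) + sin (real m * pi * y - pi * y)) / 2"
    by (rule sin_times_cos)
   also have "real m * pi * y + pi * y = real (Suc m) * pi * y" by (simp add: algebra_simps)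
   also have "real m * pi * y - pi * y = real n * pi * y" using Suc by (simp add: algebra_simps)
   finally have "cos (pi * y) * sin (real m * pi * y) = (sin (real (Suc m) * pi * y) + sin (real n * pi * y)) / 2" by simp
   from arg_cong[OF this, of "%t. a * complex_of_real t"] show ?thesis
    by (simp add: field_simps)
  qed
  then show ?thesis using sine_poly.sum[OF sine_poly.single[of "a / 2" "Suc m"] sine_poly.single[of "a / 2" n]] by simp
 qed
next
 case (sum f g)
 from sine_poly.sum[OF sum.IH] show ?case by (simp add: distrib_left)
qed

lemma sine_poly_mult_polynomial:
 assumes "real_polynomial_function (q :: real => real)"
 shows "sine_poly f ==> sine_poly (%y. of_real (q (cos (pi * y))) * f y)"
 using assms
proof (induction q arbitrary: f rule: real_polynomial_function.induct)
 case (linear q)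
 have "q t = t * q 1" for t using linear_scale[OF bounded_linear.linear[OF linear(1)], of t 1] by simp
 then have e: "of_real (q (cos (pi * y))) * f y = of_real (q 1) * (of_real (cos (pi * y)) * f y)" for y
  by (metis mult.assoc mult.commute of_real_mult)
 show ?case unfolding e using sine_poly_scale[OF sine_poly_mult_cos[OF linear(2)], of "of_real (q 1)"] .
next
 case (const c)
 then show ?case by (rule sine_poly_scale)
next
 case (add q r)
 from sine_poly.sum[OF add.IH(1)[OF add.prems] add.IH(2)[OF add.prems]] show ?case by (simp add: distrib_right)
next
 case (mult q r)
 from mult.IH(1)[OF mult.IH(2)[OF mult.prems]] show ?case by (simp add: mult.assoc)
qed

lemma sine_poly_sum:
 assumes "sine_poly f"
 shows "\<exists>N a. \<forall>y. f y = (\<Sum>m\<in>{1..N}. a m * of_real (sin (real m * pi * y)))"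
proof -
 \<comment> \<open>The induction carries coefficients that vanish beyond \<open>N\<close>, so that
   two sums can be padded to a common length.\<close>
 have "\<exists>N a. (\<forall>m>N. a m = 0) & (\<forall>y. f y = (\<Sum>m\<in>{1..N}. a m * of_real (sin (real m * pi * y))))"
  using assms
 proof (induction rule: sine_poly.induct)
  case (single b m)
  show ?case
  proof (intro exI[of _ m] exI[of _ "%n. if n = m then b else 0"] conjI allI)
   fix y
   have "(\<Sum>n\<in>{1..m}. (if n = m then b else 0) * complex_of_real (sin (real n * pi * y))) = (\<Sum>n\<in>{1..m}. if n = m then b * of_real (sin (real m * pi * y)) else 0)"
    by (rule sum.cong) auto
   then show "b * complex_of_real (sin (real m * pi * y)) = (\<Sum>n\<in>{1..m}. (if n = m then b else 0) * of_real (sin (real n * pi * y)))"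
    by (cases "m = 0") auto
  qed auto
 next
  case (sum f g)
  obtain N a where a: "\<forall>m>N. a m = 0" "\<forall>y. f y = (\<Sum>m\<in>{1..N}. a m * of_real (sin (real m * pi * y)))" using sum.IH(1) by auto
  obtain M b where b: "\<forall>m>M. b m = 0" "\<forall>y. g y = (\<Sum>m\<in>{1..M}. b m * of_real (sin (real m * pi * y)))" using sum.IH(2) by auto
  show ?case
  proof (intro exI[of _ "max N M"] exI[of _ "%m. a m + b m"] conjI allI)
   fix y
   have "f y = (\<Sum>m\<in>{1..max N M}. a m * of_real (sin (real m * pi * y)))"
    unfolding a(2)[rule_format] using a(1) by (intro sum.mono_neutral_left) auto
   moreover have "g y = (\<Sum>m\<in>{1..max N M}. b m * of_real (sin (real m * pi * y)))"
    unfolding b(2)[rule_format] using b(1) by (intro sum.mono_neutral_left) auto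
   ultimately show "f y + g y = (\<Sum>m\<in>{1..max N M}. (a m + b m) * of_real (sin (real m * pi * y)))"
    by (simp add: sum.distrib distrib_right)
  qed (use a(1) b(1) in auto)
 qed
 then show ?thesis by blast
qed

text \<open>Continuous functions are divided by \<open>sin (\<pi>y)\<close>, truncated near the end points, and the quotient is
 approximated by a polynomial in \<open>cos (\<pi>y)\<close>.\<close>

lemma sine_dense:
 fixes f :: "real => complex"
 assumes f[measurable]: "f \<in> borel_measurable borel" and f0: "!!y. y \<notin> {0<..<1} ==> f y = 0"
  and fin: "n2 UNIV f < \<infinity>" and \<delta>: "\<delta> > (0::real)"
 shows "\<exists>N a. n2 UNIV (%y. f y - (\<Sum>m\<in>{1..N}. a m * of_real (esin m y))) <= ennreal \<delta>"
proof -
 have d16: "\<delta> / 16 > 0" using \<delta> by simp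
 obtain c R where c: "continuous_on UNIV c & (\<forall>x. norm x >= R --> c x = 0) & n2 UNIV (%x. f x - c x) <= ennreal (\<delta> / 16)"
  using n2_dense[OF f fin d16] by (elim exE) (rule that)
 note cc = c[THEN conjunct1]
 note [measurable] = borel_measurable_continuous_onI[OF cc]
 define S where "S y = sin (pi * y)" for y :: real
 have S: "S y >= 0" "S y <= 1" if "y \<in> {0..1}" for y
  using that sin_ge_zero[of "pi * y"] by (auto simp: S_def)
 \<comment> \<open>The denominator \<open>sin (\<pi> y)\<close> is kept above
   \<open>1 / (j + 1)\<close>, which makes the quotient continuous at the end points.\<close>
 define h where "h j y = c y / of_real (max (S y) (1 / real (Suc j)))" for j y
 have hc: "continuous_on UNIV (h j)" for j
 proof -
  have "max (S y) (1 / real (Suc j)) ~= 0" for y using less_max_iff_disj[of 0 "S y" "1 / real (Suc j)"] by (simp add: max_def)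
  then have "complex_of_real (max (S y) (1 / real (Suc j))) ~= 0" for y using of_real_eq_0_iff by blast
  then show ?thesis unfolding h_def[abs_def] S_def[abs_def] by (intro continuous_intros cc) auto
 qed
 note [measurable] = borel_measurable_continuous_onI[OF hc]
 have Sm[measurable]: "S \<in> borel_measurable borel" unfolding S_def[abs_def] by measurable
 have hb: "cmod (c y - of_real (S y) * h j y) <= cmod (c y)" if y: "y \<in> {0..1}" for j y
 proof -
  let ?t = "S y / max (S y) (1 / real (Suc j))"
  have pos: "max (S y) (1 / real (Suc j)) > 0" by (simp add: less_max_iff_disj)
  have t: "0 <= ?t" "?t <= 1" using S[OF y] pos by (auto simp: divide_le_eq intro!: divide_nonneg_nonneg less_imp_le)
  have "c y - of_real (S y) * h j y = of_real (1 - ?t) * c y"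
   unfolding h_def by (simp add: algebra_simps)
  then have "cmod (c y - of_real (S y) * h j y) = (1 - ?t) * cmod (c y)" using t by (simp add: norm_mult del: of_real_diff)
  also have "... <= 1 * cmod (c y)" using t by (intro mult_right_mono) auto
  finally show ?thesis by simp
 qed
 have hl: "(%j. ennreal ((cmod (c y - of_real (S y) * h j y))^2) * indicator {0<..<1} y) \<longlonglongrightarrow> 0" for y
 proof (cases "y \<in> {0<..<1}")
  case True
  then have Sp: "S y > 0" using sin_gt_zero[of "pi * y"] by (simp add: S_def)
  obtain J where J: "1 / S y < real J" using reals_Archimedean2 by blast
  have "\<forall>\<^sub>F j in sequentially. ennreal ((cmod (c y - of_real (S y) * h j y))^2) * indicator {0<..<1} y = 0"
   unfolding eventually_sequentially
  proof (intro exI[of _ J] allI impI)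
   fix j assume "J <= j"
   then have "1 / S y <= real (Suc j)" using J by linarith
   then have "1 / real (Suc j) <= S y" using Sp by (simp add: field_simps)
   then have "h j y = c y / of_real (S y)" by (simp add: h_def max_def)
   then show "ennreal ((cmod (c y - of_real (S y) * h j y))^2) * indicator {0<..<1} y = 0" using Sp by simp
  qed
  then show ?thesis by (rule tendsto_eventually)
 qed simp
 have cint: "(\<integral>\<^sup>+y. ennreal ((cmod (c y))^2) * indicator {0..1} y \<partial>lborel) < \<infinity>"
 proof -
  have "integrable lborel (%y. indicator {0..1} y *\<^sub>R (cmod (c y))\<^sup>2)"
   by (rule borel_integrable_compact) (auto intro!: continuous_intros continuous_on_subset[OF cc])
  then have "(\<integral>\<^sup>+y. ennreal (norm (indicator {0..1} y *\<^sub>R (cmod (c y))\<^sup>2)) \<partial>lborel) < \<infinity>" by (simp add: integrable_iff_bounded)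
  moreover have "ennreal (norm (indicator {0..1} y *\<^sub>R (cmod (c y))\<^sup>2)) = ennreal ((cmod (c y))^2) * indicator {0..1} y" for y
   by (simp add: indicator_def)
  ultimately show ?thesis by simp
 qed
 have "(%j. \<integral>\<^sup>+y. ennreal ((cmod (c y - of_real (S y) * h j y))^2) * indicator {0<..<1} y \<partial>lborel) \<longlonglongrightarrow> (\<integral>\<^sup>+(y::real). 0 \<partial>lborel)"
 proof (rule nn_integral_dominated_convergence[where w="%y. ennreal ((cmod (c y))^2) * indicator {0..1} y"])
  fix j
  show "AE y in lborel. ennreal ((cmod (c y - of_real (S y) * h j y))^2) * indicator {0<..<1} y <= ennreal ((cmod (c y))^2) * indicator {0..1} y"
   using hb by (intro AE_I2) (auto simp: indicator_def intro!: ennreal_leI power_mono)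
 qed (use cint hl in auto)
 then have "(%j. n2 {0<..<1} (%y. c y - of_real (S y) * h j y)) \<longlonglongrightarrow> 0" by (simp add: n2_def)
 from order_tendstoD(2)[OF this, of "ennreal (\<delta> / 16)"]
 have "\<forall>\<^sub>F j in sequentially. n2 {0<..<1} (%y. c y - of_real (S y) * h j y) < ennreal (\<delta> / 16)" using d16 by simp
 then obtain j where j: "n2 {0<..<1} (%y. c y - of_real (S y) * h j y) < ennreal (\<delta> / 16)"
  unfolding eventually_sequentially by blast
 define e where "e = sqrt (\<delta> / 16)"
 have e: "e > 0" "e^2 = \<delta> / 16" using \<delta> by (simp_all add: e_def)
 \<comment> \<open>The substitution \<open>t = cos (\<pi> y)\<close> maps the unit interval
   bijectively onto \<open>{-1..1}\<close> and turns polynomials in the cosine into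
   polynomials.\<close>
 have "continuous_on {-1..1} (%t. h j (arccos t / pi))"
  by (intro continuous_on_compose2[OF hc[of j]] continuous_intros) auto
 from Stone_Weierstrass_polynomial_function[OF compact_Icc this e(1)]
 obtain g where g: "polynomial_function g" "\<forall>t\<in>{-1..1}. norm (h j (arccos t / pi) - g t) < e" by blast
 have gS: "cmod (h j y - g (cos (pi * y))) <= e" if "y \<in> {0<..<1}" for y
  using g(2)[rule_format, of "cos (pi * y)"] that by (simp add: arccos_cos)
 define T where "T y = of_real (S y) * g (cos (pi * y))" for y
 have "sine_poly T"
 proof -
  have b: "sine_poly (%y. a * of_real (S y))" for a using sine_poly.single[of a 1] by (simp add: S_def)
  have "real_polynomial_function (%t. Re (g t))" "real_polynomial_function (%t. Im (g t))"
   using g(1) bounded_linear_Re bounded_linear_Im unfolding polynomial_function_def o_def by blast+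
  from sine_poly.sum[OF sine_poly_mult_polynomial[OF this(1) b[of 1]] sine_poly_mult_polynomial[OF this(2) b[of \<i>]]]
  have "sine_poly (%y. of_real (Re (g (cos (pi * y)))) * (1 * of_real (S y)) + of_real (Im (g (cos (pi * y)))) * (\<i> * of_real (S y)))" .
  moreover have "T y = of_real (Re (g (cos (pi * y)))) * (1 * of_real (S y)) + of_real (Im (g (cos (pi * y)))) * (\<i> * of_real (S y))" for y
   unfolding T_def by (subst complex_eq[of "g (cos (pi * y))"]) (simp add: algebra_simps)
  ultimately show ?thesis by presburger
 qed
 from sine_poly_sum[OF this] obtain N a where Na: "\<forall>y. T y = (\<Sum>m\<in>{1..N}. a m * of_real (sin (real m * pi * y)))" by blast
 have Tm[measurable]: "T \<in> borel_measurable borel" using Na by (subst (asm) fun_eq_iff[symmetric]) simp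
 have n1: "n2 {0<..<1} (%y. of_real (S y) * h j y - T y) <= ennreal (\<delta> / 16)"
 proof -
  have "n2 {0<..<1} (%y. of_real (S y) * h j y - T y) <= (\<integral>\<^sup>+y. ennreal (\<delta> / 16) * indicator {0<..<1} (y::real) \<partial>lborel)"
   unfolding n2_def
  proof (intro nn_integral_mono)
   fix y :: real
   show "ennreal ((cmod (of_real (S y) * h j y - T y))^2) * indicator {0<..<1} y <= ennreal (\<delta> / 16) * indicator {0<..<1} y"
   proof (cases "y \<in> {0<..<1}")
    case True
    have "of_real (S y) * h j y - T y = of_real (S y) * (h j y - g (cos (pi * y)))" by (simp add: T_def algebra_simps)
    then have "cmod (of_real (S y) * h j y - T y) = \<bar>S y\<bar> * cmod (h j y - g (cos (pi * y)))" by (simp add: norm_mult)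
    also have "... <= 1 * e" using S[of y] True gS[OF True] by (intro mult_mono) auto
    finally have "(cmod (of_real (S y) * h j y - T y))^2 <= e^2" by (intro power_mono) auto
    then show ?thesis using True e by (simp add: ennreal_leI)
   qed simp
  qed
  also have "... = ennreal (\<delta> / 16)" by (simp add: nn_integral_cmult)
  finally show ?thesis .
 qed
 have n2': "n2 {0<..<1} (%y. f y - c y) <= ennreal (\<delta> / 16)"
  using c n2_le_UNIV[of "{0<..<1}" "%y. f y - c y"] by (meson order_trans)
 \<comment> \<open>Two splittings with \<open>t = 1\<close>: in units of \<open>\<delta>\<close>,
   first \<open>2/16 + 2/16 = 1/4\<close>, then \<open>2/16 + 2/4 = 5/8\<close>.\<close>
 have "n2 {0<..<1} (%y. f y - of_real (S y) * h j y) <= ennreal (1 + 1) * n2 {0<..<1} (%y. c y - of_real (S y) * h j y)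
   + ennreal (1 + 1 / 1) * n2 {0<..<1} (%y. (f y - of_real (S y) * h j y) - (c y - of_real (S y) * h j y))"
  by (rule n2_add_le) auto
 also have "(%y. (f y - of_real (S y) * h j y) - (c y - of_real (S y) * h j y)) = (%y. f y - c y)" by auto
 also have "ennreal (1 + 1) * n2 {0<..<1} (%y. c y - of_real (S y) * h j y) + ennreal (1 + 1 / 1) * n2 {0<..<1} (%y. f y - c y)
   <= ennreal (1 + 1) * ennreal (\<delta> / 16) + ennreal (1 + 1 / 1) * ennreal (\<delta> / 16)"
  using j n2' by (intro add_mono mult_left_mono) auto
 also have "... = ennreal (\<delta> / 4)" using \<delta> by (simp add: ennreal_mult[symmetric] ennreal_plus[symmetric] del: ennreal_plus ennreal_numeral)
 finally have n3: "n2 {0<..<1} (%y. f y - of_real (S y) * h j y) <= ennreal (\<delta> / 4)" .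
 have "n2 {0<..<1} (%y. f y - T y) <= ennreal (1 + 1) * n2 {0<..<1} (%y. of_real (S y) * h j y - T y)
   + ennreal (1 + 1 / 1) * n2 {0<..<1} (%y. (f y - T y) - (of_real (S y) * h j y - T y))"
  by (rule n2_add_le) auto
 also have "(%y. (f y - T y) - (of_real (S y) * h j y - T y)) = (%y. f y - of_real (S y) * h j y)" by auto
 also have "ennreal (1 + 1) * n2 {0<..<1} (%y. of_real (S y) * h j y - T y) + ennreal (1 + 1 / 1) * n2 {0<..<1} (%y. f y - of_real (S y) * h j y)
   <= ennreal (1 + 1) * ennreal (\<delta> / 16) + ennreal (1 + 1 / 1) * ennreal (\<delta> / 4)"
  using n1 n3 by (intro add_mono mult_left_mono) auto
 also have "... = ennreal (5 * \<delta> / 8)" using \<delta> by (simp add: ennreal_mult[symmetric] ennreal_plus[symmetric] del: ennreal_plus ennreal_numeral)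
 also have "... <= ennreal \<delta>" using \<delta> by (intro ennreal_leI) simp
 finally have fT: "n2 {0<..<1} (%y. f y - T y) <= ennreal \<delta>" .
 have "n2 UNIV (%y. f y - (\<Sum>m\<in>{1..N}. a m * of_real (esin m y))) = n2 {0<..<1} (%y. f y - T y)"
  unfolding n2_def
 proof (intro nn_integral_cong)
  fix y :: real
  show "ennreal ((cmod (f y - (\<Sum>m\<in>{1..N}. a m * of_real (esin m y))))^2) * indicator UNIV y
    = ennreal ((cmod (f y - T y))^2) * indicator {0<..<1} y"
  proof (cases "y \<in> {0<..<1}")
   case True
   then show ?thesis using Na by (simp add: esin_def)
  next
   case False
   \<comment> \<open>\<open>esin\<close> lives on the closed interval, but the sines vanish at its
     end points.\<close>
   have "esin m y = 0" for m
   proof -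
    have "sin (real m * pi) = 0" using sin_npi[of m] by simp
    then show ?thesis using False by (cases "y = 0 \<or> y = 1") (auto simp: esin_def indicator_def)
   qed
   then show ?thesis using False f0[OF False] by simp
  qed
 qed
 with fT show ?thesis by (intro exI[of _ N] exI[of _ a]) simp
qed

text \<open>Density brings some finite sine sum close to \<open>f\<close>;
  \<open>sine_distance\<close> transfers this to the Fourier partial sum of the same length, and the
  partial sums increase.\<close>

lemma sine_parseval:
 fixes f :: "real => complex"
 assumes f[measurable]: "f \<in> borel_measurable borel" and f0: "!!y. y \<notin> {0<..<1} ==> f y = 0"
  and fin: "n2 UNIV f < \<infinity>"
 shows "n2 UNIV f = (\<Sum>m. ennreal ((cmod (sine_coef (Suc m) f))^2 / 2))"
proof -
 have f2: "integrable lborel (%y. (cmod (f y))^2)"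
 proof (rule integrableI_nonneg)
  show "(\<integral>\<^sup>+y. ennreal ((cmod (f y))^2) \<partial>lborel) < \<infinity>" using fin by (simp add: n2_def)
 qed auto
 define A where "A = (LINT y|lborel. (cmod (f y))^2)"
 have nA: "n2 UNIV f = ennreal A" unfolding A_def by (rule n2_eq_integral[OF f2])
 define s where "s N = (\<Sum>m\<in>{1..N}. (cmod (sine_coef m f))^2 / 2)" for N
 have sS: "(\<Sum>m<N. (cmod (sine_coef (Suc m) f))^2 / 2) = s N" for N
  unfolding s_def by (rule sum.reindex_bij_witness[of _ "%m. m - 1" Suc]) auto
 note dist = sine_distance[OF f f0 f2, folded A_def s_def]
 have le: "s N <= A" for N
 proof -
  have "0 <= (LINT y|lborel. (cmod (f y - (\<Sum>m\<in>{1..N}. sine_coef m f * of_real (esin m y))))^2)"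
   by (rule Bochner_Integration.integral_nonneg) simp
  also have "... = A - s N" using has_bochner_integral_integral_eq[OF dist[where N=N and a="%m. sine_coef m f"]] by simp
  finally show ?thesis by simp
 qed
 have mono: "s M <= s N" if "M <= N" for M N
  unfolding s_def using that by (intro sum_mono2) auto
 have ex: "\<exists>N. A - s N <= \<delta>" if \<delta>: "\<delta> > 0" for \<delta>
 proof -
  obtain N a where Na: "n2 UNIV (%y. f y - (\<Sum>m\<in>{1..N}. a m * of_real (esin m y))) <= ennreal \<delta>"
   using sine_dense[OF f f0 fin \<delta>] by blast
  note D = dist[where N=N and a=a, unfolded has_bochner_integral_iff]
  have "ennreal (A - s N + (\<Sum>m\<in>{1..N}. (cmod (sine_coef m f - a m))^2 / 2)) <= ennreal \<delta>"
   using Na n2_eq_integral[OF D[THEN conjunct1]] D[THEN conjunct2] by simp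
  then have "A - s N + (\<Sum>m\<in>{1..N}. (cmod (sine_coef m f - a m))^2 / 2) <= \<delta>" using \<delta> by simp
  moreover have "0 <= (\<Sum>m\<in>{1..N}. (cmod (sine_coef m f - a m))^2 / 2)" by (intro sum_nonneg) auto
  ultimately show ?thesis by (intro exI[of _ N]) linarith
 qed
 have "(%N. s N) \<longlonglongrightarrow> A"
 proof (rule LIMSEQ_I)
  fix r :: real assume r: "0 < r"
  then obtain N where N: "A - s N <= r / 2" using ex[of "r / 2"] by auto
  show "\<exists>no. \<forall>n\<ge>no. norm (s n - A) < r"
  proof (intro exI[of _ N] allI impI)
   fix n assume "N <= n"
   then show "norm (s n - A) < r" using N mono[of N n] le[of n] r by simp
  qed
 qed
 then have sums: "(%m. (cmod (sine_coef (Suc m) f))^2 / 2) sums A" by (simp add: sums_def sS)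
 have "(\<Sum>m. ennreal ((cmod (sine_coef (Suc m) f))^2 / 2)) = ennreal (\<Sum>m. (cmod (sine_coef (Suc m) f))^2 / 2)"
  by (rule suminf_ennreal2) (use sums in \<open>auto simp: sums_iff\<close>)
 then show ?thesis using sums nA by (simp add: sums_iff)
qed

definition umode :: "nat => ('a::euclidean_space \<times> real => complex) => 'a => complex" where
 "umode m u x = sine_coef m (%y. u (x, y))"

lemma umode_measurable:
 assumes "u \<in> borel_measurable borel"
 shows "umode m u \<in> borel_measurable borel"
proof -
 have "(%(x, y). u (x, y) * of_real (sin (real m * pi * y))) \<in> borel_measurable (borel \<Otimes>\<^sub>M lborel)"
 proof -
  have s: "sets (borel \<Otimes>\<^sub>M lborel) = sets (borel :: ('a \<times> real) measure)"
   using borel_prod[where 'a='a and 'b=real] sets_pair_measure_cong[OF refl sets_lborel] by metis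
  have "(%p :: 'a \<times> real. u p * complex_of_real (sin (real m * pi * snd p))) \<in> borel_measurable borel"
   using assms by (intro borel_measurable_times borel_measurable_continuous_onI[of "%p. complex_of_real (sin (real m * pi * snd p))"])
    (auto intro!: continuous_intros)
  then show ?thesis by (simp add: measurable_cong_sets[OF s refl] case_prod_unfold)
 qed
 from lborel.borel_measurable_lebesgue_integral[OF this]
 show ?thesis unfolding umode_def[abs_def] sine_coef_def by (intro borel_measurable_times) auto
qed

text \<open>Tonelli reduces the norm to slices over \<open>x\<close>; almost every slice over
  \<open>A\<close> is square integrable, and Parseval applies to it. The factor 1/2 is the squared
  norm of each sine.\<close>

lemma n2_modes:
 fixes u :: "'a::euclidean_space \<times> real => complex"
 assumes u: "u \<in> borel_measurable borel" and u0: "!!x y. y \<notin> {0<..<1} ==> u (x, y) = 0"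
  and A: "A \<in> sets borel" and fin: "n2 (A \<times> UNIV) u < \<infinity>"
 shows "n2 (A \<times> UNIV) u = ennreal (1 / 2) * (\<Sum>m. n2 A (umode (Suc m) u))"
proof -
 note [measurable] = umode_measurable[OF u]
 note [measurable] = A
 have slice[measurable]: "(%y. u (x, y)) \<in> borel_measurable borel" for x
  by (rule measurable_compose[OF borel_measurable_continuous_onI u]) (intro continuous_intros)
 have AU: "indicator (A \<times> UNIV) (x, y) = (indicator A x :: ennreal)" for x :: 'a and y :: real by (simp add: indicator_def)
 have meas: "(%p. ennreal ((cmod (u p))^2) * indicator (A \<times> UNIV) p) \<in> borel_measurable (lborel \<Otimes>\<^sub>M lborel)"
 proof -
  have "A \<times> (UNIV :: real set) \<in> sets borel" using A by (rule borel_Times) simp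
  then have "(%p. ennreal ((cmod (u p))^2) * indicator (A \<times> UNIV) p) \<in> borel_measurable borel"
   using u by measurable
  then show ?thesis by (simp add: lborel_prod)
 qed
 have f: "n2 (A \<times> UNIV) u = (\<integral>\<^sup>+x. n2 UNIV (%y. u (x, y)) * indicator A x \<partial>lborel)"
 proof -
  have "n2 (A \<times> UNIV) u = (\<integral>\<^sup>+x. \<integral>\<^sup>+y. ennreal ((cmod (u (x, y)))^2) * indicator (A \<times> UNIV) (x, y) \<partial>lborel \<partial>lborel)"
   unfolding n2_def lborel_prod[symmetric] by (rule lborel.nn_integral_fst[OF meas, symmetric])
  also have "... = (\<integral>\<^sup>+x. n2 UNIV (%y. u (x, y)) * indicator A x \<partial>lborel)"
   unfolding AU n2_def by (intro nn_integral_cong) (simp add: nn_integral_multc)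
  finally show ?thesis .
 qed
 have nm: "(%x. n2 UNIV (%y. u (x, y)) * indicator A x) \<in> borel_measurable lborel"
 proof -
  have "(%x. \<integral>\<^sup>+y. ennreal ((cmod (u (x, y)))^2) * indicator (A \<times> UNIV) (x, y) \<partial>lborel) \<in> borel_measurable lborel"
   by (rule lborel.borel_measurable_nn_integral_fst[OF meas])
  also have "(%x. \<integral>\<^sup>+y. ennreal ((cmod (u (x, y)))^2) * indicator (A \<times> UNIV) (x, y) \<partial>lborel) = (%x. n2 UNIV (%y. u (x, y)) * indicator A x)"
   unfolding AU n2_def by (intro ext) (simp add: nn_integral_multc)
  finally show ?thesis .
 qed
 have "AE x in lborel. n2 UNIV (%y. u (x, y)) * indicator A x ~= \<infinity>"
  by (rule nn_integral_noteq_infinite[OF nm]) (use fin f in auto)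
 then have "AE x in lborel. n2 UNIV (%y. u (x, y)) * indicator A x
   = (\<Sum>m. ennreal (1 / 2) * (ennreal ((cmod (umode (Suc m) u x))^2) * indicator A x))"
 proof eventually_elim
  fix x assume x: "n2 UNIV (%y. u (x, y)) * indicator A x ~= \<infinity>"
  show "n2 UNIV (%y. u (x, y)) * indicator A x
   = (\<Sum>m. ennreal (1 / 2) * (ennreal ((cmod (umode (Suc m) u x))^2) * indicator A x))"
  proof (cases "x \<in> A")
   case True
   then have "n2 UNIV (%y. u (x, y)) < \<infinity>" using x by (simp add: less_top)
   then have "n2 UNIV (%y. u (x, y)) = (\<Sum>m. ennreal ((cmod (umode (Suc m) u x))^2 / 2))"
    unfolding umode_def by (intro sine_parseval[OF slice]) (rule u0)
   moreover have "ennreal ((cmod z)^2 / 2) = ennreal (1 / 2) * ennreal ((cmod z)^2)" for z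
    by (subst ennreal_mult'[symmetric]) simp_all
   ultimately have "n2 UNIV (%y. u (x, y)) = (\<Sum>m. ennreal (1 / 2) * ennreal ((cmod (umode (Suc m) u x))^2))"
    by (simp only:)
   then show ?thesis using True by (simp only: indicator_simps mult_1_right)
  qed simp
 qed
 from nn_integral_cong_AE[OF this]
 have "n2 (A \<times> UNIV) u = (\<integral>\<^sup>+x. (\<Sum>m. ennreal (1 / 2) * (ennreal ((cmod (umode (Suc m) u x))^2) * indicator A x)) \<partial>lborel)"
  unfolding f .
 also have "... = (\<Sum>m. \<integral>\<^sup>+x. ennreal (1 / 2) * (ennreal ((cmod (umode (Suc m) u x))^2) * indicator A x) \<partial>lborel)"
  by (rule nn_integral_suminf) measurable
 also have "... = (\<Sum>m. ennreal (1 / 2) * n2 A (umode (Suc m) u))"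
  unfolding n2_def by (subst nn_integral_cmult) auto
 also have "... = ennreal (1 / 2) * (\<Sum>m. n2 A (umode (Suc m) u))" by (rule ennreal_suminf_cmult)
 finally show ?thesis .
qed

section \<open>Green's formula in the strip\<close>

lemma L2_mult_integrable:
 assumes f: "L2 Om f" and h: "L2 Om h"
 shows "integrable (lebesgue_on Om) (%x. f x * h x)"
proof (rule Bochner_Integration.integrable_bound)
 show "integrable (lebesgue_on Om) (%x. (cmod (f x))^2 + (cmod (h x))^2)"
  using f h unfolding L2_def by (intro Bochner_Integration.integrable_add) auto
 show "(%x. f x * h x) \<in> borel_measurable (lebesgue_on Om)"
  using f h unfolding L2_def by (intro borel_measurable_times) auto
 have "cmod (f x) * cmod (h x) <= (cmod (f x))^2 + (cmod (h x))^2" for x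
 proof -
  have "0 <= cmod (f x) * cmod (h x)" by simp
  then show ?thesis using sum_squares_bound[of "cmod (f x)" "cmod (h x)"] by linarith
 qed
 then show "AE x in lebesgue_on Om. norm (f x * h x) <= norm ((cmod (f x))^2 + (cmod (h x))^2)"
  by (intro AE_I2) (simp add: norm_mult)
qed

lemma L2_diff:
 assumes f: "L2 Om f" and h: "L2 Om h"
 shows "L2 Om (%x. f x - h x)"
 unfolding L2_def
proof
 show m: "(%x. f x - h x) \<in> borel_measurable (lebesgue_on Om)"
  using f h unfolding L2_def by (intro borel_measurable_diff) auto
 show "integrable (lebesgue_on Om) (%x. (cmod (f x - h x))^2)"
 proof (rule Bochner_Integration.integrable_bound)
  show "integrable (lebesgue_on Om) (%x. 2 * (cmod (f x))^2 + 2 * (cmod (h x))^2)"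
   using f h unfolding L2_def by (intro Bochner_Integration.integrable_add integrable_mult_right) auto
  show "(%x. (cmod (f x - h x))^2) \<in> borel_measurable (lebesgue_on Om)"
   using m by measurable
  have "(cmod (f x - h x))^2 <= 2 * (cmod (f x))^2 + 2 * (cmod (h x))^2" for x
  proof -
   have "(cmod (f x - h x))^2 <= (cmod (f x) + cmod (h x))^2"
    by (intro power_mono norm_triangle_ineq4) auto
   also have "... = (cmod (f x))^2 + (cmod (h x))^2 + 2 * cmod (f x) * cmod (h x)" by (rule power2_sum)
   finally show ?thesis using sum_squares_bound[of "cmod (f x)" "cmod (h x)"] by linarith
  qed
  then show "AE x in lebesgue_on Om. norm ((cmod (f x - h x))^2) <= norm (2 * (cmod (f x))^2 + 2 * (cmod (h x))^2)"
   by (intro AE_I2) simp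
 qed
qed

text \<open>Young's inequality with a small weight \<open>t\<close> on the fixed factor
  \<open>h\<close> plays the role of Cauchy-Schwarz.\<close>

lemma L2_tendsto_mult:
 fixes g :: "nat => 'a::euclidean_space => complex"
 assumes f: "L2 Om f" and g: "!!j. L2 Om (g j)" and h: "L2 Om h"
  and lim: "(%j. LINT x|lebesgue_on Om. (cmod (f x - g j x))^2) \<longlonglongrightarrow> 0"
 shows "(%j. LINT x|lebesgue_on Om. g j x * h x) \<longlonglongrightarrow> (LINT x|lebesgue_on Om. f x * h x)"
proof (rule LIMSEQ_I)
 fix e :: real assume e: "e > 0"
 define H where "H = (LINT x|lebesgue_on Om. (cmod (h x))^2)"
 have H: "H >= 0" unfolding H_def by (rule Bochner_Integration.integral_nonneg) simp
 define t where "t = e / (2 * (H + 1))"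
 have t: "t > 0" "t * H <= e / 2" using e H by (simp_all add: t_def field_simps)
 have "t * (e / 2) > 0" using t e by simp
 from LIMSEQ_D[OF lim this] obtain N where N: "!!j. j >= N ==> norm ((LINT x|lebesgue_on Om. (cmod (f x - g j x))^2) - 0) < t * (e / 2)"
  by auto
 show "\<exists>no. \<forall>n\<ge>no. norm ((LINT x|lebesgue_on Om. g n x * h x) - (LINT x|lebesgue_on Om. f x * h x)) < e"
 proof (intro exI[of _ N] allI impI)
  fix j assume j: "N <= j"
  define D where "D = (LINT x|lebesgue_on Om. (cmod (f x - g j x))^2)"
  have D: "D < t * (e / 2)" using N[OF j] unfolding D_def[symmetric] by simp
  have L: "L2 Om (%x. g j x - f x)" by (rule L2_diff[OF g f])
  have iD: "integrable (lebesgue_on Om) (%x. (cmod (f x - g j x))^2)" using L2_diff[OF f g] by (simp add: L2_def)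
  have iH: "integrable (lebesgue_on Om) (%x. (cmod (h x))^2)" using h by (simp add: L2_def)
  have "(LINT x|lebesgue_on Om. g j x * h x) - (LINT x|lebesgue_on Om. f x * h x) = (LINT x|lebesgue_on Om. (g j x - f x) * h x)"
   using L2_mult_integrable[OF g h] L2_mult_integrable[OF f h] by (simp add: left_diff_distrib)
  then have "norm ((LINT x|lebesgue_on Om. g j x * h x) - (LINT x|lebesgue_on Om. f x * h x)) <= (LINT x|lebesgue_on Om. norm ((g j x - f x) * h x))"
   by (simp add: integral_norm_bound)
  also have "... <= (LINT x|lebesgue_on Om. (1 / (2 * t)) * (cmod (f x - g j x))^2 + (t / 2) * (cmod (h x))^2)"
  proof (rule integral_mono)
   show "integrable (lebesgue_on Om) (%x. norm ((g j x - f x) * h x))"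
    by (intro integrable_norm L2_mult_integrable[OF L h])
   show "integrable (lebesgue_on Om) (%x. (1 / (2 * t)) * (cmod (f x - g j x))^2 + (t / 2) * (cmod (h x))^2)"
    using iD iH by (intro Bochner_Integration.integrable_add integrable_mult_right)
   fix x
   have "2 * t * (cmod (f x - g j x) * cmod (h x)) <= (cmod (f x - g j x))^2 + (t * cmod (h x))^2"
    using sum_squares_bound[of "cmod (f x - g j x)" "t * cmod (h x)"] by (simp add: mult_ac)
   then have "cmod (f x - g j x) * cmod (h x) <= ((cmod (f x - g j x))^2 + (t * cmod (h x))^2) / (2 * t)"
    using t by (simp add: pos_le_divide_eq mult_ac)
   also have "... = (1 / (2 * t)) * (cmod (f x - g j x))^2 + (t / 2) * (cmod (h x))^2"
    using t by (simp add: field_simps power2_eq_square)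
   finally show "norm ((g j x - f x) * h x) <= (1 / (2 * t)) * (cmod (f x - g j x))^2 + (t / 2) * (cmod (h x))^2"
    by (simp add: norm_mult norm_minus_commute)
  qed
  also have "... = (1 / (2 * t)) * D + (t / 2) * H" using iD iH by (simp add: D_def H_def)
  also have "... < e"
  proof -
   have "(1 / (2 * t)) * D < (1 / (2 * t)) * (t * (e / 2))" using D t by (intro mult_strict_left_mono) auto
   also have "... = e / 4" using t by simp
   finally show ?thesis using t e by simp
  qed
  finally show "norm ((LINT x|lebesgue_on Om. g j x * h x) - (LINT x|lebesgue_on Om. f x * h x)) < e" .
 qed
qed

lemma borel_measurable_lebesgue_on: "h \<in> borel_measurable borel ==> h \<in> borel_measurable (lebesgue_on Om)"
 by (intro measurable_restrict_space1 measurable_completion) simp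

lemma borel_in_lebesgue: "Om \<in> sets borel ==> Om \<inter> space lebesgue \<in> sets lebesgue"
 by (simp add: sets_completionI_sets)

lemma L2_bounded:
 fixes h :: "'a::euclidean_space => complex"
 assumes Om: "Om \<in> sets borel" and h[measurable]: "h \<in> borel_measurable borel"
  and B: "!!x. x \<in> Om ==> cmod (h x) <= B" and R: "!!x. x \<in> Om ==> norm x >= R ==> h x = 0"
 shows "L2 Om h"
 unfolding L2_def
proof
 show "h \<in> borel_measurable (lebesgue_on Om)" by (rule borel_measurable_lebesgue_on[OF h])
 note [measurable] = Om
 have m: "(%x. indicator Om x *\<^sub>R (cmod (h x))\<^sup>2) \<in> borel_measurable lborel" by measurable
 have "integrable lborel (%x. indicator Om x *\<^sub>R (cmod (h x))\<^sup>2)"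
 proof (rule Bochner_Integration.integrable_bound[OF _ m])
  show "integrable lborel (%x. B^2 * indicator (cball (0::'a) R) x)"
   using emeasure_compact_finite[OF compact_cball, of "0::'a" R] by (intro integrable_mult_right integrable_real_indicator) auto
  show "AE x in lborel. norm (indicator Om x *\<^sub>R (cmod (h x))\<^sup>2) <= norm (B^2 * indicator (cball 0 R) x)"
  proof (rule AE_I2)
   fix x :: 'a
   show "norm (indicator Om x *\<^sub>R (cmod (h x))\<^sup>2) <= norm (B^2 * indicator (cball 0 R) x)"
   proof (cases "x \<in> Om & norm x <= R")
    case True
    then have "(cmod (h x))^2 <= B^2" using B[of x] by (intro power_mono) auto
    then show ?thesis using True by simp
   next
    case False
    then show ?thesis using R[of x] by (cases "x \<in> Om") auto
   qed
  qed
 qed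
 then show "integrable (lebesgue_on Om) (%x. (cmod (h x))^2)"
  using integrable_restrict_space[OF borel_in_lebesgue[OF Om], of "%x. (cmod (h x))^2"]
   integrable_completion[OF m] by simp
qed

text \<open>The dominating function is \<open>|g|\<close> times a multiple of the indicator of a
  ball, integrable as a product of two \<open>L2\<close> functions.\<close>

lemma L2_dominated_convergence:
 fixes g :: "'a::euclidean_space => complex"
 assumes Om: "Om \<in> sets borel" and g: "L2 Om g"
  and D: "!!j. D j \<in> borel_measurable borel" "D' \<in> borel_measurable borel"
  and B: "!!j x. x \<in> Om ==> cmod (D j x) <= B" and R: "!!j x. x \<in> Om ==> norm x >= R ==> D j x = 0"
  and lim: "!!x. x \<in> Om ==> (%j. D j x) \<longlonglongrightarrow> D' x"
 shows "(%j. LINT x|lebesgue_on Om. g x * D j x) \<longlonglongrightarrow> (LINT x|lebesgue_on Om. g x * D' x)"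
proof (rule integral_dominated_convergence[where w="%x. norm (g x * of_real (\<bar>B\<bar> * indicator (cball 0 R) x))"])
 note [measurable] = borel_measurable_lebesgue_on[OF D(1)] borel_measurable_lebesgue_on[OF D(2)]
 have [measurable]: "g \<in> borel_measurable (lebesgue_on Om)" using g by (simp add: L2_def)
 show "(%x. g x * D' x) \<in> borel_measurable (lebesgue_on Om)" "(%x. g x * D j x) \<in> borel_measurable (lebesgue_on Om)" for j
  by measurable
 have "L2 Om (%x. of_real (\<bar>B\<bar> * indicator (cball 0 R) x))"
  by (rule L2_bounded[OF Om, of _ "\<bar>B\<bar>" "R + 1"]) (auto simp: indicator_def)
 from integrable_norm[OF L2_mult_integrable[OF g this]]
 show "integrable (lebesgue_on Om) (%x. norm (g x * of_real (\<bar>B\<bar> * indicator (cball 0 R) x)))" .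
 show "AE x in lebesgue_on Om. (%j. g x * D j x) \<longlonglongrightarrow> g x * D' x"
  by (intro AE_I2 tendsto_mult_left lim) (simp add: space_restrict_space)
 show "AE x in lebesgue_on Om. norm (g x * D j x) <= norm (g x * of_real (\<bar>B\<bar> * indicator (cball 0 R) x))" for j
 proof (rule AE_I2)
  fix x assume "x \<in> space (lebesgue_on Om)"
  then have x: "x \<in> Om" by (simp add: space_restrict_space)
  show "norm (g x * D j x) <= norm (g x * of_real (\<bar>B\<bar> * indicator (cball 0 R) x))"
  proof (cases "norm x <= R")
   case True
   have "cmod (g x) * cmod (D j x) <= cmod (g x) * \<bar>B\<bar>" using B[OF x, of j] by (intro mult_left_mono) auto
   then show ?thesis using True by (simp add: norm_mult)
  next
   case False
   then show ?thesis using R[OF x, of j] by simp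
  qed
 qed
qed

text \<open>The bridge from \<open>lebesgue_on\<close> in the definitions to \<open>lborel\<close>
  in the estimates. Measurability of \<open>g\<close> on \<open>Om\<close> comes from its almost
  everywhere equality with \<open>h\<close>, by completeness of the measure.\<close>

lemma lebesgue_on_integral_eq_lborel:
 fixes g h :: "'a::euclidean_space => complex"
 assumes Om: "Om \<in> sets borel" and h: "h \<in> borel_measurable borel" and h0: "!!x. x \<notin> Om ==> h x = 0"
  and AE: "AE x in lebesgue_on Om. g x = h x"
 shows "(LINT x|lebesgue_on Om. g x) = (LINT x|lborel. h x)"
proof -
 have hl: "h \<in> borel_measurable lebesgue" using h by (intro measurable_completion) simp
 have AE': "AE x in lebesgue. h x = indicator Om x *\<^sub>R g x"
  using AE unfolding AE_restrict_space_iff[OF borel_in_lebesgue[OF Om]]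
  by eventually_elim (use h0 in \<open>auto simp: indicator_def\<close>)
 have gl: "(%x. indicator Om x *\<^sub>R g x) \<in> borel_measurable lebesgue" by (rule borel_measurable_AE[OF hl AE'])
 have "(LINT x|lebesgue_on Om. g x) = (LINT x|lebesgue. indicator Om x *\<^sub>R g x)"
  by (rule integral_restrict_space[OF borel_in_lebesgue[OF Om]])
 also have "... = (LINT x|lebesgue. h x)" by (rule integral_cong_AE[OF gl hl]) (use AE' in auto)
 also have "... = (LINT x|lborel. h x)" by (rule integral_completion) (use h in simp)
 finally show ?thesis .
qed

text \<open>The span of the sine and the cosine of one frequency is closed under
  differentiation.\<close>

lemma smooth_real_sin_cos: "smooth_real (%t. a * sin (c * t) + b * cos (c * t))"
proof (rule smooth_real_coinduct[where P="%f. \<exists>a b. f = (%t. a * sin (c * t) + b * cos (c * t))"])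
 fix \<phi> :: "real => real" assume "\<exists>a b. \<phi> = (%t. a * sin (c * t) + b * cos (c * t))"
 then obtain a b where \<phi>: "\<phi> = (%t. a * sin (c * t) + b * cos (c * t))" by (elim exE) (rule that)
 show "\<exists>\<psi>. (\<exists>a b. \<psi> = (%t. a * sin (c * t) + b * cos (c * t))) & (\<forall>t. (\<phi> has_real_derivative \<psi> t) (at t))"
 proof (rule exI[of _ "%t. (- (b * c)) * sin (c * t) + (a * c) * cos (c * t)"], intro conjI allI)
  show "\<exists>a' b'. (%t. (- (b * c)) * sin (c * t) + (a * c) * cos (c * t)) = (%t. a' * sin (c * t) + b' * cos (c * t))"
   by (rule exI, rule exI, rule refl)
  show "(\<phi> has_real_derivative (- (b * c)) * sin (c * t) + (a * c) * cos (c * t)) (at t)" for t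
   unfolding \<phi> by (auto intro!: derivative_eq_intros simp: algebra_simps)
 qed
qed auto

text \<open>The derivative of the cut-off is of order \<open>j\<close> in a layer of width \<open>1/j\<close>, where the sine is of order \<open>1/j\<close>.\<close>

lemma sine_cutoffs:
 fixes m :: nat
 defines "c \<equiv> real m * pi"
 obtains q q1 :: "nat => real => real" and B :: real where
  "!!j. smooth_real (q j)" "!!j. continuous_on UNIV (q1 j)" "!!j t. (q j has_real_derivative q1 j t) (at t)"
  "!!j t. t <= 1 / (real j + 2) \<or> t >= 1 - 1 / (real j + 2) ==> q j t = 0"
  "!!j t. 0 < t ==> t < 1 ==> \<bar>q j t\<bar> <= B" "!!j t. 0 < t ==> t < 1 ==> \<bar>q1 j t\<bar> <= B"
  "!!t. 0 < t ==> t < 1 ==> (%j. q j t) \<longlonglongrightarrow> sin (c * t)"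
  "!!t. 0 < t ==> t < 1 ==> (%j. q1 j t) \<longlonglongrightarrow> c * cos (c * t)"
proof -
 obtain S1 S2 M where S: "smooth_real S1" "smooth_real S2"
  "!!t. (smooth_step has_real_derivative S1 t) (at t)" "!!t. (S1 has_real_derivative S2 t) (at t)"
  "!!t. t <= 0 \<or> t >= 1 ==> S1 t = 0" "!!t. t <= 0 \<or> t >= 1 ==> S2 t = 0"
  "!!t. S1 t >= 0" "M > 0" "!!t. \<bar>S1 t\<bar> <= M" "!!t. \<bar>S2 t\<bar> <= M"
  by (rule smooth_step_derivs) (rule that)
 have c: "c >= 0" by (simp add: c_def)
 define n where "n j = real j + 2" for j :: nat
 have n: "n j > 0" for j by (simp add: n_def)
 \<comment> \<open>\<open>a\<close> rises from 0 to 1 on \<open>[1/n, 2/n]\<close>, and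
   \<open>b\<close> falls symmetrically near the right end.\<close>
 define a where "a j t = smooth_step (- 1 + n j * t)" for j t
 define b where "b j t = smooth_step ((n j - 1) + (- n j) * t)" for j t
 define q where "q j t = a j t * (b j t * sin (c * t))" for j t
 define q1 where "q1 j t = (n j * S1 (- 1 + n j * t)) * (b j t * sin (c * t))
   + a j t * ((- n j * S1 ((n j - 1) + (- n j) * t)) * sin (c * t) + b j t * (c * cos (c * t)))" for j t
 have sb: "\<bar>smooth_step t\<bar> <= 1" for t using smooth_step_bounds[of t] by simp
 have ca: "continuous_on UNIV smooth_step" "continuous_on UNIV S1"
  by (rule smooth_real_continuous[OF smooth_real_smooth_step], rule smooth_real_continuous[OF S(1)])
 have s1: "\<bar>sin (c * t)\<bar> <= c * t" if "t >= 0" for t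
  using abs_sin_x_le_abs_x[of "c * t"] that c by simp
 \<comment> \<open>\<open>c\<close> is a multiple of \<open>\<pi>\<close>, so the sine vanishes
   linearly at the right end too.\<close>
 have s2: "\<bar>sin (c * t)\<bar> <= c * (1 - t)" if "t <= 1" for t
 proof -
  have "sin (c * t) = sin (c - c * (1 - t))" by (simp add: algebra_simps)
  also have "... = - cos c * sin (c * (1 - t))" unfolding sin_diff by (simp add: c_def)
  finally have "\<bar>sin (c * t)\<bar> = \<bar>sin (c * (1 - t))\<bar>" by (simp add: abs_mult c_def)
  also have "... <= c * (1 - t)" using abs_sin_x_le_abs_x[of "c * (1 - t)"] that c by simp
  finally show ?thesis .
 qed
 have layer: "n j * \<bar>S1 z\<bar> * \<bar>s\<bar> <= 2 * M * c" if "z > 0 & z < 1 ==> \<bar>s\<bar> <= c * (2 / n j)" for j z s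
 proof (cases "z > 0 & z < 1")
  case True
  have "n j * \<bar>S1 z\<bar> * \<bar>s\<bar> <= n j * M * (c * (2 / n j))"
   using S(8) S(9)[of z] that[OF True] n[of j] by (intro mult_mono) auto
  then show ?thesis using n[of j] by (simp add: mult_ac)
 next
  case False
  then show ?thesis using S(5)[of z] S(8) c by (simp add: not_less)
 qed
 have bq1: "\<bar>q1 j t\<bar> <= 4 * M * c + c + 1" if t: "0 < t" "t < 1" for j t
 proof -
  have e1: "n j * \<bar>S1 (- 1 + n j * t)\<bar> * \<bar>sin (c * t)\<bar> <= 2 * M * c"
  proof (rule layer)
   assume "- 1 + n j * t > 0 & - 1 + n j * t < 1"
   then have "t <= 2 / n j" using n[of j] by (simp add: field_simps)
   then have "c * t <= c * (2 / n j)" using c by (intro mult_left_mono)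
   then show "\<bar>sin (c * t)\<bar> <= c * (2 / n j)" using s1[of t] t by linarith
  qed
  have e2: "n j * \<bar>S1 ((n j - 1) + (- n j) * t)\<bar> * \<bar>sin (c * t)\<bar> <= 2 * M * c"
  proof (rule layer)
   assume "(n j - 1) + (- n j) * t > 0 & (n j - 1) + (- n j) * t < 1"
   then have "n j * (1 - t) <= 2" by (simp add: algebra_simps)
   then have "1 - t <= 2 / n j" using n[of j] by (simp add: pos_le_divide_eq mult.commute)
   then have "c * (1 - t) <= c * (2 / n j)" using c by (intro mult_left_mono)
   then show "\<bar>sin (c * t)\<bar> <= c * (2 / n j)" using s2[of t] t by linarith
  qed
  have ab: "\<bar>a j t\<bar> <= 1" "\<bar>b j t\<bar> <= 1" using sb by (auto simp: a_def b_def)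
  have "\<bar>(n j * S1 (- 1 + n j * t)) * (b j t * sin (c * t))\<bar> = \<bar>b j t\<bar> * (n j * \<bar>S1 (- 1 + n j * t)\<bar> * \<bar>sin (c * t)\<bar>)"
   using n[of j] by (simp add: abs_mult)
  also have "... <= 1 * (2 * M * c)" by (rule mult_mono) (use ab e1 n[of j] in auto)
  finally have 1: "\<bar>(n j * S1 (- 1 + n j * t)) * (b j t * sin (c * t))\<bar> <= 2 * M * c" by simp
  have "\<bar>(- n j * S1 ((n j - 1) + (- n j) * t)) * sin (c * t)\<bar> <= 2 * M * c"
   using e2 n[of j] by (simp add: abs_mult)
  moreover have "\<bar>b j t * (c * cos (c * t))\<bar> <= 1 * (c * 1)"
   unfolding abs_mult using ab c by (intro mult_mono) auto
  ultimately have "\<bar>(- n j * S1 ((n j - 1) + (- n j) * t)) * sin (c * t) + b j t * (c * cos (c * t))\<bar> <= 2 * M * c + c" by linarith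
  then have 2: "\<bar>a j t * ((- n j * S1 ((n j - 1) + (- n j) * t)) * sin (c * t) + b j t * (c * cos (c * t)))\<bar> <= 1 * (2 * M * c + c)"
   unfolding abs_mult[of "a j t"] using ab by (intro mult_mono) auto
  show ?thesis unfolding q1_def
   by (rule order_trans[OF abs_triangle_ineq order_trans[OF add_mono[OF 1 2]]]) (simp add: algebra_simps)
 qed
 have ev: "\<forall>\<^sub>F j in sequentially. n j * t > 2 & n j * (1 - t) > 2" if t: "0 < t" "t < 1" for t
 proof -
  obtain N where N: "real N >= 2 / t + 2 / (1 - t)" using real_arch_simple by blast
  have pos: "2 / t > 0" "2 / (1 - t) > 0" using t by auto
  show ?thesis
   unfolding eventually_sequentially
  proof (intro exI[of _ N] allI impI)
   fix j assume "N <= j"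
   then have "real N <= real j" by simp
   then have "n j > 2 / t" "n j > 2 / (1 - t)" using N pos unfolding n_def by linarith+
   then show "n j * t > 2 & n j * (1 - t) > 2" using t by (simp add: pos_divide_less_eq)
  qed
 qed
 have ev1: "a j t = 1 & b j t = 1 & S1 (- 1 + n j * t) = 0 & S1 ((n j - 1) + (- n j) * t) = 0"
  if "n j * t > 2 & n j * (1 - t) > 2" for j t
  using that S(5)[of "- 1 + n j * t"] S(5)[of "(n j - 1) + (- n j) * t"] unfolding a_def b_def
  by (auto intro!: smooth_step_1 simp: algebra_simps)
 have lq: "q j t = sin (c * t)" if "n j * t > 2 & n j * (1 - t) > 2" for j t
  using ev1[OF that] by (simp add: q_def)
 have lq1: "q1 j t = c * cos (c * t)" if "n j * t > 2 & n j * (1 - t) > 2" for j t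
  using ev1[OF that] by (simp add: q1_def)
 show ?thesis
 proof (rule that[of q q1 "4 * M * c + c + 1"])
  show "smooth_real (q j)" for j
   unfolding q_def[abs_def] a_def[abs_def] b_def[abs_def]
   using smooth_real_sin_cos[of 1 c 0] by (intro smooth_real_mult smooth_real_affine smooth_real_smooth_step) simp
  show "continuous_on UNIV (q1 j)" for j
   unfolding q1_def[abs_def] a_def[abs_def] b_def[abs_def]
   by (intro continuous_intros continuous_on_compose2[OF ca(1)] continuous_on_compose2[OF ca(2)]) auto
  show "(q j has_real_derivative q1 j t) (at t)" for j t
  proof -
   have 1: "(a j has_real_derivative n j * S1 (- 1 + n j * t)) (at t)"
    unfolding a_def[abs_def] by (rule DERIV_cong[OF DERIV_chain2[OF S(3)]]) (auto intro!: derivative_eq_intros)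
   have 2: "(b j has_real_derivative - n j * S1 ((n j - 1) + (- n j) * t)) (at t)"
    unfolding b_def[abs_def] by (rule DERIV_cong[OF DERIV_chain2[OF S(3)]]) (auto intro!: derivative_eq_intros)
   have 3: "((%t. sin (c * t)) has_real_derivative c * cos (c * t)) (at t)" by (auto intro!: derivative_eq_intros)
   from DERIV_mult[OF 1 DERIV_mult[OF 2 3]] show ?thesis
    unfolding q_def[abs_def] by (rule DERIV_cong) (simp add: q1_def algebra_simps)
  qed
  show "q j t = 0" if "t <= 1 / (real j + 2) \<or> t >= 1 - 1 / (real j + 2)" for j t
  proof -
   have "- 1 + n j * t <= 0 \<or> (n j - 1) + (- n j) * t <= 0"
    using that n[of j] unfolding n_def[symmetric] by (auto simp: field_simps)
   then show ?thesis unfolding q_def a_def b_def using smooth_step_0 by auto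
  qed
  show "\<bar>q j t\<bar> <= 4 * M * c + c + 1" for j t
  proof -
   have "\<bar>q j t\<bar> <= 1 * (1 * 1)" unfolding q_def abs_mult a_def b_def using sb by (intro mult_mono) auto
   moreover have "0 <= 4 * M * c + c" using S(8) c by simp
   ultimately show ?thesis by linarith
  qed
  show "\<bar>q1 j t\<bar> <= 4 * M * c + c + 1" if "0 < t" "t < 1" for j t by (rule bq1[OF that])
  show "(%j. q j t) \<longlonglongrightarrow> sin (c * t)" if "0 < t" "t < 1" for t
   by (rule tendsto_eventually, rule eventually_mono[OF ev[OF that]]) (rule lq)
  show "(%j. q1 j t) \<longlonglongrightarrow> c * cos (c * t)" if "0 < t" "t < 1" for t
   by (rule tendsto_eventually, rule eventually_mono[OF ev[OF that]]) (rule lq1)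
 qed
qed

section \<open>Products of a function on the cross-section with a profile across the strip\<close>

definition tensor :: "('a::euclidean_space => complex) => (real => real) => 'a \<times> real => complex" where
 "tensor zt q p = zt (fst p) * complex_of_real (q (snd p))"

lemma smooth_of_real: "smooth_real q ==> smooth (%t. complex_of_real (q t))"
 using smooth_comp_of_real[of q "%t::real. t"] smooth_inner[of "1::real"] by simp

lemma smooth_tensor: "smooth zt ==> smooth_real q ==> smooth (tensor zt q)"
 unfolding tensor_def[abs_def] by (intro smooth_mult smooth_fst smooth_snd smooth_of_real)

lemma pd_tensor:
 fixes zt :: "'a::euclidean_space => complex"
 assumes zt: "smooth zt" and q: "smooth_real q" "!!t. (q has_real_derivative q1 t) (at t)"
 shows "pd b (tensor zt q) p = zt (fst p) * of_real (q1 (snd p) * snd b) + frechet_derivative zt (at (fst p)) (fst b) * of_real (q (snd p))"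
proof -
 have "((%t. complex_of_real (q t)) has_derivative (%h. complex_of_real (q1 (snd p) * h))) (at (snd p))"
  using q(2)[of "snd p"] unfolding has_field_derivative_def by (intro has_derivative_of_real)
 then have f: "frechet_derivative (%t. complex_of_real (q t)) (at (snd p)) = (%h. complex_of_real (q1 (snd p) * h))"
  by (rule frechet_derivative_at[symmetric])
 have d2: "(%t. complex_of_real (q t)) differentiable (at (snd p))"
  by (rule smooth_differentiable[OF smooth_of_real[OF q(1)]])
 have d1: "zt differentiable (at (fst p))" by (rule smooth_differentiable[OF zt])
 have "pd b (tensor zt q) p = zt (fst p) * pd b (%p. complex_of_real (q (snd p))) p + pd b (%p. zt (fst p)) p * of_real (q (snd p))"
  unfolding tensor_def[abs_def]
  by (rule pd_mult) (rule smooth_differentiable[OF smooth_fst[OF zt]], rule smooth_differentiable[OF smooth_snd[OF smooth_of_real[OF q(1)]]])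
 then show ?thesis unfolding pd_snd[OF d2] pd_fst[OF d1] f .
qed

lemma pd_tensor_fst:
 fixes zt :: "'a::euclidean_space => complex"
 assumes "smooth zt" "smooth_real q"
 shows "pd (i, 0) (tensor zt q) = tensor (pd i zt) q"
proof
 fix p :: "'a \<times> real"
 obtain q1 where q1: "!!t. (q has_real_derivative q1 t) (at t)" by (rule smooth_realE[OF assms(2)]) (rule that)
 from pd_tensor[OF assms q1, of "(i, 0)" p] show "pd (i, 0) (tensor zt q) p = tensor (pd i zt) q p"
  by (simp add: tensor_def pd_def)
qed

lemma pd_tensor_snd:
 fixes zt :: "'a::euclidean_space => complex"
 assumes "smooth zt" "smooth_real q" "!!t. (q has_real_derivative q1 t) (at t)"
 shows "pd (0, 1) (tensor zt q) = tensor zt q1"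
proof
 fix p :: "'a \<times> real"
 have "frechet_derivative zt (at (fst p)) 0 = 0"
  by (rule linear_0[OF linear_frechet_derivative[OF smooth_differentiable[OF assms(1)]]])
 with pd_tensor[OF assms, of "(0, 1)" p] show "pd (0, 1) (tensor zt q) p = tensor zt q1 p"
  by (simp add: tensor_def)
qed

lemma Basis_prod_real_cases:
 assumes "b \<in> (Basis :: ('a::euclidean_space \<times> real) set)"
 obtains i where "i \<in> Basis" "b = (i, 0)" | "b = (0, 1)"
 using assms unfolding Basis_prod_def by auto

lemma sum_Basis_prod_real:
 fixes f :: "'a::euclidean_space \<times> real => complex"
 shows "(\<Sum>b\<in>Basis. f b) = (\<Sum>i\<in>Basis. f (i, 0)) + f (0, 1)"
proof -
 have B: "(Basis :: ('a \<times> real) set) = insert (0, 1) ((%i. (i, 0)) ` Basis)" by (auto simp: Basis_prod_def)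
 have "(0, 1) \<notin> (%i::'a. (i, 0::real)) ` Basis" by auto
 then show ?thesis unfolding B by (simp add: sum.reindex inj_on_def)
qed

lemma lap_tensor:
 fixes zt :: "'a::euclidean_space => complex"
 assumes zt: "smooth zt" and q: "smooth_real q" "smooth_real q1"
  and d: "!!t. (q has_real_derivative q1 t) (at t)" "!!t. (q1 has_real_derivative q2 t) (at t)"
 shows "lap (tensor zt q) p = lap zt (fst p) * of_real (q (snd p)) + zt (fst p) * of_real (q2 (snd p))"
proof -
 have "pd (i, 0) (pd (i, 0) (tensor zt q)) p = pd i (pd i zt) (fst p) * of_real (q (snd p))" if "i \<in> Basis" for i
  unfolding pd_tensor_fst[OF zt q(1)] pd_tensor_fst[OF smooth_pd[OF zt that] q(1)] by (simp add: tensor_def)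
 moreover have "pd (0, 1) (pd (0, 1) (tensor zt q)) p = zt (fst p) * of_real (q2 (snd p))"
  unfolding pd_tensor_snd[OF zt q(1) d(1)] pd_tensor_snd[OF zt q(2) d(2)] by (simp add: tensor_def)
 ultimately show ?thesis unfolding lap_def sum_Basis_prod_real by (simp add: sum_distrib_right)
qed

text \<open>The product has compact support inside \<open>Om\<close>, so the integrals over
  \<open>Om\<close> are integrals over the whole space and no boundary term arises.\<close>

lemma integral_by_parts_test:
 fixes \<phi> \<psi> :: "'a::euclidean_space => complex"
 assumes Om: "Om \<in> sets borel" and \<phi>: "test_function Om \<phi>" and \<psi>: "smooth \<psi>" and b: "b \<in> Basis"
 shows "(LINT x|lebesgue_on Om. \<phi> x * pd b \<psi> x) = - (LINT x|lebesgue_on Om. pd b \<phi> x * \<psi> x)"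
proof -
 obtain K where K: "smooth \<phi>" "compact K" "K \<subseteq> Om" "!!x. x \<notin> K ==> \<phi> x = 0" by (rule test_functionE[OF \<phi>]) (rule that)
 have z: "\<phi> x = 0" "pd b \<phi> x = 0" if "x \<notin> Om" for x
 proof -
  have "x \<notin> K" using K(3) that by blast
  then show "\<phi> x = 0" "pd b \<phi> x = 0" by (rule K(4), intro pd_eq_0_outside[OF compact_imp_closed[OF K(2)] K(4)])
 qed
 have t1: "test_function Om (%x. \<phi> x * pd b \<psi> x)" by (rule test_function_mult[OF \<phi> smooth_pd[OF \<psi> b]])
 have t2: "test_function Om (%x. pd b \<phi> x * \<psi> x)" by (rule test_function_mult[OF test_function_pd[OF \<phi> b] \<psi>])
 have t3: "test_function Om (%x. \<phi> x * \<psi> x)" by (rule test_function_mult[OF \<phi> \<psi>])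
 have "pd b (%x. \<phi> x * \<psi> x) = (%x. \<phi> x * pd b \<psi> x + pd b \<phi> x * \<psi> x)"
  by (rule ext) (rule pd_mult[OF smooth_differentiable[OF K(1)] smooth_differentiable[OF \<psi>]])
 then have "0 = (LINT x|lborel. \<phi> x * pd b \<psi> x + pd b \<phi> x * \<psi> x)" using integral_pd_test_function[OF t3 b] by simp
 also have "... = (LINT x|lborel. \<phi> x * pd b \<psi> x) + (LINT x|lborel. pd b \<phi> x * \<psi> x)"
  by (rule Bochner_Integration.integral_add[OF test_function_integrable[OF t1] test_function_integrable[OF t2]])
 also have "(LINT x|lborel. \<phi> x * pd b \<psi> x) = (LINT x|lebesgue_on Om. \<phi> x * pd b \<psi> x)"
  by (rule lebesgue_on_integral_eq_lborel[OF Om borel_measurable_continuous_onI[OF test_function_continuous[OF t1]], symmetric]) (use z in auto)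
 also have "(LINT x|lborel. pd b \<phi> x * \<psi> x) = (LINT x|lebesgue_on Om. pd b \<phi> x * \<psi> x)"
  by (rule lebesgue_on_integral_eq_lborel[OF Om borel_measurable_continuous_onI[OF test_function_continuous[OF t2]], symmetric]) (use z in auto)
 finally show ?thesis by (simp add: add_eq_0_iff)
qed

lemma waveguide_borel: "(waveguide :: ((real^'d) \<times> real) set) \<in> sets borel"
 unfolding waveguide_def by (intro borel_open open_Times) auto

lemma in_waveguide: "p \<in> waveguide \<longleftrightarrow> 0 < snd p & snd p < 1"
 by (cases p) (simp add: waveguide_def)

lemma ex_cutoff_function:
 assumes "T > 0"
 shows "\<exists>\<eta>. test_function UNIV \<eta> & (\<forall>p::'a::euclidean_space. norm p <= T --> \<eta> p = 1)"
proof -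
 obtain M where M: "M > 0 & (\<forall>T>0. \<exists>Q Q1 Q2. smooth_real Q & smooth_real Q1 & smooth_real Q2 &
   (\<forall>t. (Q has_real_derivative Q1 t) (at t)) & (\<forall>t. (Q1 has_real_derivative Q2 t) (at t)) &
   (\<forall>s. 0 <= Q s & Q s <= 1 & Q1 s <= 0 & \<bar>Q1 s\<bar> <= M / T^2 & \<bar>Q2 s\<bar> <= M / T ^ 4) &
   (\<forall>s\<le>T^2. Q s = 1) & (\<forall>s\<ge>2 * T^2. Q s = 0) &
   (\<forall>s. s <= T^2 \<or> s >= 2 * T^2 --> Q1 s = 0 & Q2 s = 0))"
  using cutoff_exists by (elim exE) (rule that)
 obtain Q Q1 Q2 where Q: "smooth_real Q & smooth_real Q1 & smooth_real Q2 &
   (\<forall>t. (Q has_real_derivative Q1 t) (at t)) & (\<forall>t. (Q1 has_real_derivative Q2 t) (at t)) &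
   (\<forall>s. 0 <= Q s & Q s <= 1 & Q1 s <= 0 & \<bar>Q1 s\<bar> <= M / T^2 & \<bar>Q2 s\<bar> <= M / T ^ 4) &
   (\<forall>s\<le>T^2. Q s = 1) & (\<forall>s\<ge>2 * T^2. Q s = 0) &
   (\<forall>s. s <= T^2 \<or> s >= 2 * T^2 --> Q1 s = 0 & Q2 s = 0)"
  using M[THEN conjunct2, rule_format, OF assms] by (elim exE) (rule that)
 note Qs = Q[THEN conjunct2, THEN conjunct2, THEN conjunct2, THEN conjunct2, THEN conjunct2, THEN conjunct2]
 note Q1s = Qs[THEN conjunct1, rule_format] and Q0s = Qs[THEN conjunct2, THEN conjunct1, rule_format]
 have "test_function UNIV (radial Q :: 'a => complex)"
 proof (rule test_function_UNIVI[OF smooth_radial[OF Q[THEN conjunct1]], of "2 * T"])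
  fix x :: 'a assume "2 * T <= norm x"
  then have "(2 * T)^2 <= (norm x)^2" using assms by (intro power_mono) auto
  moreover have "(2 * T)^2 = 4 * T^2" by (simp add: power_mult_distrib)
  ultimately have "2 * T^2 <= (norm x)^2" using zero_le_power2[of T] by linarith
  from Q0s[OF this] show "radial Q x = 0" by (simp add: radial_def)
 qed
 moreover have "radial Q p = 1" if "norm p <= T" for p :: 'a
 proof -
  have "(norm p)^2 <= T^2" using that by (intro power_mono) auto
  from Q1s[OF this] show ?thesis by (simp add: radial_def)
 qed
 ultimately show ?thesis by (intro exI[of _ "radial Q"] conjI allI impI)
qed

lemma L2_test_function:
 assumes "Om \<in> sets borel" "test_function Om' f"
 shows "L2 Om f"
proof -
 obtain M where M: "!!x. norm (f x) <= M" by (rule test_function_bounded[OF assms(2)]) (rule that)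
 obtain R where R: "!!x. norm x >= R ==> f x = 0" by (rule test_function_cball[OF assms(2)]) (rule that)
 show ?thesis
  by (rule L2_bounded[where h=f and B=M and R=R, OF assms(1) borel_measurable_continuous_onI[OF test_function_continuous[OF assms(2)]] M R])
qed

lemma tensor_measurable:
 assumes Z: "continuous_on UNIV Z" and q: "continuous_on UNIV q"
 shows "tensor Z q \<in> borel_measurable borel"
proof -
 have "continuous_on UNIV (%p. Z (fst p))"
  by (rule continuous_on_compose2[OF Z]) (intro continuous_intros, simp)
 moreover have "continuous_on UNIV (%p. q (snd p))"
  by (rule continuous_on_compose2[OF q]) (intro continuous_intros, simp)
 then have "continuous_on UNIV (%p. complex_of_real (q (snd p)))" by (rule continuous_on_of_real)
 ultimately show ?thesis
  unfolding tensor_def[abs_def] by (intro borel_measurable_continuous_onI continuous_on_mult)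
qed

lemma tensor_outside:
 fixes Z :: "real^'d => complex"
 assumes "!!x. norm x >= R ==> Z x = 0" "p \<in> waveguide" "norm p >= R + 1"
 shows "tensor Z q p = 0"
proof -
 have "norm p <= norm (fst p) + norm (snd p)" using norm_Pair_le[of "fst p" "snd p"] by simp
 then have "norm (fst p) >= R" using assms(2,3) by (simp add: in_waveguide)
 then show ?thesis by (simp add: tensor_def assms(1))
qed

lemma tensor_limit:
 fixes Z :: "real^'d => complex" and g :: "(real^'d) \<times> real => complex"
 assumes g: "L2 waveguide g" and Z: "continuous_on UNIV Z" "!!x. norm x >= R ==> Z x = 0"
  and q: "!!j. continuous_on UNIV (q j)" "continuous_on UNIV r"
  and B: "!!j t. 0 < t ==> t < 1 ==> \<bar>q j t\<bar> <= B" and lim: "!!t. 0 < t ==> t < 1 ==> (%j. q j t) \<longlonglongrightarrow> r t"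
 shows "(%j. LINT p|lebesgue_on waveguide. g p * tensor Z (q j) p) \<longlonglongrightarrow> (LINT p|lebesgue_on waveguide. g p * tensor Z r p)"
proof -
 obtain M where M: "!!x. cmod (Z x) <= M" by (rule bounded_compact_support[where f=Z and R=R, OF Z(1)]) (rule Z(2), assumption, rule that)
 show ?thesis
 proof (rule L2_dominated_convergence[OF waveguide_borel g tensor_measurable[OF Z(1) q(1)] tensor_measurable[OF Z(1) q(2)]])
  show "cmod (tensor Z (q j) p) <= M * B" if "p \<in> waveguide" for j p
   unfolding tensor_def norm_mult norm_of_real using that M[of "fst p"] B[of "snd p" j] order_trans[OF norm_ge_zero M]
   by (intro mult_mono) (auto simp: in_waveguide)
  show "tensor Z (q j) p = 0" if "p \<in> waveguide" "norm p >= R + 1" for j p by (rule tensor_outside[OF Z(2) that])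
  show "(%j. tensor Z (q j) p) \<longlonglongrightarrow> tensor Z r p" if "p \<in> waveguide" for p
   unfolding tensor_def using that by (intro tendsto_intros lim) (auto simp: in_waveguide)
 qed
qed

lemma L2_tensor:
 fixes Z :: "real^'d => complex"
 assumes Z: "continuous_on UNIV Z" "!!x. norm x >= R ==> Z x = 0" and q: "continuous_on UNIV q"
 shows "L2 (waveguide :: ((real^'d) \<times> real) set) (tensor Z q)"
proof -
 obtain M where M: "!!x. cmod (Z x) <= M" by (rule bounded_compact_support[where f=Z and R=R, OF Z(1)]) (rule Z(2), assumption, rule that)
 have "compact (q ` {0..1})" by (rule compact_continuous_image[OF continuous_on_subset[OF q]]) auto
 then obtain B where B: "\<forall>s\<in>q ` {0..1}. norm s <= B" using compact_imp_bounded bounded_iff by metis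
 show ?thesis
 proof (rule L2_bounded[OF waveguide_borel tensor_measurable[OF Z(1) q]])
  show "cmod (tensor Z q p) <= M * B" if "p \<in> waveguide" for p
  proof -
   have "\<bar>q (snd p)\<bar> <= B" using B that by (simp add: in_waveguide)
   then show ?thesis unfolding tensor_def norm_mult norm_of_real using M[of "fst p"] order_trans[OF norm_ge_zero M]
    by (intro mult_mono) auto
  qed
  show "tensor Z q p = 0" if "p \<in> waveguide" "norm p >= R + 1" for p by (rule tensor_outside[OF Z(2) that])
 qed
qed

lemma pd_zero_outside_ball:
 assumes "!!x. norm x >= R ==> f x = 0" "norm x >= R + 1"
 shows "pd b f x = 0"
 by (rule pd_eq_0_outside[of "cball 0 R"]) (use assms in auto)

lemma integral_cong_waveguide:
 "(!!p. p \<in> Om ==> f p = (g p :: complex)) ==> (LINT p|lebesgue_on Om. f p) = (LINT p|lebesgue_on Om. g p)"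
 by (rule Bochner_Integration.integral_cong) (auto simp: space_restrict_space)

text \<open>The product \<open>\<psi>(x, y) = \<zeta>(x) sin (m\<pi>y)\<close> vanishes on the boundary but is not a test function of the strip. The weak
 equation is tested with \<open>\<psi>\<close> cut off near the boundary, which costs only one derivative once one of them has been
 moved to \<open>u\<close>; Green's formula for \<open>\<psi>\<close> itself follows by approximating \<open>u\<close>.\<close>

lemma weak_solution_tensor:
 fixes u V :: "(real^'d) \<times> real => complex" and zt :: "real^'d => complex"
 assumes sol: "weak_solution k V u" and V: "V \<in> borel_measurable (lebesgue_on waveguide)"
  and Vb: "AE p in lebesgue_on waveguide. cmod (V p) <= v" and tzt: "test_function UNIV zt"
  and \<psi>: "\<psi> = tensor zt (%t. sin (real m * pi * t))"
 shows "(LINT p|lebesgue_on waveguide. u p * lap \<psi> p) = - (LINT p|lebesgue_on waveguide. (of_real k + V p) * u p * \<psi> p)"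
proof -
 let ?Om = "waveguide :: ((real^'d) \<times> real) set"
 note Om = waveguide_borel[where 'd='d]
 have smzt: "smooth zt" by (rule test_function_smooth[OF tzt])
 obtain R where R: "R > 0" "!!x. norm x >= R ==> zt x = 0" by (rule test_function_cball[OF tzt]) (rule that)
 define c where "c = real m * pi"
 define s s1 s2 where "s t = sin (c * t)" and "s1 t = c * cos (c * t)" and "s2 t = - (c^2) * sin (c * t)" for t :: real
 have \<psi>s: "\<psi> = tensor zt s" by (simp add: \<psi> s_def[abs_def] c_def)
 have sms: "smooth_real s" using smooth_real_sin_cos[of 1 c 0] by (simp add: s_def[abs_def])
 have sms1: "smooth_real s1" using smooth_real_sin_cos[of 0 c c] by (simp add: s1_def[abs_def])
 have d: "(s has_real_derivative s1 t) (at t)" "(s1 has_real_derivative s2 t) (at t)" for t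
  unfolding s_def[abs_def] s1_def[abs_def] s2_def by (auto intro!: derivative_eq_intros simp: power2_eq_square)
 have cs: "continuous_on UNIV s" "continuous_on UNIV s1" "continuous_on UNIV s2"
  unfolding s_def[abs_def] s1_def[abs_def] s2_def[abs_def] by (intro continuous_intros)+
 have czt: "continuous_on UNIV zt" by (rule smooth_continuous[OF smzt])
 have zt0: "zt x = 0" if "norm x >= R + 2" for x using R that by simp
 have c1: "continuous_on UNIV (pd i zt)" "pd i zt x = 0" if "i \<in> Basis" "norm x >= R + 2" for i x
  using smooth_continuous[OF smooth_pd[OF smzt that(1)]] pd_zero_outside_ball[OF R(2), where x=x and b=i] that(2) by auto
 have c1': "continuous_on UNIV (pd i zt)" if "i \<in> Basis" for i by (rule smooth_continuous[OF smooth_pd[OF smzt that]])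
 have z1: "pd i zt x = 0" if "norm x >= R + 1" for i x by (rule pd_zero_outside_ball[OF R(2) that])
 have z2: "pd i (pd i zt) x = 0" if "norm x >= R + 2" for i x
  by (rule pd_zero_outside_ball[of "R + 1"]) (use z1 that in auto)
 have z1': "pd i zt x = 0" if "norm x >= R + 2" for i x using z1 that by simp
 have sm\<psi>: "smooth \<psi>" unfolding \<psi>s by (rule smooth_tensor[OF smzt sms])
 \<comment> \<open>\<open>\<eta>\<close> has to equal 1 wherever the test functions live: the
   cross-section contributes at most \<open>R + 2\<close> to the norm, the height at most 1.\<close>
 have "R + 3 > 0" using R by simp
 from ex_cutoff_function[OF this, where 'a="(real^'d) \<times> real"]
 obtain \<eta> :: "(real^'d) \<times> real => complex" where \<eta>: "test_function UNIV \<eta> & (\<forall>p. norm p <= R + 3 --> \<eta> p = 1)" by (elim exE) (rule that)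
 note t\<eta> = \<eta>[THEN conjunct1] and \<eta>1 = \<eta>[THEN conjunct2, rule_format]
 define U where "U p = \<eta> p * u p" for p
 have "H1_0 ?Om U" using sol t\<eta> unfolding weak_solution_def zero_boundary_values_def U_def[abs_def] by simp
 then obtain G \<phi> where G: "H1_with_gradient ?Om U G & (\<forall>j::nat. test_function ?Om (\<phi> j)) &
   (%j. LINT x|lebesgue_on ?Om. (cmod (U x - \<phi> j x))^2) \<longlonglongrightarrow> 0 &
   (\<forall>b\<in>Basis. (%j. LINT x|lebesgue_on ?Om. (cmod (G b x - frechet_derivative (\<phi> j) (at x) b))^2) \<longlonglongrightarrow> 0)"
  unfolding H1_0_def by (elim exE) (rule that)
 have LU: "L2 ?Om U" and LG: "!!b. b \<in> Basis ==> L2 ?Om (G b)" and wdU: "!!b. b \<in> Basis ==> weak_deriv ?Om b U (G b)"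
  using G[THEN conjunct1] unfolding H1_with_gradient_def by auto
 note t\<phi> = G[THEN conjunct2, THEN conjunct1, rule_format]
 note lim0 = G[THEN conjunct2, THEN conjunct2, THEN conjunct1]
 note lim1 = G[THEN conjunct2, THEN conjunct2, THEN conjunct2, rule_format, folded pd_def]
 have "\<exists>G'. (\<forall>b\<in>Basis. weak_deriv ?Om b u (G' b)) &
    (\<forall>\<phi>. test_function ?Om \<phi> --> (\<Sum>b\<in>Basis. LINT p|lebesgue_on ?Om. G' b p * frechet_derivative \<phi> (at p) b)
      = (LINT p|lebesgue_on ?Om. (complex_of_real k + V p) * u p * \<phi> p))"
  using sol unfolding weak_solution_def by (elim conjE)
 then obtain G' where G': "(\<forall>b\<in>Basis. weak_deriv ?Om b u (G' b)) &
    (\<forall>\<phi>. test_function ?Om \<phi> --> (\<Sum>b\<in>Basis. LINT p|lebesgue_on ?Om. G' b p * frechet_derivative \<phi> (at p) b)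
      = (LINT p|lebesgue_on ?Om. (complex_of_real k + V p) * u p * \<phi> p))"
  by (elim exE) (rule that)
 note wdu = G'[THEN conjunct1, rule_format]
 note weq = G'[THEN conjunct2, rule_format, folded pd_def]
 define KU where "KU p = (of_real k + V p) * U p" for p
 have LK: "L2 ?Om KU"
  unfolding L2_def
 proof
  have Um: "U \<in> borel_measurable (lebesgue_on ?Om)" and U2: "integrable (lebesgue_on ?Om) (%p. (cmod (U p))^2)" using LU by (auto simp: L2_def)
  show m: "KU \<in> borel_measurable (lebesgue_on ?Om)" unfolding KU_def[abs_def]
   by (intro borel_measurable_times borel_measurable_add borel_measurable_const V Um)
  show "integrable (lebesgue_on ?Om) (%p. (cmod (KU p))^2)"
  proof (rule Bochner_Integration.integrable_bound)
   show "integrable (lebesgue_on ?Om) (%p. (\<bar>k\<bar> + v)^2 * (cmod (U p))^2)" using U2 by (rule integrable_mult_right)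
   show "(%p. (cmod (KU p))^2) \<in> borel_measurable (lebesgue_on ?Om)" using m by measurable
   show "AE p in lebesgue_on ?Om. norm ((cmod (KU p))^2) <= norm ((\<bar>k\<bar> + v)^2 * (cmod (U p))^2)"
    using Vb
   proof eventually_elim
    fix p assume v: "cmod (V p) <= v"
    have "cmod (of_real k + V p) <= \<bar>k\<bar> + v" using norm_triangle_ineq[of "of_real k" "V p"] v by simp
    then have "(cmod (of_real k + V p))^2 <= (\<bar>k\<bar> + v)^2" by (intro power_mono) auto
    then have "(cmod (of_real k + V p))^2 * (cmod (U p))^2 <= (\<bar>k\<bar> + v)^2 * (cmod (U p))^2" by (intro mult_right_mono) auto
    then show "norm ((cmod (KU p))^2) <= norm ((\<bar>k\<bar> + v)^2 * (cmod (U p))^2)"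
     by (simp add: KU_def norm_mult power_mult_distrib)
   qed
  qed
 qed
 obtain q q1 :: "nat => real => real" and B :: real where q:
  "!!j. smooth_real (q j)" "!!j. continuous_on UNIV (q1 j)" "!!j t. (q j has_real_derivative q1 j t) (at t)"
  "!!j t. t <= 1 / (real j + 2) \<or> t >= 1 - 1 / (real j + 2) ==> q j t = 0"
  "!!j t. 0 < t ==> t < 1 ==> \<bar>q j t\<bar> <= B" "!!j t. 0 < t ==> t < 1 ==> \<bar>q1 j t\<bar> <= B"
  "!!t. 0 < t ==> t < 1 ==> (%j. q j t) \<longlonglongrightarrow> sin (real m * pi * t)"
  "!!t. 0 < t ==> t < 1 ==> (%j. q1 j t) \<longlonglongrightarrow> real m * pi * cos (real m * pi * t)"
  by (rule sine_cutoffs[of m]) (rule that)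
 have q7: "(%j. q j t) \<longlonglongrightarrow> s t" if "0 < t" "t < 1" for t unfolding s_def c_def by (rule q(7)[OF that])
 have q8: "(%j. q1 j t) \<longlonglongrightarrow> s1 t" if "0 < t" "t < 1" for t unfolding s1_def c_def by (rule q(8)[OF that])
 \<comment> \<open>On the support of the cut-off product \<open>\<eta>\<close> equals 1, so the weak
   gradients of \<open>U\<close> and \<open>u\<close> pair with it alike. This is seen by moving the
   derivative to the test function and back, not by comparing \<open>G\<close> and \<open>G'\<close>
   pointwise.\<close>
 have A: "(\<Sum>b\<in>Basis. LINT p|lebesgue_on ?Om. G b p * pd b (tensor zt (q j)) p) = (LINT p|lebesgue_on ?Om. KU p * tensor zt (q j) p)" for j
 proof -
  define \<chi>' where "\<chi>' = tensor zt (q j)"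
  define K where "K = cball (0::real^'d) R \<times> {1 / (real j + 2)..1 - 1 / (real j + 2)}"
  have K: "compact K" unfolding K_def by (intro compact_Times) auto
  have KOm: "K \<subseteq> ?Om"
  proof
   fix p assume "p \<in> K"
   then have "1 / (real j + 2) <= snd p" "snd p <= 1 - 1 / (real j + 2)" by (auto simp: K_def)
   moreover have "1 / (real j + 2) > 0" by simp
   ultimately show "p \<in> ?Om" unfolding in_waveguide by linarith
  qed
  have Kn: "\<eta> p = 1" if "p \<in> K" for p
  proof (rule \<eta>1)
   have "norm p <= norm (fst p) + norm (snd p)" using norm_Pair_le[of "fst p" "snd p"] by simp
   moreover have "norm (fst p) <= R" using that by (auto simp: K_def)
   moreover have "0 < snd p & snd p < 1" using that KOm by (auto simp: in_waveguide)
   ultimately show "norm p <= R + 3" by simp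
  qed
  have z: "\<chi>' p = 0" if "p \<notin> K" for p
  proof (cases "norm (fst p) <= R")
   case True
   then have "q j (snd p) = 0" using that by (intro q(4)) (cases p, auto simp: K_def)
   then show ?thesis by (simp add: \<chi>'_def tensor_def)
  qed (simp add: \<chi>'_def tensor_def R(2))
  have zp: "pd b \<chi>' p = 0" if "p \<notin> K" for b p
   by (rule pd_eq_0_outside[OF compact_imp_closed[OF K] _ that]) (rule z)
  have zpp: "pd b (pd b \<chi>') p = 0" if "p \<notin> K" for b p
   by (rule pd_eq_0_outside[OF compact_imp_closed[OF K] _ that]) (rule zp)
  have t\<chi>: "test_function ?Om \<chi>'"
   by (rule test_functionI[OF _ K KOm z]) (use smooth_tensor[OF smzt q(1)] in \<open>simp add: \<chi>'_def\<close>)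
  have e1: "U p * pd b (pd b \<chi>') p = u p * pd b (pd b \<chi>') p" for b p
   by (cases "p \<in> K") (simp_all add: U_def Kn zpp)
  have e2: "KU p * \<chi>' p = (of_real k + V p) * u p * \<chi>' p" for p
   by (cases "p \<in> K") (simp_all add: KU_def U_def Kn z)
  have gg: "(LINT p|lebesgue_on ?Om. G b p * pd b \<chi>' p) = (LINT p|lebesgue_on ?Om. G' b p * pd b \<chi>' p)" if b: "b \<in> Basis" for b
  proof -
   note tp = test_function_pd[OF t\<chi> b]
   have "(LINT p|lebesgue_on ?Om. U p * pd b (pd b \<chi>') p) = - (LINT p|lebesgue_on ?Om. G b p * pd b \<chi>' p)"
    using wdU[OF b] tp unfolding weak_deriv_def pd_def[of b "pd b \<chi>'"] by simp
   moreover have "(LINT p|lebesgue_on ?Om. u p * pd b (pd b \<chi>') p) = - (LINT p|lebesgue_on ?Om. G' b p * pd b \<chi>' p)"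
    using wdu[OF b] tp unfolding weak_deriv_def pd_def[of b "pd b \<chi>'"] by simp
   ultimately show ?thesis unfolding e1 by simp
  qed
  have "(\<Sum>b\<in>Basis. LINT p|lebesgue_on ?Om. G b p * pd b \<chi>' p) = (\<Sum>b\<in>Basis. LINT p|lebesgue_on ?Om. G' b p * pd b \<chi>' p)"
   by (rule sum.cong[OF refl gg])
  also have "... = (LINT p|lebesgue_on ?Om. (of_real k + V p) * u p * \<chi>' p)" by (rule weq[OF t\<chi>])
  also have "... = (LINT p|lebesgue_on ?Om. KU p * \<chi>' p)" unfolding e2 ..
  finally show ?thesis unfolding \<chi>'_def .
 qed
 have cq: "continuous_on UNIV (q j)" for j by (rule smooth_real_continuous[OF q(1)])
 \<comment> \<open>Only \<open>q j\<close> and its first derivative occur, and both stay bounded on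
   the strip, so the cut-off can be removed against an \<open>L2\<close> function.\<close>
 have limA: "(%j. LINT p|lebesgue_on ?Om. G b p * pd b (tensor zt (q j)) p) \<longlonglongrightarrow> (LINT p|lebesgue_on ?Om. G b p * pd b \<psi> p)" if b: "b \<in> Basis" for b
 proof (rule Basis_prod_real_cases[OF b])
  fix i :: "real^'d" assume i: "i \<in> Basis" "b = (i, 0)"
  show ?thesis
   unfolding i(2) \<psi>s pd_tensor_fst[OF smzt q(1)] pd_tensor_fst[OF smzt sms]
   by (rule tensor_limit[where Z="pd i zt" and q=q and r=s and B=B and R="R + 2", OF LG[OF b, unfolded i(2)] c1'[OF i(1)] z1' cq cs(1) q(5) q7])
 next
  assume b1: "b = (0, 1)"
  show ?thesis
   unfolding b1 \<psi>s pd_tensor_snd[OF smzt q(1) q(3)] pd_tensor_snd[OF smzt sms d(1)]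
   by (rule tensor_limit[where Z=zt and q=q1 and r=s1 and B=B and R=R, OF LG[OF b, unfolded b1] czt R(2) q(2) cs(2) q(6) q8])
 qed
 have "(%j. \<Sum>b\<in>Basis. LINT p|lebesgue_on ?Om. G b p * pd b (tensor zt (q j)) p) \<longlonglongrightarrow> (\<Sum>b\<in>Basis. LINT p|lebesgue_on ?Om. G b p * pd b \<psi> p)"
  by (rule tendsto_sum) (rule limA)
 moreover have "(%j. LINT p|lebesgue_on ?Om. KU p * tensor zt (q j) p) \<longlonglongrightarrow> (LINT p|lebesgue_on ?Om. KU p * \<psi> p)"
  unfolding \<psi>s by (rule tensor_limit[where Z=zt and q=q and r=s and B=B and R=R, OF LK czt R(2) cq cs(1) q(5) q7])
 ultimately have E1: "(\<Sum>b\<in>Basis. LINT p|lebesgue_on ?Om. G b p * pd b \<psi> p) = (LINT p|lebesgue_on ?Om. KU p * \<psi> p)"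
  unfolding A by (rule LIMSEQ_unique)
 have L\<psi>: "L2 ?Om (pd b \<psi>)" "L2 ?Om (pd b (pd b \<psi>))" if b: "b \<in> Basis" for b
 proof -
  show "L2 ?Om (pd b \<psi>)"
  proof (rule Basis_prod_real_cases[OF b])
   fix i :: "real^'d" assume i: "i \<in> Basis" "b = (i, 0)"
   show ?thesis unfolding i(2) \<psi>s pd_tensor_fst[OF smzt sms] by (rule L2_tensor[where Z="pd i zt" and R="R + 2", OF c1'[OF i(1)] z1' cs(1)])
  next
   assume b1: "b = (0, 1)"
   show ?thesis unfolding b1 \<psi>s pd_tensor_snd[OF smzt sms d(1)] by (rule L2_tensor[where Z=zt and R=R, OF czt R(2) cs(2)])
  qed
  show "L2 ?Om (pd b (pd b \<psi>))"
  proof (rule Basis_prod_real_cases[OF b])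
   fix i :: "real^'d" assume i: "i \<in> Basis" "b = (i, 0)"
   note spi = smooth_pd[OF smzt i(1)]
   show ?thesis unfolding i(2) \<psi>s pd_tensor_fst[OF smzt sms] pd_tensor_fst[OF spi sms]
    by (rule L2_tensor[where Z="pd i (pd i zt)" and R="R + 2", OF smooth_continuous[OF smooth_pd[OF spi i(1)]] z2 cs(1)])
  next
   assume b1: "b = (0, 1)"
   show ?thesis unfolding b1 \<psi>s pd_tensor_snd[OF smzt sms d(1)] pd_tensor_snd[OF smzt sms1 d(2)]
    by (rule L2_tensor[where Z=zt and R=R, OF czt R(2) cs(3)])
  qed
 qed
 \<comment> \<open>The boundary condition acts here: the formula holds for the approximating test
   functions from \<open>H1_0\<close>, which have no boundary terms, and survives their
   \<open>L2\<close> limit.\<close>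
 have E2: "(LINT p|lebesgue_on ?Om. U p * pd b (pd b \<psi>) p) = - (LINT p|lebesgue_on ?Om. G b p * pd b \<psi> p)" if b: "b \<in> Basis" for b
 proof -
  have l1: "(%j. LINT p|lebesgue_on ?Om. \<phi> j p * pd b (pd b \<psi>) p) \<longlonglongrightarrow> (LINT p|lebesgue_on ?Om. U p * pd b (pd b \<psi>) p)"
   by (rule L2_tendsto_mult[OF LU L2_test_function[OF Om t\<phi>] L\<psi>(2)[OF b] lim0])
  have "(%j. LINT p|lebesgue_on ?Om. pd b (\<phi> j) p * pd b \<psi> p) \<longlonglongrightarrow> (LINT p|lebesgue_on ?Om. G b p * pd b \<psi> p)"
   by (rule L2_tendsto_mult[OF LG[OF b] L2_test_function[OF Om test_function_pd[OF t\<phi> b]] L\<psi>(1)[OF b] lim1[OF b]])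
  from tendsto_minus[OF this] show ?thesis
   using l1 unfolding integral_by_parts_test[OF Om t\<phi> smooth_pd[OF sm\<psi> b] b] by (intro LIMSEQ_unique)
 qed
 have n1: "\<eta> p = 1" if "p \<in> ?Om" "\<not> norm (fst p) >= R + 2" for p
 proof (rule \<eta>1)
  have "norm p <= norm (fst p) + norm (snd p)" using norm_Pair_le[of "fst p" "snd p"] by simp
  then show "norm p <= R + 3" using that by (simp add: in_waveguide)
 qed
 have "(LINT p|lebesgue_on ?Om. u p * lap \<psi> p) = (LINT p|lebesgue_on ?Om. (\<Sum>b\<in>Basis. U p * pd b (pd b \<psi>) p))"
 proof (rule integral_cong_waveguide)
  fix p :: "(real^'d) \<times> real" assume p: "p \<in> ?Om"
  have "u p * lap \<psi> p = U p * lap \<psi> p"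
  proof (cases "norm (fst p) >= R + 2")
   case True
   have "lap zt (fst p) = 0" unfolding lap_def using z2[OF True] by simp
   then have "lap \<psi> p = 0" using zt0[OF True] unfolding \<psi>s lap_tensor[OF smzt sms sms1 d] by simp
   then show ?thesis by simp
  next
   case False
   then show ?thesis using n1[OF p] by (simp add: U_def)
  qed
  then show "u p * lap \<psi> p = (\<Sum>b\<in>Basis. U p * pd b (pd b \<psi>) p)" by (simp add: lap_def sum_distrib_left)
 qed
 also have "... = (\<Sum>b\<in>Basis. LINT p|lebesgue_on ?Om. U p * pd b (pd b \<psi>) p)"
  by (rule Bochner_Integration.integral_sum) (rule L2_mult_integrable[OF LU L\<psi>(2)])
 also have "... = (\<Sum>b\<in>Basis. - (LINT p|lebesgue_on ?Om. G b p * pd b \<psi> p))" by (rule sum.cong[OF refl E2])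
 also have "... = - (LINT p|lebesgue_on ?Om. KU p * \<psi> p)" unfolding sum_negf E1 ..
 also have "(LINT p|lebesgue_on ?Om. KU p * \<psi> p) = (LINT p|lebesgue_on ?Om. (of_real k + V p) * u p * \<psi> p)"
 proof (rule integral_cong_waveguide)
  fix p :: "(real^'d) \<times> real" assume p: "p \<in> ?Om"
  show "KU p * \<psi> p = (of_real k + V p) * u p * \<psi> p"
   by (cases "norm (fst p) >= R + 2") (simp_all add: KU_def U_def n1[OF p] \<psi>s tensor_def zt0)
 qed
 finally show ?thesis .
qed

text \<open>A bounded \<open>Z\<close> supported in a ball makes square integrability of
  \<open>g\<close> on one bounded cylinder sufficient for Fubini. The final division by 2 undoes the
  factor in \<open>sine_coef\<close>.\<close>

lemma umode_fubini:
 fixes g :: "'a::euclidean_space \<times> real => complex" and Z :: "'a => complex"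
 assumes g: "g \<in> borel_measurable borel" and g0: "!!x y. y \<notin> {0<..<1} ==> g (x, y) = 0"
  and fin: "n2 (cball 0 R \<times> UNIV) g < \<infinity>"
  and Z: "Z \<in> borel_measurable borel" "!!x. cmod (Z x) <= B" "!!x. \<not> norm x <= R ==> Z x = 0"
 shows "integrable lborel (%p. g p * tensor Z (%t. sin (real m * pi * t)) p)"
  "integrable lborel (%x. umode m g x * Z x)"
  "(LINT p|lborel. g p * tensor Z (%t. sin (real m * pi * t)) p) = (LINT x|lborel. umode m g x * Z x) / 2"
proof -
 define f where "f p = g p * tensor Z (%t. sin (real m * pi * t)) p" for p
 have sm: "(%p::'a \<times> real. complex_of_real (sin (real m * pi * snd p))) \<in> borel_measurable borel"
  by (intro borel_measurable_continuous_onI continuous_intros)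
 have Zm: "(%p::'a \<times> real. Z (fst p)) \<in> borel_measurable borel"
  by (rule measurable_compose[OF borel_measurable_continuous_onI Z(1)]) (intro continuous_intros)
 have fm: "f \<in> borel_measurable borel"
  unfolding f_def[abs_def] tensor_def by (intro borel_measurable_times g Zm sm)
 let ?S = "cball (0::'a) R \<times> (UNIV::real set)" and ?T = "cball (0::'a) R \<times> {0..1::real}"
 have S: "?S \<in> sets borel" and T: "?T \<in> sets borel" by (intro borel_Times; simp)+
 have B0: "B >= 0" using order_trans[OF norm_ge_zero Z(2)] .
 have int: "integrable lborel f"
 proof (rule Bochner_Integration.integrable_bound)
  have "integrable lborel (%p. (cmod (g p))^2 * indicator ?S p)"
  proof (rule integrableI_nonneg)
   show "(%p. (cmod (g p))^2 * indicator ?S p) \<in> borel_measurable lborel" using g S by simp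
   have "(\<integral>\<^sup>+p. ennreal ((cmod (g p))^2 * indicator ?S p) \<partial>lborel) = n2 ?S g"
    unfolding n2_def by (intro nn_integral_cong) (simp add: indicator_def)
   then show "(\<integral>\<^sup>+p. ennreal ((cmod (g p))^2 * indicator ?S p) \<partial>lborel) < \<infinity>" using fin by simp
  qed auto
  moreover have "integrable lborel (indicator ?T :: 'a \<times> real => real)"
   using emeasure_compact_finite[OF compact_Times[OF compact_cball compact_Icc], of "0::'a" R "0::real" 1] T
   by (intro integrable_real_indicator) auto
  ultimately show "integrable lborel (%p. B * ((cmod (g p))^2 * indicator ?S p + indicator ?T p))"
   by (intro integrable_mult_right Bochner_Integration.integrable_add)
  show "f \<in> borel_measurable lborel" using fm by simp
  show "AE p in lborel. norm (f p) <= norm (B * ((cmod (g p))^2 * indicator ?S p + indicator ?T p))"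
  proof (rule AE_I2)
   fix p :: "'a \<times> real"
   show "norm (f p) <= norm (B * ((cmod (g p))^2 * indicator ?S p + indicator ?T p))"
   proof (cases "norm (fst p) <= R & snd p \<in> {0<..<1}")
    case True
    have "cmod (f p) = cmod (g p) * (cmod (Z (fst p)) * \<bar>sin (real m * pi * snd p)\<bar>)"
     by (simp add: f_def tensor_def norm_mult)
    also have "... <= cmod (g p) * (B * 1)"
     using Z(2)[of "fst p"] B0 by (intro mult_left_mono mult_mono) auto
    also have "... <= B * ((cmod (g p))^2 + 1)"
    proof -
     have "0 <= (cmod (g p))^2 + 1 - 2 * cmod (g p)"
      using zero_le_power2[of "cmod (g p) - 1"] by (simp add: power2_diff)
     then have "cmod (g p) <= (cmod (g p))^2 + 1" using norm_ge_zero[of "g p"] by linarith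
     from mult_left_mono[OF this B0] show ?thesis by (simp add: mult.commute)
    qed
    also have "... = norm (B * ((cmod (g p))^2 * indicator ?S p + indicator ?T p))"
     using True B0 by (cases p) (simp add: abs_mult)
    finally show ?thesis .
   next
    case False
    then have "f p = 0" using g0[of "snd p" "fst p"] Z(3)[of "fst p"] by (auto simp: f_def tensor_def)
    then show ?thesis by simp
   qed
  qed
 qed
 then show "integrable lborel (%p. g p * tensor Z (%t. sin (real m * pi * t)) p)" unfolding f_def[abs_def] .
 have int': "integrable (lborel \<Otimes>\<^sub>M lborel) f" using int by (simp add: lborel_prod)
 have inner: "(LINT y|lborel. f (x, y)) = (umode m g x * Z x) / 2" for x
 proof -
  have "f (x, y) = Z x * (g (x, y) * of_real (sin (real m * pi * y)))" for y by (simp add: f_def tensor_def)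
  then have "(LINT y|lborel. f (x, y)) = Z x * (LINT y|lborel. g (x, y) * of_real (sin (real m * pi * y)))"
   by (simp only: integral_mult_right_zero)
  then show ?thesis by (simp add: umode_def sine_coef_def)
 qed
 have "integrable lborel (%x. 2 * (LINT y|lborel. f (x, y)))"
  by (intro integrable_mult_right lborel_pair.integrable_fst'[OF int'])
 then show "integrable lborel (%x. umode m g x * Z x)" unfolding inner by simp
 have "integral\<^sup>L lborel f = (LINT x|lborel. (LINT y|lborel. f (x, y)))"
  using lborel_pair.integral_fst'[OF int'] by (simp add: lborel_prod)
 then have "integral\<^sup>L lborel f = (LINT x|lborel. umode m g x * Z x) / 2"
  unfolding inner by simp
 then show "(LINT p|lborel. g p * tensor Z (%t. sin (real m * pi * t)) p) = (LINT x|lborel. umode m g x * Z x) / 2"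
  unfolding f_def[abs_def] .
qed

text \<open>Local integrability is \<open>umode_fubini\<close> with the indicator of a ball as the
  factor \<open>Z\<close>.\<close>

lemma loc_int_umode:
 fixes g :: "'a::euclidean_space \<times> real => complex"
 assumes g: "g \<in> borel_measurable borel" and g0: "!!x y. y \<notin> {0<..<1} ==> g (x, y) = 0"
  and fin: "!!R. n2 (cball 0 R \<times> UNIV) g < \<infinity>"
 shows "loc_int (umode m g)"
 unfolding loc_int_def
proof (intro conjI allI umode_measurable[OF g])
 fix R
 have "integrable lborel (%x. umode m g x * indicator (cball 0 R) x)"
 proof (rule umode_fubini(2)[where B=1 and R=R])
  show "g \<in> borel_measurable borel" "n2 (cball 0 R \<times> UNIV) g < \<infinity>" by (rule g, rule fin)
  show "g (x, y) = 0" if "y \<notin> {0<..<1}" for x y by (rule g0[OF that])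
  show "(indicator (cball 0 R) :: 'a => complex) \<in> borel_measurable borel" by (rule borel_measurable_indicator) simp
 qed (auto simp: indicator_def)
 moreover have "(%x. umode m g x * indicator (cball 0 R) x) = (%x. indicator (cball 0 R) x *\<^sub>R umode m g x)"
  by (simp add: fun_eq_iff indicator_def)
 ultimately show "set_integrable lborel (cball 0 R) (umode m g)"
  unfolding set_integrable_def by simp
qed

text \<open>For \<open>\<zeta>(x) sin (m \<pi> y)\<close> the Laplacian separates into
  \<open>(\<Delta> - (m \<pi>)^2) \<zeta>\<close> times the same sine. Fubini then turns Green's
  formula in the strip into the weak equation on the cross-section.\<close>

lemma umode_weak_helm:
 fixes u V Ub W :: "(real^'d) \<times> real => complex"
 assumes sol: "weak_solution k V u" and V: "V \<in> borel_measurable (lebesgue_on waveguide)"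
  and Vb: "AE p in lebesgue_on waveguide. cmod (V p) <= v"
  and Ub: "Ub \<in> borel_measurable borel" "!!p. p \<notin> waveguide ==> Ub p = 0" "AE p in lebesgue_on waveguide. u p = Ub p"
  and W: "W \<in> borel_measurable borel" "AE p in lebesgue_on waveguide. V p = W p"
  and finU: "!!R. n2 (cball 0 R \<times> UNIV) Ub < \<infinity>" and finF: "!!R. n2 (cball 0 R \<times> UNIV) (%p. W p * Ub p) < \<infinity>"
 shows "weak_helm (k - (real m * pi)\<^sup>2) (umode m Ub) (umode m (%p. W p * Ub p))"
proof -
 define F where "F p = W p * Ub p" for p
 have Fm: "F \<in> borel_measurable borel" unfolding F_def[abs_def] by (intro borel_measurable_times W Ub)
 have U0: "Ub (x, y) = 0" if "y \<notin> {0<..<1}" for x y using Ub(2)[of "(x, y)"] that by (simp add: in_waveguide)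
 have F0: "F (x, y) = 0" if "y \<notin> {0<..<1}" for x y using U0[OF that] by (simp add: F_def)
 have finF': "n2 (cball 0 R \<times> UNIV) F < \<infinity>" for R using finF unfolding F_def[abs_def] .
 define c where "c = real m * pi"
 let ?s = "%t. sin (real m * pi * t)"
 have key: "(LINT x|lborel. umode m Ub x * (lap zt x + of_real (k - c\<^sup>2) * zt x)) = - (LINT x|lborel. umode m F x * zt x)"
  if tzt: "test_function UNIV zt" for zt
 proof -
  define Z where "Z x = lap zt x + of_real (- (c^2)) * zt x" for x
  have smzt: "smooth zt" by (rule test_function_smooth[OF tzt])
  obtain R0 where R0: "!!x. norm x >= R0 ==> zt x = 0" by (rule test_function_cball[OF tzt]) (rule that)
  define R where "R = R0 + 2"
  have zzt: "zt x = 0" if "norm x >= R" for x using R0 that by (simp add: R_def)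
  have zl: "lap zt x = 0" if "norm x >= R" for x
  proof -
   have 1: "pd b zt x = 0" if "norm x >= R0 + 1" for b x by (rule pd_zero_outside_ball[OF R0 that])
   have "pd b (pd b zt) x = 0" for b by (rule pd_zero_outside_ball[of "R0 + 1"]) (use 1 that in \<open>auto simp: R_def\<close>)
   then show ?thesis by (simp add: lap_def)
  qed
  have zZ: "Z x = 0" if "norm x >= R" for x using zzt[OF that] zl[OF that] by (simp add: Z_def)
  have smZ: "smooth Z" unfolding Z_def[abs_def] by (intro smooth_add smooth_mult smooth_const smooth_lap smzt)
  obtain BZ where BZ: "!!x. cmod (Z x) <= BZ" by (rule bounded_compact_support[where f=Z and R=R, OF smooth_continuous[OF smZ]]) (rule zZ, assumption, rule that)
  obtain Bzt where Bzt: "!!x. cmod (zt x) <= Bzt" by (rule bounded_compact_support[where f=zt and R=R, OF smooth_continuous[OF smzt]]) (rule zzt, assumption, rule that)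
  have zZ': "Z x = 0" if "\<not> norm x <= R" for x using zZ that by simp
  have zzt': "zt x = 0" if "\<not> norm x <= R" for x using zzt that by simp
  note mZ = borel_measurable_continuous_onI[OF smooth_continuous[OF smZ]]
  note mzt = borel_measurable_continuous_onI[OF smooth_continuous[OF smzt]]
  note fZ = umode_fubini[where g=Ub and Z=Z and B=BZ and R=R and m=m, OF Ub(1) U0 finU mZ BZ zZ']
  note fzt = umode_fubini[where g=Ub and Z=zt and B=Bzt and R=R and m=m, OF Ub(1) U0 finU mzt Bzt zzt']
  note fF = umode_fubini[where g=F and Z=zt and B=Bzt and R=R and m=m, OF Fm F0 finF' mzt Bzt zzt']
  have sms: "smooth_real ?s" using smooth_real_sin_cos[of 1 "real m * pi" 0] by simp
  have sms1: "smooth_real (%t. c * cos (real m * pi * t))" using smooth_real_sin_cos[of 0 "real m * pi" c] by simp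
  have lapt: "lap (tensor zt ?s) p = tensor Z ?s p" for p
  proof -
   have "lap (tensor zt ?s) p = lap zt (fst p) * of_real (sin (real m * pi * snd p)) + zt (fst p) * of_real (- (c^2) * sin (real m * pi * snd p))"
    by (rule lap_tensor[OF smzt sms sms1]) (auto intro!: derivative_eq_intros simp: c_def power2_eq_square)
   then show ?thesis by (simp add: tensor_def Z_def algebra_simps)
  qed
  have ct: "tensor Z ?s \<in> borel_measurable borel" "tensor zt ?s \<in> borel_measurable borel"
   by (intro tensor_measurable smooth_continuous smZ smzt continuous_intros)+
  have eU: "(LINT p|lborel. Ub p * tensor zt ?s p) = (LINT x|lborel. umode m Ub x * zt x) / 2" by (rule fzt(3))
  have eF: "(LINT p|lborel. F p * tensor zt ?s p) = (LINT x|lborel. umode m F x * zt x) / 2" by (rule fF(3))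
  have "(LINT x|lborel. umode m Ub x * Z x) / 2 = (LINT p|lborel. Ub p * tensor Z ?s p)" by (rule fZ(3)[symmetric])
  also have "... = (LINT p|lebesgue_on waveguide. u p * tensor Z ?s p)"
   by (rule lebesgue_on_integral_eq_lborel[OF waveguide_borel borel_measurable_times[OF Ub(1) ct(1)], symmetric])
    (use Ub(2,3) in \<open>auto elim!: eventually_mono\<close>)
  also have "... = - (LINT p|lebesgue_on waveguide. (of_real k + V p) * u p * tensor zt ?s p)"
   using weak_solution_tensor[OF sol V Vb tzt refl, of m] unfolding lapt .
  also have "(LINT p|lebesgue_on waveguide. (of_real k + V p) * u p * tensor zt ?s p)
   = (LINT p|lborel. of_real k * (Ub p * tensor zt ?s p) + F p * tensor zt ?s p)"
  proof (rule lebesgue_on_integral_eq_lborel[OF waveguide_borel])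
   show "(%p. of_real k * (Ub p * tensor zt ?s p) + F p * tensor zt ?s p) \<in> borel_measurable borel"
    by (intro borel_measurable_add borel_measurable_times borel_measurable_const Ub(1) Fm ct)
   show "of_real k * (Ub p * tensor zt ?s p) + F p * tensor zt ?s p = 0" if "p \<notin> waveguide" for p
    using Ub(2)[OF that] by (simp add: F_def)
   show "AE p in lebesgue_on waveguide. (of_real k + V p) * u p * tensor zt ?s p = of_real k * (Ub p * tensor zt ?s p) + F p * tensor zt ?s p"
    using Ub(3) W(2) by eventually_elim (simp add: F_def algebra_simps)
  qed
  also have "... = of_real k * (LINT p|lborel. Ub p * tensor zt ?s p) + (LINT p|lborel. F p * tensor zt ?s p)"
   using fzt(1) fF(1) by simp
  also have "... = of_real k * ((LINT x|lborel. umode m Ub x * zt x) / 2) + (LINT x|lborel. umode m F x * zt x) / 2"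
   unfolding eU eF ..
  finally have e0: "(LINT x|lborel. umode m Ub x * Z x) / 2
   = - (of_real k * ((LINT x|lborel. umode m Ub x * zt x) / 2) + (LINT x|lborel. umode m F x * zt x) / 2)" .
  have "a + q * b = - c" if "a / 2 = - (q * (b / 2) + c / 2)" for a b c q :: complex
  proof -
   have "2 * (a + q * b) = 2 * (- c)" using that by (simp add: field_simps)
   then show ?thesis by (simp only: mult_cancel_left) simp
  qed
  from this[OF e0] have e: "(LINT x|lborel. umode m Ub x * Z x) + of_real k * (LINT x|lborel. umode m Ub x * zt x) = - (LINT x|lborel. umode m F x * zt x)" .
  have "(LINT x|lborel. umode m Ub x * (lap zt x + of_real (k - c\<^sup>2) * zt x))
    = (LINT x|lborel. umode m Ub x * Z x + of_real k * (umode m Ub x * zt x))"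
   by (rule Bochner_Integration.integral_cong[OF refl]) (simp add: Z_def algebra_simps)
  also have "... = (LINT x|lborel. umode m Ub x * Z x) + of_real k * (LINT x|lborel. umode m Ub x * zt x)"
   using fZ(2) fzt(2) by simp
  finally show ?thesis using e by simp
 qed
 have "weak_helm (k - c\<^sup>2) (umode m Ub) (umode m F)"
  unfolding weak_helm_def
  using key loc_int_umode[OF Ub(1) U0 finU] loc_int_umode[OF Fm F0 finF'] by (intro conjI allI impI)
 then show ?thesis by (simp add: c_def F_def[abs_def])
qed

section \<open>The main theorem\<close>

text \<open>Real and imaginary parts reduce this to real functions that are measurable for the
  completion of \<open>lborel\<close>.\<close>

lemma ex_borel_representative:
 fixes f :: "'a::euclidean_space => complex"
 assumes Om: "Om \<in> sets borel" and f: "f \<in> borel_measurable (lebesgue_on Om)"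
 shows "\<exists>g. g \<in> borel_measurable borel & (\<forall>p. p \<notin> Om --> g p = 0) & (AE p in lebesgue_on Om. f p = g p)"
proof -
 define h where "h p = indicator Om p *\<^sub>R f p" for p
 have h: "h \<in> borel_measurable lebesgue"
  unfolding h_def[abs_def] using borel_measurable_restrict_space_iff[OF borel_in_lebesgue[OF Om], of f] f by simp
 have "(%p. Re (h p)) \<in> borel_measurable lebesgue" "(%p. Im (h p)) \<in> borel_measurable lebesgue" using h by measurable
 from this[THEN completion_ex_borel_measurable_real]
 obtain a b where ab: "a \<in> borel_measurable lborel" "AE p in lborel. Re (h p) = a p"
   "b \<in> borel_measurable lborel" "AE p in lborel. Im (h p) = b p"
  by blast
 define g where "g p = indicator Om p *\<^sub>R (complex_of_real (a p) + \<i> * complex_of_real (b p))" for p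
 have "g \<in> borel_measurable borel"
 proof -
  have [measurable]: "a \<in> borel_measurable borel" "b \<in> borel_measurable borel" "Om \<in> sets borel" using ab Om by auto
  show ?thesis unfolding g_def[abs_def] by measurable
 qed
 moreover have "AE p in lebesgue. p \<in> Om --> f p = g p"
  unfolding AE_completion_iff using ab(2,4)
  by eventually_elim (auto simp: g_def h_def complex_eq_iff)
 then have "AE p in lebesgue_on Om. f p = g p"
  unfolding AE_restrict_space_iff[OF borel_in_lebesgue[OF Om]] .
 ultimately show ?thesis by (intro exI[of _ g]) (auto simp: g_def)
qed

lemma n2_eq_0_iff_AE:
 assumes "f \<in> borel_measurable borel" "A \<in> sets borel"
 shows "n2 A f = 0 \<longleftrightarrow> (AE x in lborel. x \<in> A --> f x = 0)"
proof -
 have m: "(%x. ennreal ((cmod (f x))^2) * indicator A x) \<in> borel_measurable lborel" using assms by simp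
 show ?thesis unfolding n2_def nn_integral_0_iff_AE[OF m]
  by (intro eventually_subst always_eventually allI) (auto simp: indicator_def)
qed

lemma n2_L2_finite:
 fixes f g :: "'a::euclidean_space => complex"
 assumes Om: "Om \<in> sets borel" and f: "L2 Om f" and fg: "AE p in lborel. p \<in> Om --> f p = g p"
 shows "n2 Om g < \<infinity>"
proof -
 have "(\<integral>\<^sup>+p. ennreal (norm ((cmod (f p))^2)) \<partial>lebesgue_on Om) < \<infinity>"
  using f unfolding L2_def integrable_iff_bounded by simp
 also have "(\<integral>\<^sup>+p. ennreal (norm ((cmod (f p))^2)) \<partial>lebesgue_on Om) = (\<integral>\<^sup>+p. ennreal (norm ((cmod (f p))^2)) * indicator Om p \<partial>lebesgue)"
  by (rule nn_integral_restrict_space[OF borel_in_lebesgue[OF Om]])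
 also have "... = n2 Om f" unfolding nn_integral_completion n2_def by simp
 also have "... = n2 Om g" by (rule n2_cong_AE[OF fg])
 finally show ?thesis .
qed

text \<open>Each truncation to a ball is measurable as part of \<open>L2\<close>, and the
  truncations converge pointwise.\<close>

lemma H1_loc_measurable:
 fixes u :: "'a::euclidean_space => complex"
 assumes Om: "Om \<in> sets borel" and u: "H1_loc Om u"
 shows "u \<in> borel_measurable (lebesgue_on Om)"
proof -
 have L: "L2 (Om \<inter> ball 0 R) u" if "R > 0" for R
  using u that unfolding H1_loc_def H1_def H1_with_gradient_def by blast
 have B: "Om \<inter> ball 0 R \<in> sets borel" for R using Om by auto
 have m: "(%p. indicator (Om \<inter> ball 0 (real (Suc n))) p *\<^sub>R u p) \<in> borel_measurable lebesgue" for n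
  using L[of "real (Suc n)"] borel_measurable_restrict_space_iff[OF borel_in_lebesgue[OF B], of u "real (Suc n)"]
  by (simp add: L2_def)
 have "(%p. indicator Om p *\<^sub>R u p) \<in> borel_measurable lebesgue"
 proof (rule borel_measurable_LIMSEQ_metric[OF m])
  fix p :: 'a
  obtain N where N: "norm p < real N" using reals_Archimedean2 by blast
  have "\<forall>\<^sub>F n in sequentially. indicator (Om \<inter> ball 0 (real (Suc n))) p *\<^sub>R u p = indicator Om p *\<^sub>R u p"
   unfolding eventually_sequentially
  proof (intro exI[of _ N] allI impI)
   fix n assume "N <= n"
   then have "real N <= real n" by simp
   then have "p \<in> ball 0 (real (Suc n))" using N by simp
   then show "indicator (Om \<inter> ball 0 (real (Suc n))) p *\<^sub>R u p = indicator Om p *\<^sub>R u p" by (simp add: indicator_def)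
  qed
  then show "(%n. indicator (Om \<inter> ball 0 (real (Suc n))) p *\<^sub>R u p) \<longlonglongrightarrow> indicator Om p *\<^sub>R u p"
   by (rule tendsto_eventually)
 qed
 then show ?thesis using borel_measurable_restrict_space_iff[OF borel_in_lebesgue[OF Om], of u] by simp
qed

text \<open>By Fubini the exceptional null set meets almost every fibre in a null set, so the fibre
  integrals agree.\<close>

lemma mode_eq_umode:
 fixes u Ub :: "(real^'d) \<times> real => complex"
 assumes Ub: "Ub \<in> borel_measurable borel" "!!p. p \<notin> waveguide ==> Ub p = 0" and AE: "AE p in lborel. p \<in> waveguide --> u p = Ub p"
 shows "AE x in lborel. umode m Ub x = mode m u x"
proof -
 have "AE p in lborel \<Otimes>\<^sub>M lborel. p \<in> waveguide --> u p = Ub p"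
  using AE by ((unfold lborel_prod[symmetric], assumption) | (subst lborel_prod, assumption) | (simp only: lborel_prod))
 from lborel_pair.AE_pair[OF this] show ?thesis
 proof eventually_elim
  fix x assume x: "AE y in lborel. (x, y) \<in> waveguide --> u (x, y) = Ub (x, y)"
  have sl: "(%y. Ub (x, y)) \<in> borel_measurable borel"
   by (rule measurable_compose[OF borel_measurable_continuous_onI Ub(1)]) (intro continuous_intros)
  have sn: "(%y. complex_of_real (sin (real m * pi * y))) \<in> borel_measurable borel"
   by (intro borel_measurable_continuous_onI continuous_intros)
  have "(LINT y|lebesgue_on {0<..<1}. u (x, y) * complex_of_real (sin (real m * pi * y)))
    = (LINT y|lborel. Ub (x, y) * complex_of_real (sin (real m * pi * y)))"
  proof (rule lebesgue_on_integral_eq_lborel)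
   show "Ub (x, y) * complex_of_real (sin (real m * pi * y)) = 0" if "y \<notin> {0<..<1}" for y
    using Ub(2)[of "(x, y)"] that by (simp add: in_waveguide)
   have "AE y in lebesgue. y \<in> {0<..<1} --> u (x, y) * complex_of_real (sin (real m * pi * y)) = Ub (x, y) * complex_of_real (sin (real m * pi * y))"
    unfolding AE_completion_iff using x by eventually_elim (simp add: in_waveguide)
   then show "AE y in lebesgue_on {0<..<1}. u (x, y) * complex_of_real (sin (real m * pi * y)) = Ub (x, y) * complex_of_real (sin (real m * pi * y))"
    by (subst AE_restrict_space_iff) auto
  qed (use sl sn in \<open>auto intro: borel_measurable_times\<close>)
  then show "umode m Ub x = mode m u x" by (simp add: umode_def sine_coef_def mode_def)
 qed
qed

text \<open>The differences \<open>f m - a m\<close> have sum zero; finiteness is what permits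
  cancelling the sum of \<open>a\<close>.\<close>

lemma suminf_ennreal_squeeze:
 fixes a f :: "nat => ennreal"
 assumes le: "!!m. a m <= f m" and sum: "(\<Sum>m. f m) <= (\<Sum>m. a m)" and fin: "(\<Sum>m. f m) < \<infinity>"
 shows "f m <= a m"
proof -
 have e: "f m - a m + a m = f m" for m using le by (rule diff_add_cancel_ennreal)
 have "(\<Sum>m. f m - a m) + (\<Sum>m. a m) = (\<Sum>m. f m)"
  by (subst suminf_add) (simp_all add: e)
 then have "(\<Sum>m. a m) + (\<Sum>m. f m - a m) <= (\<Sum>m. a m) + 0" using sum by (simp add: add.commute)
 moreover have "(\<Sum>m. a m) <= (\<Sum>m. f m)" by (intro suminf_le le) auto
 then have "(\<Sum>m. a m) ~= \<infinity>" using fin by auto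
 ultimately have "(\<Sum>m. f m - a m) <= 0" by (simp add: ennreal_add_left_cancel_le)
 moreover have "(\<Sum>i\<in>{m}. f i - a i) <= (\<Sum>m. f m - a m)" by (rule sum_le_suminf) auto
 ultimately have "f m - a m = 0" by simp
 then show ?thesis using e[of m] by simp
qed

text \<open>Each mode is a single term of the Parseval series, which is finite.\<close>

lemma n2_umode_le:
 fixes u :: "'a::euclidean_space \<times> real => complex"
 assumes "u \<in> borel_measurable borel" "!!x y. y \<notin> {0<..<1} ==> u (x, y) = 0"
  and "A \<in> sets borel" "n2 (A \<times> UNIV) u < \<infinity>" and m: "m >= 1"
 shows "n2 A (umode m u) < \<infinity>"
proof -
 obtain m' where m': "m = Suc m'" using m by (cases m) auto
 have "(\<Sum>i\<in>{m'}. n2 A (umode (Suc i) u)) <= (\<Sum>m. n2 A (umode (Suc m) u))" by (rule sum_le_suminf) auto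
 then have "ennreal (1 / 2) * n2 A (umode m u) <= ennreal (1 / 2) * (\<Sum>m. n2 A (umode (Suc m) u))"
  unfolding m' by (intro mult_left_mono) auto
 also have "... = n2 (A \<times> UNIV) u" by (rule n2_modes[symmetric]) (use assms in auto)
 finally have "ennreal (1 / 2) * n2 A (umode m u) < \<infinity>" using assms(4) by (rule le_less_trans)
 then show ?thesis by (auto simp: ennreal_mult_less_top less_top)
qed

text \<open>The contrapositive in real terms: \<open>evan\<close> and \<open>prp\<close> spell out,
  mode by mode, that the maximum in the theorem times the bound \<open>v\<close> is at most
  1.\<close>

lemma admissible_solution_eq_0:
 fixes u V :: "(real^'d) \<times> real => complex"
 assumes sol: "admissible_solution k V u" and k: "k \<notin> resonances"
  and V: "V \<in> borel_measurable (lebesgue_on waveguide)" and Vb: "AE p in lebesgue_on waveguide. cmod (V p) <= v" and v: "v >= 0"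
  and V0: "AE p in lebesgue_on waveguide. p \<notin> I \<times> {0<..<1} --> V p = 0" and I: "I \<subseteq> ball x0 \<rho>" and \<rho>: "\<rho> > 0"
  and evan: "!!m. m >= 1 ==> (real m)^2 * pi^2 > k ==> v <= (real m)^2 * pi^2 - k"
  and prp: "!!m. m >= 1 ==> (real m)^2 * pi^2 < k ==> \<rho> * sqrt (k - (real m)\<^sup>2 * pi^2) > 1 / 10 &
    sqrt (200 * propagating_const CARD('d)) * \<rho> * v <= sqrt (k - (real m)\<^sup>2 * pi^2)"
 shows "AE p in lebesgue_on waveguide. u p = 0"
proof -
 let ?Om = "waveguide :: ((real^'d) \<times> real) set"
 let ?K = "propagating_const CARD('d)"
 note Om = waveguide_borel[where 'd='d]
 note AEr = AE_restrict_space_iff[OF borel_in_lebesgue[OF Om]]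

 \<comment> \<open>Borel representatives of the solution and the potential\<close>
 have ws: "weak_solution k V u" using sol by (simp add: admissible_solution_def)
 have H: "H1_loc ?Om u" using ws by (simp add: weak_solution_def)
 obtain Ub where Ub': "Ub \<in> borel_measurable borel & (\<forall>p. p \<notin> ?Om --> Ub p = 0) & (AE p in lebesgue_on ?Om. u p = Ub p)"
  using ex_borel_representative[OF Om H1_loc_measurable[OF Om H]] by (elim exE) (rule that)
 note Ub = Ub'[THEN conjunct1] Ub'[THEN conjunct2, THEN conjunct1, rule_format] Ub'[THEN conjunct2, THEN conjunct2]
 have Ua: "AE p in lborel. p \<in> ?Om --> u p = Ub p" using Ub(3) unfolding AEr AE_completion_iff .
 obtain Vr where Vr': "Vr \<in> borel_measurable borel & (\<forall>p. p \<notin> ?Om --> Vr p = 0) & (AE p in lebesgue_on ?Om. V p = Vr p)"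
  using ex_borel_representative[OF Om V] by (elim exE) (rule that)
 note Vr = Vr'[THEN conjunct1] Vr'[THEN conjunct2, THEN conjunct2]
 \<comment> \<open>The truncation makes the size and support bounds of the potential hold
   everywhere. The ball stands in for \<open>I\<close>, which may fail to be measurable.\<close>
 define T where "T = {p. fst p \<in> ball x0 \<rho> & cmod (Vr p) <= v}"
 have T: "T \<in> sets borel"
 proof -
  have [measurable]: "Vr \<in> borel_measurable borel" by (rule Vr(1))
  have "{p \<in> space borel. cmod (Vr p) <= v} \<in> sets borel" by measurable
  then have "(ball x0 \<rho> \<times> (UNIV :: real set)) \<inter> {p. cmod (Vr p) <= v} \<in> sets borel"
   using borel_open[OF open_Times[OF open_ball open_UNIV]] by (intro sets.Int) auto
  moreover have "T = (ball x0 \<rho> \<times> UNIV) \<inter> {p. cmod (Vr p) <= v}" by (auto simp: T_def)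
  ultimately show ?thesis by simp
 qed
 define W where "W p = indicator T p *\<^sub>R Vr p" for p
 have Wm: "W \<in> borel_measurable borel" unfolding W_def[abs_def] using T Vr(1) by simp
 have Wv: "cmod (W p) <= v" for p using v by (auto simp: W_def T_def indicator_def)
 have W0: "W p = 0" if "fst p \<notin> ball x0 \<rho>" for p using that by (simp add: W_def T_def)
 have VW: "AE p in lebesgue_on ?Om. V p = W p"
  using Vr(2) Vb V0
 proof eventually_elim
  fix p assume p: "V p = Vr p" "cmod (V p) <= v" "p \<notin> I \<times> {0<..<1} --> V p = 0"
  show "V p = W p"
  proof (cases "V p = 0")
   case True
   then show ?thesis using p(1) by (simp add: W_def)
  next
   case False
   then have "p \<in> T" using p I by (auto simp: T_def)
   then show ?thesis using p(1) by (simp add: W_def)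
  qed
 qed
 have U0: "Ub (x, y) = 0" if "y \<notin> {0<..<1}" for x y using Ub(2)[of "(x, y)"] that by (simp add: in_waveguide)
 have finU0: "n2 (cball 0 R \<times> UNIV) Ub < \<infinity>" for R
 proof -
  \<comment> \<open>Points of the strip above \<open>cball 0 R\<close> have norm at most
    \<open>R + 1\<close>.\<close>
  let ?S = "?Om \<inter> ball 0 (\<bar>R\<bar> + 2)"
  have "L2 ?S u" using H unfolding H1_loc_def H1_def H1_with_gradient_def by (auto dest!: spec[of _ "\<bar>R\<bar> + 2"])
  moreover have "AE p in lborel. p \<in> ?S --> u p = Ub p" using Ua by eventually_elim simp
  ultimately have "n2 ?S Ub < \<infinity>" using Om by (intro n2_L2_finite) auto
  moreover have "n2 (cball 0 R \<times> UNIV) Ub <= n2 ?S Ub"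
   unfolding n2_def
  proof (intro nn_integral_mono)
   fix p :: "(real^'d) \<times> real"
   show "ennreal ((cmod (Ub p))^2) * indicator (cball 0 R \<times> UNIV) p <= ennreal ((cmod (Ub p))^2) * indicator ?S p"
   proof (cases "p \<in> ?Om & p \<in> cball 0 R \<times> UNIV")
    case True
    have "norm p <= norm (fst p) + norm (snd p)" using norm_Pair_le[of "fst p" "snd p"] by simp
    moreover have "norm (fst p) <= R" using True by (cases p) simp
    moreover have "0 < snd p" "snd p < 1" using True by (auto simp: in_waveguide)
    ultimately have "p \<in> ball 0 (\<bar>R\<bar> + 2)" by simp
    then show ?thesis using True by simp
   next
    case False
    then show ?thesis using Ub(2)[of p] by (cases "p \<in> ?Om") auto
   qed
  qed
  ultimately show ?thesis by (rule le_less_trans[rotated])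
 qed
 have sub0: "cball x0 r \<subseteq> cball 0 (norm x0 + r)" for r
 proof
  fix y assume "y \<in> cball x0 r"
  then show "y \<in> cball 0 (norm x0 + r)"
   using norm_triangle_sub[of y x0] by (simp add: dist_norm norm_minus_commute)
 qed
 have finU: "n2 (cball x0 r \<times> UNIV) Ub < \<infinity>" for r
  by (rule le_less_trans[OF n2_mono_set finU0[of "norm x0 + r"]]) (use sub0 in auto)

 \<comment> \<open>The source and the equations of the modes\<close>
 define F where "F p = W p * Ub p" for p
 have Fm: "F \<in> borel_measurable borel" unfolding F_def[abs_def] by (intro borel_measurable_times Wm Ub)
 have F0: "F (x, y) = 0" if "y \<notin> {0<..<1}" for x y using U0[OF that] by (simp add: F_def)
 have F0': "F p = 0" if "fst p \<notin> ball x0 \<rho>" for p using W0[OF that] by (simp add: F_def)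
 have FU: "n2 UNIV F <= ennreal (v^2) * n2 (cball x0 \<rho> \<times> UNIV) Ub"
 proof -
  have "n2 UNIV F <= (\<integral>\<^sup>+p. ennreal (v^2) * (ennreal ((cmod (Ub p))^2) * indicator (cball x0 \<rho> \<times> UNIV) p) \<partial>lborel)"
   unfolding n2_def
  proof (intro nn_integral_mono)
   fix p :: "(real^'d) \<times> real"
   show "ennreal ((cmod (F p))^2) * indicator UNIV p <= ennreal (v^2) * (ennreal ((cmod (Ub p))^2) * indicator (cball x0 \<rho> \<times> UNIV) p)"
   proof (cases "fst p \<in> ball x0 \<rho>")
    case True
    have "(cmod (F p))^2 <= v^2 * (cmod (Ub p))^2"
     using power_mono[OF Wv[of p], of 2] by (simp add: F_def norm_mult power_mult_distrib mult_right_mono)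
    then have "ennreal ((cmod (F p))^2) <= ennreal (v^2) * ennreal ((cmod (Ub p))^2)"
     by (subst ennreal_mult[symmetric]) (auto intro: ennreal_leI)
    moreover have "p \<in> cball x0 \<rho> \<times> UNIV" using True by (cases p) auto
    ultimately show ?thesis by simp
   qed (simp add: F0')
  qed
  also have "... = ennreal (v^2) * n2 (cball x0 \<rho> \<times> UNIV) Ub"
  proof -
   note [measurable] = Ub(1)
   have [measurable]: "cball x0 \<rho> \<times> (UNIV :: real set) \<in> sets borel" by (rule borel_Times) simp_all
   show ?thesis unfolding n2_def by (rule nn_integral_cmult) measurable
  qed
  finally show ?thesis .
 qed
 have finFU: "n2 UNIV F < \<infinity>"
  by (rule le_less_trans[OF FU]) (use finU[of \<rho>] in \<open>simp add: ennreal_mult_less_top\<close>)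
 have finF: "n2 A F < \<infinity>" for A by (rule le_less_trans[OF n2_le_UNIV finFU])
 have wh: "weak_helm (k - (real m * pi)\<^sup>2) (umode m Ub) (umode m F)" for m
  unfolding F_def[abs_def]
  by (rule umode_weak_helm[OF ws V Vb Ub(1) _ Ub(3) Wm VW]) (use Ub(2) finU0 finF[unfolded F_def[abs_def]] in auto)
 have modF0: "umode m F x = 0" if "x \<notin> ball x0 \<rho>" for m x
  using F0'[of "(x, _)"] that by (simp add: umode_def sine_coef_def)
 have finFm: "n2 UNIV (umode m F) < \<infinity>" if "m >= 1" for m
  by (rule n2_umode_le[where u=F]) (use Fm F0 finF that in auto)
 have finUm: "n2 (cball 0 r) (umode m Ub) < \<infinity>" if "m >= 1" for m r
  by (rule n2_umode_le[where u=Ub]) (use Ub(1) U0 finU0 that in auto)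
 have UmM: "umode m Ub \<in> borel_measurable borel" for m by (rule umode_measurable[OF Ub(1)])
 have mm: "AE x in lborel. umode m Ub x = mode m u x" for m by (rule mode_eq_umode[OF Ub(1) _ Ua]) (rule Ub(2))
 have kres: "(real m)^2 * pi^2 < k \<or> (real m)^2 * pi^2 > k" if "m >= 1" for m
 proof -
  have "k ~= (real m)^2 * pi^2" using k that unfolding resonances_def by blast
  then show ?thesis by linarith
 qed

 \<comment> \<open>Estimates for single modes\<close>
 have propm: "ennreal (k - (real m)\<^sup>2 * pi^2) * n2 (cball x0 R) (umode m Ub) <= ennreal (?K * R^2) * n2 UNIV (umode m F)"
  if m: "m >= 1" and mk: "(real m)^2 * pi^2 < k" and R: "R >= 10 * \<rho>" for m R
 proof -
  define kp where "kp = sqrt (k - (real m)\<^sup>2 * pi^2)"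
  have kp: "kp > 0" "kp^2 = k - (real m)\<^sup>2 * pi^2" using mk by (simp_all add: kp_def)
  have wh': "weak_helm (kp^2) (umode m Ub) (umode m F)" using wh[of m] unfolding kp(2) by (simp add: power_mult_distrib)
  have out: "outgoing (complex_of_real kp) (mode m u)"
   using sol m mk unfolding admissible_solution_def wavenumber_def kp_def by auto
  have kp\<rho>: "\<rho> * kp > 1 / 10" using prp[OF m mk] by (simp add: kp_def)
  \<comment> \<open>\<open>\<rho> kp > 1/10\<close> and \<open>R \<ge> 10 \<rho>\<close> together
    give the hypothesis \<open>kp R \<ge> 1\<close> of the propagating estimate.\<close>
  have "kp * R >= kp * (10 * \<rho>)" using R kp by (intro mult_left_mono) auto
  moreover have "kp * (10 * \<rho>) = 10 * (\<rho> * kp)" by simp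
  ultimately have kpR: "kp * R >= 1" using kp\<rho> by linarith
  have R\<rho>: "R > \<rho>" using R \<rho> by linarith
  show ?thesis unfolding kp(2)[symmetric]
   by (rule weak_helm_outgoing[OF wh' kp(1) _ \<rho> R\<rho> kpR _ out mm]) (use modF0 finUm[OF m] in auto)
 qed
 have finev: "n2 UNIV (umode m Ub) < \<infinity>" if m: "m >= 1" and mk: "(real m)^2 * pi^2 > k" for m
 proof -
  have "H1 UNIV (mode m u)" using sol m mk unfolding admissible_solution_def by auto
  then have "L2 UNIV (mode m u)" unfolding H1_def H1_with_gradient_def by blast
  moreover have "AE x in lborel. x \<in> UNIV --> mode m u x = umode m Ub x" using mm[of m] by eventually_elim simp
  ultimately show ?thesis by (intro n2_L2_finite[where f="mode m u"]) auto
 qed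
 have whe: "weak_helm (- ((real m)^2 * pi^2 - k)) (umode m Ub) (umode m F)" for m
  using wh[of m] by (simp add: power_mult_distrib)
 have evanm: "ennreal (((real m)^2 * pi^2 - k)^2) * n2 UNIV (umode m Ub) <= n2 UNIV (umode m F)"
  if m: "m >= 1" and mk: "(real m)^2 * pi^2 > k" for m
  by (rule weak_helm_evanescent[OF _ whe finev[OF m mk]]) (use mk in simp)
 \<comment> \<open>The first half is summed over the modes; the second says that equality is
   possible only for a vanishing source.\<close>
 have bound: "ennreal (v^2) * n2 (cball x0 \<rho>) (umode m Ub) <= n2 UNIV (umode m F) &
   (n2 UNIV (umode m F) <= ennreal (v^2) * n2 (cball x0 \<rho>) (umode m Ub) --> n2 UNIV (umode m F) = 0)" if m: "m >= 1" for m
 proof (cases "(real m)^2 * pi^2 < k")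
  case True
  define kp2 where "kp2 = k - (real m)\<^sup>2 * pi^2"
  have kp2: "kp2 > 0" using True by (simp add: kp2_def)
  define L where "L = ?K * (10 * \<rho>)^2"
  have L: "L > 0" using propagating_const_pos[of "CARD('d)"] \<rho> by (simp add: L_def)
  obtain f where f: "n2 UNIV (umode m F) = ennreal f" "f >= 0" using finFm[OF m] by (cases "n2 UNIV (umode m F)") auto
  have "n2 (cball x0 \<rho>) (umode m Ub) <= n2 (cball 0 (norm x0 + \<rho>)) (umode m Ub)" by (rule n2_mono_set[OF sub0])
  then have "n2 (cball x0 \<rho>) (umode m Ub) < \<infinity>" using finUm[OF m] by (rule le_less_trans)
  then obtain a where a: "n2 (cball x0 \<rho>) (umode m Ub) = ennreal a" "a >= 0" by (cases "n2 (cball x0 \<rho>) (umode m Ub)") auto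
  have "ennreal kp2 * n2 (cball x0 \<rho>) (umode m Ub) <= ennreal kp2 * n2 (cball x0 (10 * \<rho>)) (umode m Ub)"
   using \<rho> by (intro mult_left_mono n2_mono_set) auto
  also have "... <= ennreal L * n2 UNIV (umode m F)" unfolding kp2_def L_def by (rule propm[OF m True]) simp
  finally have "kp2 * a <= L * f" using f a kp2 L by (simp add: ennreal_mult[symmetric])
  \<comment> \<open>Of \<open>200 = 2 * 10^2\<close>, the square of 10 is used up by the radius
    \<open>10 \<rho>\<close>. The spare 2 yields \<open>2 v^2 a \<le> f\<close>, which is compatible
    with \<open>f \<le> v^2 a\<close> only if \<open>f = 0\<close>.\<close>
  moreover have "2 * L * v^2 <= kp2"
  proof -
   have "sqrt (200 * ?K) * \<rho> * v <= sqrt kp2" using prp[OF m True] by (simp add: kp2_def)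
   moreover have "0 <= sqrt (200 * ?K) * \<rho> * v" using v \<rho> propagating_const_pos[of "CARD('d)"] by simp
   ultimately have "(sqrt (200 * ?K) * \<rho> * v)^2 <= (sqrt kp2)^2" by (intro power_mono)
   then show ?thesis using kp2 propagating_const_pos[of "CARD('d)"] by (simp add: power_mult_distrib L_def mult_ac)
  qed
  then have "2 * L * v^2 * a <= kp2 * a" using a by (intro mult_right_mono) auto
  ultimately have "L * (2 * (v^2 * a)) <= L * f" by (simp add: mult_ac)
  then have 2: "2 * (v^2 * a) <= f" using L by (simp only: mult_le_cancel_left_pos)
  have e: "ennreal (v^2) * n2 (cball x0 \<rho>) (umode m Ub) = ennreal (v^2 * a)" unfolding a(1) by (simp add: ennreal_mult')
  have nn: "0 <= v^2 * a" using a by simp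
  show ?thesis unfolding e f(1) using 2 nn f(2) by (auto simp: ennreal_leI)
 next
  case False
  then have mk: "(real m)^2 * pi^2 > k" using kres[OF m] by simp
  define \<mu> where "\<mu> = (real m)^2 * pi^2 - k"
  have \<mu>: "\<mu> > 0" "v <= \<mu>" using mk evan[OF m mk] by (auto simp: \<mu>_def)
  have "v^2 <= \<mu>^2" using \<mu> v by (intro power_mono)
  then have le: "ennreal (v^2) * n2 (cball x0 \<rho>) (umode m Ub) <= ennreal (\<mu>^2) * n2 (cball x0 \<rho>) (umode m Ub)"
   by (intro mult_right_mono ennreal_leI) auto
  have "ennreal (\<mu>^2) * n2 (cball x0 \<rho>) (umode m Ub) <= ennreal (\<mu>^2) * n2 UNIV (umode m Ub)"
   by (intro mult_left_mono n2_le_UNIV) auto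
  also have "... <= n2 UNIV (umode m F)" using evanm[OF m mk] by (simp add: \<mu>_def)
  finally have 1: "ennreal (v^2) * n2 (cball x0 \<rho>) (umode m Ub) <= n2 UNIV (umode m F)" using le by (rule order_trans[rotated])
  have "n2 UNIV (umode m F) = 0" if "n2 UNIV (umode m F) <= ennreal (v^2) * n2 (cball x0 \<rho>) (umode m Ub)"
  proof (rule weak_helm_evanescent_strict[OF \<mu>(1) whe[of m, folded \<mu>_def] finev[OF m mk] finFm[OF m] _ sub0])
   show "n2 UNIV (umode m F) <= ennreal (\<mu>^2) * n2 (cball x0 \<rho>) (umode m Ub)" using that le by (rule order_trans)
   show "0 < norm x0 + \<rho>" using \<rho> by (simp add: add_nonneg_pos)
  qed simp
  with 1 show ?thesis by simp
 qed

 \<comment> \<open>Summation over the modes and vanishing of the solution\<close>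
 have Fz: "n2 UNIV (umode (Suc m) F) = 0" for m
 proof -
  define a where "a m = ennreal (v^2) * n2 (cball x0 \<rho>) (umode (Suc m) Ub)" for m
  define f where "f m = n2 UNIV (umode (Suc m) F)" for m
  have half: "ennreal (2 :: real) > 0" "(2::real) > 0" by auto
  have e1: "n2 UNIV F = ennreal (1 / 2) * (\<Sum>m. f m)"
   unfolding f_def UNIV_Times_UNIV[symmetric] by (rule n2_modes) (use Fm F0 finF in auto)
  have e2: "n2 (cball x0 \<rho> \<times> UNIV) Ub = ennreal (1 / 2) * (\<Sum>m. n2 (cball x0 \<rho>) (umode (Suc m) Ub))"
   by (rule n2_modes) (use Ub(1) U0 finU in auto)
  have "ennreal (1 / 2) * (\<Sum>m. f m) <= ennreal (v^2) * (ennreal (1 / 2) * (\<Sum>m. n2 (cball x0 \<rho>) (umode (Suc m) Ub)))"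
   using FU unfolding e1 e2 .
  also have "... = ennreal (1 / 2) * (\<Sum>m. a m)"
   unfolding a_def by (simp add: mult.left_commute)
  finally have "ennreal 2 * (ennreal (1 / 2) * (\<Sum>m. f m)) <= ennreal 2 * (ennreal (1 / 2) * (\<Sum>m. a m))"
   by (rule mult_left_mono) simp
  then have sum: "(\<Sum>m. f m) <= (\<Sum>m. a m)" unfolding ennreal_cancel_left[OF half(2)] .
  have fin: "(\<Sum>m. f m) < \<infinity>"
  proof -
   have "(\<Sum>m. f m) = ennreal 2 * n2 UNIV F" unfolding e1 ennreal_cancel_left[OF half(2)] ..
   then show ?thesis using finFU by (simp add: ennreal_mult_less_top)
  qed
  \<comment> \<open>The pointwise bound on the potential orders the two sums against the termwise
    inequalities, so each of these is an equality.\<close>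
  have "f m <= a m"
   by (rule suminf_ennreal_squeeze[OF _ sum fin]) (use bound in \<open>simp add: a_def f_def\<close>)
  then show ?thesis using bound[of "Suc m"] by (simp add: a_def f_def)
 qed
 \<comment> \<open>With vanishing source the propagating estimate holds at every radius from
   \<open>10 \<rho>\<close> on, which exhausts the cross-section.\<close>
 have Uz: "n2 (cball x0 r) (umode (Suc m) Ub) = 0" for m r
 proof (cases "(real (Suc m))^2 * pi^2 < k")
  case True
  let ?R = "max r (10 * \<rho>)"
  have "ennreal (k - (real (Suc m))\<^sup>2 * pi^2) * n2 (cball x0 ?R) (umode (Suc m) Ub) <= 0"
   using propm[of "Suc m" ?R] True unfolding Fz by simp
  moreover have "ennreal (k - (real (Suc m))\<^sup>2 * pi^2) ~= 0" using True by (simp only: ennreal_eq_0_iff not_le diff_gt_0_iff_gt)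
  ultimately have "n2 (cball x0 ?R) (umode (Suc m) Ub) = 0" by simp
  moreover have "n2 (cball x0 r) (umode (Suc m) Ub) <= n2 (cball x0 ?R) (umode (Suc m) Ub)" by (rule n2_mono_set) auto
  ultimately show ?thesis by simp
 next
  case False
  then have mk: "(real (Suc m))^2 * pi^2 > k" using kres[of "Suc m"] by simp
  have "ennreal (((real (Suc m))^2 * pi^2 - k)^2) * n2 UNIV (umode (Suc m) Ub) <= 0"
   using evanm[OF _ mk] unfolding Fz by simp
  moreover have "((real (Suc m))^2 * pi^2 - k)^2 > 0" using mk by (intro zero_less_power) linarith
  then have "ennreal (((real (Suc m))^2 * pi^2 - k)^2) ~= 0" by (simp only: ennreal_eq_0_iff not_le)
  ultimately have "n2 UNIV (umode (Suc m) Ub) = 0" by simp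
  then show ?thesis using n2_le_UNIV[of "cball x0 r" "umode (Suc m) Ub"] by simp
 qed
 have "AE p in lborel. p \<in> cball x0 (real n) \<times> UNIV --> Ub p = 0" for n
 proof -
  have "n2 (cball x0 (real n) \<times> UNIV) Ub = ennreal (1 / 2) * (\<Sum>m. n2 (cball x0 (real n)) (umode (Suc m) Ub))"
   by (rule n2_modes) (use Ub(1) U0 finU in auto)
  then have "n2 (cball x0 (real n) \<times> UNIV) Ub = 0" unfolding Uz by simp
  have S: "cball x0 (real n) \<times> (UNIV :: real set) \<in> sets borel" by (rule borel_Times) simp_all
  show ?thesis by (rule n2_eq_0_iff_AE[OF Ub(1) S, THEN iffD1]) fact
 qed
 then have "AE p in lborel. \<forall>n. p \<in> cball x0 (real n) \<times> UNIV --> Ub p = 0" unfolding AE_all_countable by simp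
 then have "AE p in lborel. p \<in> ?Om --> u p = 0"
  using Ua
 proof eventually_elim
  fix p assume p: "\<forall>n. p \<in> cball x0 (real n) \<times> UNIV --> Ub p = 0" "p \<in> ?Om --> u p = Ub p"
  obtain n where "dist x0 (fst p) <= real n" using real_arch_simple by blast
  then have pn: "p \<in> cball x0 (real n) \<times> UNIV" by (cases p) simp
  have "Ub p = 0" by (rule p(1)[rule_format, OF pn])
  then show "p \<in> ?Om --> u p = 0" using p(2) by simp
 qed
 then show ?thesis unfolding AEr AE_completion_iff .
qed

lemma cmod_wavenumber:
 "(real m)^2 * pi^2 < k ==> cmod (wavenumber k m) = sqrt (k - (real m)\<^sup>2 * pi^2)"
 "(real m)^2 * pi^2 > k ==> cmod (wavenumber k m) = sqrt ((real m)^2 * pi^2 - k)"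
 by (simp_all add: wavenumber_def norm_mult)

theorem theorem2p3:
  "\<exists>C>0. \<forall>(k::real) (I::(real^'d) set) (x\<^sub>0::real^'d) (\<rho>::real)
       (V::(real^'d) \<times> real \<Rightarrow> complex).
     k \<notin> resonances \<and>
     bounded (I \<times> {0<..<1::real}) \<and> \<rho> > 0 \<and> I \<subseteq> ball x\<^sub>0 \<rho> \<and>
     ereal \<rho> * delta_minus k > ereal 0.1 \<and>
     Linf waveguide V \<and>
     (AE p in lebesgue_on waveguide. p \<notin> I \<times> {0<..<1} \<longrightarrow> V p = 0) \<and>
     (\<exists>u. admissible_solution k V u \<and> \<not> (AE p in lebesgue_on waveguide. u p = 0))
     \<longrightarrow> max (1 / (delta_plus k)\<^sup>2) (ereal (C * \<rho>) / delta_minus k) * Linf_norm waveguide V > 1"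
proof -
 \<comment> \<open>The root appears because the mode estimates are quadratic: they need
   \<open>200\<close> times \<open>propagating_const\<close> times \<open>(\<rho> v)^2\<close> to be
   at most \<open>|k_m|^2\<close>.\<close>
 define C where "C = sqrt (200 * propagating_const CARD('d))"
 have C: "C > 0" using propagating_const_pos by (simp add: C_def)
 show ?thesis
 proof (rule exI[of _ C], intro conjI[OF C] allI impI, elim conjE exE)
  fix k :: real and I :: "(real^'d) set" and x0 :: "real^'d" and \<rho> :: real and V u :: "(real^'d) \<times> real => complex"
  assume k: "k \<notin> resonances" and \<rho>: "\<rho> > 0" and I: "I \<subseteq> ball x0 \<rho>" and dm: "ereal 0.1 < ereal \<rho> * delta_minus k"
   and Linf: "Linf waveguide V" and V0: "AE p in lebesgue_on waveguide. p \<notin> I \<times> {0<..<1} --> V p = 0"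
   and sol: "admissible_solution k V u" and nz: "\<not> (AE p in lebesgue_on waveguide. u p = 0)"
  let ?n = "Linf_norm waveguide V"
  let ?M = "max (1 / (delta_plus k)^2) (ereal (C * \<rho>) / delta_minus k)"
  have Vm: "V \<in> borel_measurable (lebesgue_on waveguide)" and nf: "?n < \<infinity>" using Linf by (auto simp: Linf_def)
  have AEn: "AE p in lebesgue_on waveguide. ereal (cmod (V p)) <= ?n" unfolding Linf_norm_def by (rule esssup_AE)
  \<comment> \<open>A negative essential supremum would leave almost no points in the strip; then
    \<open>u\<close> vanishes almost everywhere, contrary to \<open>nz\<close>.\<close>
  have n0: "0 <= ?n"
  proof (rule ccontr)
   assume "\<not> 0 <= ?n"
   have neg: "\<not> ereal (cmod (V p)) <= ?n" for p
   proof
    assume "ereal (cmod (V p)) <= ?n"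
    moreover have "0 <= ereal (cmod (V p))" by simp
    ultimately have "0 <= ?n" by (rule order_trans[rotated])
    with \<open>\<not> 0 <= ?n\<close> show False by contradiction
   qed
   from AEn have "AE p in lebesgue_on waveguide. u p = 0" by eventually_elim (rule notE[OF neg])
   then show False using nz by simp
  qed
  obtain v where v: "?n = ereal v" "v >= 0" using n0 nf by (cases ?n) auto
  have Vb: "AE p in lebesgue_on waveguide. cmod (V p) <= v" using AEn unfolding v(1) by simp
  show "1 < ?M * ?n"
  proof (rule ccontr)
   assume "\<not> 1 < ?M * ?n"
   then have le1: "?M * ereal v <= 1" using v by simp
   have use: "t * v <= 1" if "ereal t <= ?M" for t
   proof -
    have "ereal t * ereal v <= ?M * ereal v" using that v(2) by (intro ereal_mult_right_mono) auto
    from order_trans[OF this le1] have "ereal (t * v) <= 1" by simp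
    then show ?thesis by simp
   qed
   have "AE p in lebesgue_on waveguide. u p = 0"
   proof (rule admissible_solution_eq_0[OF sol k Vm Vb v(2) V0 I \<rho>])
    fix m :: nat assume m: "m >= 1" "(real m)^2 * pi^2 > k"
    define \<mu> where "\<mu> = (real m)^2 * pi^2 - k"
    have \<mu>: "\<mu> > 0" using m by (simp add: \<mu>_def)
    have "delta_plus k <= ereal (cmod (wavenumber k m))" unfolding delta_plus_def by (rule INF_lower) (use m in simp)
    then have d: "delta_plus k <= ereal (sqrt \<mu>)" using cmod_wavenumber(2)[OF m(2)] by (simp add: \<mu>_def)
    have d0: "0 <= delta_plus k" unfolding delta_plus_def by (rule INF_greatest) simp
    obtain r where r: "delta_plus k = ereal r" "0 <= r" "r <= sqrt \<mu>" using d d0 by (cases "delta_plus k") auto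
    have "ereal (1 / \<mu>) <= 1 / (delta_plus k)^2"
    proof (cases "r = 0")
     \<comment> \<open>Here \<open>1 / 0 = \<infinity>\<close> in \<open>ereal\<close> makes the
       claim trivial.\<close>
     case True
     have inf: "1 / ereal 0 = \<infinity>"
      by (simp add: divide_ereal_def zero_ereal_def[symmetric])
     have sq: "(ereal 0)^2 = ereal 0" by simp
     show ?thesis unfolding r(1) True sq inf by simp
    next
     case False
     have "r^2 <= \<mu>" using power_mono[OF r(3,2), of 2] \<mu> by simp
     then have "1 / \<mu> <= 1 / r^2" using False by (intro divide_left_mono) (auto simp: \<mu>)
     then show ?thesis using False unfolding r(1) by (simp add: one_ereal_def)
    qed
    then have "ereal (1 / \<mu>) <= ?M" by (rule order_trans[OF _ max.cobounded1])
    from use[OF this] show "v <= (real m)^2 * pi^2 - k" using \<mu> by (simp add: \<mu>_def[symmetric] pos_divide_le_eq)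
   next
    fix m :: nat assume m: "m >= 1" "(real m)^2 * pi^2 < k"
    define kp where "kp = sqrt (k - (real m)\<^sup>2 * pi^2)"
    have kp: "kp > 0" using m by (simp add: kp_def)
    have "delta_minus k <= ereal (cmod (wavenumber k m))" unfolding delta_minus_def by (rule INF_lower) (use m in simp)
    then have d: "delta_minus k <= ereal kp" using cmod_wavenumber(1)[OF m(2)] by (simp add: kp_def)
    have d0: "0 <= delta_minus k" unfolding delta_minus_def by (rule INF_greatest) simp
    \<comment> \<open>The propagating mode \<open>m\<close> at hand makes
      \<open>delta_minus k\<close> finite.\<close>
    obtain r where r: "delta_minus k = ereal r" "0 <= r" "r <= kp" using d d0 by (cases "delta_minus k") auto
    have r10: "1 / 10 < \<rho> * r" using dm unfolding r(1) by simp
    then have rp: "r > 0" using r(2) by (cases "r = 0") auto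
    have "\<rho> * r <= \<rho> * kp" using r(3) \<rho> by (intro mult_left_mono) auto
    then have 1: "1 / 10 < \<rho> * kp" using r10 by linarith
    have "C * \<rho> / kp <= C * \<rho> / r" using r(3) rp kp C \<rho> by (intro divide_left_mono) auto
    then have "ereal (C * \<rho> / kp) <= ereal (C * \<rho>) / delta_minus k" unfolding r(1) using rp by simp
    then have "ereal (C * \<rho> / kp) <= ?M" by (rule order_trans[OF _ max.cobounded2])
    from use[OF this] have "C * \<rho> * v <= kp" using kp by (simp add: pos_divide_le_eq)
    with 1 show "\<rho> * sqrt (k - (real m)\<^sup>2 * pi^2) > 1 / 10 &
     sqrt (200 * propagating_const CARD('d)) * \<rho> * v <= sqrt (k - (real m)\<^sup>2 * pi^2)"
     by (simp add: kp_def C_def)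
   qed
   then show False using nz by simp
  qed
 qed
qed

end
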